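(* Let $(\mathcal A,K)$ be a Harish-Chandra pair and let $\gamma:T\to K$ be a morphism of complex algebraic groups with injective differential. Then the functor $\Gamma^{eq}_{K,T}:\mathcal M(\mathcal A,T,N(\mathfrak t))\to\mathcal M(\mathcal A,K,N(\mathfrak k))$, $V\mapsto \mathrm{Hom}^\cdot_{(\mathcal U(\mathfrak k),T,N(\mathfrak t))}(N(\mathfrak k),R(K,V))$, is right adjoint to the forgetful functor from the category $\mathcal M(\mathcal A,K,N(\mathfrak k))$ into the category $\mathcal M(\mathcal A,T,N(\mathfrak t))$.
   Context: All vector spaces are over $\mathbb C$. An algebraic $K$-module is a union of finite-dimensional $K$-invariant subspaces on which $K$ acts through morphisms of algebraic groups. A Harish-Chandra pair $(\mathcal A,K)$ consists of a complex algebraic group $K$ with Lie algebra $\mathfrak k$, an associative unital algebra $\mathcal A$, an algebraic action $\phi:K\to\mathrm{Aut}(\mathcal A)$ and a Lie algebra homomorphism $\psi:\mathfrak k\to\mathcal A$ with $\psi\circ\mathrm{Ad}(k)=\phi(k)\circ\psi$ for $k\in K$ and such that the differential of $\phi$ is $\xi\mapsto[\psi(\xi),-]$. DG algebras: graded unital algebras $\mathcal D$ with differential $d$ of degree $+1$, $d(1)=0$, $d(xy)=d(x)y+(-1)^{\deg x}x\,d(y)$; as DG Lie algebras they carry $[a,b]=ab-(-1)^{\deg a\deg b}ba$. A triple $(\mathcal A,K,\mathcal D)$ is a Harish-Chandra pair $(\mathcal A,K)$ with a DG algebra $\mathcal D$ carrying an algebraic $K$-action $\chi$ by DG automorphisms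 and a $K$-equivariant morphism $\rho:\mathfrak k\to\mathcal D$ of DG Lie algebras ($\mathfrak k$ in degree $0$) such that the differential of $\chi$ is $\xi\mapsto[\rho(\xi),-]$. An $(\mathcal A,K,\mathcal D)$-module is a complex $V$ of vector spaces with actions $\pi$ of $\mathcal A$ and $\nu$ of $K$ by chain maps ($\nu$ algebraic) and a graded action $\omega$ of $\mathcal D$ with $d(xv)=(dx)v+(-1)^{\deg x}x\,dv$, such that $\pi$ and $\omega$ are $K$-equivariant ($\pi(\phi(k)a)=\nu(k)\pi(a)\nu(k)^{-1}$, $\omega(\chi(k)x)=\nu(k)\omega(x)\nu(k)^{-1}$), $\pi$ and $\omega$ commute, and $\pi(\psi(\xi))+\omega(\rho(\xi))=d\nu(\xi)$ for $\xi\in\mathfrak k$. Morphisms are chain maps preserving all actions; the category is $\mathcal M(\mathcal A,K,\mathcal D)$. $\mathrm{Hom}^\cdot_{(\mathcal A,K,\mathcal D)}(V,W)$ is the subcomplex of the usual Hom complex ($\mathrm{Hom}^k=\prod_j\mathrm{Hom}_{\mathbb C}(V^j,W^{j+k})$, $df=d_Wf-(-1)^{\deg f}fd_V$) spanned by homogeneous $f$ that commute with $\mathcal A$ and $K$ and satisfy $f(xv)=(-1)^{\deg f\deg x}xf(v)$ for $x\in\mathcal D$. $N(\mathfrak k)$ is the standard complex $N^{-p}(\mathfrak k)=\mathcal U(\mathfrak k)\otimes\bigwedge^p\mathfrak k$, with its DG algebra structure: it is generated by $\mathfrak k$ in degree $0$ (generating $\mathcal U(\mathfrak k)$) and a copy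 $\{\bar\xi:\xi\in\mathfrak k\}$ of $\mathfrak k$ in degree $-1$ (generating $\bigwedge\mathfrak k$), with $X\bar\xi-\bar\xi X=\overline{[X,\xi]}$, $\bar\xi\bar\eta+\bar\eta\bar\xi=0$, $d\bar\xi=\xi$, $dX=0$. $K$ acts on it by $\mathrm{Ad}$ and $\rho$ is the inclusion of $\mathfrak k$ in degree $0$. The principal antiautomorphism $\iota$ is the linear map with ${}^\iota X=-X$, ${}^\iota\bar\xi=-\bar\xi$ and ${}^\iota(uv)=(-1)^{\deg u\deg v}\,{}^\iota v\,{}^\iota u$. $(\mathcal A,K,N(\mathfrak k))$-modules are called equivariant $(\mathcal A,K)$-complexes. Via $\gamma$, $(\mathcal A,T)$ (with $\phi\circ\gamma$, $\psi\circ\gamma$) and $(\mathcal U(\mathfrak k),T)$ (with $\mathrm{Ad}\circ\gamma$ and the inclusion) are Harish-Chandra pairs, the Lie algebra $\mathfrak t$ of $T$ is identified with a subalgebra of $\mathfrak k$, and $N(\mathfrak t)\subset N(\mathfrak k)$. The forgetful functor restricts the $K$-action to $T$ via $\gamma$ and the $N(\mathfrak k)$-action to $N(\mathfrak t)$. For an $(\mathcal A,T,N(\mathfrak t))$-module $V$ with actions $\pi_V,\nu_V,\omega_V$, let $R(K,V)=R(K)\otimes V$ be the complex of $V$-valued regular functions on $K$ (differential induced by $d_V$). It has actions $(\nu_R(g)F)(k)=F(kg)$ of $K$ and $(\pi_R(a)F)(k)=\pi_V(\phi(k)a)(F(k))$ of $\mathcal A$. It is a $(\mathcal U(\mathfrak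 k),T,N(\mathfrak t))$-module via $\lambda$: $\mathfrak k$ and $T$ act by the tensor product of the left regular action on $R(K)$ with the action on $V$, i.e. $(\lambda(X)F)(k)=\pi_V(X)(F(k))+\frac{d}{dt}F(\exp(-tX)k)|_{t=0}$ (where $\pi_V(X)=\pi_V(\psi(X))$), $(\lambda(t)F)(k)=\nu_V(t)(F(\gamma(t)^{-1}k))$, and $N(\mathfrak t)$ acts by $(\lambda(n)F)(k)=\omega_V(n)(F(k))$. $N(\mathfrak k)$ is a $(\mathcal U(\mathfrak k),T,N(\mathfrak t))$-module: $\mathfrak k$ acts by left multiplication, $T$ by $\mathrm{Ad}\circ\gamma$, and $m\in N(\mathfrak t)$ by $\omega_N(m)n=(-1)^{\deg m\deg n}n\,{}^\iota m$. Then $$\Gamma^{eq}_{K,T}(V)=\mathrm{Hom}^\cdot_{(\mathcal U(\mathfrak k),T,N(\mathfrak t))}(N(\mathfrak k),R(K,V))$$ is an $(\mathcal A,K,N(\mathfrak k))$-module with $\pi_\Gamma(a)f=\pi_R(a)\circ f$, $\nu_\Gamma(k)f=\nu_R(k)\circ f$, $(\omega_\Gamma(n)f)(m)(k)=(-1)^{\deg n\deg f}f(\mathrm{Ad}(k)({}^\iota n)\,m)(k)$, and on morphisms $(\Gamma^{eq}_{K,T}(\varphi)f)(n)(k)=\varphi(f(n)(k))$. *)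

theory Defs
  imports Complex_Main "HOL-Library.Function_Algebras" "HOL-Library.FuncSet"
begin

section \<open>Complex vector spaces and unital complex algebras\<close>

class scaleC =
  fixes scaleC :: "complex \<Rightarrow> 'a \<Rightarrow> 'a"  (infixr "*\<^sub>C" 75)

class complex_vector = scaleC + ab_group_add +
  assumes scaleC_add_right: "a *\<^sub>C (x + y) = a *\<^sub>C x + a *\<^sub>C y"
    and scaleC_add_left: "(a + b) *\<^sub>C x = a *\<^sub>C x + b *\<^sub>C x"
    and scaleC_scaleC: "a *\<^sub>C (b *\<^sub>C x) = (a * b) *\<^sub>C x"
    and scaleC_one: "1 *\<^sub>C x = x"

global_interpretation complex_vector:
  vector_space "scaleC :: complex \<Rightarrow> 'a \<Rightarrow> 'a :: complex_vector"
  by unfold_locales (simp_all add: scaleC_add_right scaleC_add_left scaleC_scaleC scaleC_one)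

instantiation "fun" :: (type, complex_vector) complex_vector
begin

definition scaleC_fun :: "complex \<Rightarrow> ('a \<Rightarrow> 'b) \<Rightarrow> 'a \<Rightarrow> 'b" where
  "scaleC_fun c f = (\<lambda>x. c *\<^sub>C f x)"

instance
  by standard
    (simp_all add: scaleC_fun_def fun_eq_iff scaleC_add_right scaleC_add_left scaleC_scaleC scaleC_one)

end

text \<open>Linear maps between linear subspaces; nothing is said about values outside \<open>S\<close>.\<close>

definition lin_on :: "'v::complex_vector set \<Rightarrow> 'w::complex_vector set \<Rightarrow> ('v \<Rightarrow> 'w) \<Rightarrow> bool" where
  "lin_on S T f \<longleftrightarrow> f ` S \<subseteq> T \<and> (\<forall>x\<in>S. \<forall>y\<in>S. f (x + y) = f x + f y)
     \<and> (\<forall>c. \<forall>x\<in>S. f (c *\<^sub>C x) = c *\<^sub>C f x)"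

text \<open>The class \<^class>\<open>ring_1\<close> would exclude the zero algebra.\<close>

class complex_algebra_1 = complex_vector + ring + monoid_mult +
  assumes scaleC_mult_left: "(c *\<^sub>C x) * y = c *\<^sub>C (x * y)"
    and scaleC_mult_right: "x * (c *\<^sub>C y) = c *\<^sub>C (x * y)"


section \<open>Complex algebraic groups\<close>

text \<open>
  A variety is a set with a Zariski topology and, on every open set \<open>U\<close>, a set \<open>Reg X U\<close> of
  complex-valued regular functions. Functions are total; membership in \<open>Reg X U\<close> depends only on
  the values on \<open>U\<close> (this follows from the description of \<open>Reg\<close> in affine charts).
\<close>

record 'x fspace =
  Opn :: "'x set set"
  Reg :: "'x set \<Rightarrow> ('x \<Rightarrow> complex) set"

inductive_set poly_fun :: "nat \<Rightarrow> ((nat \<Rightarrow> complex) \<Rightarrow> complex) set" for n :: nat where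
  poly_const: "(\<lambda>z. c) \<in> poly_fun n"
| poly_coord: "i < n \<Longrightarrow> (\<lambda>z. z i) \<in> poly_fun n"
| poly_add: "p \<in> poly_fun n \<Longrightarrow> q \<in> poly_fun n \<Longrightarrow> (\<lambda>z. p z + q z) \<in> poly_fun n"
| poly_mult: "p \<in> poly_fun n \<Longrightarrow> q \<in> poly_fun n \<Longrightarrow> (\<lambda>z. p z * q z) \<in> poly_fun n"

text \<open>
  \<open>U\<close> is affine: coordinates \<open>x\<close> identify \<open>U\<close>, with its induced topology and regular functions,
  with the zero set of a family \<open>P\<close> of polynomials in affine \<open>n\<close>-space.
\<close>

definition affine_open :: "'x fspace \<Rightarrow> 'x set \<Rightarrow> bool" where
  "affine_open X U \<longleftrightarrow> U \<in> Opn X \<and>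
     (\<exists>n x P. P \<subseteq> poly_fun n
       \<and> bij_betw x U {z \<in> {..<n} \<rightarrow>\<^sub>E UNIV. \<forall>p\<in>P. p z = 0}
       \<and> (\<forall>V. V \<subseteq> U \<longrightarrow> (V \<in> Opn X \<longleftrightarrow> (\<exists>Q\<subseteq>poly_fun n. V = {a \<in> U. \<exists>q\<in>Q. q (x a) \<noteq> 0})))
       \<and> (\<forall>V\<in>Opn X. V \<subseteq> U \<longrightarrow> Reg X V =
            {f. \<forall>a\<in>V. \<exists>p\<in>poly_fun n. \<exists>q\<in>poly_fun n. q (x a) \<noteq> 0 \<and>
                  (\<forall>b\<in>V. q (x b) \<noteq> 0 \<longrightarrow> f b = p (x b) / q (x b))}))"

definition prevariety :: "'x fspace \<Rightarrow> bool" where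
  "prevariety X \<longleftrightarrow>
     UNIV \<in> Opn X
     \<and> (\<forall>U\<in>Opn X. \<forall>V\<in>Opn X. U \<inter> V \<in> Opn X)
     \<and> (\<forall>\<V>\<subseteq>Opn X. \<Union>\<V> \<in> Opn X)
     \<and> (\<forall>\<V>\<subseteq>Opn X. Reg X (\<Union>\<V>) = (\<Inter>V\<in>\<V>. Reg X V))
     \<and> (\<exists>\<U>. finite \<U> \<and> \<Union>\<U> = UNIV \<and> (\<forall>U\<in>\<U>. affine_open X U))"

definition morphism :: "'x fspace \<Rightarrow> 'y fspace \<Rightarrow> ('x \<Rightarrow> 'y) \<Rightarrow> bool" where
  "morphism X Y h \<longleftrightarrow>
     (\<forall>V\<in>Opn Y. h -` V \<in> Opn X \<and> (\<forall>f\<in>Reg Y V. f \<circ> h \<in> Reg X (h -` V)))"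

text \<open>
  The product variety: \<open>sum_prod X Y U V\<close> is the image of \<open>Reg X U \<otimes> Reg Y V\<close> in the functions
  on \<open>U \<times> V\<close>; basic open sets are the non-vanishing loci of such functions, and regular
  functions are locally quotients of them.
\<close>

definition sum_prod ::
  "'x fspace \<Rightarrow> 'y fspace \<Rightarrow> 'x set \<Rightarrow> 'y set \<Rightarrow> ('x \<times> 'y \<Rightarrow> complex) set" where
  "sum_prod X Y U V = {F. \<exists>(n::nat) a b. (\<forall>i<n. a i \<in> Reg X U \<and> b i \<in> Reg Y V)
      \<and> F = (\<lambda>(u, v). \<Sum>i<n. a i u * b i v)}"

definition prod_fspace :: "'x fspace \<Rightarrow> 'y fspace \<Rightarrow> ('x \<times> 'y) fspace" where
  "prod_fspace X Y = \<lparr>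
     Opn = {W. \<forall>w\<in>W. \<exists>U\<in>Opn X. \<exists>V\<in>Opn Y. \<exists>q\<in>sum_prod X Y U V.
              w \<in> U \<times> V \<and> q w \<noteq> 0 \<and> {r \<in> U \<times> V. q r \<noteq> 0} \<subseteq> W},
     Reg = (\<lambda>W. {F. \<forall>w\<in>W. \<exists>U\<in>Opn X. \<exists>V\<in>Opn Y. \<exists>p\<in>sum_prod X Y U V. \<exists>q\<in>sum_prod X Y U V.
              w \<in> U \<times> V \<and> q w \<noteq> 0 \<and> (\<forall>r\<in>W \<inter> U \<times> V. q r \<noteq> 0 \<longrightarrow> F r = p r / q r)}) \<rparr>"

class group_mult = monoid_mult + inverse +
  assumes group_left_inverse: "inverse x * x = 1"
    and group_divide: "x / y = x * inverse y"

text \<open>Algebraic groups; separatedness is automatic for groups and therefore not required.\<close>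

class complex_algebraic_group = group_mult +
  fixes variety :: "'a fspace"
  assumes variety: "prevariety variety"
    and mult_morphism: "morphism (prod_fspace variety variety) variety (\<lambda>(x, y). x * y)"
    and inverse_morphism: "morphism variety variety inverse"

definition alg_group_morphism ::
  "('t::complex_algebraic_group \<Rightarrow> 'k::complex_algebraic_group) \<Rightarrow> bool" where
  "alg_group_morphism \<gamma> \<longleftrightarrow> morphism variety variety \<gamma> \<and> (\<forall>s t. \<gamma> (s * t) = \<gamma> s * \<gamma> t)"

text \<open>The algebra \<open>R(K)\<close>.\<close>

definition regfun :: "('k::complex_algebraic_group \<Rightarrow> complex) set" where
  "regfun = Reg variety UNIV"


section \<open>The ring of regular functions on an open set\<close>

lemma Opn_Int: "prevariety X \<Longrightarrow> U \<in> Opn X \<Longrightarrow> V \<in> Opn X \<Longrightarrow> U \<inter> V \<in> Opn X"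
  by (simp add: prevariety_def)

lemma Opn_Union: "prevariety X \<Longrightarrow> \<V> \<subseteq> Opn X \<Longrightarrow> \<Union>\<V> \<in> Opn X"
  by (simp add: prevariety_def)

lemma Opn_local:
  assumes "prevariety X" "\<And>a. a \<in> U \<Longrightarrow> \<exists>V\<in>Opn X. a \<in> V \<and> V \<subseteq> U"
  shows "U \<in> Opn X"
proof -
  have "U = \<Union>{V\<in>Opn X. V \<subseteq> U}" using assms(2) by blast
  then show ?thesis using Opn_Union[OF assms(1), of "{V\<in>Opn X. V \<subseteq> U}"] by auto
qed

lemma Reg_mono:
  assumes "prevariety X" "U \<in> Opn X" "V \<in> Opn X" "V \<subseteq> U" "f \<in> Reg X U"
  shows "f \<in> Reg X V"
proof -
  have "Reg X (\<Union>{U,V}) = (\<Inter>W\<in>{U,V}. Reg X W)"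
  proof -
    have "{U,V} \<subseteq> Opn X" using assms by blast
    then show ?thesis using assms(1) unfolding prevariety_def by blast
  qed
  moreover have "\<Union>{U,V} = U" using assms(4) by auto
  ultimately show ?thesis using assms(5) by auto
qed

lemma Reg_local:
  assumes "prevariety X" "\<And>a. a \<in> U \<Longrightarrow> \<exists>V\<in>Opn X. a \<in> V \<and> V \<subseteq> U \<and> f \<in> Reg X V"
  shows "f \<in> Reg X U"
proof -
  let ?V = "{V\<in>Opn X. V \<subseteq> U \<and> f \<in> Reg X V}"
  have "U = \<Union>?V" using assms(2) by blast
  moreover have "Reg X (\<Union>?V) = (\<Inter>V\<in>?V. Reg X V)"
  proof -
    have "?V \<subseteq> Opn X" by blast
    then show ?thesis using assms(1) unfolding prevariety_def by blast
  qed
  ultimately show ?thesis by auto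
qed

lemma affine_nbhd:
  assumes "prevariety X" obtains W where "affine_open X W" "a \<in> W"
proof -
  obtain \<U> where "\<Union>\<U> = UNIV" "\<forall>U\<in>\<U>. affine_open X U"
    using assms unfolding prevariety_def by (elim conjE exE)
  then show ?thesis using that by blast
qed

lemma affine_Reg_arith:
  assumes X: "prevariety X" and W: "affine_open X W" and V: "V \<in> Opn X" "V \<subseteq> W"
  shows "(\<lambda>a. c) \<in> Reg X V"
    and "f \<in> Reg X V \<Longrightarrow> g \<in> Reg X V \<Longrightarrow> (\<lambda>a. f a + g a) \<in> Reg X V"
    and "f \<in> Reg X V \<Longrightarrow> g \<in> Reg X V \<Longrightarrow> (\<lambda>a. f a * g a) \<in> Reg X V"
    and "f \<in> Reg X V \<Longrightarrow> (\<And>a. a \<in> V \<Longrightarrow> g a = f a) \<Longrightarrow> g \<in> Reg X V"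
    and "f \<in> Reg X V \<Longrightarrow> {a \<in> V. f a \<noteq> 0} \<in> Opn X"
    and "f \<in> Reg X V \<Longrightarrow> (\<lambda>a. inverse (f a)) \<in> Reg X {a \<in> V. f a \<noteq> 0}"
proof -
  have "\<exists>n x. W \<in> Opn X \<and> 
       (\<forall>V. V \<subseteq> W \<longrightarrow> (V \<in> Opn X \<longleftrightarrow> (\<exists>Q\<subseteq>poly_fun n. V = {a \<in> W. \<exists>q\<in>Q. q (x a) \<noteq> 0})))
       \<and> (\<forall>V\<in>Opn X. V \<subseteq> W \<longrightarrow> Reg X V =
            {f. \<forall>a\<in>V. \<exists>p\<in>poly_fun n. \<exists>q\<in>poly_fun n. q (x a) \<noteq> 0 \<and>
                  (\<forall>b\<in>V. q (x b) \<noteq> 0 \<longrightarrow> f b = p (x b) / q (x b))})"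
    using W unfolding affine_open_def by (elim conjE exE) (intro exI conjI; assumption)
  then obtain n x where Wop: "W \<in> Opn X" and
    top': "\<forall>V. V \<subseteq> W \<longrightarrow> (V \<in> Opn X \<longleftrightarrow> (\<exists>Q\<subseteq>poly_fun n. V = {a \<in> W. \<exists>q\<in>Q. q (x a) \<noteq> 0}))"
    and reg': "\<forall>V\<in>Opn X. V \<subseteq> W \<longrightarrow> Reg X V =
            {f. \<forall>a\<in>V. \<exists>p\<in>poly_fun n. \<exists>q\<in>poly_fun n. q (x a) \<noteq> 0 \<and>
                  (\<forall>b\<in>V. q (x b) \<noteq> 0 \<longrightarrow> f b = p (x b) / q (x b))}"
    by (elim conjE exE) (rule that; assumption)
  note top = top'[rule_format] and reg = reg'[rule_format]
  have regI: "h \<in> Reg X U" if "U \<in> Opn X" "U \<subseteq> W"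
    "\<And>a. a\<in>U \<Longrightarrow> \<exists>p\<in>poly_fun n. \<exists>q\<in>poly_fun n. q (x a) \<noteq> 0 \<and>
                  (\<forall>b\<in>U. q (x b) \<noteq> 0 \<longrightarrow> h b = p (x b) / q (x b))" for h U
    unfolding reg[OF that(1,2)] using that(3) by (intro CollectI ballI)
  have regD: "\<exists>p\<in>poly_fun n. \<exists>q\<in>poly_fun n. q (x a) \<noteq> 0 \<and>
                  (\<forall>b\<in>V. q (x b) \<noteq> 0 \<longrightarrow> h b = p (x b) / q (x b))" 
    if "h \<in> Reg X V" "a \<in> V" for h a
    using that(1) unfolding reg[OF V] using that(2) by (elim CollectE bspec)
  show "(\<lambda>a. c) \<in> Reg X V"
  proof (rule regI[OF V])
    fix a assume "a \<in> V"
    show "\<exists>p\<in>poly_fun n. \<exists>q\<in>poly_fun n. q (x a) \<noteq> 0 \<and> (\<forall>b\<in>V. q (x b) \<noteq> 0 \<longrightarrow> c = p (x b) / q (x b))"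
      by (rule bexI[of _ "\<lambda>z. c"], rule bexI[of _ "\<lambda>z. 1"]) (auto intro: poly_const)
  qed
  show "(\<lambda>a. f a + g a) \<in> Reg X V" if f: "f \<in> Reg X V" and g: "g \<in> Reg X V"
  proof (rule regI[OF V])
    fix a assume "a \<in> V"
    obtain p q where 1: "p \<in> poly_fun n" "q \<in> poly_fun n" "q (x a) \<noteq> 0"
      "\<forall>b\<in>V. q (x b) \<noteq> 0 \<longrightarrow> f b = p (x b) / q (x b)"
      using regD[OF f \<open>a \<in> V\<close>] by (elim bexE conjE)
    obtain p' q' where 2: "p' \<in> poly_fun n" "q' \<in> poly_fun n" "q' (x a) \<noteq> 0"
      "\<forall>b\<in>V. q' (x b) \<noteq> 0 \<longrightarrow> g b = p' (x b) / q' (x b)"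
      using regD[OF g \<open>a \<in> V\<close>] by (elim bexE conjE)
    note * = 1(1,2) 2(1,2) 1(3) 2(3) 1(4)[rule_format] 2(4)[rule_format]
    show "\<exists>p\<in>poly_fun n. \<exists>q\<in>poly_fun n. q (x a) \<noteq> 0 \<and>
        (\<forall>b\<in>V. q (x b) \<noteq> 0 \<longrightarrow> f b + g b = p (x b) / q (x b))"
    proof (rule bexI[of _ "\<lambda>z. p z * q' z + p' z * q z"], rule bexI[of _ "\<lambda>z. q z * q' z"])
      show "q (x a) * q' (x a) \<noteq> 0 \<and>
        (\<forall>b\<in>V. q (x b) * q' (x b) \<noteq> 0 \<longrightarrow>
          f b + g b = (p (x b) * q' (x b) + p' (x b) * q (x b)) / (q (x b) * q' (x b)))"
        using *(5-8) by (auto simp: add_divide_distrib)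
    qed (use * in \<open>auto intro!: poly_fun.intros\<close>)
  qed
  show "(\<lambda>a. f a * g a) \<in> Reg X V" if f: "f \<in> Reg X V" and g: "g \<in> Reg X V"
  proof (rule regI[OF V])
    fix a assume "a \<in> V"
    obtain p q where 1: "p \<in> poly_fun n" "q \<in> poly_fun n" "q (x a) \<noteq> 0"
      "\<forall>b\<in>V. q (x b) \<noteq> 0 \<longrightarrow> f b = p (x b) / q (x b)"
      using regD[OF f \<open>a \<in> V\<close>] by (elim bexE conjE)
    obtain p' q' where 2: "p' \<in> poly_fun n" "q' \<in> poly_fun n" "q' (x a) \<noteq> 0"
      "\<forall>b\<in>V. q' (x b) \<noteq> 0 \<longrightarrow> g b = p' (x b) / q' (x b)"
      using regD[OF g \<open>a \<in> V\<close>] by (elim bexE conjE)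
    note * = 1(1,2) 2(1,2) 1(3) 2(3) 1(4)[rule_format] 2(4)[rule_format]
    show "\<exists>p\<in>poly_fun n. \<exists>q\<in>poly_fun n. q (x a) \<noteq> 0 \<and>
        (\<forall>b\<in>V. q (x b) \<noteq> 0 \<longrightarrow> f b * g b = p (x b) / q (x b))"
    proof (rule bexI[of _ "\<lambda>z. p z * p' z"], rule bexI[of _ "\<lambda>z. q z * q' z"])
      show "q (x a) * q' (x a) \<noteq> 0 \<and>
        (\<forall>b\<in>V. q (x b) * q' (x b) \<noteq> 0 \<longrightarrow>
          f b * g b = (p (x b) * p' (x b)) / (q (x b) * q' (x b)))"
        using *(5-8) by auto
    qed (use * in \<open>auto intro!: poly_fun.intros\<close>)
  qed
  show "g \<in> Reg X V" if f: "f \<in> Reg X V" and "\<And>a. a \<in> V \<Longrightarrow> g a = f a"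
    by (rule regI[OF V]) (use regD[OF f] that(2) in simp)
  have *: "\<exists>p q. p\<in>poly_fun n \<and> q\<in>poly_fun n \<and> q (x a) \<noteq> 0 \<and> p (x a) \<noteq> 0 \<and>
       {b \<in> V. p (x b) * q (x b) \<noteq> 0} \<in> Opn X \<and>
       (\<forall>b\<in>V. q (x b) \<noteq> 0 \<longrightarrow> f b = p (x b) / q (x b))" if f: "f \<in> Reg X V" and "a \<in> V" "f a \<noteq> 0" for a
  proof -
    obtain p q where pq: "p \<in> poly_fun n" "q \<in> poly_fun n" "q (x a) \<noteq> 0" 
      "\<forall>b\<in>V. q (x b) \<noteq> 0 \<longrightarrow> f b = p (x b) / q (x b)"
      using regD[OF f \<open>a \<in> V\<close>] by (elim bexE conjE)
    have "{b \<in> W. p (x b) * q (x b) \<noteq> 0} \<in> Opn X"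
      by (rule top[THEN iffD2]) (use pq poly_mult in \<open>auto intro!: exI[of _ "{\<lambda>z. p z * q z}"]\<close>)
    then have "V \<inter> {b \<in> W. p (x b) * q (x b) \<noteq> 0} \<in> Opn X"
      using Opn_Int[OF X V(1)] by blast
    moreover have "V \<inter> {b \<in> W. p (x b) * q (x b) \<noteq> 0} = {b \<in> V. p (x b) * q (x b) \<noteq> 0}"
      using V by auto
    moreover have "p (x a) \<noteq> 0" using pq(3) pq(4) that by auto
    ultimately show ?thesis using pq by (intro exI[of _ p] exI[of _ q]) simp
  qed
  show op: "{a \<in> V. f a \<noteq> 0} \<in> Opn X" if f: "f \<in> Reg X V"
  proof (rule Opn_local[OF X])
    fix a assume "a \<in> {a \<in> V. f a \<noteq> 0}"
    then obtain p q where "{b \<in> V. p (x b) * q (x b) \<noteq> 0} \<in> Opn X" "q (x a) \<noteq> 0" "p (x a) \<noteq> 0"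
       "(\<forall>b\<in>V. q (x b) \<noteq> 0 \<longrightarrow> f b = p (x b) / q (x b))" "a \<in> V"
      using *[OF f] by blast
    then show "\<exists>U\<in>Opn X. a \<in> U \<and> U \<subseteq> {a \<in> V. f a \<noteq> 0}"
      by (intro bexI[of _ "{b \<in> V. p (x b) * q (x b) \<noteq> 0}"]) auto
  qed
  show "(\<lambda>a. inverse (f a)) \<in> Reg X {a \<in> V. f a \<noteq> 0}" if f: "f \<in> Reg X V"
  proof (rule regI[OF op[OF f]])
    show "{a \<in> V. f a \<noteq> 0} \<subseteq> W" using V by blast
    fix a assume "a \<in> {a \<in> V. f a \<noteq> 0}"
    then obtain p q where "q (x a) \<noteq> 0" "p (x a) \<noteq> 0" "p\<in>poly_fun n" "q\<in>poly_fun n"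
       "(\<forall>b\<in>V. q (x b) \<noteq> 0 \<longrightarrow> f b = p (x b) / q (x b))" "a \<in> V"
      using *[OF f] by blast
    then show "\<exists>p\<in>poly_fun n. \<exists>q\<in>poly_fun n. q (x a) \<noteq> 0 \<and>
       (\<forall>b\<in>{a \<in> V. f a \<noteq> 0}. q (x b) \<noteq> 0 \<longrightarrow> inverse (f b) = p (x b) / q (x b))"
      by (intro bexI[of _ "\<lambda>z. q z * q z"] bexI[of _ "\<lambda>z. p z * q z"])
        (auto intro: poly_fun.intros)
  qed
qed

lemma affine_Int:
  assumes "prevariety X" "affine_open X W" "U \<in> Opn X"
  shows "U \<inter> W \<in> Opn X"
  using assms(2) unfolding affine_open_def by (elim conjE) (rule Opn_Int[OF assms(1,3)])

lemma Reg_restrict_affine: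
  assumes X: "prevariety X" and U: "U \<in> Opn X"
    and *: "\<And>W. affine_open X W \<Longrightarrow> f \<in> Reg X (U \<inter> W)"
  shows "f \<in> Reg X U"
proof (rule Reg_local[OF X])
  fix a assume "a \<in> U"
  obtain W where W: "affine_open X W" "a \<in> W" by (rule affine_nbhd[OF X])
  then have "U \<inter> W \<in> Opn X" using affine_Int[OF X _ U] by blast
  then show "\<exists>V\<in>Opn X. a \<in> V \<and> V \<subseteq> U \<and> f \<in> Reg X V"
    using * W \<open>a \<in> U\<close> by blast
qed

lemma Reg_const:
  assumes X: "prevariety X" and U: "U \<in> Opn X"
  shows "(\<lambda>a. c) \<in> Reg X U"
proof (rule Reg_restrict_affine[OF X U])
  fix W assume W: "affine_open X W"
  have "U \<inter> W \<in> Opn X" by (rule affine_Int[OF X W U])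
  then show "(\<lambda>a. c) \<in> Reg X (U \<inter> W)" by (rule affine_Reg_arith(1)[OF X W _ Int_lower2])
qed

lemma
  assumes X: "prevariety X" and U: "U \<in> Opn X" and f: "f \<in> Reg X U"
  shows Reg_add: "g \<in> Reg X U \<Longrightarrow> (\<lambda>a. f a + g a) \<in> Reg X U"
    and Reg_mult: "g \<in> Reg X U \<Longrightarrow> (\<lambda>a. f a * g a) \<in> Reg X U"
    and Reg_cong: "(\<And>a. a \<in> U \<Longrightarrow> g a = f a) \<Longrightarrow> g \<in> Reg X U"
    and Opn_nonzero: "{a \<in> U. f a \<noteq> 0} \<in> Opn X"
    and Reg_inverse: "(\<lambda>a. inverse (f a)) \<in> Reg X {a \<in> U. f a \<noteq> 0}"
proof -
  have fW: "f \<in> Reg X (U \<inter> W)" if "affine_open X W" for W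
    using Reg_mono[OF X U affine_Int[OF X that U] _ f] by blast
  note ar = affine_Reg_arith(2-)[OF X _ affine_Int[OF X _ U] Int_lower2 fW]
  show "(\<lambda>a. f a + g a) \<in> Reg X U" if "g \<in> Reg X U"
    by (rule Reg_restrict_affine[OF X U], rule ar(1))
      (use that Reg_mono[OF X U affine_Int[OF X _ U] Int_lower1] in auto)
  show "(\<lambda>a. f a * g a) \<in> Reg X U" if "g \<in> Reg X U"
    by (rule Reg_restrict_affine[OF X U], rule ar(2))
      (use that Reg_mono[OF X U affine_Int[OF X _ U] Int_lower1] in auto)
  show "g \<in> Reg X U" if "\<And>a. a \<in> U \<Longrightarrow> g a = f a"
    by (rule Reg_restrict_affine[OF X U], rule ar(3)) (use that in auto)
  show op: "{a \<in> U. f a \<noteq> 0} \<in> Opn X"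
  proof (rule Opn_local[OF X])
    fix a assume a: "a \<in> {a \<in> U. f a \<noteq> 0}"
    obtain W where W: "affine_open X W" "a \<in> W" by (rule affine_nbhd[OF X])
    show "\<exists>V\<in>Opn X. a \<in> V \<and> V \<subseteq> {a \<in> U. f a \<noteq> 0}"
      by (rule bexI[of _ "{a \<in> U \<inter> W. f a \<noteq> 0}"]) (use W a ar(4) in auto)
  qed
  show "(\<lambda>a. inverse (f a)) \<in> Reg X {a \<in> U. f a \<noteq> 0}"
  proof (rule Reg_restrict_affine[OF X op])
    fix W assume W: "affine_open X W"
    have "{a \<in> U. f a \<noteq> 0} \<inter> W = {a \<in> U \<inter> W. f a \<noteq> 0}" by blast
    with ar(5)[OF W W W] show "(\<lambda>a. inverse (f a)) \<in> Reg X ({a \<in> U. f a \<noteq> 0} \<inter> W)"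
      by simp
  qed
qed


lemma Reg_sum:
  assumes X: "prevariety X" and U: "U \<in> Opn X"
  shows "(\<And>i. i \<in> I \<Longrightarrow> f i \<in> Reg X U) \<Longrightarrow> (\<lambda>a. \<Sum>i\<in>I. f i a) \<in> Reg X U"
proof (induction I rule: infinite_finite_induct)
  case (insert i I)
  then have "(\<lambda>a. f i a + (\<Sum>i\<in>I. f i a)) \<in> Reg X U"
    by (intro Reg_add[OF X U]) auto
  with insert show ?case by simp
qed (simp_all add: Reg_const[OF X U])


section \<open>The Lie algebra of an algebraic group\<close>

class complex_lie_algebra = complex_vector +
  fixes bracket :: "'a \<Rightarrow> 'a \<Rightarrow> 'a"
  assumes bracket_add_left: "bracket (x + y) z = bracket x z + bracket y z"
    and bracket_scaleC_left: "bracket (c *\<^sub>C x) z = c *\<^sub>C bracket x z"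
    and bracket_add_right: "bracket z (x + y) = bracket z x + bracket z y"
    and bracket_scaleC_right: "bracket z (c *\<^sub>C x) = c *\<^sub>C bracket z x"
    and bracket_self: "bracket x x = 0"
    and jacobi: "bracket x (bracket y z) + bracket y (bracket z x) + bracket z (bracket x y) = 0"

text \<open>
  Functions regular near the identity. Tangent vectors at the identity are the derivations of the
  local ring at the identity; a derivation is extended by \<open>0\<close> to the functions that are not
  regular near the identity.
\<close>

definition near_one :: "('k::complex_algebraic_group \<Rightarrow> complex) set" where
  "near_one = {f. \<exists>U\<in>Opn variety. 1 \<in> U \<and> f \<in> Reg variety U}"

definition point_derivation ::
  "(('k::complex_algebraic_group \<Rightarrow> complex) \<Rightarrow> complex) \<Rightarrow> bool" where
  "point_derivation X \<longleftrightarrow>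
     (\<forall>f\<in>near_one. \<forall>g\<in>near_one. X (\<lambda>k. f k + g k) = X f + X g
        \<and> X (\<lambda>k. f k * g k) = f 1 * X g + X f * g 1)
     \<and> (\<forall>c. \<forall>f\<in>near_one. X (\<lambda>k. c * f k) = c * X f)
     \<and> (\<forall>f\<in>near_one. \<forall>g\<in>near_one. (\<exists>U\<in>Opn variety. 1 \<in> U \<and> (\<forall>k\<in>U. f k = g k)) \<longrightarrow> X f = X g)
     \<and> (\<forall>f. f \<notin> near_one \<longrightarrow> X f = 0)"

typedef (overloaded) 'k lie =
  "{X :: ('k::complex_algebraic_group \<Rightarrow> complex) \<Rightarrow> complex. point_derivation X}"
  morphisms apply_lie Abs_lie
  by (rule exI[of _ "\<lambda>f. 0"]) (simp add: point_derivation_def)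

lemma near_one_common:
  assumes "f \<in> near_one" "g \<in> near_one"
  obtains U where "U \<in> Opn variety" "1 \<in> U" "f \<in> Reg variety U" "g \<in> Reg variety U"
proof -
  obtain U V where UV: "U \<in> Opn variety" "1 \<in> U" "f \<in> Reg variety U"
    "V \<in> Opn variety" "1 \<in> V" "g \<in> Reg variety V"
    using assms unfolding near_one_def by auto
  have UV': "U \<inter> V \<in> Opn variety" by (rule Opn_Int[OF variety UV(1,4)])
  show ?thesis
    by (rule that[OF UV'])
      (use UV Reg_mono[OF variety UV(1) UV' _ UV(3)] Reg_mono[OF variety UV(4) UV' _ UV(6)] in auto)
qed

lemma near_oneI: "U \<in> Opn variety \<Longrightarrow> 1 \<in> U \<Longrightarrow> f \<in> Reg variety U \<Longrightarrow> f \<in> near_one"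
  unfolding near_one_def by blast

lemma near_one_add: "f \<in> near_one \<Longrightarrow> g \<in> near_one \<Longrightarrow> (\<lambda>k. f k + g k) \<in> near_one"
  by (erule (1) near_one_common) (blast intro: near_oneI Reg_add[OF variety])

lemma near_one_mult: "f \<in> near_one \<Longrightarrow> g \<in> near_one \<Longrightarrow> (\<lambda>k. f k * g k) \<in> near_one"
  by (erule (1) near_one_common) (blast intro: near_oneI Reg_mult[OF variety])

lemma UNIV_Opn: "UNIV \<in> Opn (variety :: 'k::complex_algebraic_group fspace)"
  using variety[where 'a='k] by (simp add: prevariety_def)

lemma near_one_const: "(\<lambda>k. c) \<in> near_one"
  by (rule near_oneI[OF UNIV_Opn]) (simp_all add: Reg_const[OF variety UNIV_Opn])

lemma near_one_scale: "f \<in> near_one \<Longrightarrow> (\<lambda>k. c * f k) \<in> near_one"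
  by (rule near_one_mult[OF near_one_const])

lemma near_one_diff: "f \<in> near_one \<Longrightarrow> g \<in> near_one \<Longrightarrow> (\<lambda>k. f k - g k) \<in> near_one"
  using near_one_add[OF _ near_one_scale[of g "-1"], of f] by simp

lemma near_one_sum:
  "(\<And>i. i \<in> I \<Longrightarrow> f i \<in> near_one) \<Longrightarrow> (\<lambda>k. \<Sum>i\<in>I. f i k) \<in> near_one"
proof (induction I rule: infinite_finite_induct)
  case (insert i I)
  then have "(\<lambda>a. f i a + (\<Sum>i\<in>I. f i a)) \<in> near_one" by (intro near_one_add) auto
  with insert show ?case by simp
qed (simp_all add: near_one_const)

lemma near_one_inverse:
  assumes "f \<in> near_one" "f 1 \<noteq> 0"
  shows "(\<lambda>k. inverse (f k)) \<in> near_one"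
proof -
  obtain U where U: "U \<in> Opn variety" "1 \<in> U" "f \<in> Reg variety U"
    using assms unfolding near_one_def by blast
  show ?thesis
    by (rule near_oneI[OF Opn_nonzero[OF variety U(1,3)]])
      (use U assms Reg_inverse[OF variety U(1,3)] in auto)
qed

lemma near_one_cong:
  assumes f: "f \<in> near_one" and W: "W \<in> Opn variety" "1 \<in> W" "\<And>k. k \<in> W \<Longrightarrow> g k = f k"
  shows "g \<in> near_one"
proof -
  obtain U where U: "U \<in> Opn variety" "1 \<in> U" "f \<in> Reg variety U"
    using f unfolding near_one_def by blast
  have UW: "U \<inter> W \<in> Opn variety" by (rule Opn_Int[OF variety U(1) W(1)])
  have "f \<in> Reg variety (U \<inter> W)" by (rule Reg_mono[OF variety U(1) UW _ U(3)]) blast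
  then have "g \<in> Reg variety (U \<inter> W)" by (rule Reg_cong[OF variety UW]) (use W in auto)
  then show ?thesis using UW U W by (intro near_oneI) auto
qed

lemma
  shows lie_add: "f \<in> near_one \<Longrightarrow> g \<in> near_one \<Longrightarrow>
      apply_lie X (\<lambda>k. f k + g k) = apply_lie X f + apply_lie X g"
    and lie_mult: "f \<in> near_one \<Longrightarrow> g \<in> near_one \<Longrightarrow>
      apply_lie X (\<lambda>k. f k * g k) = f 1 * apply_lie X g + apply_lie X f * g 1"
    and lie_scale: "f \<in> near_one \<Longrightarrow> apply_lie X (\<lambda>k. c * f k) = c * apply_lie X f"
    and lie_cong: "f \<in> near_one \<Longrightarrow> U \<in> Opn variety \<Longrightarrow> 1 \<in> U \<Longrightarrow>
      (\<And>k. k \<in> U \<Longrightarrow> g k = f k) \<Longrightarrow> apply_lie X g = apply_lie X f"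
    and lie_undef: "f \<notin> near_one \<Longrightarrow> apply_lie X f = 0"
proof -
  have "point_derivation (apply_lie X)" using apply_lie[of X] by simp
  note X = this[unfolded point_derivation_def]
  note X1 = X[THEN conjunct1, THEN bspec, THEN bspec] and X2 = X[THEN conjunct2]
  note X3 = X2[THEN conjunct2]
  show "apply_lie X (\<lambda>k. f k + g k) = apply_lie X f + apply_lie X g"
    "apply_lie X (\<lambda>k. f k * g k) = f 1 * apply_lie X g + apply_lie X f * g 1"
    if "f \<in> near_one" "g \<in> near_one"
    using X1[OF that] by (rule conjunct1, rule conjunct2)
  show "apply_lie X (\<lambda>k. c * f k) = c * apply_lie X f" if "f \<in> near_one"
    by (rule X2[THEN conjunct1, THEN spec, THEN bspec, OF that])
  show "apply_lie X g = apply_lie X f" if "f \<in> near_one" "U \<in> Opn variety" "1 \<in> U"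
      "\<And>k. k \<in> U \<Longrightarrow> g k = f k"
    by (rule X3[THEN conjunct1, THEN bspec, THEN bspec, THEN mp])
      (use near_one_cong[OF that] that in auto)
  show "apply_lie X f = 0" if "f \<notin> near_one"
    by (rule X3[THEN conjunct2, THEN spec, THEN mp, OF that])
qed

lemma lie_diff: "f \<in> near_one \<Longrightarrow> g \<in> near_one \<Longrightarrow>
    apply_lie X (\<lambda>k. f k - g k) = apply_lie X f - apply_lie X g"
  using lie_add[OF _ near_one_scale[of g "-1"], of f] lie_scale[of g X "-1"] by simp

lemma lie_const: "apply_lie X (\<lambda>k. c) = 0"
  using lie_mult[OF near_one_const near_one_const, of X 1 1] lie_scale[OF near_one_const, of X c 1]
  by simp

lemma lie_sum: "(\<And>i. i \<in> I \<Longrightarrow> f i \<in> near_one) \<Longrightarrow>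
    apply_lie X (\<lambda>k. \<Sum>i\<in>I. f i k) = (\<Sum>i\<in>I. apply_lie X (f i))"
proof (induction I rule: infinite_finite_induct)
  case (insert i I)
  then show ?case using lie_add[OF _ near_one_sum[of I f], of "f i"] by simp
qed (simp_all add: lie_const)

lemma lie_quotient:
  assumes f: "f \<in> near_one" and g: "g \<in> near_one" "g 1 \<noteq> 0"
  shows "apply_lie X (\<lambda>k. f k / g k)
    = (apply_lie X f * g 1 - f 1 * apply_lie X g) * inverse (g 1 * g 1)"
proof -
  obtain U where U: "U \<in> Opn variety" "1 \<in> U" "g \<in> Reg variety U"
    using g unfolding near_one_def by blast
  let ?h = "\<lambda>k. f k / g k"
  have h: "?h \<in> near_one"
    using near_one_mult[OF f near_one_inverse[OF g]] by (simp add: divide_inverse)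
  have "apply_lie X f = apply_lie X (\<lambda>k. ?h k * g k)"
    by (rule lie_cong[OF near_one_mult[OF h g(1)] Opn_nonzero[OF variety U(1,3)]]) (use U g in auto)
  also have "\<dots> = f 1 / g 1 * apply_lie X g + apply_lie X ?h * g 1"
    by (rule lie_mult[OF h g(1)])
  finally show ?thesis using g(2) by (simp add: field_simps)
qed

lemma lie_eqI: "(\<And>f. f \<in> near_one \<Longrightarrow> apply_lie X f = apply_lie Y f) \<Longrightarrow> X = Y"
  by (metis apply_lie_inject ext lie_undef)

instantiation lie :: (complex_algebraic_group) complex_vector
begin

definition zero_lie where "zero_lie = Abs_lie (\<lambda>f. 0)"
definition plus_lie where "plus_lie X Y = Abs_lie (\<lambda>f. apply_lie X f + apply_lie Y f)"
definition minus_lie where "minus_lie X Y = Abs_lie (\<lambda>f. apply_lie X f - apply_lie Y f)"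
definition uminus_lie where "uminus_lie X = Abs_lie (\<lambda>f. - apply_lie X f)"
definition scaleC_lie where "scaleC_lie c X = Abs_lie (\<lambda>f. c * apply_lie X f)"

lemma apply_lie_lincomb:
  fixes X Y :: "'a lie"
  shows "apply_lie (Abs_lie (\<lambda>f. a * apply_lie X f + b * apply_lie Y f))
     = (\<lambda>f. a * apply_lie X f + b * apply_lie Y f)"
proof (rule Abs_lie_inverse, rule CollectI, unfold point_derivation_def, intro conjI allI ballI impI)
  fix f g :: "'a \<Rightarrow> complex" assume "f \<in> near_one" "g \<in> near_one"
  then show "a * apply_lie X (\<lambda>k. f k + g k) + b * apply_lie Y (\<lambda>k. f k + g k)
      = a * apply_lie X f + b * apply_lie Y f + (a * apply_lie X g + b * apply_lie Y g)"
    by (simp add: lie_add algebra_simps)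
next
  fix f g :: "'a \<Rightarrow> complex" assume "f \<in> near_one" "g \<in> near_one"
  then show "a * apply_lie X (\<lambda>k. f k * g k) + b * apply_lie Y (\<lambda>k. f k * g k)
      = f 1 * (a * apply_lie X g + b * apply_lie Y g) + (a * apply_lie X f + b * apply_lie Y f) * g 1"
    by (simp add: lie_mult algebra_simps)
next
  fix c and f :: "'a \<Rightarrow> complex" assume "f \<in> near_one"
  then show "a * apply_lie X (\<lambda>k. c * f k) + b * apply_lie Y (\<lambda>k. c * f k)
      = c * (a * apply_lie X f + b * apply_lie Y f)"
    by (simp add: lie_scale algebra_simps)
next
  fix f g :: "'a \<Rightarrow> complex"
  assume *: "f \<in> near_one" "g \<in> near_one" "\<exists>U\<in>Opn variety. 1 \<in> U \<and> (\<forall>k\<in>U. f k = g k)"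
  then have "apply_lie Z f = apply_lie Z g" for Z :: "'a lie" using lie_cong[OF *(2)] by blast
  then show "a * apply_lie X f + b * apply_lie Y f = a * apply_lie X g + b * apply_lie Y g" by simp
next
  fix f :: "'a \<Rightarrow> complex" assume "f \<notin> near_one"
  then show "a * apply_lie X f + b * apply_lie Y f = 0" by (simp add: lie_undef)
qed

lemma apply_zero_lie [simp]: "apply_lie 0 f = 0"
  using fun_cong[OF apply_lie_lincomb[of 0 undefined 0 undefined], of f] by (simp add: zero_lie_def)

lemma apply_plus_lie [simp]: "apply_lie (X + Y) f = apply_lie X f + apply_lie Y f"
  using fun_cong[OF apply_lie_lincomb[of 1 X 1 Y], of f] by (simp add: plus_lie_def)

lemma apply_minus_lie [simp]: "apply_lie (X - Y) f = apply_lie X f - apply_lie Y f"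
  using fun_cong[OF apply_lie_lincomb[of 1 X "-1" Y], of f] by (simp add: minus_lie_def)

lemma apply_uminus_lie [simp]: "apply_lie (- X) f = - apply_lie X f"
  using fun_cong[OF apply_lie_lincomb[of "-1" X 0 X], of f] by (simp add: uminus_lie_def)

lemma apply_scaleC_lie [simp]: "apply_lie (c *\<^sub>C X) f = c * apply_lie X f"
  using fun_cong[OF apply_lie_lincomb[of c X 0 X], of f] by (simp add: scaleC_lie_def)

instance
  by standard (rule lie_eqI; simp add: algebra_simps)+

end


lemma sum_prodI:
  assumes "finite I" "\<And>i. i \<in> I \<Longrightarrow> a i \<in> Reg X U" "\<And>i. i \<in> I \<Longrightarrow> b i \<in> Reg Y V"
  shows "(\<lambda>(u, v). \<Sum>i\<in>I. a i u * b i v) \<in> sum_prod X Y U V"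
proof -
  obtain h where h: "bij_betw h {0..<card I} I"
    using ex_bij_betw_nat_finite[OF assms(1)] by blast
  have "(\<Sum>i\<in>I. a i u * b i v) = (\<Sum>i<card I. a (h i) u * b (h i) v)" for u v
    using sum.reindex_bij_betw[OF h, of "\<lambda>i. a i u * b i v"] by (simp add: atLeast0LessThan)
  moreover have "h i \<in> I" if "i < card I" for i using h that by (auto simp: bij_betw_def)
  ultimately show ?thesis unfolding sum_prod_def
    by (auto intro!: exI[of _ "card I"] exI[of _ "\<lambda>i. a (h i)"] exI[of _ "\<lambda>i. b (h i)"] assms(2,3))
qed

lemma sum_prod_mult:
  assumes X: "prevariety X" "U \<in> Opn X" and Y: "prevariety Y" "V \<in> Opn Y"
    and "p \<in> sum_prod X Y U V" "q \<in> sum_prod X Y U V"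
  shows "(\<lambda>r. p r * q r) \<in> sum_prod X Y U V"
proof -
  obtain m :: nat and a b where p: "\<And>i. i < m \<Longrightarrow> a i \<in> Reg X U" "\<And>i. i < m \<Longrightarrow> b i \<in> Reg Y V"
    "p = (\<lambda>(u, v). \<Sum>i<m. a i u * b i v)"
    using assms(5) unfolding sum_prod_def by blast
  obtain n :: nat and c d where q: "\<And>i. i < n \<Longrightarrow> c i \<in> Reg X U" "\<And>i. i < n \<Longrightarrow> d i \<in> Reg Y V"
    "q = (\<lambda>(u, v). \<Sum>i<n. c i u * d i v)"
    using assms(6) unfolding sum_prod_def by blast
  have "(\<lambda>(u, v). \<Sum>k\<in>{..<m}\<times>{..<n}. (a (fst k) u * c (snd k) u) * (b (fst k) v * d (snd k) v))
      \<in> sum_prod X Y U V"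
    by (rule sum_prodI) (auto intro!: Reg_mult[OF X] Reg_mult[OF Y] p(1,2) q(1,2))
  moreover have "(\<Sum>k\<in>{..<m}\<times>{..<n}. (a (fst k) u * c (snd k) u) * (b (fst k) v * d (snd k) v))
      = p (u, v) * q (u, v)" for u v
    unfolding p(3) q(3) by (simp add: sum_product sum.cartesian_product split_def algebra_simps)
  ultimately show ?thesis by (simp add: split_def)
qed

lemma sum_prod_mono:
  assumes "prevariety X" "U \<in> Opn X" "U' \<in> Opn X" "U' \<subseteq> U"
    and "prevariety Y" "V \<in> Opn Y" "V' \<in> Opn Y" "V' \<subseteq> V" and "p \<in> sum_prod X Y U V"
  shows "p \<in> sum_prod X Y U' V'"
  using assms(9) Reg_mono[OF assms(1-4)] Reg_mono[OF assms(5-8)] unfolding sum_prod_def by blast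

lemma prod_Reg_iff: "F \<in> Reg (prod_fspace X Y) W \<longleftrightarrow>
    (\<forall>w\<in>W. \<exists>U\<in>Opn X. \<exists>V\<in>Opn Y. \<exists>p\<in>sum_prod X Y U V. \<exists>q\<in>sum_prod X Y U V.
       w \<in> U \<times> V \<and> q w \<noteq> 0 \<and> (\<forall>r\<in>W \<inter> U \<times> V. q r \<noteq> 0 \<longrightarrow> F r = p r / q r))"
  by (simp only: prod_fspace_def fspace.simps mem_Collect_eq)

lemma prod_Opn_iff: "W \<in> Opn (prod_fspace X Y) \<longleftrightarrow>
    (\<forall>w\<in>W. \<exists>U\<in>Opn X. \<exists>V\<in>Opn Y. \<exists>q\<in>sum_prod X Y U V.
       w \<in> U \<times> V \<and> q w \<noteq> 0 \<and> {r \<in> U \<times> V. q r \<noteq> 0} \<subseteq> W)"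
  by (simp only: prod_fspace_def fspace.simps mem_Collect_eq)

lemma near_one_translate_prod:
  fixes f :: "'k::complex_algebraic_group \<Rightarrow> complex"
  assumes "f \<in> near_one"
  obtains U V p q
  where "U \<in> Opn variety" "V \<in> Opn variety" "(1::'k) \<in> U" "(1::'k) \<in> V"
    "p \<in> sum_prod variety variety U V" "q \<in> sum_prod variety variety U V" "q (1, 1) \<noteq> 0"
    "\<forall>g\<in>U. \<forall>h\<in>V. q (g, h) \<noteq> 0 \<longrightarrow> f (g * h) = p (g, h) / q (g, h)"
proof -
  let ?X = "variety :: 'k fspace"
  let ?\<mu> = "\<lambda>(x::'k, y). x * y"
  obtain U0 where U0: "U0 \<in> Opn ?X" "1 \<in> U0" "f \<in> Reg ?X U0"
    using assms unfolding near_one_def by blast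
  let ?W = "?\<mu> -` U0"
  have W: "?W \<in> Opn (prod_fspace ?X ?X)" and F: "f \<circ> ?\<mu> \<in> Reg (prod_fspace ?X ?X) ?W"
    using mult_morphism[where 'a='k] U0 unfolding morphism_def by blast+
  have w: "(1, 1) \<in> ?W" using U0 by simp
  obtain U1 V1 p1 q1 where 1: "U1 \<in> Opn ?X" "V1 \<in> Opn ?X" "p1 \<in> sum_prod ?X ?X U1 V1"
    "q1 \<in> sum_prod ?X ?X U1 V1" "(1, 1) \<in> U1 \<times> V1" "q1 (1, 1) \<noteq> 0"
    "\<forall>r\<in>?W \<inter> U1 \<times> V1. q1 r \<noteq> 0 \<longrightarrow> (f \<circ> ?\<mu>) r = p1 r / q1 r"
    using F[unfolded prod_Reg_iff, THEN bspec, OF w] by (elim bexE conjE)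
  obtain U2 V2 q2 where 2: "U2 \<in> Opn ?X" "V2 \<in> Opn ?X" 
    "q2 \<in> sum_prod ?X ?X U2 V2" "(1, 1) \<in> U2 \<times> V2" "q2 (1, 1) \<noteq> 0"
    "{r \<in> U2 \<times> V2. q2 r \<noteq> 0} \<subseteq> ?W"
    using W[unfolded prod_Opn_iff, THEN bspec, OF w] by (elim bexE conjE)
  let ?U = "U1 \<inter> U2" and ?V = "V1 \<inter> V2"
  have UV: "?U \<in> Opn ?X" "?V \<in> Opn ?X" using 1 2 Opn_Int[OF variety] by blast+
  have s: "p1 \<in> sum_prod ?X ?X ?U ?V" "q1 \<in> sum_prod ?X ?X ?U ?V" "q2 \<in> sum_prod ?X ?X ?U ?V"
    using sum_prod_mono[OF variety 1(1) UV(1) _ variety 1(2) UV(2) _ 1(3)]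
      sum_prod_mono[OF variety 1(1) UV(1) _ variety 1(2) UV(2) _ 1(4)]
      sum_prod_mono[OF variety 2(1) UV(1) _ variety 2(2) UV(2) _ 2(3)] by auto
  show ?thesis
  proof (rule that[OF UV _ _ sum_prod_mult[OF variety UV(1) variety UV(2) s(1,3)]
        sum_prod_mult[OF variety UV(1) variety UV(2) s(2,3)]])
    have "f (g * h) = p1 (g, h) * q2 (g, h) / (q1 (g, h) * q2 (g, h))"
      if *: "g \<in> ?U" "h \<in> ?V" "q1 (g, h) * q2 (g, h) \<noteq> 0" for g h
    proof -
    from * have "(g, h) \<in> ?W \<inter> U1 \<times> V1" using 2(6) by (intro IntI set_mp[OF 2(6)]) auto
    then have "(f \<circ> ?\<mu>) (g, h) = p1 (g, h) / q1 (g, h)" using 1(7) * by auto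
    then show ?thesis using * by simp
    qed
    then show "\<forall>g\<in>?U. \<forall>h\<in>?V. q1 (g, h) * q2 (g, h) \<noteq> 0 \<longrightarrow>
        f (g * h) = p1 (g, h) * q2 (g, h) / (q1 (g, h) * q2 (g, h))" by blast
  qed (use 1 2 in auto)
qed

lemma
  fixes p :: "'k::complex_algebraic_group \<times> 'k \<Rightarrow> complex"
  assumes U: "U \<in> Opn variety" and V: "V \<in> Opn variety" "1 \<in> V"
    and p: "p \<in> sum_prod variety variety U V"
  shows sum_prod_slice_right: "(\<lambda>h. p (g, h)) \<in> Reg variety V"
    and sum_prod_slice_left: "(\<lambda>g. p (g, h)) \<in> Reg variety U"
    and sum_prod_partial: "(\<lambda>g. apply_lie Y (\<lambda>h. p (g, h))) \<in> Reg variety U"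
proof -
  obtain m :: nat and a b where p: "\<And>i. i < m \<Longrightarrow> a i \<in> Reg variety U"
    "\<And>i. i < m \<Longrightarrow> b i \<in> Reg variety V" "p = (\<lambda>(u, v). \<Sum>i<m. a i u * b i v)"
    using p unfolding sum_prod_def by blast
  show "(\<lambda>h. p (g, h)) \<in> Reg variety V"
    unfolding p(3) split
    by (intro Reg_sum[OF variety V(1)] Reg_mult[OF variety V(1)] Reg_const[OF variety V(1)] p) auto
  show "(\<lambda>g. p (g, h)) \<in> Reg variety U"
    unfolding p(3) split
    by (intro Reg_sum[OF variety U] Reg_mult[OF variety U] Reg_const[OF variety U] p) auto
  have b: "b i \<in> near_one" if "i < m" for i using near_oneI[OF V p(2)[OF that]] .
  have "apply_lie Y (\<lambda>h. p (g, h)) = (\<Sum>i<m. a i g * apply_lie Y (b i))" for g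
    unfolding p(3) split using b by (subst lie_sum) (auto intro: near_one_scale simp: lie_scale)
  then show "(\<lambda>g. apply_lie Y (\<lambda>h. p (g, h))) \<in> Reg variety U"
    by (simp, intro Reg_sum[OF variety U] Reg_mult[OF variety U] Reg_const[OF variety U] p) auto
qed

lemma near_one_translate:
  fixes f :: "'k::complex_algebraic_group \<Rightarrow> complex"
  assumes "f \<in> near_one"
  obtains G where "G \<in> Opn variety" "1 \<in> G" "\<And>g. g \<in> G \<Longrightarrow> (\<lambda>h. f (g * h)) \<in> near_one"
    "\<And>Y. (\<lambda>g. apply_lie Y (\<lambda>h. f (g * h))) \<in> near_one"
proof -
  obtain U V p q
  where UV: "U \<in> Opn variety" "V \<in> Opn variety" "(1::'k) \<in> U" "(1::'k) \<in> V"
    and pq: "p \<in> sum_prod variety variety U V" "q \<in> sum_prod variety variety U V" "q (1, 1) \<noteq> 0"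
    and f: "\<forall>g\<in>U. \<forall>h\<in>V. q (g, h) \<noteq> 0 \<longrightarrow> f (g * h) = p (g, h) / q (g, h)"
    by (rule near_one_translate_prod[OF assms]) (rule that; assumption)
  note S = UV(1,2,4) 
  let ?G = "{g \<in> U. q (g, 1) \<noteq> 0}"
  have G: "?G \<in> Opn variety" by (rule Opn_nonzero[OF variety UV(1) sum_prod_slice_left[OF S pq(2)]])
  have 1: "1 \<in> ?G" using UV pq by simp
  have sl: "(\<lambda>h. p (g, h)) \<in> near_one" "(\<lambda>h. q (g, h)) \<in> near_one" for g
    using near_oneI[OF UV(2,4) sum_prod_slice_right[OF S pq(1)]]
      near_oneI[OF UV(2,4) sum_prod_slice_right[OF S pq(2)]] by auto
  have quot: "(\<lambda>h. p (g, h) / q (g, h)) \<in> near_one" if "g \<in> ?G" for g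
    using near_one_mult[OF sl(1) near_one_inverse[OF sl(2)]] that by (simp add: divide_inverse)
  have N: "{h \<in> V. q (g, h) \<noteq> 0} \<in> Opn variety" for g
    by (rule Opn_nonzero[OF variety UV(2) sum_prod_slice_right[OF S pq(2)]])
  have N1: "1 \<in> {h \<in> V. q (g, h) \<noteq> 0}" if "g \<in> ?G" for g using UV that by simp
  have eq: "f (g * h) = p (g, h) / q (g, h)" if "g \<in> ?G" "h \<in> {h \<in> V. q (g, h) \<noteq> 0}" for g h
    using f that by simp
  show ?thesis
  proof (rule that[OF G 1])
    fix g assume g: "g \<in> ?G"
    show "(\<lambda>h. f (g * h)) \<in> near_one"
      by (rule near_one_cong[OF quot[OF g] N N1[OF g] eq[OF g]])
  next
    fix Y :: "'k lie"
    have **: "apply_lie Y (\<lambda>h. f (g * h)) = (apply_lie Y (\<lambda>h. p (g, h)) * q (g, 1)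
        - p (g, 1) * apply_lie Y (\<lambda>h. q (g, h))) * inverse (q (g, 1) * q (g, 1))" if g: "g \<in> ?G" for g
    proof -
      have "apply_lie Y (\<lambda>h. f (g * h)) = apply_lie Y (\<lambda>h. p (g, h) / q (g, h))"
        by (rule lie_cong[OF quot[OF g] N N1[OF g] eq[OF g]])
      also have "\<dots> = (apply_lie Y (\<lambda>h. p (g, h)) * q (g, 1)
        - p (g, 1) * apply_lie Y (\<lambda>h. q (g, h))) * inverse (q (g, 1) * q (g, 1))"
        by (rule lie_quotient[OF sl]) (use g in simp)
      finally show ?thesis .
    qed
    have q1: "(\<lambda>g. q (g, 1)) \<in> near_one" "(\<lambda>g. p (g, 1)) \<in> near_one"
      by (rule near_oneI[OF UV(1,3) sum_prod_slice_left[OF S]], rule pq)+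
    have pd: "(\<lambda>g. apply_lie Y (\<lambda>h. p (g, h))) \<in> near_one" "(\<lambda>g. apply_lie Y (\<lambda>h. q (g, h))) \<in> near_one"
      by (rule near_oneI[OF UV(1,3) sum_prod_partial[OF S]], rule pq)+
    show "(\<lambda>g. apply_lie Y (\<lambda>h. f (g * h))) \<in> near_one"
      by (rule near_one_cong[OF _ G 1 **], intro near_one_mult near_one_diff near_one_inverse q1 pd)
        (use pq in auto)
  qed
qed

definition conv :: "'k::complex_algebraic_group lie \<Rightarrow> 'k lie \<Rightarrow> ('k \<Rightarrow> complex) \<Rightarrow> complex" where
  "conv X Y f = apply_lie X (\<lambda>g. apply_lie Y (\<lambda>h. f (g * h)))"

lemma
  assumes f: "f \<in> near_one" and f': "f' \<in> near_one"
  shows conv_add: "conv X Y (\<lambda>k. f k + f' k) = conv X Y f + conv X Y f'"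
    and conv_mult: "conv X Y (\<lambda>k. f k * f' k)
      = f 1 * conv X Y f' + apply_lie X f * apply_lie Y f' + apply_lie Y f * apply_lie X f' + conv X Y f * f' 1"
    and conv_scale: "conv X Y (\<lambda>k. c * f k) = c * conv X Y f"
proof -
  obtain G where G: "G \<in> Opn variety" "1 \<in> G" "\<And>g. g \<in> G \<Longrightarrow> (\<lambda>h. f (g * h)) \<in> near_one"
    "\<And>Y. (\<lambda>g. apply_lie Y (\<lambda>h. f (g * h))) \<in> near_one" by (rule near_one_translate[OF f]) (rule that; simp)
  obtain G' where G': "G' \<in> Opn variety" "1 \<in> G'" "\<And>g. g \<in> G' \<Longrightarrow> (\<lambda>h. f' (g * h)) \<in> near_one"
    "\<And>Y. (\<lambda>g. apply_lie Y (\<lambda>h. f' (g * h))) \<in> near_one" by (rule near_one_translate[OF f']) (rule that; simp)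
  have I: "G \<inter> G' \<in> Opn variety" by (rule Opn_Int[OF variety G(1) G'(1)])
  have I1: "1 \<in> G \<inter> G'" using G G' by blast
  have "conv X Y (\<lambda>k. f k + f' k)
      = apply_lie X (\<lambda>g. apply_lie Y (\<lambda>h. f (g * h)) + apply_lie Y (\<lambda>h. f' (g * h)))"
    unfolding conv_def by (rule lie_cong[OF near_one_add[OF G(4) G'(4)] I I1]) (simp add: lie_add G G')
  then show "conv X Y (\<lambda>k. f k + f' k) = conv X Y f + conv X Y f'"
    unfolding conv_def by (simp add: lie_add[OF G(4) G'(4)])
  have "conv X Y (\<lambda>k. c * f k) = apply_lie X (\<lambda>g. c * apply_lie Y (\<lambda>h. f (g * h)))"
    unfolding conv_def by (rule lie_cong[OF near_one_scale[OF G(4)] G(1,2)]) (simp add: lie_scale G)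
  then show "conv X Y (\<lambda>k. c * f k) = c * conv X Y f"
    unfolding conv_def by (simp add: lie_scale[OF G(4)])
  have "conv X Y (\<lambda>k. f k * f' k) = apply_lie X (\<lambda>g. f g * apply_lie Y (\<lambda>h. f' (g * h))
       + apply_lie Y (\<lambda>h. f (g * h)) * f' g)"
    unfolding conv_def
    by (rule lie_cong[OF near_one_add[OF near_one_mult[OF f G'(4)] near_one_mult[OF G(4) f']] I I1])
      (simp add: lie_mult G G')
  also have "\<dots> = apply_lie X (\<lambda>g. f g * apply_lie Y (\<lambda>h. f' (g * h)))
      + apply_lie X (\<lambda>g. apply_lie Y (\<lambda>h. f (g * h)) * f' g)"
    by (rule lie_add[OF near_one_mult[OF f G'(4)] near_one_mult[OF G(4) f']])
  finally show "conv X Y (\<lambda>k. f k * f' k)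
      = f 1 * conv X Y f' + apply_lie X f * apply_lie Y f' + apply_lie Y f * apply_lie X f' + conv X Y f * f' 1"
    unfolding lie_mult[OF f G'(4)] lie_mult[OF G(4) f'] by (simp add: conv_def)
qed

lemma conv_cong:
  assumes f: "f \<in> near_one" and U: "U \<in> Opn variety" "1 \<in> U" "\<And>k. k \<in> U \<Longrightarrow> f' k = f k"
  shows "conv X Y f' = conv X Y f"
proof -
  have f': "f' \<in> near_one" by (rule near_one_cong[OF assms])
  define d where "d k = f' k - f k" for k
  define \<chi> :: "'a \<Rightarrow> complex" where "\<chi> k = (if k \<in> U then 0 else 1)" for k
  have d: "d \<in> near_one" unfolding d_def by (rule near_one_diff[OF f' f])
  have \<chi>: "\<chi> \<in> near_one"
    by (rule near_one_cong[OF near_one_const[of 0] U(1,2)]) (simp add: \<chi>_def)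
  have "apply_lie Z d = 0" for Z
    using lie_cong[OF near_one_const[of 0] U(1,2), of d Z] U(3) by (simp add: d_def lie_const)
  moreover have "(\<lambda>k. d k * \<chi> k) = d" by (auto simp: d_def \<chi>_def U)
  ultimately have "conv X Y d = 0"
    using conv_mult[OF d \<chi>, of X Y] U by (simp add: d_def \<chi>_def)
  then show ?thesis using conv_add[OF d f, of X Y] by (simp add: d_def)
qed

text \<open>
  The bracket \<open>[X, Y] f = X\<^sub>g Y\<^sub>h f(g h) - Y\<^sub>g X\<^sub>h f(g h)\<close> is the value at the identity of the commutator
  of the left-invariant vector fields extending \<open>X\<close> and \<open>Y\<close>.
\<close>

instantiation lie :: (complex_algebraic_group) complex_lie_algebra
begin

definition bracket_lie where
  "bracket_lie X Y = Abs_lie (\<lambda>f. if f \<in> near_one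
     then apply_lie X (\<lambda>g. apply_lie Y (\<lambda>h. f (g * h))) - apply_lie Y (\<lambda>g. apply_lie X (\<lambda>h. f (g * h)))
     else 0)"

lemma apply_bracket_lie:
  fixes X Y :: "'a lie"
  shows "apply_lie (bracket X Y) = (\<lambda>f. if f \<in> near_one then conv X Y f - conv Y X f else 0)"
  unfolding bracket_lie_def conv_def[symmetric]
proof (rule Abs_lie_inverse, rule CollectI, unfold point_derivation_def, intro conjI allI ballI impI)
  fix f g :: "'a \<Rightarrow> complex" assume *: "f \<in> near_one" "g \<in> near_one"
  let ?B = "\<lambda>f. if f \<in> near_one then conv X Y f - conv Y X f else 0"
  show "?B (\<lambda>k. f k + g k) = ?B f + ?B g"
    using * near_one_add[OF *] by (simp add: conv_add)
  show "?B (\<lambda>k. f k * g k) = f 1 * ?B g + ?B f * g 1"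
    using * near_one_mult[OF *] by (simp add: conv_mult algebra_simps)
  show "?B f = ?B g" if "\<exists>U\<in>Opn variety. 1 \<in> U \<and> (\<forall>k\<in>U. f k = g k)"
    using * that conv_cong[OF *(2), of _ f] by auto
  show "?B (\<lambda>k. c * f k) = c * ?B f" for c
    using * near_one_scale[OF *(1)] by (simp add: conv_scale algebra_simps)
qed auto

lemma conv_bracket_right:
  fixes X Y Z :: "'a lie"
  assumes f: "f \<in> near_one"
  shows "conv X (bracket Y Z) f = 
      apply_lie X (\<lambda>a. apply_lie Y (\<lambda>b. apply_lie Z (\<lambda>c. f (a * b * c))))
    - apply_lie X (\<lambda>a. apply_lie Z (\<lambda>b. apply_lie Y (\<lambda>c. f (a * b * c))))"
proof -
  obtain G where G: "G \<in> Opn variety" "1 \<in> G" "\<And>g. g \<in> G \<Longrightarrow> (\<lambda>h. f (g * h)) \<in> near_one"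
    "\<And>Y. (\<lambda>g. apply_lie Y (\<lambda>h. f (g * h))) \<in> near_one" by (rule near_one_translate[OF f]) (rule that; simp)
  have n: "(\<lambda>a. apply_lie Y (\<lambda>b. apply_lie Z (\<lambda>c. f (a * b * c)))) \<in> near_one" for Y Z
    by (rule near_one_translate[OF G(4)[of Z]]) (simp add: mult.assoc)
  have "conv X (bracket Y Z) f = 
      apply_lie X (\<lambda>a. apply_lie Y (\<lambda>b. apply_lie Z (\<lambda>c. f (a * b * c)))
         - apply_lie Z (\<lambda>b. apply_lie Y (\<lambda>c. f (a * b * c))))"
    unfolding conv_def[of X "bracket Y Z"]
    by (rule lie_cong[OF near_one_diff[OF n n] G(1,2)])
      (simp add: apply_bracket_lie G conv_def mult.assoc)
  then show ?thesis by (simp add: lie_diff[OF n n])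
qed

lemma conv_bracket_left:
  fixes X Y Z :: "'a lie"
  assumes f: "f \<in> near_one"
  shows "conv (bracket Y Z) X f = 
      apply_lie Y (\<lambda>a. apply_lie Z (\<lambda>b. apply_lie X (\<lambda>c. f (a * b * c))))
    - apply_lie Z (\<lambda>a. apply_lie Y (\<lambda>b. apply_lie X (\<lambda>c. f (a * b * c))))"
proof -
  have "(\<lambda>g. apply_lie X (\<lambda>h. f (g * h))) \<in> near_one"
    by (rule near_one_translate[OF f]) blast
  then show ?thesis by (simp add: conv_def[of "bracket Y Z" X] apply_bracket_lie) (simp add: conv_def)
qed

lemma conv_lin:
  fixes X Y Z :: "'a lie"
  assumes f: "f \<in> near_one"
  shows "conv X (Y + Z) f = conv X Y f + conv X Z f" "conv (Y + Z) X f = conv Y X f + conv Z X f"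
    "conv X (c *\<^sub>C Y) f = c * conv X Y f" "conv (c *\<^sub>C Y) X f = c * conv Y X f"
proof -
  have n: "(\<lambda>g. apply_lie X (\<lambda>h. f (g * h))) \<in> near_one" for X
    by (rule near_one_translate[OF f]) blast
  show "conv X (Y + Z) f = conv X Y f + conv X Z f" "conv (Y + Z) X f = conv Y X f + conv Z X f"
    "conv X (c *\<^sub>C Y) f = c * conv X Y f" "conv (c *\<^sub>C Y) X f = c * conv Y X f"
    by (simp_all add: conv_def lie_add[OF n n] lie_scale[OF n])
qed

instance
proof
  fix x y z :: "'a lie" and c :: complex
  show "bracket (x + y) z = bracket x z + bracket y z" "bracket (c *\<^sub>C x) z = c *\<^sub>C bracket x z"
    "bracket z (x + y) = bracket z x + bracket z y" "bracket z (c *\<^sub>C x) = c *\<^sub>C bracket z x"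
    "bracket x x = 0"
    by (rule lie_eqI; simp add: apply_bracket_lie conv_lin algebra_simps)+
  show "bracket x (bracket y z) + bracket y (bracket z x) + bracket z (bracket x y) = 0"
    by (rule lie_eqI) (simp add: apply_bracket_lie[of _ "bracket _ _"] conv_bracket_left conv_bracket_right)
qed

end

definition lie_map ::
  "('t::complex_algebraic_group \<Rightarrow> 'k::complex_algebraic_group) \<Rightarrow> 't lie \<Rightarrow> 'k lie" where
  "lie_map \<gamma> X = Abs_lie (\<lambda>f. if f \<in> near_one then apply_lie X (f \<circ> \<gamma>) else 0)"

lemma apply_lie_map:
  fixes \<gamma> :: "'t::complex_algebraic_group \<Rightarrow> 'k::complex_algebraic_group"
  assumes \<gamma>: "morphism variety variety \<gamma>" "\<gamma> 1 = 1"
  shows "apply_lie (lie_map \<gamma> X) f = (if f \<in> near_one then apply_lie X (f \<circ> \<gamma>) else 0)"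
proof -
  have pull: "f \<circ> \<gamma> \<in> near_one" if f: "f \<in> near_one" for f
  proof -
    obtain U where "U \<in> Opn variety" "1 \<in> U" "f \<in> Reg variety U"
      using f unfolding near_one_def by blast
    then show ?thesis using \<gamma> unfolding morphism_def by (intro near_oneI[of "\<gamma> -` U"]) auto
  qed
  have "point_derivation (\<lambda>f. if f \<in> near_one then apply_lie X (f \<circ> \<gamma>) else 0)"
    unfolding point_derivation_def
  proof (intro conjI allI ballI impI)
    fix f g :: "'k \<Rightarrow> complex" assume *: "f \<in> near_one" "g \<in> near_one"
    let ?B = "\<lambda>f. if f \<in> near_one then apply_lie X (f \<circ> \<gamma>) else 0"
    show "?B (\<lambda>k. f k + g k) = ?B f + ?B g"
      using * near_one_add[OF *] lie_add[OF pull pull, of f g X] by (simp add: o_def)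
    show "?B (\<lambda>k. f k * g k) = f 1 * ?B g + ?B f * g 1"
      using * near_one_mult[OF *] lie_mult[OF pull pull, of f g X] by (simp add: o_def \<gamma>)
    show "?B (\<lambda>k. c * f k) = c * ?B f" for c
      using * near_one_scale[OF *(1)] lie_scale[OF pull, of f X c] by (simp add: o_def)
    show "?B f = ?B g" if ex: "\<exists>U\<in>Opn variety. 1 \<in> U \<and> (\<forall>k\<in>U. f k = g k)"
    proof -
      obtain U where U: "U \<in> Opn variety" "1 \<in> U" "\<forall>k\<in>U. f k = g k"
        using ex by (elim bexE conjE)
      have "\<gamma> -` U \<in> Opn variety" using U \<gamma> unfolding morphism_def by blast
      from lie_cong[OF pull[OF *(2)] this, of "f \<circ> \<gamma>" X] U * show ?thesis by (simp add: \<gamma>)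
    qed
  qed auto
  then show ?thesis unfolding lie_map_def by (subst Abs_lie_inverse) simp_all
qed

text \<open>\<open>Ad k\<close> is the differential of conjugation by \<open>k\<close>.\<close>

definition Ad :: "'k::complex_algebraic_group \<Rightarrow> 'k lie \<Rightarrow> 'k lie" where
  "Ad k = lie_map (\<lambda>h. k * h * inverse k)"

text \<open>
  The value of a tangent vector on a vector-valued regular function
  \<open>F = \<Sum>\<^sub>i c\<^sub>i w\<^sub>i \<in> R(K) \<otimes> V\<close>, that is, \<open>d/dt F(exp(tX))\<close> at \<open>t = 0\<close>.
\<close>

definition vderiv :: "'k::complex_algebraic_group lie \<Rightarrow> ('k \<Rightarrow> 'v::complex_vector) \<Rightarrow> 'v" where
  "vderiv X F = (THE u. \<exists>(n::nat) c w. (\<forall>i<n. c i \<in> regfun)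
     \<and> F = (\<lambda>k. \<Sum>i<n. c i k *\<^sub>C w i) \<and> u = (\<Sum>i<n. apply_lie X (c i) *\<^sub>C w i))"


section \<open>Algebras given by generators and relations\<close>

datatype 'g aterm = Gen 'g | Scalar complex | Plus "'g aterm" "'g aterm" | Times "'g aterm" "'g aterm"

class presentation =
  fixes relator :: "'a aterm \<Rightarrow> 'a aterm \<Rightarrow> bool"

inductive aeq :: "'g::presentation aterm \<Rightarrow> 'g aterm \<Rightarrow> bool" where
  aeq_refl: "aeq s s"
| aeq_sym: "aeq s t \<Longrightarrow> aeq t s"
| aeq_trans: "aeq s t \<Longrightarrow> aeq t u \<Longrightarrow> aeq s u"
| aeq_plus_cong: "aeq s s' \<Longrightarrow> aeq t t' \<Longrightarrow> aeq (Plus s t) (Plus s' t')"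
| aeq_times_cong: "aeq s s' \<Longrightarrow> aeq t t' \<Longrightarrow> aeq (Times s t) (Times s' t')"
| aeq_plus_assoc: "aeq (Plus (Plus s t) u) (Plus s (Plus t u))"
| aeq_plus_commute: "aeq (Plus s t) (Plus t s)"
| aeq_plus_zero: "aeq (Plus (Scalar 0) s) s"
| aeq_times_assoc: "aeq (Times (Times s t) u) (Times s (Times t u))"
| aeq_times_one_left: "aeq (Times (Scalar 1) s) s"
| aeq_times_zero: "aeq (Times (Scalar 0) s) (Scalar 0)"
| aeq_distrib_left: "aeq (Times s (Plus t u)) (Plus (Times s t) (Times s u))"
| aeq_distrib_right: "aeq (Times (Plus s t) u) (Plus (Times s u) (Times t u))"
| aeq_scalar_plus: "aeq (Scalar (a + b)) (Plus (Scalar a) (Scalar b))"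
| aeq_scalar_times: "aeq (Scalar (a * b)) (Times (Scalar a) (Scalar b))"
| aeq_scalar_central: "aeq (Times (Scalar a) s) (Times s (Scalar a))"
| aeq_relator: "relator s t \<Longrightarrow> aeq s t"

quotient_type (overloaded) 'g presented = "'g::presentation aterm" / aeq
  by (rule equivpI) (auto intro!: reflpI sympI transpI intro: aeq_refl aeq_sym aeq_trans)

instantiation presented :: (presentation) complex_algebra_1
begin

lift_definition zero_presented :: "'a presented" is "Scalar 0" .
lift_definition one_presented :: "'a presented" is "Scalar 1" .
lift_definition plus_presented :: "'a presented \<Rightarrow> 'a presented \<Rightarrow> 'a presented" is Plus
  by (rule aeq_plus_cong)
lift_definition times_presented :: "'a presented \<Rightarrow> 'a presented \<Rightarrow> 'a presented" is Times
  by (rule aeq_times_cong)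
lift_definition scaleC_presented :: "complex \<Rightarrow> 'a presented \<Rightarrow> 'a presented"
  is "\<lambda>c. Times (Scalar c)"
  by (rule aeq_times_cong[OF aeq_refl])
definition uminus_presented :: "'a presented \<Rightarrow> 'a presented" where "uminus_presented x = (- 1) *\<^sub>C x"
definition minus_presented :: "'a presented \<Rightarrow> 'a presented \<Rightarrow> 'a presented" where "minus_presented x y = x + - y"

instance
proof
  fix x y z :: "'a presented" and a b :: complex
  show 1: "(a + b) *\<^sub>C x = a *\<^sub>C x + b *\<^sub>C x" for a b and x :: "'a presented"
    by transfer (meson aeq_distrib_right aeq_scalar_plus aeq_times_cong aeq_refl aeq_trans)
  show "a *\<^sub>C (x + y) = a *\<^sub>C x + a *\<^sub>C y" by transfer (rule aeq_distrib_left)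
  show "a *\<^sub>C b *\<^sub>C x = (a * b) *\<^sub>C x"
    by transfer (meson aeq_scalar_times aeq_times_assoc aeq_times_cong aeq_refl aeq_sym aeq_trans)
  show 2: "1 *\<^sub>C x = x" for x :: "'a presented" by transfer (rule aeq_times_one_left)
  show "x + y + z = x + (y + z)" by transfer (rule aeq_plus_assoc)
  show 3: "x + y = y + x" for x y :: "'a presented" by transfer (rule aeq_plus_commute)
  show "0 + x = x" by transfer (rule aeq_plus_zero)
  have "0 *\<^sub>C x = 0" by transfer (rule aeq_times_zero)
  then show "- x + x = 0" unfolding uminus_presented_def using 1[of "-1" 1 x] 2[of x] by simp
  show "x - y = x + - y" by (rule minus_presented_def)
  show "x * y * z = x * (y * z)" by transfer (rule aeq_times_assoc)
  show "(x + y) * z = x * z + y * z" by transfer (rule aeq_distrib_right)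
  show "x * (y + z) = x * y + x * z" by transfer (rule aeq_distrib_left)
  show "1 * x = x" by transfer (rule aeq_times_one_left)
  show "x * 1 = x" by transfer (meson aeq_scalar_central aeq_times_one_left aeq_sym aeq_trans)
  show "a *\<^sub>C x * y = a *\<^sub>C (x * y)" by transfer (rule aeq_times_assoc)
  show "x * a *\<^sub>C y = a *\<^sub>C (x * y)"
    by transfer (meson aeq_scalar_central aeq_times_assoc aeq_times_cong aeq_refl aeq_sym aeq_trans)
qed

end

lift_definition gen :: "'g::presentation \<Rightarrow> 'g presented" is Gen .

text \<open>
  The algebra homomorphism, respectively the action by linear operators, with prescribed values on
  the generators. The choice of a representing term is immaterial if the prescribed values satisfy
  the relations.
\<close>

primrec eval_alg :: "('g \<Rightarrow> 'b::complex_algebra_1) \<Rightarrow> 'g aterm \<Rightarrow> 'b" where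
  "eval_alg h (Gen g) = h g"
| "eval_alg h (Scalar c) = c *\<^sub>C 1"
| "eval_alg h (Plus s t) = eval_alg h s + eval_alg h t"
| "eval_alg h (Times s t) = eval_alg h s * eval_alg h t"

definition alg_hom :: "('g::presentation \<Rightarrow> 'b::complex_algebra_1) \<Rightarrow> 'g presented \<Rightarrow> 'b" where
  "alg_hom h x = eval_alg h (rep_presented x)"

primrec eval_act :: "('g \<Rightarrow> 'v \<Rightarrow> 'v::complex_vector) \<Rightarrow> 'g aterm \<Rightarrow> 'v \<Rightarrow> 'v" where
  "eval_act r (Gen g) v = r g v"
| "eval_act r (Scalar c) v = c *\<^sub>C v"
| "eval_act r (Plus s t) v = eval_act r s v + eval_act r t v"
| "eval_act r (Times s t) v = eval_act r s (eval_act r t v)"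

definition alg_act :: "('g::presentation \<Rightarrow> 'v \<Rightarrow> 'v::complex_vector) \<Rightarrow> 'g presented \<Rightarrow> 'v \<Rightarrow> 'v" where
  "alg_act r x = eval_act r (rep_presented x)"

lemma scaleC_one_central: "(c *\<^sub>C 1) * x = x * (c *\<^sub>C 1)" for x :: "'b::complex_algebra_1"
  by (simp add: scaleC_mult_left scaleC_mult_right)

lemma eval_alg_aeq:
  assumes rel: "\<And>s t. relator s t \<Longrightarrow> eval_alg h s = eval_alg h t" and "aeq s t"
  shows "eval_alg h s = eval_alg h t"
  using assms(2) by induction
    (simp_all add: rel algebra_simps scaleC_one scaleC_add_left scaleC_scaleC scaleC_mult_left scaleC_mult_right)

lemma alg_hom:
  fixes h :: "'g::presentation \<Rightarrow> 'b::complex_algebra_1"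
  assumes rel: "\<And>s t. relator s t \<Longrightarrow> eval_alg h s = eval_alg h t"
  shows "alg_hom h (gen g) = h g" "alg_hom h 1 = 1" "alg_hom h (x + y) = alg_hom h x + alg_hom h y"
    "alg_hom h (x * y) = alg_hom h x * alg_hom h y" "alg_hom h (c *\<^sub>C x) = c *\<^sub>C alg_hom h x"
proof -
  have abs: "alg_hom h (abs_presented t) = eval_alg h t" for t
    unfolding alg_hom_def
    by (rule eval_alg_aeq[OF rel]) (simp_all add: Quotient3_rep_abs[OF Quotient3_presented] aeq_refl)
  have rep: "x = abs_presented (rep_presented x)" for x :: "'g presented"
    by (simp add: Quotient3_abs_rep[OF Quotient3_presented])
  obtain s t where st: "x = abs_presented s" "y = abs_presented t" using rep by blast
  show "alg_hom h (gen g) = h g" by (simp add: gen.abs_eq abs)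
  show "alg_hom h 1 = 1" by (simp add: one_presented.abs_eq abs scaleC_one)
  show "alg_hom h (x + y) = alg_hom h x + alg_hom h y" by (simp add: st plus_presented.abs_eq abs)
  show "alg_hom h (x * y) = alg_hom h x * alg_hom h y" by (simp add: st times_presented.abs_eq abs)
  show "alg_hom h (c *\<^sub>C x) = c *\<^sub>C alg_hom h x"
    by (simp add: st scaleC_presented.abs_eq abs scaleC_mult_left)
qed


section \<open>The enveloping algebra and the standard complex\<close>

datatype 'l ugen = UGen 'l

inductive urel :: "'l::complex_lie_algebra ugen aterm \<Rightarrow> 'l ugen aterm \<Rightarrow> bool" where
  "urel (Gen (UGen (x + y))) (Plus (Gen (UGen x)) (Gen (UGen y)))"
| "urel (Gen (UGen (c *\<^sub>C x))) (Times (Scalar c) (Gen (UGen x)))"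
| "urel (Times (Gen (UGen x)) (Gen (UGen y)))
     (Plus (Times (Gen (UGen y)) (Gen (UGen x))) (Gen (UGen (bracket x y))))"

instantiation ugen :: (complex_lie_algebra) presentation
begin
definition "relator_ugen = (urel :: 'a ugen aterm \<Rightarrow> _)"
instance ..
end

type_synonym 'l U = "'l ugen presented"

abbreviation U_in :: "'l::complex_lie_algebra \<Rightarrow> 'l U" where "U_in x \<equiv> gen (UGen x)"

text \<open>
  Generators \<open>Ev x\<close> for \<open>x\<close> in degree \<open>0\<close> and \<open>Od x\<close> for the copy of \<open>x\<close> in degree \<open>-1\<close>.
\<close>

datatype 'l ngen = Ev 'l | Od 'l

inductive nrel :: "'l::complex_lie_algebra ngen aterm \<Rightarrow> 'l ngen aterm \<Rightarrow> bool" where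
  "nrel (Gen (Ev (x + y))) (Plus (Gen (Ev x)) (Gen (Ev y)))"
| "nrel (Gen (Ev (c *\<^sub>C x))) (Times (Scalar c) (Gen (Ev x)))"
| "nrel (Gen (Od (x + y))) (Plus (Gen (Od x)) (Gen (Od y)))"
| "nrel (Gen (Od (c *\<^sub>C x))) (Times (Scalar c) (Gen (Od x)))"
| "nrel (Times (Gen (Ev x)) (Gen (Ev y)))
     (Plus (Times (Gen (Ev y)) (Gen (Ev x))) (Gen (Ev (bracket x y))))"
| "nrel (Times (Gen (Ev x)) (Gen (Od y)))
     (Plus (Times (Gen (Od y)) (Gen (Ev x))) (Gen (Od (bracket x y))))"
| "nrel (Plus (Times (Gen (Od x)) (Gen (Od y))) (Times (Gen (Od y)) (Gen (Od x)))) (Scalar 0)"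

instantiation ngen :: (complex_lie_algebra) presentation
begin
definition "relator_ngen = (nrel :: 'a ngen aterm \<Rightarrow> _)"
instance ..
end

type_synonym 'l N = "'l ngen presented"

abbreviation N_ev :: "'l::complex_lie_algebra \<Rightarrow> 'l N" where "N_ev x \<equiv> gen (Ev x)"
abbreviation N_od :: "'l::complex_lie_algebra \<Rightarrow> 'l N" where "N_od x \<equiv> gen (Od x)"

definition U_to_N :: "'l::complex_lie_algebra U \<Rightarrow> 'l N" where
  "U_to_N = alg_hom (\<lambda>g. case g of UGen x \<Rightarrow> N_ev x)"

text \<open>The component \<open>U \<otimes> \<Lambda>\<^sup>p\<close> in degree \<open>-p\<close>.\<close>

definition N_deg :: "int \<Rightarrow> 'l::complex_lie_algebra N set" where
  "N_deg j = (if j \<le> 0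
     then complex_vector.span {U_to_N u * prod_list (map N_od xs) | u xs. int (length xs) = - j}
     else {0})"

text \<open>Functoriality; applied to linear maps that preserve brackets.\<close>

definition N_map :: "('l \<Rightarrow> 'm) \<Rightarrow> 'l::complex_lie_algebra N \<Rightarrow> 'm::complex_lie_algebra N" where
  "N_map h = alg_hom (\<lambda>g. case g of Ev x \<Rightarrow> N_ev (h x) | Od x \<Rightarrow> N_od (h x))"

text \<open>\<open>N_parity_gen\<close> extends to the automorphism \<open>x \<mapsto> (-1)\<^bsup>deg x\<^esup> x\<close>.\<close>

primrec N_parity_gen :: "'l::complex_lie_algebra ngen \<Rightarrow> 'l N" where
  "N_parity_gen (Ev x) = N_ev x"
| "N_parity_gen (Od x) = - N_od x"

primrec N_diff_gen :: "'l::complex_lie_algebra ngen \<Rightarrow> 'l N" where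
  "N_diff_gen (Ev x) = 0"
| "N_diff_gen (Od x) = N_ev x"

primrec N_diff_term :: "'l::complex_lie_algebra ngen aterm \<Rightarrow> 'l N" where
  "N_diff_term (Gen g) = N_diff_gen g"
| "N_diff_term (Scalar c) = 0"
| "N_diff_term (Plus s t) = N_diff_term s + N_diff_term t"
| "N_diff_term (Times s t) =
     N_diff_term s * abs_presented t + eval_alg N_parity_gen s * N_diff_term t"

definition N_diff :: "'l::complex_lie_algebra N \<Rightarrow> 'l N" where
  "N_diff x = N_diff_term (rep_presented x)"

text \<open>
  The principal antiautomorphism. On terms it is computed together with the parity decomposition:
  the two components are the images of the even and of the odd part, so that the sign
  \<open>(-1)\<^bsup>deg u deg v\<^esup>\<close> occurs exactly for the product of the odd parts.
\<close>

primrec iota_gen :: "'l::complex_lie_algebra ngen \<Rightarrow> 'l N \<times> 'l N" where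
  "iota_gen (Ev x) = (- N_ev x, 0)"
| "iota_gen (Od x) = (0, - N_od x)"

primrec iota_term :: "'l::complex_lie_algebra ngen aterm \<Rightarrow> 'l N \<times> 'l N" where
  "iota_term (Gen g) = iota_gen g"
| "iota_term (Scalar c) = (c *\<^sub>C 1, 0)"
| "iota_term (Plus s t) =
     (fst (iota_term s) + fst (iota_term t), snd (iota_term s) + snd (iota_term t))"
| "iota_term (Times s t) =
     (fst (iota_term t) * fst (iota_term s) - snd (iota_term t) * snd (iota_term s),
      fst (iota_term t) * snd (iota_term s) + snd (iota_term t) * fst (iota_term s))"

definition iota :: "'l::complex_lie_algebra N \<Rightarrow> 'l N" where
  "iota x = fst (iota_term (rep_presented x)) + snd (iota_term (rep_presented x))"

lemma presented_rep: "abs_presented (rep_presented x) = x"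
  by (simp add: Quotient3_abs_rep[OF Quotient3_presented])

lemma aeq_rep_abs: "aeq (rep_presented (abs_presented t)) t"
  by (simp add: Quotient3_rep_abs[OF Quotient3_presented] aeq_refl)

lemma abs_presented_simps:
  "abs_presented (Gen g) = gen g" "abs_presented (Scalar c) = c *\<^sub>C 1"
  "abs_presented (Plus s t) = abs_presented s + abs_presented t"
  "abs_presented (Times s t) = abs_presented s * abs_presented t"
proof -
  show "abs_presented (Scalar c) = c *\<^sub>C 1"
    unfolding one_presented.abs_eq scaleC_presented.abs_eq presented.abs_eq_iff
    using aeq_scalar_times[of c 1] by simp
qed (simp_all add: gen.abs_eq plus_presented.abs_eq times_presented.abs_eq)

lemma abs_presented_eqI: "aeq s t \<Longrightarrow> abs_presented s = abs_presented t"
  by (simp add: presented.abs_eq_iff)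

lemma N_relations:
  "N_ev (x + y) = N_ev x + N_ev y" "N_ev (c *\<^sub>C x) = c *\<^sub>C N_ev x"
  "N_od (x + y) = N_od x + N_od y" "N_od (c *\<^sub>C x) = c *\<^sub>C N_od x"
  "N_ev x * N_ev y = N_ev y * N_ev x + N_ev (bracket x y)"
  "N_ev x * N_od y = N_od y * N_ev x + N_od (bracket x y)"
  "N_od x * N_od y + N_od y * N_od x = 0"
  by (rule nrel.intros[folded relator_ngen_def, THEN aeq_relator, THEN abs_presented_eqI,
      unfolded abs_presented_simps scaleC_mult_left mult_1_left complex_vector.scale_zero_left])+

lemma bracket_antisym: "bracket x y = - bracket y (x::'l::complex_lie_algebra)"
proof -
  have "0 = bracket (x + y) (x + y)" by (simp only: bracket_self)
  also have "\<dots> = bracket x y + bracket y x"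
    by (simp only: bracket_add_left bracket_add_right bracket_self[of x] bracket_self[of y]) simp
  finally show ?thesis by (simp add: eq_neg_iff_add_eq_0)
qed

lemma N_neg:
  fixes x :: "'l::complex_lie_algebra"
  shows "N_ev (- x) = - N_ev x" "N_od (- x) = - N_od x"
  using N_relations(2)[of "-1" x] N_relations(4)[of "-1" x]
  by (simp_all only: complex_vector.scale_minus_left complex_vector.scale_one)

lemma N_parity_relator: "relator s t \<Longrightarrow> eval_alg N_parity_gen s = eval_alg N_parity_gen t"
  unfolding relator_ngen_def
proof (induction rule: nrel.induct)
  case (5 x y)
  show ?case using N_relations(5)[of x y] by simp
next
  case (6 x y)
  show ?case using N_relations(6)[of x y] by simp
qed (simp_all add: N_relations(1-4,7) scaleC_mult_left)

lemma N_parity_aeq: "aeq s t \<Longrightarrow> eval_alg N_parity_gen s = eval_alg N_parity_gen t"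
  by (rule eval_alg_aeq[OF N_parity_relator])

lemma N_diff_relator: "relator s t \<Longrightarrow> N_diff_term s = N_diff_term t"
  unfolding relator_ngen_def
proof (induction rule: nrel.induct)
  case (5 x y)
  show ?case by simp
next
  case (6 x y)
  show ?case using N_relations(5)[of x y] by (simp add: abs_presented_simps)
next
  case (7 x y)
  have "bracket x y + bracket y x = 0" using bracket_antisym[of x y] by simp
  then have "N_od (bracket x y) + N_od (bracket y x) = 0"
    using N_relations(3)[of "bracket x y" "bracket y x"] N_relations(4)[of 0 x] by simp
  then show ?case using N_relations(6)[of x y] N_relations(6)[of y x]
    by (simp add: abs_presented_simps)
qed (simp_all add: N_relations(1-4) abs_presented_simps scaleC_mult_left)

lemma N_diff_aeq: "aeq s t \<Longrightarrow> N_diff_term s = N_diff_term t"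
proof (induction rule: aeq.induct)
  case (aeq_times_cong s s' t t')
  then show ?case using abs_presented_eqI[OF aeq_times_cong(2)] N_parity_aeq[OF aeq_times_cong(1)] by simp
next
  case (aeq_relator s t)
  then show ?case by (rule N_diff_relator)
qed (simp_all add: abs_presented_simps algebra_simps scaleC_mult_left scaleC_mult_right)

definition N_parity :: "'l::complex_lie_algebra N \<Rightarrow> 'l N" where
  "N_parity = alg_hom N_parity_gen"

lemma N_parity_abs: "N_parity (abs_presented t) = eval_alg N_parity_gen t"
  unfolding N_parity_def alg_hom_def by (rule N_parity_aeq[OF aeq_rep_abs])

lemma N_parity_hom:
  fixes x y :: "'l::complex_lie_algebra N" and z :: 'l
  shows "N_parity (x + y) = N_parity x + N_parity y" "N_parity (x * y) = N_parity x * N_parity y"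
    "N_parity (c *\<^sub>C x) = c *\<^sub>C N_parity x" "N_parity (1 :: 'l N) = 1"
    "N_parity (N_ev z) = N_ev z" "N_parity (N_od z) = - N_od z"
  unfolding N_parity_def by (simp_all add: alg_hom[OF N_parity_relator])

lemma N_parity_zero: "N_parity 0 = 0"
  using N_parity_hom(3)[of 0 0] by simp

lemma N_diff_abs: "N_diff (abs_presented t) = N_diff_term t"
  unfolding N_diff_def by (rule N_diff_aeq[OF aeq_rep_abs])

lemma N_diff_simps:
  fixes x y :: "'l::complex_lie_algebra N" and z :: 'l
  shows "N_diff (N_ev z) = 0" "N_diff (N_od z) = N_ev z" "N_diff (1 :: 'l N) = 0"
  "N_diff (x + y) = N_diff x + N_diff y" "N_diff (c *\<^sub>C x) = c *\<^sub>C N_diff x"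
  "N_diff (x * y) = N_diff x * y + N_parity x * N_diff y"
proof -
  obtain s t where st: "x = abs_presented s" "y = abs_presented t" using presented_rep[of x, symmetric] presented_rep[of y, symmetric] by blast
  show "N_diff (x + y) = N_diff x + N_diff y" "N_diff (x * y) = N_diff x * y + N_parity x * N_diff y"
    "N_diff (c *\<^sub>C x) = c *\<^sub>C N_diff x" 
    by (simp_all add: st plus_presented.abs_eq times_presented.abs_eq scaleC_presented.abs_eq
      N_diff_abs N_parity_abs scaleC_mult_left)
qed (simp_all add: gen.abs_eq one_presented.abs_eq N_diff_abs)

lemma iota_relator: "relator s t \<Longrightarrow> iota_term s = iota_term t"
  unfolding relator_ngen_def
proof (induction rule: nrel.induct)
  case (5 x y)
  then show ?case using N_relations(5)[of x y] by (simp add: N_relations(1))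
next
  case (6 x y)
  then show ?case using N_relations(6)[of x y] by (simp add: N_relations(1))
next
  case (7 x y)
  then show ?case using minus_unique[OF N_relations(7)[of x y]] by (simp add: prod_eq_iff)
qed (simp_all add: N_relations(1-4) scaleC_mult_right)

lemma iota_aeq: "aeq s t \<Longrightarrow> iota_term s = iota_term t"
proof (induction rule: aeq.induct)
  case (aeq_relator s t)
  then show ?case by (rule iota_relator)
qed (simp_all add: prod_eq_iff algebra_simps scaleC_mult_left scaleC_mult_right)

lemma iota_abs: "iota (abs_presented t) = fst (iota_term t) + snd (iota_term t)"
  unfolding iota_def by (simp add: iota_aeq[OF aeq_rep_abs])

lemma iota_simps:
  fixes x y :: "'l::complex_lie_algebra N" and z :: 'l
  shows "iota (N_ev z) = - N_ev z" "iota (N_od z) = - N_od z" "iota (1 :: 'l N) = 1"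
  "iota (x + y) = iota x + iota y" "iota (c *\<^sub>C x) = c *\<^sub>C iota x"
proof -
  obtain s t where st: "x = abs_presented s" "y = abs_presented t"
    using presented_rep[of x, symmetric] presented_rep[of y, symmetric] by blast
  show "iota (x + y) = iota x + iota y" "iota (c *\<^sub>C x) = c *\<^sub>C iota x" 
    by (simp_all add: st plus_presented.abs_eq scaleC_presented.abs_eq iota_abs scaleC_mult_right algebra_simps)
qed (simp_all add: gen.abs_eq one_presented.abs_eq iota_abs scaleC_one)

definition iota_pair :: "'l::complex_lie_algebra N \<Rightarrow> 'l N \<times> 'l N" where
  "iota_pair x = iota_term (rep_presented x)"

lemma iota_pair_abs: "iota_pair (abs_presented t) = iota_term t"
  unfolding iota_pair_def by (rule iota_aeq[OF aeq_rep_abs])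

lemma iota_pair_mult:
  "iota_pair (x * y) =
     (fst (iota_pair y) * fst (iota_pair x) - snd (iota_pair y) * snd (iota_pair x),
      fst (iota_pair y) * snd (iota_pair x) + snd (iota_pair y) * fst (iota_pair x))"
proof -
  have "x * y = abs_presented (Times (rep_presented x) (rep_presented y))"
    by (simp only: abs_presented_simps presented_rep)
  then have "iota_pair (x * y) = iota_term (Times (rep_presented x) (rep_presented y))"
    by (simp only: iota_pair_abs)
  then show ?thesis by (simp only: iota_term.simps iota_pair_def)
qed

lemma iota_pair_lin:
  fixes x y :: "'l::complex_lie_algebra N" and z :: 'l
  shows
  "iota_pair (x + y) = (fst (iota_pair x) + fst (iota_pair y), snd (iota_pair x) + snd (iota_pair y))"
  "iota_pair (c *\<^sub>C x) = (c *\<^sub>C fst (iota_pair x), c *\<^sub>C snd (iota_pair x))"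
  "iota_pair (0 :: 'l N) = (0, 0)" "iota_pair (N_ev z) = (- N_ev z, 0)" "iota_pair (N_od z) = (0, - N_od z)"
  "iota_pair (1 :: 'l N) = (1, 0)"
proof -
  obtain s t where st: "x = abs_presented s" "y = abs_presented t" using presented_rep[of x, symmetric] presented_rep[of y, symmetric] by blast
  show "iota_pair (x + y) = (fst (iota_pair x) + fst (iota_pair y), snd (iota_pair x) + snd (iota_pair y))"
    "iota_pair (c *\<^sub>C x) = (c *\<^sub>C fst (iota_pair x), c *\<^sub>C snd (iota_pair x))"
    by (simp_all add: st plus_presented.abs_eq scaleC_presented.abs_eq iota_pair_abs scaleC_mult_right)
qed (simp_all add: gen.abs_eq one_presented.abs_eq zero_presented.abs_eq iota_pair_abs scaleC_one)

lemma U_to_N_even: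
  fixes u :: "'l::complex_lie_algebra U"
  shows "snd (iota_pair (U_to_N u)) = 0" "N_parity (U_to_N u) = U_to_N u"
proof -
  let ?h = "\<lambda>g. case g of UGen x \<Rightarrow> N_ev x"
  have "snd (iota_pair (eval_alg ?h t)) = 0 \<and> N_parity (eval_alg ?h t) = eval_alg ?h t" for t :: "'l ugen aterm"
    by (induction t)
      (auto simp: iota_pair_lin iota_pair_mult N_parity_hom split: ugen.split)
  then show "snd (iota_pair (U_to_N u)) = 0" "N_parity (U_to_N u) = U_to_N u"
    by (simp_all add: U_to_N_def alg_hom_def)
qed

lemma N_deg_homogeneous:
  fixes x :: "'l::complex_lie_algebra N"
  assumes "x \<in> N_deg j"
  shows "(if even j then snd (iota_pair x) = 0 else fst (iota_pair x) = 0) \<and>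
    N_parity x = (- 1) powi j *\<^sub>C x"
proof (cases "j \<le> 0")
  case False
  then show ?thesis using assms N_parity_zero
    by (simp add: N_deg_def iota_pair_lin)
next
  case True
  have l: "(if even (length xs) then snd (iota_pair (prod_list (map N_od xs))) = 0
      else fst (iota_pair (prod_list (map N_od xs))) = 0) \<and>
    N_parity (prod_list (map N_od xs)) = (- 1) ^ length xs *\<^sub>C prod_list (map N_od xs)"
    for xs :: "'l list"
    by (induction xs)
      (auto simp: iota_pair_lin iota_pair_mult N_parity_hom scaleC_one
         scaleC_mult_left scaleC_mult_right)
  let ?P = "\<lambda>x. (if even j then snd (iota_pair x) = 0 else fst (iota_pair x) = 0) \<and>
    N_parity x = (- 1) powi j *\<^sub>C x"
  have "x \<in> complex_vector.span {U_to_N u * prod_list (map N_od xs) | u xs. int (length xs) = - j}"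
    using assms True by (simp add: N_deg_def)
  then show "?P x"
  proof (induction rule: complex_vector.span_induct_alt)
    case base
    then show ?case using N_parity_zero by (simp add: iota_pair_lin)
  next
    case (step c z y)
    then obtain u xs where z: "z = U_to_N u * prod_list (map N_od xs)" "int (length xs) = - j" by blast
    have j: "j = - int (length xs)" using z by simp
    have s: "((- 1) powi j :: complex) = (- 1) ^ length xs"
      unfolding j by (simp add: power_int_minus flip: power_inverse)
    have "?P z"
      using l[of xs] unfolding z(1) s
      by (auto simp: j iota_pair_mult U_to_N_even N_parity_hom scaleC_mult_right)
    with step(2) show ?case
      by (auto simp: iota_pair_lin scaleC_add_right complex_vector.scale_left_commute
        N_parity_hom split: if_splits)
  qed
qed

lemma iota_mult:
  fixes x y :: "'l::complex_lie_algebra N"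
  assumes "x \<in> N_deg i" "y \<in> N_deg j"
  shows "iota (x * y) = (- 1) powi (i * j) *\<^sub>C (iota y * iota x)"
proof -
  have i: "iota z = fst (iota_pair z) + snd (iota_pair z)" for z :: "'l N"
    by (simp add: iota_def iota_pair_def)
  show ?thesis
    using N_deg_homogeneous[OF assms(1)] N_deg_homogeneous[OF assms(2)]
    by (cases "even i"; cases "even j") (simp_all add: i iota_pair_mult scaleC_one power_int_minus_left)
qed

lemma N_diff_mult:
  assumes "x \<in> N_deg i"
  shows "N_diff (x * y) = N_diff x * y + (- 1) powi i *\<^sub>C (x * N_diff y)"
  using N_deg_homogeneous[OF assms] by (simp add: N_diff_simps scaleC_mult_left)


section \<open>Harish-Chandra pairs and equivariant modules\<close>

text \<open>
  An algebraic action of \<open>K\<close> on the subspace \<open>S\<close>: every vector lies in the span of a finite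
  independent set \<open>B \<subseteq> S\<close> on which \<open>K\<close> acts by a matrix \<open>c\<close> of regular functions, i.e. through a
  morphism of algebraic groups from \<open>K\<close> to the general linear group of that span.
\<close>

definition algebraic_action ::
  "'v::complex_vector set \<Rightarrow> ('k::complex_algebraic_group \<Rightarrow> 'v \<Rightarrow> 'v) \<Rightarrow> bool" where
  "algebraic_action S \<nu> \<longleftrightarrow>
     (\<forall>k. lin_on S S (\<nu> k)) \<and> (\<forall>v\<in>S. \<nu> 1 v = v) \<and> (\<forall>k l. \<forall>v\<in>S. \<nu> (k * l) v = \<nu> k (\<nu> l v))
     \<and> (\<forall>v\<in>S. \<exists>B c. finite B \<and> B \<subseteq> S \<and> complex_vector.independent B \<and> v \<in> complex_vector.span B
          \<and> (\<forall>a\<in>B. \<forall>b\<in>B. c a b \<in> regfun)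
          \<and> (\<forall>k. \<forall>b\<in>B. \<nu> k b = (\<Sum>a\<in>B. c a b k *\<^sub>C a)))"

text \<open>\<open>hc_act\<close> is \<open>\<phi> : K \<rightarrow> Aut(A)\<close> and \<open>hc_inc\<close> is \<open>\<psi> : k \<rightarrow> A\<close>.\<close>

record (overloaded) ('k, 'a) hc_pair =
  hc_act :: "'k \<Rightarrow> 'a \<Rightarrow> 'a"
  hc_inc :: "'k lie \<Rightarrow> 'a"

definition harish_chandra_pair ::
  "('k::complex_algebraic_group, 'a::complex_algebra_1) hc_pair \<Rightarrow> bool" where
  "harish_chandra_pair H \<longleftrightarrow>
     algebraic_action UNIV (hc_act H)
     \<and> (\<forall>k a b. hc_act H k (a * b) = hc_act H k a * hc_act H k b) \<and> (\<forall>k. hc_act H k 1 = 1)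
     \<and> lin_on UNIV UNIV (hc_inc H)
     \<and> (\<forall>\<xi> \<eta>. hc_inc H (bracket \<xi> \<eta>) = hc_inc H \<xi> * hc_inc H \<eta> - hc_inc H \<eta> * hc_inc H \<xi>)
     \<and> (\<forall>k \<xi>. hc_inc H (Ad k \<xi>) = hc_act H k (hc_inc H \<xi>))
     \<and> (\<forall>\<xi> a. vderiv \<xi> (\<lambda>k. hc_act H k a) = hc_inc H \<xi> * a - a * hc_inc H \<xi>)"

definition hc_pullback ::
  "('t::complex_algebraic_group \<Rightarrow> 'k::complex_algebraic_group) \<Rightarrow> ('k, 'a) hc_pair \<Rightarrow> ('t, 'a) hc_pair"
  where
  "hc_pullback \<gamma> H = \<lparr> hc_act = hc_act H \<circ> \<gamma>, hc_inc = hc_inc H \<circ> lie_map \<gamma> \<rparr>"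

text \<open>
  The data of the third component of a triple: grading, differential, \<open>\<chi>\<close> and \<open>\<rho>\<close>.
\<close>

record (overloaded) ('k, 'd) dg_data =
  dg_deg :: "int \<Rightarrow> 'd set"
  dg_diff :: "'d \<Rightarrow> 'd"
  dg_act :: "'k \<Rightarrow> 'd \<Rightarrow> 'd"
  dg_inc :: "'k lie \<Rightarrow> 'd"

definition std_dg :: "('k::complex_algebraic_group, 'k lie N) dg_data" where
  "std_dg = \<lparr> dg_deg = N_deg, dg_diff = N_diff, dg_act = (\<lambda>k. N_map (Ad k)), dg_inc = N_ev \<rparr>"

text \<open>
  A complex is a family of subspaces \<open>mcar V j\<close>, one for every degree \<open>j\<close>. Operators carry the
  degree \<open>j\<close> of the vector as an argument (\<open>mdiff V j\<close> is the differential from degree \<open>j\<close> to degree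
  \<open>j + 1\<close>), and \<open>mdg V i x j\<close> is the action of \<open>x\<close> of degree \<open>i\<close> on vectors of degree \<open>j\<close>. Values of
  the operators outside the indicated subspaces are irrelevant.
\<close>

record ('k, 'a, 'd, 'v) dg_module =
  mcar :: "int \<Rightarrow> 'v set"
  mdiff :: "int \<Rightarrow> 'v \<Rightarrow> 'v"
  malg :: "'a \<Rightarrow> int \<Rightarrow> 'v \<Rightarrow> 'v"
  mgrp :: "'k \<Rightarrow> int \<Rightarrow> 'v \<Rightarrow> 'v"
  mdg :: "int \<Rightarrow> 'd \<Rightarrow> int \<Rightarrow> 'v \<Rightarrow> 'v"

definition is_module ::
  "('k::complex_algebraic_group, 'a::complex_algebra_1) hc_pair \<Rightarrow>
   ('k, 'd::complex_algebra_1) dg_data \<Rightarrow> ('k, 'a, 'd, 'v::complex_vector) dg_module \<Rightarrow> bool" where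
  "is_module H D V \<longleftrightarrow>
     (\<forall>j. complex_vector.subspace (mcar V j))
     \<and> (\<forall>j. lin_on (mcar V j) (mcar V (j + 1)) (mdiff V j))
     \<and> (\<forall>j. \<forall>v\<in>mcar V j. mdiff V (j + 1) (mdiff V j v) = 0)
     \<and> (\<forall>a j. lin_on (mcar V j) (mcar V j) (malg V a j))
     \<and> (\<forall>j. \<forall>v\<in>mcar V j. malg V 1 j v = v
          \<and> (\<forall>a b. malg V (a + b) j v = malg V a j v + malg V b j v
               \<and> malg V (a * b) j v = malg V a j (malg V b j v))
          \<and> (\<forall>c a. malg V (c *\<^sub>C a) j v = c *\<^sub>C malg V a j v)
          \<and> (\<forall>a. mdiff V j (malg V a j v) = malg V a (j + 1) (mdiff V j v)))
     \<and> (\<forall>j. algebraic_action (mcar V j) (\<lambda>k. mgrp V k j))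
     \<and> (\<forall>k j. \<forall>v\<in>mcar V j. mdiff V j (mgrp V k j v) = mgrp V k (j + 1) (mdiff V j v))
     \<and> (\<forall>i j. \<forall>x\<in>dg_deg D i. lin_on (mcar V j) (mcar V (i + j)) (mdg V i x j))
     \<and> (\<forall>j. \<forall>v\<in>mcar V j. mdg V 0 1 j v = v)
     \<and> (\<forall>i j. \<forall>v\<in>mcar V j. lin_on (dg_deg D i) (mcar V (i + j)) (\<lambda>x. mdg V i x j v))
     \<and> (\<forall>h i j. \<forall>x\<in>dg_deg D h. \<forall>y\<in>dg_deg D i. \<forall>v\<in>mcar V j.
          mdg V (h + i) (x * y) j v = mdg V h x (i + j) (mdg V i y j v))
     \<and> (\<forall>i j. \<forall>x\<in>dg_deg D i. \<forall>v\<in>mcar V j.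
          mdiff V (i + j) (mdg V i x j v)
            = mdg V (i + 1) (dg_diff D x) j v + (- 1) powi i *\<^sub>C mdg V i x (j + 1) (mdiff V j v))
     \<and> (\<forall>k a j. \<forall>v\<in>mcar V j.
          malg V (hc_act H k a) j v = mgrp V k j (malg V a j (mgrp V (inverse k) j v)))
     \<and> (\<forall>k i j. \<forall>x\<in>dg_deg D i. \<forall>v\<in>mcar V j.
          mdg V i (dg_act D k x) j v = mgrp V k (i + j) (mdg V i x j (mgrp V (inverse k) j v)))
     \<and> (\<forall>a i j. \<forall>x\<in>dg_deg D i. \<forall>v\<in>mcar V j.
          malg V a (i + j) (mdg V i x j v) = mdg V i x j (malg V a j v))
     \<and> (\<forall>\<xi> j. \<forall>v\<in>mcar V j.
          malg V (hc_inc H \<xi>) j v + mdg V 0 (dg_inc D \<xi>) j v = vderiv \<xi> (\<lambda>k. mgrp V k j v))"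

text \<open>
  The component of degree \<open>p\<close> of the complex \<open>Hom\<close>: families \<open>f j\<close> from degree \<open>j\<close> to degree
  \<open>j + p\<close>, normalised to be \<open>0\<close> outside \<open>mcar V j\<close> so that equality is equality of maps.
\<close>

definition Hom_deg ::
  "('k, 'd) dg_data \<Rightarrow> ('k, 'a, 'd, 'v::complex_vector) dg_module \<Rightarrow>
   ('k, 'a, 'd, 'w::complex_vector) dg_module \<Rightarrow> int \<Rightarrow> (int \<Rightarrow> 'v \<Rightarrow> 'w) set" where
  "Hom_deg D V W p = {f.
     (\<forall>j. lin_on (mcar V j) (mcar W (j + p)) (f j) \<and> (\<forall>v. v \<notin> mcar V j \<longrightarrow> f j v = 0))
     \<and> (\<forall>a j. \<forall>v\<in>mcar V j. f j (malg V a j v) = malg W a (j + p) (f j v))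
     \<and> (\<forall>k j. \<forall>v\<in>mcar V j. f j (mgrp V k j v) = mgrp W k (j + p) (f j v))
     \<and> (\<forall>i j. \<forall>x\<in>dg_deg D i. \<forall>v\<in>mcar V j.
          f (i + j) (mdg V i x j v) = (- 1) powi (p * i) *\<^sub>C mdg W i x (j + p) (f j v))}"

definition Hom_diff ::
  "('k, 'a, 'd, 'v::complex_vector) dg_module \<Rightarrow> ('k, 'a, 'd, 'w::complex_vector) dg_module \<Rightarrow>
   int \<Rightarrow> (int \<Rightarrow> 'v \<Rightarrow> 'w) \<Rightarrow> (int \<Rightarrow> 'v \<Rightarrow> 'w)" where
  "Hom_diff V W p f = (\<lambda>j v. if v \<in> mcar V j
     then mdiff W (j + p) (f j v) - (- 1) powi p *\<^sub>C f (j + 1) (mdiff V j v) else 0)"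

definition Mor ::
  "('k, 'd) dg_data \<Rightarrow> ('k, 'a, 'd, 'v::complex_vector) dg_module \<Rightarrow>
   ('k, 'a, 'd, 'w::complex_vector) dg_module \<Rightarrow> (int \<Rightarrow> 'v \<Rightarrow> 'w) set" where
  "Mor D V W = {f.
     (\<forall>j. lin_on (mcar V j) (mcar W j) (f j) \<and> (\<forall>v. v \<notin> mcar V j \<longrightarrow> f j v = 0))
     \<and> (\<forall>j. \<forall>v\<in>mcar V j. f (j + 1) (mdiff V j v) = mdiff W j (f j v))
     \<and> (\<forall>a j. \<forall>v\<in>mcar V j. f j (malg V a j v) = malg W a j (f j v))
     \<and> (\<forall>k j. \<forall>v\<in>mcar V j. f j (mgrp V k j v) = mgrp W k j (f j v))
     \<and> (\<forall>i j. \<forall>x\<in>dg_deg D i. \<forall>v\<in>mcar V j. f (i + j) (mdg V i x j v) = mdg W i x j (f j v))}"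

definition id_mor :: "('k, 'a, 'd, 'v::complex_vector) dg_module \<Rightarrow> int \<Rightarrow> 'v \<Rightarrow> 'v" where
  "id_mor V = (\<lambda>j v. if v \<in> mcar V j then v else 0)"

definition comp_mor :: "(int \<Rightarrow> 'v \<Rightarrow> 'w) \<Rightarrow> (int \<Rightarrow> 'u \<Rightarrow> 'v) \<Rightarrow> int \<Rightarrow> 'u \<Rightarrow> 'w" (infixl "\<odot>" 70) where
  "g \<odot> f = (\<lambda>j v. g j (f j v))"


section \<open>The forgetful functor and the equivariant Zuckerman functor\<close>

type_synonym ('k, 'a, 'v) equiv_complex = "('k, 'a, 'k lie N, 'v) dg_module"

text \<open>The forgetful functor is the identity on morphisms.\<close>

definition Res ::
  "('t::complex_algebraic_group \<Rightarrow> 'k::complex_algebraic_group) \<Rightarrow>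
   ('k, 'a, 'v) equiv_complex \<Rightarrow> ('t, 'a, 'v) equiv_complex" where
  "Res \<gamma> V = \<lparr> mcar = mcar V, mdiff = mdiff V, malg = malg V, mgrp = mgrp V \<circ> \<gamma>,
     mdg = (\<lambda>i x. mdg V i (N_map (lie_map \<gamma>) x)) \<rparr>"

text \<open>\<open>R(K) \<otimes> S\<close>, realised as regular functions with values in the subspace \<open>S\<close>.\<close>

definition regfun_in ::
  "'v::complex_vector set \<Rightarrow> ('k::complex_algebraic_group \<Rightarrow> 'v) set" where
  "regfun_in S = {F. \<exists>(n::nat) c w. (\<forall>i<n. c i \<in> regfun \<and> w i \<in> S)
     \<and> F = (\<lambda>k. \<Sum>i<n. c i k *\<^sub>C w i)}"

text \<open>
  \<open>R(K, V)\<close> as a \<open>(U(k), T, N(t))\<close>-module via \<open>\<lambda>\<close>; the term \<open>vderiv\<close> is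
  \<open>d/dt F(exp(-tX) k)\<close> at \<open>t = 0\<close>.
\<close>

definition RK ::
  "('k::complex_algebraic_group, 'a) hc_pair \<Rightarrow> ('t::complex_algebraic_group \<Rightarrow> 'k) \<Rightarrow>
   ('t, 'a, 'v::complex_vector) equiv_complex \<Rightarrow>
   ('t, 'k lie U, 't lie N, 'k \<Rightarrow> 'v) dg_module" where
  "RK H \<gamma> V = \<lparr>
     mcar = (\<lambda>j. regfun_in (mcar V j)),
     mdiff = (\<lambda>j F k. mdiff V j (F k)),
     malg = (\<lambda>u j. alg_act (\<lambda>g. case g of UGen X \<Rightarrow>
        (\<lambda>F k. malg V (hc_inc H X) j (F k) + vderiv X (\<lambda>g. F (inverse g * k)))) u),
     mgrp = (\<lambda>t j F k. mgrp V t j (F (inverse (\<gamma> t) * k))),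
     mdg = (\<lambda>i x j F k. mdg V i x j (F k)) \<rparr>"

definition NK ::
  "('t::complex_algebraic_group \<Rightarrow> 'k::complex_algebraic_group) \<Rightarrow>
   ('t, 'k lie U, 't lie N, 'k lie N) dg_module" where
  "NK \<gamma> = \<lparr>
     mcar = N_deg,
     mdiff = (\<lambda>j. N_diff),
     malg = (\<lambda>u j n. U_to_N u * n),
     mgrp = (\<lambda>t j. N_map (Ad (\<gamma> t))),
     mdg = (\<lambda>i m j n. (- 1) powi (i * j) *\<^sub>C (n * iota (N_map (lie_map \<gamma>) m))) \<rparr>"

definition Gamma_eq ::
  "('k::complex_algebraic_group, 'a) hc_pair \<Rightarrow> ('t::complex_algebraic_group \<Rightarrow> 'k) \<Rightarrow>
   ('t, 'a, 'v::complex_vector) equiv_complex \<Rightarrow>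
   ('k, 'a, int \<Rightarrow> 'k lie N \<Rightarrow> 'k \<Rightarrow> 'v) equiv_complex" where
  "Gamma_eq H \<gamma> V = \<lparr>
     mcar = Hom_deg std_dg (NK \<gamma>) (RK H \<gamma> V),
     mdiff = Hom_diff (NK \<gamma>) (RK H \<gamma> V),
     malg = (\<lambda>a p f j m k. malg V (hc_act H k a) (j + p) (f j m k)),
     mgrp = (\<lambda>g p f j m k. f j m (k * g)),
     mdg = (\<lambda>i n p f j m k. if m \<in> N_deg j
        then (- 1) powi (i * p) *\<^sub>C f (i + j) (N_map (Ad k) (iota n) * m) k else 0) \<rparr>"

definition Gamma_eq_mor ::
  "('k::complex_algebraic_group, 'a) hc_pair \<Rightarrow> ('t::complex_algebraic_group \<Rightarrow> 'k) \<Rightarrow>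
   ('t, 'a, 'v::complex_vector) equiv_complex \<Rightarrow> (int \<Rightarrow> 'v \<Rightarrow> 'w::complex_vector) \<Rightarrow>
   int \<Rightarrow> (int \<Rightarrow> 'k lie N \<Rightarrow> 'k \<Rightarrow> 'v) \<Rightarrow> (int \<Rightarrow> 'k lie N \<Rightarrow> 'k \<Rightarrow> 'w)" where
  "Gamma_eq_mor H \<gamma> V \<phi> = (\<lambda>p f. if f \<in> mcar (Gamma_eq H \<gamma> V) p
     then (\<lambda>j n k. \<phi> (j + p) (f j n k)) else 0)"

end

theory Submission
  imports Defs "HOL-Analysis.Continuum_Not_Denumerable" "HOL-Computational_Algebra.Fundamental_Theorem_Algebra"
begin

text \<open>
  The adjunction sends \<open>f : V \<rightarrow> \<Gamma>(W)\<close> to \<open>v \<mapsto> f(v)(1)(1)\<close>; its inverse sends \<open>h\<close> to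
  \<open>v \<mapsto> (n \<mapsto> (k \<mapsto> \<plusminus> h(\<omega>(\<iota> n) \<nu>(k) v)))\<close>, the sign being \<open>(-1)^(deg n deg v)\<close>. The main point is that
  \<open>K\<close> acts algebraically on \<open>\<Gamma>(W)\<close>. As \<open>N(k)\<close> is a finitely generated \<open>U(k)\<close>-module, an element of
  \<open>\<Gamma>(W)\<close> is determined by finitely many functions in \<open>R(K, W)\<close>, on which \<open>K\<close> acts by translation, so that it
  suffices to write \<open>c(gh)\<close>, for a regular function \<open>c\<close> on \<open>K\<close>, as a sum of products of regular functions of
  \<open>g\<close> and \<open>h\<close>. The latter holds for all regular functions on a product of prevarieties; on affine pieces it is
  a consequence of the Nullstellensatz, which follows from the uncountability of the complex numbers.
\<close>

section \<open>Linear algebra\<close>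

text \<open>The formula for the inverse is forced: acting on f(v) by \<iota> n and k and evaluating
  at (1, 1) returns f(v)(n)(k) up to sign, because \<iota> is an involution. Most of the work lies
  in showing that the operators on \<Gamma>(W) respect the conditions that define it. Where an
  operator involves a factor depending on k, such as \<phi>(k)a or Ad(k)(\<iota> n), linearity over
  U(k) has a defect that is cancelled by the derivative of this factor, which is a commutator.
  Algebraicity is harder to see because an element of \<Gamma>(W) is a family of functions indexed
  by all of N(k); regularity of an orbit map is therefore tested after an injective linear map into
  finitely many coordinates. Groups need not be affine. Regular functions and tangent vectors are
  known only through local quotients, so Ad is differentiated on functions near 1. To decompose
  c(gh) for a global c, the local decompositions are not glued: only the finite dimension of the
  space of slices is passed from the charts to the whole product.\<close>

instantiation complex :: complex_vector
begin

definition scaleC_complex :: "complex \<Rightarrow> complex \<Rightarrow> complex" where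
  "scaleC_complex c x = c * x"

instance
  by standard (simp_all add: scaleC_complex_def algebra_simps)

end

lemma scaleC_sum_left: "(\<Sum>i\<in>I. a i) *\<^sub>C (x::'v::complex_vector) = (\<Sum>i\<in>I. a i *\<^sub>C x)"
  by (rule complex_vector.scale_sum_left)

lemma scaleC_sum_right: "a *\<^sub>C (\<Sum>i\<in>I. f i) = (\<Sum>i\<in>I. a *\<^sub>C (f i::'v::complex_vector))"
  by (rule complex_vector.scale_sum_right)

lemma sum_fun_apply: "(\<Sum>i\<in>I. f i) x = (\<Sum>i\<in>I. f i x)"
  by (induction I rule: infinite_finite_induct) auto

lemma lin_onI:
  assumes "\<And>x. x \<in> S \<Longrightarrow> f x \<in> T"
    "\<And>x y. x \<in> S \<Longrightarrow> y \<in> S \<Longrightarrow> f (x + y) = f x + f y"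
    "\<And>c x. x \<in> S \<Longrightarrow> f (c *\<^sub>C x) = c *\<^sub>C f x"
  shows "lin_on S T f"
  using assms by (auto simp: lin_on_def)

lemma
  assumes "lin_on S T f"
  shows lin_on_in: "x \<in> S \<Longrightarrow> f x \<in> T"
    and lin_on_add: "x \<in> S \<Longrightarrow> y \<in> S \<Longrightarrow> f (x + y) = f x + f y"
    and lin_on_scale: "x \<in> S \<Longrightarrow> f (c *\<^sub>C x) = c *\<^sub>C f x"
    and lin_on_zero: "complex_vector.subspace S \<Longrightarrow> f 0 = 0"
    and lin_on_uminus: "x \<in> S \<Longrightarrow> f (- x) = - f x"
    and lin_on_diff: "complex_vector.subspace S \<Longrightarrow> x \<in> S \<Longrightarrow> y \<in> S \<Longrightarrow> f (x - y) = f x - f y"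
proof -
  show "x \<in> S \<Longrightarrow> f x \<in> T" "x \<in> S \<Longrightarrow> y \<in> S \<Longrightarrow> f (x + y) = f x + f y"
    and s: "\<And>c x. x \<in> S \<Longrightarrow> f (c *\<^sub>C x) = c *\<^sub>C f x"
    using assms by (auto simp: lin_on_def)
  show m: "f (- x) = - f x" if "x \<in> S" for x
    using s[OF that, of "-1"] by simp
  show "complex_vector.subspace S \<Longrightarrow> f 0 = 0"
    using s[of 0 0] complex_vector.subspace_0[of S] by simp
  show "f (x - y) = f x - f y" if "complex_vector.subspace S" "x \<in> S" "y \<in> S"
    using assms that m[of y] complex_vector.subspace_neg[of S y] unfolding lin_on_def
    by (metis add_uminus_conv_diff)
qed

lemma lin_on_sum:
  assumes "lin_on S T f" "complex_vector.subspace S" "\<And>i. i \<in> I \<Longrightarrow> w i \<in> S"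
  shows "f (\<Sum>i\<in>I. c i *\<^sub>C w i) = (\<Sum>i\<in>I. c i *\<^sub>C f (w i))"
  using assms(3)
proof (induction I rule: infinite_finite_induct)
  case (insert i I)
  have "(\<Sum>i\<in>I. c i *\<^sub>C w i) \<in> S"
    using insert by (intro complex_vector.subspace_sum[OF assms(2)] complex_vector.subspace_scale[OF assms(2)]) auto
  with insert show ?case
    by (simp add: lin_on_add[OF assms(1)] lin_on_scale[OF assms(1)] complex_vector.subspace_scale[OF assms(2)])
qed (simp_all add: lin_on_zero[OF assms(1,2)])

lemma lin_on_compose: "lin_on S T f \<Longrightarrow> lin_on T T' g \<Longrightarrow> lin_on S T' (\<lambda>x. g (f x))"
  by (auto simp: lin_on_def image_subset_iff)

lemma lin_on_linear: "lin_on UNIV UNIV f \<longleftrightarrow> Vector_Spaces.linear scaleC scaleC f"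
  by (auto simp: lin_on_def Vector_Spaces.linear_iff module_hom_def module_hom_axioms_def
      complex_vector.module_axioms complex_vector.vector_space_axioms)

text \<open>The step also receives that the partial sum y lies in the span, so that maps which are
  linear only on the span can be applied to it.\<close>

lemma span_induct_strong [consumes 1, case_names zero add]:
  assumes "x \<in> complex_vector.span B" "P 0"
    "\<And>c x y. x \<in> B \<Longrightarrow> y \<in> complex_vector.span B \<Longrightarrow> P y \<Longrightarrow> P (c *\<^sub>C x + y)"
  shows "P x"
proof -
  have "x \<in> complex_vector.span B \<and> P x"
    using assms(1)
  proof (induction rule: complex_vector.span_induct_alt)
    case (step c x y)
    then show ?case
      using assms(3) by (simp add: complex_vector.span_add complex_vector.span_scale complex_vector.span_base)
  qed (simp add: assms(2) complex_vector.span_zero)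
  then show ?thesis ..
qed

lemma lin_on_span_eqI:
  assumes "lin_on (complex_vector.span B) T f" "lin_on (complex_vector.span B) T' g"
    and "\<And>b. b \<in> B \<Longrightarrow> f b = g b" and "x \<in> complex_vector.span B"
  shows "f x = g x"
  using assms(4)
proof (induction rule: span_induct_strong)
  case zero
  show ?case using lin_on_zero[OF assms(1)] lin_on_zero[OF assms(2)] complex_vector.subspace_span by metis
next
  case (add c x y)
  then show ?case
    using assms(3)[OF add(1)]
    by (simp add: lin_on_add[OF assms(1)] lin_on_scale[OF assms(1)] lin_on_add[OF assms(2)]
        lin_on_scale[OF assms(2)] complex_vector.span_scale complex_vector.span_base)
qed

text \<open>Extending the identity of a basis of S gives a projection. It later moves the vectors in
  a representation of a regular function into a subspace that contains all its values.\<close>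

lemma subspace_projection:
  fixes S :: "'v::complex_vector set"
  assumes "complex_vector.subspace S"
  obtains g where "lin_on UNIV S g" "\<And>x. x \<in> S \<Longrightarrow> g x = x"
proof -
  interpret p: vector_space_pair "scaleC :: complex \<Rightarrow> 'v \<Rightarrow> 'v" "scaleC :: complex \<Rightarrow> 'v \<Rightarrow> 'v"
    by unfold_locales
  obtain B where B: "B \<subseteq> S" "complex_vector.independent B" "S \<subseteq> complex_vector.span B"
    by (rule complex_vector.basis_exists[of S]) (rule that)
  have S: "complex_vector.span B = S"
    using B complex_vector.span_minimal[OF B(1) assms] by blast
  obtain g where g: "Vector_Spaces.linear scaleC scaleC g" "\<And>x. x \<in> B \<Longrightarrow> g x = x"
    "range g = complex_vector.span B"
    using p.linear_independent_extend_subspace[OF B(2), of "\<lambda>x. x"] by auto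
  have l: "lin_on UNIV UNIV g" using g(1) by (simp add: lin_on_linear)
  show ?thesis
  proof (rule that[of g])
    show "lin_on UNIV S g" using l g(3) S by (auto simp: lin_on_def)
    show "g x = x" if "x \<in> S" for x
      by (rule lin_on_span_eqI[of B UNIV g UNIV "\<lambda>x. x"]) (use l g that S in \<open>auto simp: lin_on_def\<close>)
  qed
qed

section \<open>Groups and translations\<close>

lemma group_right_inverse: "(x::'g::group_mult) * inverse x = 1"
proof -
  have "x * inverse x = inverse (inverse x) * inverse x * (x * inverse x)"
    by (simp add: group_left_inverse)
  also have "\<dots> = inverse (inverse x) * (inverse x * x) * inverse x" by (simp only: mult.assoc)
  also have "\<dots> = 1" by (simp add: group_left_inverse)
  finally show ?thesis .
qed

lemma group_cancel: 
  fixes x y :: "'g::group_mult"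
  shows "inverse x * (x * y) = y" "x * (inverse x * y) = y" "y * inverse x * x = y" "y * x * inverse x = y"
  using group_left_inverse[of x] group_right_inverse[of x]
  by (simp_all add: mult.assoc) (simp_all flip: mult.assoc)

lemma group_inverse_unique: "x * y = 1 \<Longrightarrow> inverse x = (y::'g::group_mult)"
  by (metis group_cancel(1) mult_1_right)

lemma group_inverse: 
  fixes x y :: "'g::group_mult"
  shows "inverse (inverse x) = x" "inverse (1::'g) = 1" "inverse (x * y) = inverse y * inverse x"
  by (rule group_inverse_unique; simp add: group_left_inverse group_right_inverse group_cancel mult.assoc)+

lemmas group_simps = group_left_inverse group_right_inverse group_cancel group_inverse

lemma group_hom:
  fixes \<gamma> :: "'t::group_mult \<Rightarrow> 'k::group_mult"
  assumes "\<And>s t. \<gamma> (s * t) = \<gamma> s * \<gamma> t"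
  shows "\<gamma> 1 = 1" "\<gamma> (inverse t) = inverse (\<gamma> t)"
proof -
  show 1: "\<gamma> 1 = 1" using assms[of 1 1] group_cancel(1)[of "\<gamma> 1" "\<gamma> 1"] by (simp add: group_left_inverse)
  show "\<gamma> (inverse t) = inverse (\<gamma> t)"
    by (rule group_inverse_unique[symmetric]) (simp flip: assms add: group_right_inverse 1)
qed

section \<open>Slices of functions on a product, and regularity of translations\<close>

lemma Reg_divide:
  assumes X: "prevariety X" and U: "U \<in> Opn X" and f: "f \<in> Reg X U" and g: "g \<in> Reg X U"
  shows "(\<lambda>a. f a / g a) \<in> Reg X {a \<in> U. g a \<noteq> 0}"
proof -
  have op: "{a \<in> U. g a \<noteq> 0} \<in> Opn X" by (rule Opn_nonzero[OF X U g])
  have "f \<in> Reg X {a \<in> U. g a \<noteq> 0}" by (rule Reg_mono[OF X U op _ f]) blast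
  then show ?thesis
    unfolding divide_inverse by (rule Reg_mult[OF X op _ Reg_inverse[OF X U g]])
qed

lemma
  assumes X: "prevariety X" and Y: "prevariety Y" 
    and U: "U \<in> Opn X" and V: "V \<in> Opn Y" and p: "p \<in> sum_prod X Y U V"
  shows sum_prod_Reg_right: "x \<in> U \<Longrightarrow> (\<lambda>y. p (x, y)) \<in> Reg Y V"
    and sum_prod_Reg_left: "y \<in> V \<Longrightarrow> (\<lambda>x. p (x, y)) \<in> Reg X U"
proof -
  obtain m :: nat and a b where p: "\<And>i. i < m \<Longrightarrow> a i \<in> Reg X U"
    "\<And>i. i < m \<Longrightarrow> b i \<in> Reg Y V" "p = (\<lambda>(u, v). \<Sum>i<m. a i u * b i v)"
    using p unfolding sum_prod_def by blast
  show "(\<lambda>y. p (x, y)) \<in> Reg Y V"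
    unfolding p(3) split by (intro Reg_sum[OF Y V] Reg_mult[OF Y V] Reg_const[OF Y V] p) auto
  show "(\<lambda>x. p (x, y)) \<in> Reg X U"
    unfolding p(3) split by (intro Reg_sum[OF X U] Reg_mult[OF X U] Reg_const[OF X U] p) auto
qed

lemma
  assumes X: "prevariety X" and Y: "prevariety Y" and W: "W \<in> Opn (prod_fspace X Y)"
  shows prod_Opn_right: "{y. (x, y) \<in> W} \<in> Opn Y"
    and prod_Opn_left: "{x. (x, y) \<in> W} \<in> Opn X"
proof -
  show "{y. (x, y) \<in> W} \<in> Opn Y"
  proof (rule Opn_local[OF Y])
    fix y assume "y \<in> {y. (x, y) \<in> W}"
    then have w: "(x, y) \<in> W" by simp
    obtain U V q where *: "U \<in> Opn X" "V \<in> Opn Y" "q \<in> sum_prod X Y U V"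
       "(x, y) \<in> U \<times> V" "q (x, y) \<noteq> 0" "{r \<in> U \<times> V. q r \<noteq> 0} \<subseteq> W"
      using W[unfolded prod_Opn_iff, THEN bspec, OF w] by (elim bexE conjE)
    have "{y \<in> V. q (x, y) \<noteq> 0} \<in> Opn Y"
      by (rule Opn_nonzero[OF Y *(2) sum_prod_Reg_right[OF X Y *(1-3)]]) (use * in auto)
    with * show "\<exists>V\<in>Opn Y. y \<in> V \<and> V \<subseteq> {y. (x, y) \<in> W}"
      by (intro bexI[of _ "{y \<in> V. q (x, y) \<noteq> 0}"]) auto
  qed
  show "{x. (x, y) \<in> W} \<in> Opn X"
  proof (rule Opn_local[OF X])
    fix x assume "x \<in> {x. (x, y) \<in> W}"
    then have w: "(x, y) \<in> W" by simp
    obtain U V q where *: "U \<in> Opn X" "V \<in> Opn Y" "q \<in> sum_prod X Y U V"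
       "(x, y) \<in> U \<times> V" "q (x, y) \<noteq> 0" "{r \<in> U \<times> V. q r \<noteq> 0} \<subseteq> W"
      using W[unfolded prod_Opn_iff, THEN bspec, OF w] by (elim bexE conjE)
    have "{x \<in> U. q (x, y) \<noteq> 0} \<in> Opn X"
      by (rule Opn_nonzero[OF X *(1) sum_prod_Reg_left[OF X Y *(1-3)]]) (use * in auto)
    with * show "\<exists>V\<in>Opn X. x \<in> V \<and> V \<subseteq> {x. (x, y) \<in> W}"
      by (intro bexI[of _ "{x \<in> U. q (x, y) \<noteq> 0}"]) auto
  qed
qed

text \<open>Slicing a local quotient of sums of products gives a quotient of regular functions of
  one variable; intersecting with the slice of W keeps the neighbourhood inside the domain.\<close>

lemma
  assumes X: "prevariety X" and Y: "prevariety Y" and W: "W \<in> Opn (prod_fspace X Y)"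
    and F: "F \<in> Reg (prod_fspace X Y) W"
  shows prod_Reg_right: "(\<lambda>y. F (x, y)) \<in> Reg Y {y. (x, y) \<in> W}"
    and prod_Reg_left: "(\<lambda>x. F (x, y)) \<in> Reg X {x. (x, y) \<in> W}"
proof -
  show "(\<lambda>y. F (x, y)) \<in> Reg Y {y. (x, y) \<in> W}"
  proof (rule Reg_local[OF Y])
    fix y assume "y \<in> {y. (x, y) \<in> W}"
    then have w: "(x, y) \<in> W" by simp
    obtain U V p q where *: "U \<in> Opn X" "V \<in> Opn Y" "p \<in> sum_prod X Y U V" "q \<in> sum_prod X Y U V"
       "(x, y) \<in> U \<times> V" "q (x, y) \<noteq> 0" "\<forall>r\<in>W \<inter> U \<times> V. q r \<noteq> 0 \<longrightarrow> F r = p r / q r"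
      using F[unfolded prod_Reg_iff, THEN bspec, OF w] by (elim bexE conjE)
    have r: "(\<lambda>y. p (x, y)) \<in> Reg Y V" "(\<lambda>y. q (x, y)) \<in> Reg Y V"
      using * sum_prod_Reg_right[OF X Y *(1,2)] by auto
    let ?V = "{y \<in> V. q (x, y) \<noteq> 0}"
    let ?V' = "?V \<inter> {y. (x, y) \<in> W}"
    have V: "?V \<in> Opn Y" by (rule Opn_nonzero[OF Y *(2) r(2)])
    have V': "?V' \<in> Opn Y" by (rule Opn_Int[OF Y V prod_Opn_right[OF X Y W]])
    have "(\<lambda>y. p (x, y) / q (x, y)) \<in> Reg Y ?V'"
      by (rule Reg_mono[OF Y V V' _ Reg_divide[OF Y *(2) r]]) blast
    then have "(\<lambda>y. F (x, y)) \<in> Reg Y ?V'"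
      by (rule Reg_cong[OF Y V']) (use * in auto)
    with V' w * show "\<exists>V\<in>Opn Y. y \<in> V \<and> V \<subseteq> {y. (x, y) \<in> W} \<and> (\<lambda>y. F (x, y)) \<in> Reg Y V"
      by (intro bexI[of _ ?V']) auto
  qed
  show "(\<lambda>x. F (x, y)) \<in> Reg X {x. (x, y) \<in> W}"
  proof (rule Reg_local[OF X])
    fix x assume "x \<in> {x. (x, y) \<in> W}"
    then have w: "(x, y) \<in> W" by simp
    obtain U V p q where *: "U \<in> Opn X" "V \<in> Opn Y" "p \<in> sum_prod X Y U V" "q \<in> sum_prod X Y U V"
       "(x, y) \<in> U \<times> V" "q (x, y) \<noteq> 0" "\<forall>r\<in>W \<inter> U \<times> V. q r \<noteq> 0 \<longrightarrow> F r = p r / q r"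
      using F[unfolded prod_Reg_iff, THEN bspec, OF w] by (elim bexE conjE)
    have r: "(\<lambda>x. p (x, y)) \<in> Reg X U" "(\<lambda>x. q (x, y)) \<in> Reg X U"
      using * sum_prod_Reg_left[OF X Y *(1,2)] by auto
    let ?V = "{x \<in> U. q (x, y) \<noteq> 0}"
    let ?V' = "?V \<inter> {x. (x, y) \<in> W}"
    have V: "?V \<in> Opn X" by (rule Opn_nonzero[OF X *(1) r(2)])
    have V': "?V' \<in> Opn X" by (rule Opn_Int[OF X V prod_Opn_left[OF X Y W]])
    have "(\<lambda>x. p (x, y) / q (x, y)) \<in> Reg X ?V'"
      by (rule Reg_mono[OF X V V' _ Reg_divide[OF X *(1) r]]) blast
    then have "(\<lambda>x. F (x, y)) \<in> Reg X ?V'"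
      by (rule Reg_cong[OF X V']) (use * in auto)
    with V' w * show "\<exists>V\<in>Opn X. x \<in> V \<and> V \<subseteq> {x. (x, y) \<in> W} \<and> (\<lambda>x. F (x, y)) \<in> Reg X V"
      by (intro bexI[of _ ?V']) auto
  qed
qed

lemma morphism_compose:
  "morphism X Y g \<Longrightarrow> morphism Y Z h \<Longrightarrow> morphism X Z (h \<circ> g)"
  unfolding morphism_def by (metis comp_assoc vimage_comp)

text \<open>Translations arise by freezing one argument of the multiplication morphism, so the slice
  lemmas suffice.\<close>

lemma
  fixes a :: "'k::complex_algebraic_group"
  shows morphism_mult_left: "morphism variety variety (\<lambda>k. a * k)"
    and morphism_mult_right: "morphism variety variety (\<lambda>k. k * a)"
proof -
  note m = mult_morphism[where 'a='k, unfolded morphism_def, rule_format]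
  show "morphism variety variety (\<lambda>k. a * k)" unfolding morphism_def
  proof (intro ballI conjI)
    fix V :: "'k set" and f assume V: "V \<in> Opn variety"
    show "(\<lambda>k. a * k) -` V \<in> Opn variety"
      using prod_Opn_right[OF variety variety m[OF V, THEN conjunct1], of a] by (simp add: vimage_def)
    assume "f \<in> Reg variety V"
    from m[OF V, THEN conjunct2, THEN bspec, OF this]
    show "f \<circ> (\<lambda>k. a * k) \<in> Reg variety ((\<lambda>k. a * k) -` V)"
      using prod_Reg_right[OF variety variety m[OF V, THEN conjunct1], of "f \<circ> (\<lambda>(x, y). x * y)" a]
      by (simp add: vimage_def o_def)
  qed
  show "morphism variety variety (\<lambda>k. k * a)" unfolding morphism_def
  proof (intro ballI conjI)
    fix V :: "'k set" and f assume V: "V \<in> Opn variety"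
    show "(\<lambda>k. k * a) -` V \<in> Opn variety"
      using prod_Opn_left[OF variety variety m[OF V, THEN conjunct1], of a] by (simp add: vimage_def)
    assume "f \<in> Reg variety V"
    from m[OF V, THEN conjunct2, THEN bspec, OF this]
    show "f \<circ> (\<lambda>k. k * a) \<in> Reg variety ((\<lambda>k. k * a) -` V)"
      using prod_Reg_left[OF variety variety m[OF V, THEN conjunct1], of "f \<circ> (\<lambda>(x, y). x * y)" a]
      by (simp add: vimage_def o_def)
  qed
qed

lemma morphism_conj:
  fixes a :: "'k::complex_algebraic_group"
  shows "morphism variety variety (\<lambda>h. a * h * inverse a)"
  using morphism_compose[OF morphism_mult_left[of a] morphism_mult_right[of "inverse a"]]
  by (simp add: o_def)

section \<open>Regular functions\<close>

lemma regfun_const: "(\<lambda>k. c) \<in> regfun"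
  unfolding regfun_def by (rule Reg_const[OF variety UNIV_Opn])

lemma regfun_add: "f \<in> regfun \<Longrightarrow> g \<in> regfun \<Longrightarrow> (\<lambda>k. f k + g k) \<in> regfun"
  unfolding regfun_def by (rule Reg_add[OF variety UNIV_Opn])

lemma regfun_mult: "f \<in> regfun \<Longrightarrow> g \<in> regfun \<Longrightarrow> (\<lambda>k. f k * g k) \<in> regfun"
  unfolding regfun_def by (rule Reg_mult[OF variety UNIV_Opn])

lemma regfun_sum: "(\<And>i. i \<in> I \<Longrightarrow> f i \<in> regfun) \<Longrightarrow> (\<lambda>k. \<Sum>i\<in>I. f i k) \<in> regfun"
  unfolding regfun_def by (rule Reg_sum[OF variety UNIV_Opn])

lemma regfun_near_one: "f \<in> regfun \<Longrightarrow> f \<in> near_one"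
  unfolding regfun_def by (rule near_oneI[OF UNIV_Opn UNIV_I])

lemma regfun_morphism: "morphism variety variety h \<Longrightarrow> f \<in> regfun \<Longrightarrow> (\<lambda>k. f (h k)) \<in> regfun"
  unfolding regfun_def morphism_def using UNIV_Opn by (fastforce simp: o_def)

lemma regfun_mult_left: "f \<in> regfun \<Longrightarrow> (\<lambda>k. f (a * k)) \<in> regfun"
  and regfun_mult_right: "f \<in> regfun \<Longrightarrow> (\<lambda>k. f (k * a)) \<in> regfun"
  and regfun_inverse: "f \<in> regfun \<Longrightarrow> (\<lambda>k. f (inverse k)) \<in> regfun"
  by (rule regfun_morphism[OF morphism_mult_left] regfun_morphism[OF morphism_mult_right]
      regfun_morphism[OF inverse_morphism]; assumption)+

section \<open>Vector-valued regular functions\<close>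

lemma regfun_inI:
  assumes "finite I" "\<And>i. i \<in> I \<Longrightarrow> c i \<in> regfun" "\<And>i. i \<in> I \<Longrightarrow> w i \<in> S"
  shows "(\<lambda>k. \<Sum>i\<in>I. c i k *\<^sub>C w i) \<in> regfun_in S"
proof -
  obtain h where h: "bij_betw h {0..<card I} I"
    using ex_bij_betw_nat_finite[OF assms(1)] by blast
  have "(\<Sum>i\<in>I. c i k *\<^sub>C w i) = (\<Sum>i<card I. c (h i) k *\<^sub>C w (h i))" for k
    using sum.reindex_bij_betw[OF h, of "\<lambda>i. c i k *\<^sub>C w i"] by (simp add: atLeast0LessThan)
  moreover have "h i \<in> I" if "i < card I" for i using h that by (auto simp: bij_betw_def)
  ultimately show ?thesis unfolding regfun_in_def
    by (auto intro!: exI[of _ "card I"] exI[of _ "\<lambda>i. c (h i)"] exI[of _ "\<lambda>i. w (h i)"] assms(2,3))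
qed

lemma regfun_inE:
  assumes "F \<in> regfun_in S"
  obtains n :: nat and c w where "\<And>i. i < n \<Longrightarrow> c i \<in> regfun" "\<And>i. i < n \<Longrightarrow> w i \<in> S"
    "F = (\<lambda>k. \<Sum>i<n. c i k *\<^sub>C w i)"
  using assms unfolding regfun_in_def by blast

lemma regfun_in_mono: "F \<in> regfun_in S \<Longrightarrow> S \<subseteq> S' \<Longrightarrow> F \<in> regfun_in S'"
  unfolding regfun_in_def by blast

lemma regfun_in_zero: "(\<lambda>k. 0) \<in> regfun_in S"
  using regfun_inI[of "{}" undefined undefined S] by simp

lemma regfun_in_add:
  assumes "F \<in> regfun_in S" "G \<in> regfun_in S"
  shows "(\<lambda>k. F k + G k) \<in> regfun_in S"
proof -
  obtain n :: nat and c w where F: "\<And>i. i < n \<Longrightarrow> c i \<in> regfun" "\<And>i. i < n \<Longrightarrow> w i \<in> S"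
    "F = (\<lambda>k. \<Sum>i<n. c i k *\<^sub>C w i)" using assms(1) by (rule regfun_inE) (rule that)
  obtain m :: nat and d v where G: "\<And>i. i < m \<Longrightarrow> d i \<in> regfun" "\<And>i. i < m \<Longrightarrow> v i \<in> S"
    "G = (\<lambda>k. \<Sum>i<m. d i k *\<^sub>C v i)" using assms(2) by (rule regfun_inE) (rule that)
  have "(\<lambda>k. \<Sum>i\<in>{..<n} <+> {..<m}. case_sum c d i k *\<^sub>C case_sum w v i) \<in> regfun_in S"
    by (rule regfun_inI) (use F G in auto)
  then show ?thesis unfolding F(3) G(3) by (subst (asm) sum.Plus) auto
qed

lemma regfun_in_single: "c \<in> regfun \<Longrightarrow> w \<in> S \<Longrightarrow> (\<lambda>k. c k *\<^sub>C w) \<in> regfun_in S"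
  using regfun_inI[of "{()}" "\<lambda>_. c" "\<lambda>_. w" S] by simp

lemma regfun_in_const: "w \<in> S \<Longrightarrow> (\<lambda>k. w) \<in> regfun_in S"
  using regfun_in_single[OF regfun_const[of 1]] by (simp add: scaleC_one)

text \<open>Reduces linear statements about R(K) \<otimes> S to pure tensors, while the remainder G
  stays in R(K) \<otimes> S.\<close>

lemma regfun_in_induct [consumes 1, case_names zero add]:
  assumes F: "F \<in> regfun_in S" and z: "P (\<lambda>k. 0)"
    and a: "\<And>c w G. c \<in> regfun \<Longrightarrow> w \<in> S \<Longrightarrow> G \<in> regfun_in S \<Longrightarrow> P G \<Longrightarrow> P (\<lambda>k. c k *\<^sub>C w + G k)"
  shows "P F"
proof -
  obtain n :: nat and c w where F: "\<And>i. i < n \<Longrightarrow> c i \<in> regfun" "\<And>i. i < n \<Longrightarrow> w i \<in> S"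
    "F = (\<lambda>k. \<Sum>i<n. c i k *\<^sub>C w i)" using F by (rule regfun_inE) (rule that)
  have "m \<le> n \<Longrightarrow> P (\<lambda>k. \<Sum>i<m. c i k *\<^sub>C w i)" for m
  proof (induction m)
    case (Suc m)
    have "(\<lambda>k. \<Sum>i<m. c i k *\<^sub>C w i) \<in> regfun_in S"
      by (rule regfun_inI) (use Suc F in auto)
    with Suc F a[of "c m" "w m" "\<lambda>k. \<Sum>i<m. c i k *\<^sub>C w i"] show ?case
      by (simp add: add.commute)
  qed (simp add: z)
  then show ?thesis unfolding F(3) by simp
qed

lemma regfun_in_sum:
  "(\<And>i. i \<in> I \<Longrightarrow> F i \<in> regfun_in S) \<Longrightarrow> (\<lambda>k. \<Sum>i\<in>I. F i k) \<in> regfun_in S"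
  by (induction I rule: infinite_finite_induct) (simp_all add: regfun_in_zero regfun_in_add)

lemma regfun_in_value:
  assumes "complex_vector.subspace S" "F \<in> regfun_in S"
  shows "F k \<in> S"
  using assms(2) by (induction rule: regfun_in_induct)
    (auto intro: complex_vector.subspace_0[OF assms(1)] complex_vector.subspace_add[OF assms(1)]
      complex_vector.subspace_scale[OF assms(1)])

lemma regfun_in_precompose:
  assumes "F \<in> regfun_in S" "\<And>c. c \<in> regfun \<Longrightarrow> (\<lambda>t. c (h t)) \<in> regfun"
  shows "(\<lambda>t. F (h t)) \<in> regfun_in S"
  using assms(1) by (induction rule: regfun_in_induct)
    (simp_all add: regfun_in_zero regfun_in_add regfun_in_single assms(2))

lemma regfun_in_lin:
  assumes F: "F \<in> regfun_in S" and S: "complex_vector.subspace S" and L: "lin_on S T L"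
  shows "(\<lambda>k. L (F k)) \<in> regfun_in T"
  using F
proof (induction rule: regfun_in_induct)
  case zero
  show ?case using lin_on_zero[OF L S] by (simp add: regfun_in_zero)
next
  case (add c w G)
  then show ?case using regfun_in_value[OF S add(3)]
    by (simp add: lin_on_add[OF L] lin_on_scale[OF L] complex_vector.subspace_scale[OF S]
        regfun_in_add regfun_in_single lin_on_in[OF L])
qed

lemma regfun_in_scale:
  assumes "F \<in> regfun_in S" "c \<in> regfun"
  shows "(\<lambda>k. c k *\<^sub>C F k) \<in> regfun_in S"
  using assms(1)
proof (induction rule: regfun_in_induct)
  case (add d w G)
  have "(\<lambda>k. (c k * d k) *\<^sub>C w) \<in> regfun_in S"
    by (rule regfun_in_single[OF regfun_mult]) (use add assms in auto)
  with add show ?case by (simp add: scaleC_add_right scaleC_scaleC regfun_in_add)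
qed (simp add: regfun_in_zero)

text \<open>The total function B is bilinear only on S and S'. Typical uses are the product of N(k)
  and the action of \<phi>(k)a on F(k).\<close>

lemma regfun_in_bilin:
  assumes F: "F \<in> regfun_in S" and G: "G \<in> regfun_in S'" 
    and S: "complex_vector.subspace S" "complex_vector.subspace S'"
    and B: "\<And>x. x \<in> S \<Longrightarrow> lin_on S' T (B x)" "\<And>y. y \<in> S' \<Longrightarrow> lin_on S T (\<lambda>x. B x y)"
  shows "(\<lambda>k. B (F k) (G k)) \<in> regfun_in T"
  using F
proof (induction rule: regfun_in_induct)
  case zero
  have "B 0 (G k) = 0" for k
    using lin_on_zero[OF B(2) S(1)] regfun_in_value[OF S(2) G] by blast
  then show ?case by (simp add: regfun_in_zero)
next
  case (add c w H)
  have "B (c k *\<^sub>C w + H k) (G k) = c k *\<^sub>C B w (G k) + B (H k) (G k)" for k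
    using B(2)[OF regfun_in_value[OF S(2) G, of k]] add(2) regfun_in_value[OF S(1) add(3), of k]
    by (simp add: lin_on_def complex_vector.subspace_scale[OF S(1)])
  moreover have "(\<lambda>k. B w (G k)) \<in> regfun_in T" by (rule regfun_in_lin[OF G S(2) B(1)[OF add(2)]])
  ultimately show ?case using add by (simp add: regfun_in_add regfun_in_scale)
qed

text \<open>The vectors in a given representation of F may lie outside S. Composing with a
  projection onto S replaces them by vectors of S and does not change F.\<close>

lemma regfun_in_restrict:
  assumes F: "F \<in> regfun_in UNIV" and S: "complex_vector.subspace S" "\<And>k. F k \<in> S"
  shows "F \<in> regfun_in S"
proof -
  obtain g where g: "lin_on UNIV S g" "\<And>x. x \<in> S \<Longrightarrow> g x = x"
    by (rule subspace_projection[OF S(1)]) (rule that)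
  have "(\<lambda>k. g (F k)) \<in> regfun_in S"
    by (rule regfun_in_lin[OF F complex_vector.subspace_UNIV g(1)])
  then show ?thesis using g(2) S(2) by simp
qed

text \<open>Regularity can be tested after an injective linear map. By
  \<open>regfun_in_restrict\<close> the vectors representing the composite may be taken in the image
  of L; their preimages define a function that L cannot distinguish from F, hence F itself.\<close>

lemma regfun_in_reflect:
  assumes LF: "(\<lambda>k. L (F k)) \<in> regfun_in UNIV" and S: "complex_vector.subspace S" "\<And>k. F k \<in> S"
    and L: "lin_on S UNIV L" "\<And>x. x \<in> S \<Longrightarrow> L x = 0 \<Longrightarrow> x = 0"
  shows "F \<in> regfun_in S"
proof -
  have T: "complex_vector.subspace (L ` S)"
  proof (rule complex_vector.subspaceI)
    show "0 \<in> L ` S" using lin_on_zero[OF L(1) S(1)] complex_vector.subspace_0[OF S(1)] by (metis imageI)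
    fix x y c assume "x \<in> L ` S" 
    then obtain a where a: "x = L a" "a \<in> S" by blast
    then show "c *\<^sub>C x \<in> L ` S" using complex_vector.subspace_scale[OF S(1)]
      by (auto simp flip: lin_on_scale[OF L(1)])
    assume "y \<in> L ` S"
    then obtain b where "y = L b" "b \<in> S" by blast
    with a show "x + y \<in> L ` S" using complex_vector.subspace_add[OF S(1)]
      by (auto simp flip: lin_on_add[OF L(1)])
  qed
  have "(\<lambda>k. L (F k)) \<in> regfun_in (L ` S)" by (rule regfun_in_restrict[OF LF T]) (use S in auto)
  then obtain n :: nat and c w where *: "\<And>i. i < n \<Longrightarrow> c i \<in> regfun" "\<And>i. i < n \<Longrightarrow> w i \<in> L ` S"
    "(\<lambda>k. L (F k)) = (\<lambda>k. \<Sum>i<n. c i k *\<^sub>C w i)" by (rule regfun_inE) (rule that)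
  have "\<forall>i. \<exists>s. i < n \<longrightarrow> s \<in> S \<and> w i = L s" using *(2) by blast
  then obtain s where s: "\<And>i. i < n \<Longrightarrow> s i \<in> S" "\<And>i. i < n \<Longrightarrow> w i = L (s i)" by metis
  have "F k = (\<Sum>i<n. c i k *\<^sub>C s i)" for k
  proof -
    have m: "(\<Sum>i<n. c i k *\<^sub>C s i) \<in> S"
      by (intro complex_vector.subspace_sum[OF S(1)] complex_vector.subspace_scale[OF S(1)]) (use s in auto)
    have "L (F k) = (\<Sum>i<n. c i k *\<^sub>C L (s i))" using fun_cong[OF *(3), of k] s by simp
    also have "\<dots> = L (\<Sum>i<n. c i k *\<^sub>C s i)" by (rule lin_on_sum[OF L(1) S(1), symmetric]) (use s in auto)
    finally have "L (F k - (\<Sum>i<n. c i k *\<^sub>C s i)) = 0"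
      using lin_on_diff[OF L(1) S(1) S(2) m] by simp
    then show ?thesis using L(2) complex_vector.subspace_diff[OF S(1) S(2) m] by fastforce
  qed
  then have "F = (\<lambda>k. \<Sum>i<n. c i k *\<^sub>C s i)" by blast
  then show ?thesis using regfun_inI[of "{..<n}" c s S] *(1) s(1) by simp
qed

lemma regfun_in_span_finite:
  assumes "F \<in> regfun_in (complex_vector.span B)" "finite B"
  obtains c where "\<And>a. a \<in> B \<Longrightarrow> c a \<in> regfun" "\<And>k. F k = (\<Sum>a\<in>B. c a k *\<^sub>C a)"
proof -
  have "\<exists>c. (\<forall>a\<in>B. c a \<in> regfun) \<and> (\<forall>k. F k = (\<Sum>a\<in>B. c a k *\<^sub>C a))"
    using assms(1)
  proof (induction rule: regfun_in_induct)
    case zero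
    show ?case by (rule exI[of _ "\<lambda>a k. 0"]) (simp add: regfun_const)
  next
    case (add c w G)
    obtain d where d: "\<forall>a\<in>B. d a \<in> regfun" "\<forall>k. G k = (\<Sum>a\<in>B. d a k *\<^sub>C a)" using add by blast
    obtain u where u: "w = (\<Sum>a\<in>B. u a *\<^sub>C a)"
      using add(2) complex_vector.span_finite[OF assms(2)] by auto
    show ?case
    proof (intro exI[of _ "\<lambda>a k. c k * u a + d a k"] conjI ballI allI)
      show "(\<lambda>k. c k * u a + d a k) \<in> regfun" if "a \<in> B" for a
        using add(1) d that by (intro regfun_add regfun_mult regfun_const) auto
      show "c k *\<^sub>C w + G k = (\<Sum>a\<in>B. (c k * u a + d a k) *\<^sub>C a)" for k
        by (simp add: u d(2) scaleC_add_left sum.distrib scaleC_sum_right scaleC_scaleC)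
    qed
  qed
  then show ?thesis using that by blast
qed

text \<open>A regular orbit map already forces local finiteness: the orbit of v lies in the span of
  the finitely many vectors of one representation, so its own span is finite-dimensional and
  invariant. The matrix entries in a basis of it are the coordinates of the orbit maps of the basis
  vectors.\<close>

lemma algebraic_actionI:
  fixes \<nu> :: "'k::complex_algebraic_group \<Rightarrow> 'v::complex_vector \<Rightarrow> 'v"
  assumes S: "complex_vector.subspace S" and lin: "\<And>k. lin_on S S (\<nu> k)"
    and one: "\<And>v. v \<in> S \<Longrightarrow> \<nu> 1 v = v" and mult: "\<And>k l v. v \<in> S \<Longrightarrow> \<nu> (k * l) v = \<nu> k (\<nu> l v)"
    and reg: "\<And>v. v \<in> S \<Longrightarrow> (\<lambda>k. \<nu> k v) \<in> regfun_in UNIV"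
  shows "algebraic_action S \<nu>"
  unfolding algebraic_action_def
proof (intro conjI allI ballI lin one mult)
  fix v assume v: "v \<in> S"
  let ?O = "complex_vector.span (range (\<lambda>k. \<nu> k v))"
  have OS: "?O \<subseteq> S" 
    by (rule complex_vector.span_minimal[OF _ S]) (use lin_on_in[OF lin v] in blast)
  obtain n :: nat and c w where F: "(\<lambda>k. \<nu> k v) = (\<lambda>k. \<Sum>i<n. c i k *\<^sub>C w i)"
    using reg[OF v] by (rule regfun_inE) (rule that)
  have rw: "range (\<lambda>k. \<nu> k v) \<subseteq> complex_vector.span (w ` {..<n})"
    using fun_cong[OF F]
    by (auto intro!: complex_vector.span_sum complex_vector.span_scale intro: complex_vector.span_base)
  obtain B where B: "B \<subseteq> ?O" "complex_vector.independent B" "?O \<subseteq> complex_vector.span B"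
    by (rule complex_vector.basis_exists[of ?O]) (rule that)
  have O: "complex_vector.span B = ?O"
    using B complex_vector.span_minimal[OF B(1) complex_vector.subspace_span] by blast
  have "finite B"
  proof -
    have "B \<subseteq> complex_vector.span (w ` {..<n})"
      using B(1) complex_vector.span_minimal[OF rw complex_vector.subspace_span] by blast
    then show ?thesis using complex_vector.independent_span_bound[OF _ B(2)] by blast
  qed
  have r: "(\<lambda>k. \<nu> k b) \<in> regfun_in ?O" if "b \<in> ?O" for b
    using that
  proof (induction rule: span_induct_strong)
    case zero
    show ?case using lin_on_zero[OF lin S] by (simp add: regfun_in_zero)
  next
    case (add c x y)
    then obtain g where x: "x = \<nu> g v" by blast
    \<comment> \<open>For x = \<nu>(g) v the orbit map is k \<mapsto> \<nu>(kg) v, a right translate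
      of the orbit map of v.\<close>
    have "(\<lambda>k. \<nu> k x) \<in> regfun_in ?O"
    proof (rule regfun_in_restrict[OF _ complex_vector.subspace_span])
      show "(\<lambda>k. \<nu> k x) \<in> regfun_in UNIV"
        using regfun_in_precompose[OF reg[OF v], of "\<lambda>k. k * g"]
        by (simp add: x mult[OF v] regfun_mult_right)
      show "\<nu> k x \<in> ?O" for k
        unfolding x mult[OF v, symmetric] by (rule complex_vector.span_base) blast
    qed
    moreover have "x \<in> S" "y \<in> S" using x lin_on_in[OF lin v] OS add by auto
    ultimately show ?case using add(3)
      by (simp add: lin_on_add[OF lin] lin_on_scale[OF lin] complex_vector.subspace_scale[OF S]
         regfun_in_add regfun_in_scale[OF _ regfun_const])
  qed
  have "\<exists>c. (\<forall>a\<in>B. c a \<in> regfun) \<and> (\<forall>k. \<nu> k b = (\<Sum>a\<in>B. c a k *\<^sub>C a))" if "b \<in> B" for b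
    by (rule regfun_in_span_finite[OF _ \<open>finite B\<close>, of "\<lambda>k. \<nu> k b"]) (use O r that B in auto)
  then obtain c where c: "\<And>b a. b \<in> B \<Longrightarrow> a \<in> B \<Longrightarrow> c b a \<in> regfun"
    "\<And>b k. b \<in> B \<Longrightarrow> \<nu> k b = (\<Sum>a\<in>B. c b a k *\<^sub>C a)" by metis
  show "\<exists>B c. finite B \<and> B \<subseteq> S \<and> complex_vector.independent B \<and> v \<in> complex_vector.span B
          \<and> (\<forall>a\<in>B. \<forall>b\<in>B. c a b \<in> regfun)
          \<and> (\<forall>k. \<forall>b\<in>B. \<nu> k b = (\<Sum>a\<in>B. c a b k *\<^sub>C a))"
  proof (intro exI[of _ B] exI[of _ "\<lambda>a b. c b a"] conjI)
    show "v \<in> complex_vector.span B"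
      unfolding O using one[OF v] by (metis complex_vector.span_base rangeI)
  qed (use \<open>finite B\<close> B OS c in auto)
qed

lemma
  assumes "algebraic_action S \<nu>"
  shows algebraic_action_lin: "lin_on S S (\<nu> k)"
    and algebraic_action_one: "v \<in> S \<Longrightarrow> \<nu> 1 v = v"
    and algebraic_action_mult: "v \<in> S \<Longrightarrow> \<nu> (k * l) v = \<nu> k (\<nu> l v)"
  using assms unfolding algebraic_action_def by blast+

lemma algebraic_action_in: "algebraic_action S \<nu> \<Longrightarrow> v \<in> S \<Longrightarrow> \<nu> k v \<in> S"
  by (rule lin_on_in[OF algebraic_action_lin])

lemma algebraic_action_inverse:
  assumes "algebraic_action S \<nu>" "v \<in> S"
  shows "\<nu> k (\<nu> (inverse k) v) = v" "\<nu> (inverse k) (\<nu> k v) = v"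
  using algebraic_action_mult[OF assms] algebraic_action_one[OF assms]
  by (metis group_left_inverse group_right_inverse)+

lemma algebraic_action_reg:
  assumes A: "algebraic_action S \<nu>" and S: "complex_vector.subspace S" and v: "v \<in> S"
  shows "(\<lambda>k. \<nu> k v) \<in> regfun_in S"
proof -
  have "\<exists>B c. finite B \<and> B \<subseteq> S \<and> complex_vector.independent B \<and> v \<in> complex_vector.span B
          \<and> (\<forall>a\<in>B. \<forall>b\<in>B. c a b \<in> regfun)
          \<and> (\<forall>k. \<forall>b\<in>B. \<nu> k b = (\<Sum>a\<in>B. c a b k *\<^sub>C a))"
    using A[unfolded algebraic_action_def, THEN conjunct2, THEN conjunct2, THEN conjunct2] v by (rule bspec)
  then obtain B c where B: "finite B" "B \<subseteq> S" "v \<in> complex_vector.span B"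
    "\<forall>a\<in>B. \<forall>b\<in>B. c a b \<in> regfun" and "\<forall>k. \<forall>b\<in>B. \<nu> k b = (\<Sum>a\<in>B. c a b k *\<^sub>C a)"
    by (elim exE conjE) (rule that)
  then have B5: "b \<in> B \<Longrightarrow> \<nu> k b = (\<Sum>a\<in>B. c a b k *\<^sub>C a)" for k b by blast
  obtain u where u: "v = (\<Sum>b\<in>B. u b *\<^sub>C b)"
    using B(3) complex_vector.span_finite[OF B(1)] by auto
  have "\<nu> k v = (\<Sum>b\<in>B. u b *\<^sub>C (\<Sum>a\<in>B. c a b k *\<^sub>C a))" for k
  proof -
    have "\<nu> k v = (\<Sum>b\<in>B. u b *\<^sub>C \<nu> k b)"
      unfolding u by (rule lin_on_sum[OF algebraic_action_lin[OF A] S]) (use B(2) in blast)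
    also have "\<dots> = (\<Sum>b\<in>B. u b *\<^sub>C (\<Sum>a\<in>B. c a b k *\<^sub>C a))"
      by (rule sum.cong[OF refl], subst B5) simp_all
    finally show ?thesis .
  qed
  moreover have "(\<lambda>k. \<Sum>b\<in>B. u b *\<^sub>C (\<Sum>a\<in>B. c a b k *\<^sub>C a)) \<in> regfun_in S"
    by (intro regfun_in_sum regfun_in_scale[OF _ regfun_const] regfun_in_single) (use B in auto)
  ultimately show ?thesis by simp
qed

section \<open>Derivatives of vector-valued regular functions\<close>

text \<open>This makes the description in \<open>vderiv\<close> independent of the representation.
  After expansion in an independent subfamily of the w i, the coefficient functions vanish
  identically, and then so do their derivatives.\<close>

lemma vderiv_sum_zero:
  assumes "finite I" "\<And>i. i \<in> I \<Longrightarrow> c i \<in> regfun" "\<And>k. (\<Sum>i\<in>I. c i k *\<^sub>C w i) = (0::'v::complex_vector)"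
  shows "(\<Sum>i\<in>I. apply_lie X (c i) *\<^sub>C w i) = 0"
proof -
  obtain B where B: "B \<subseteq> w ` I" "complex_vector.independent B" "w ` I \<subseteq> complex_vector.span B"
    by (rule complex_vector.basis_exists[of "w ` I"]) (rule that)
  have fB: "finite B" using B(1) assms(1) finite_subset by blast
  have "\<forall>i\<in>I. \<exists>u. w i = (\<Sum>b\<in>B. u b *\<^sub>C b)"
    using B(3) complex_vector.span_finite[OF fB] by auto
  then obtain u where u: "\<And>i. i \<in> I \<Longrightarrow> w i = (\<Sum>b\<in>B. u i b *\<^sub>C b)" by metis
  have e: "(\<Sum>i\<in>I. a i *\<^sub>C w i) = (\<Sum>b\<in>B. (\<Sum>i\<in>I. u i b * a i) *\<^sub>C b)" for a
  proof -
    have "(\<Sum>i\<in>I. a i *\<^sub>C w i) = (\<Sum>i\<in>I. \<Sum>b\<in>B. (u i b * a i) *\<^sub>C b)"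
      by (rule sum.cong[OF refl]) (simp add: u scaleC_sum_right scaleC_scaleC mult.commute)
    then show ?thesis by (subst (asm) sum.swap) (simp add: scaleC_sum_left)
  qed
  have "(\<Sum>i\<in>I. u i b * c i k) = 0" if "b \<in> B" for b k
  proof -
    have "(\<Sum>b\<in>B. (\<Sum>i\<in>I. u i b * c i k) *\<^sub>C b) = 0" using assms(3)[of k] e[of "\<lambda>i. c i k"] by simp
    then show ?thesis
      using B(2) that complex_vector.dependent_finite[OF fB] by auto
  qed
  moreover have "(\<Sum>i\<in>I. u i b * apply_lie X (c i)) = apply_lie X (\<lambda>k. \<Sum>i\<in>I. u i b * c i k)" for b
    using assms(2) by (subst lie_sum) (auto simp: lie_scale regfun_near_one intro: near_one_scale)
  ultimately show ?thesis unfolding e by (simp add: lie_const)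
qed

lemma vderiv_eq:
  assumes "finite I" "\<And>i. i \<in> I \<Longrightarrow> c i \<in> regfun"
  shows "vderiv X (\<lambda>k. \<Sum>i\<in>I. c i k *\<^sub>C w i) = (\<Sum>i\<in>I. apply_lie X (c i) *\<^sub>C (w i :: 'v::complex_vector))"
  unfolding vderiv_def
proof (rule the_equality)
  obtain h where h: "bij_betw h {0..<card I} I"
    using ex_bij_betw_nat_finite[OF assms(1)] by blast
  have *: "(\<Sum>i\<in>I. a i *\<^sub>C w i) = (\<Sum>i<card I. a (h i) *\<^sub>C w (h i))" for a
    using sum.reindex_bij_betw[OF h, of "\<lambda>i. a i *\<^sub>C w i"] by (simp add: atLeast0LessThan)
  have "h i \<in> I" if "i < card I" for i using h that by (auto simp: bij_betw_def)
  then show "\<exists>(n::nat) c' w'. (\<forall>i<n. c' i \<in> regfun) \<and>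
       (\<lambda>k. \<Sum>i\<in>I. c i k *\<^sub>C w i) = (\<lambda>k. \<Sum>i<n. c' i k *\<^sub>C w' i) \<and>
       (\<Sum>i\<in>I. apply_lie X (c i) *\<^sub>C w i) = (\<Sum>i<n. apply_lie X (c' i) *\<^sub>C w' i)"
    by (intro exI[of _ "card I"] exI[of _ "\<lambda>i. c (h i)"] exI[of _ "\<lambda>i. w (h i)"])
      (use assms * in auto)
next
  fix u assume "\<exists>(n::nat) c' w'. (\<forall>i<n. c' i \<in> regfun) \<and>
       (\<lambda>k. \<Sum>i\<in>I. c i k *\<^sub>C w i) = (\<lambda>k. \<Sum>i<n. c' i k *\<^sub>C w' i) \<and>
       u = (\<Sum>i<n. apply_lie X (c' i) *\<^sub>C w' i)"
  then obtain n :: nat and c' w' where *: "\<forall>i<n. c' i \<in> regfun"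
     "(\<lambda>k. \<Sum>i\<in>I. c i k *\<^sub>C w i) = (\<lambda>k. \<Sum>i<n. c' i k *\<^sub>C w' i)"
     "u = (\<Sum>i<n. apply_lie X (c' i) *\<^sub>C w' i)" by blast
  \<comment> \<open>The difference of two representations of the same function is a representation
    of 0, indexed by the disjoint union.\<close>
  have "(\<Sum>i\<in>I <+> {..<n}. apply_lie X (case_sum c c' i) *\<^sub>C case_sum w (\<lambda>i. - w' i) i) = 0"
  proof (rule vderiv_sum_zero)
    show "(\<Sum>i\<in>I <+> {..<n}. case_sum c c' i k *\<^sub>C case_sum w (\<lambda>i. - w' i) i) = 0" for k
      using fun_cong[OF *(2), of k] assms(1)
      by (subst sum.Plus) (auto simp: sum_negf)
  qed (use assms * in auto)
  then show "u = (\<Sum>i\<in>I. apply_lie X (c i) *\<^sub>C w i)"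
    using assms(1) by (subst (asm) sum.Plus) (auto simp: sum_negf *(3))
qed

lemma vderiv_zero: "vderiv X (\<lambda>k. 0) = 0"
  using vderiv_eq[of "{}" undefined X undefined] by simp

lemma vderiv_single: "c \<in> regfun \<Longrightarrow> vderiv X (\<lambda>k. c k *\<^sub>C w) = apply_lie X c *\<^sub>C w"
  using vderiv_eq[of "{()}" "\<lambda>_. c" X "\<lambda>_. w"] by simp

lemma vderiv_const: "vderiv X (\<lambda>k. w) = 0"
  using vderiv_single[OF regfun_const[of 1], of X w] by (simp add: scaleC_one lie_const)

lemma vderiv_add:
  assumes "F \<in> regfun_in S" "G \<in> regfun_in S'"
  shows "vderiv X (\<lambda>k. F k + G k) = vderiv X F + vderiv X G"
proof -
  obtain n :: nat and c w where F: "\<And>i. i < n \<Longrightarrow> c i \<in> regfun" 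
    "F = (\<lambda>k. \<Sum>i<n. c i k *\<^sub>C w i)" using assms(1) by (rule regfun_inE) (rule that)
  obtain m :: nat and d v where G: "\<And>i. i < m \<Longrightarrow> d i \<in> regfun" 
    "G = (\<lambda>k. \<Sum>i<m. d i k *\<^sub>C v i)" using assms(2) by (rule regfun_inE) (rule that)
  have "vderiv X (\<lambda>k. \<Sum>i\<in>{..<n} <+> {..<m}. case_sum c d i k *\<^sub>C case_sum w v i) = 
     (\<Sum>i\<in>{..<n} <+> {..<m}. apply_lie X (case_sum c d i) *\<^sub>C case_sum w v i)"
    by (rule vderiv_eq) (use F G in auto)
  moreover have "vderiv X F = (\<Sum>i<n. apply_lie X (c i) *\<^sub>C w i)"
    "vderiv X G = (\<Sum>i<m. apply_lie X (d i) *\<^sub>C v i)"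
    unfolding F(2) G(2) by (rule vderiv_eq; use F(1) G(1) in simp)+
  ultimately show ?thesis unfolding F(2) G(2) by (simp add: sum.Plus)
qed

lemma vderiv_in:
  assumes "F \<in> regfun_in S" "complex_vector.subspace S"
  shows "vderiv X F \<in> S"
  using assms(1)
proof (induction rule: regfun_in_induct)
  case (add c w G)
  then show ?case
    by (simp add: vderiv_add[OF regfun_in_single[OF add(1,2)] add(3)] vderiv_single
      complex_vector.subspace_add[OF assms(2)] complex_vector.subspace_scale[OF assms(2)])
qed (simp add: vderiv_zero complex_vector.subspace_0[OF assms(2)])

lemma vderiv_lin:
  assumes "F \<in> regfun_in S" "complex_vector.subspace S" "lin_on S T L"
  shows "vderiv X (\<lambda>k. L (F k)) = L (vderiv X F)"
  using assms(1)
proof (induction rule: regfun_in_induct)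
  case zero
  show ?case using lin_on_zero[OF assms(3,2)] by (simp add: vderiv_zero)
next
  case (add c w G)
  have "(\<lambda>k. L (c k *\<^sub>C w + G k)) = (\<lambda>k. c k *\<^sub>C L w + L (G k))"
    using regfun_in_value[OF assms(2) add(3)] add(2)
    by (simp add: lin_on_add[OF assms(3)] lin_on_scale[OF assms(3)] complex_vector.subspace_scale[OF assms(2)])
  moreover have "L w \<in> T" by (rule lin_on_in[OF assms(3) add(2)])
  ultimately show ?case using add vderiv_in[OF add(3) assms(2), of X]
    by (simp add: vderiv_add[OF regfun_in_single[OF add(1,2)] add(3)] vderiv_single
        vderiv_add[OF regfun_in_single[OF add(1)] regfun_in_lin[OF add(3) assms(2,3)], of "L w" T]
        lin_on_add[OF assms(3)] lin_on_scale[OF assms(3)] complex_vector.subspace_scale[OF assms(2)])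
qed

lemma vderiv_scale:
  assumes "F \<in> regfun_in S" "c \<in> regfun" 
  shows "vderiv X (\<lambda>k. c k *\<^sub>C F k) = apply_lie X c *\<^sub>C F 1 + c 1 *\<^sub>C vderiv X F"
  using assms(1)
proof (induction rule: regfun_in_induct)
  case (add d w G)
  have "vderiv X (\<lambda>k. c k *\<^sub>C (d k *\<^sub>C w + G k)) = 
    vderiv X (\<lambda>k. (c k * d k) *\<^sub>C w + c k *\<^sub>C G k)"
    by (simp add: scaleC_add_right scaleC_scaleC)
  also have "\<dots> = apply_lie X (\<lambda>k. c k * d k) *\<^sub>C w + vderiv X (\<lambda>k. c k *\<^sub>C G k)"
    by (subst vderiv_add[OF regfun_in_single[OF regfun_mult[OF assms(2) add(1)] add(2)] 
       regfun_in_scale[OF add(3) assms(2)]]) (simp add: vderiv_single regfun_mult assms add)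
  finally show ?case
    by (simp add: add.IH vderiv_add[OF regfun_in_single[OF add(1,2)] add(3)] vderiv_single[OF add(1)]
       lie_mult[OF regfun_near_one regfun_near_one] assms add(1) scaleC_add_right scaleC_add_left scaleC_scaleC)
qed (simp add: vderiv_zero)

lemma vderiv_bilin:
  assumes F: "F \<in> regfun_in S" and G: "G \<in> regfun_in S'" 
    and S: "complex_vector.subspace S" "complex_vector.subspace S'"
    and B: "\<And>x. x \<in> S \<Longrightarrow> lin_on S' T (B x)" "\<And>y. y \<in> S' \<Longrightarrow> lin_on S T (\<lambda>x. B x y)"
  shows "vderiv X (\<lambda>k. B (F k) (G k)) = B (vderiv X F) (G 1) + B (F 1) (vderiv X G)"
  using F
proof (induction rule: regfun_in_induct)
  case zero
  have "B 0 y = 0" if "y \<in> S'" for y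
    using lin_on_zero[OF B(2) S(1)] that by blast
  then show ?case using regfun_in_value[OF S(2) G] vderiv_in[OF G S(2)] by (simp add: vderiv_zero)
next
  case (add c w H)
  have *: "B (a *\<^sub>C w + x) y = a *\<^sub>C B w y + B x y" if "x \<in> S" "y \<in> S'" for a x y
    using B(2)[OF that(2)] add(2) that(1)
    by (simp add: lin_on_def complex_vector.subspace_scale[OF S(1)])
  note v = regfun_in_value[OF S(1) add(3)] regfun_in_value[OF S(2) G] vderiv_in[OF G S(2)] vderiv_in[OF add(3) S(1)]
  have w: "(\<lambda>k. B w (G k)) \<in> regfun_in T" by (rule regfun_in_lin[OF G S(2) B(1)[OF add(2)]])
  have "vderiv X (\<lambda>k. B (c k *\<^sub>C w + H k) (G k)) = vderiv X (\<lambda>k. c k *\<^sub>C B w (G k)) + vderiv X (\<lambda>k. B (H k) (G k))"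
    using vderiv_add[OF regfun_in_scale[OF w add(1)] regfun_in_bilin[OF add(3) G S B], of X]
    by (simp add: * v)
  moreover have "\<dots> = apply_lie X c *\<^sub>C B w (G 1) + c 1 *\<^sub>C B w (vderiv X G) + 
     (B (vderiv X H) (G 1) + B (H 1) (vderiv X G))"
    by (simp add: vderiv_scale[OF w add(1)] add.IH vderiv_lin[OF G S(2) B(1)[OF add(2)]])
  moreover have "vderiv X (\<lambda>k. c k *\<^sub>C w + H k) = apply_lie X c *\<^sub>C w + vderiv X H"
    by (simp add: vderiv_add[OF regfun_in_single[OF add(1,2)] add(3)] vderiv_single[OF add(1)])
  ultimately show ?case
    by (simp add: * v)
qed

lemma vderiv_lie:
  assumes "F \<in> regfun_in S"
  shows "vderiv (X + Y) F = vderiv X F + vderiv Y F" "vderiv (a *\<^sub>C X) F = a *\<^sub>C vderiv X F"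
    "vderiv (- X) F = - vderiv X F"
proof -
  obtain n :: nat and c w where F: "\<And>i. i < n \<Longrightarrow> c i \<in> regfun" 
    "F = (\<lambda>k. \<Sum>i<n. c i k *\<^sub>C w i)" using assms(1) by (rule regfun_inE) (rule that)
  have "vderiv Z F = (\<Sum>i<n. apply_lie Z (c i) *\<^sub>C w i)" for Z
    unfolding F(2) by (rule vderiv_eq) (use F(1) in simp_all)
  then show "vderiv (X + Y) F = vderiv X F + vderiv Y F" "vderiv (a *\<^sub>C X) F = a *\<^sub>C vderiv X F"
    "vderiv (- X) F = - vderiv X F"
    by (simp_all add: scaleC_add_left sum.distrib scaleC_sum_right scaleC_scaleC sum_negf)
qed

section \<open>The Nullstellensatz\<close>

lemma poly_fun_mono: "p \<in> poly_fun n \<Longrightarrow> n \<le> m \<Longrightarrow> p \<in> poly_fun m"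
  by (induction rule: poly_fun.induct) (auto intro: poly_fun.intros)

lemma poly_fun_cong: "p \<in> poly_fun n \<Longrightarrow> (\<And>i. i < n \<Longrightarrow> z i = z' i) \<Longrightarrow> p z = p z'"
  by (induction rule: poly_fun.induct) auto

lemma poly_fun_shift: "p \<in> poly_fun m \<Longrightarrow> (\<lambda>z. p (\<lambda>i. z (n + i))) \<in> poly_fun (n + m)"
  by (induction rule: poly_fun.induct) (auto intro: poly_fun.intros)

lemma poly_fun_diff: "p \<in> poly_fun n \<Longrightarrow> q \<in> poly_fun n \<Longrightarrow> (\<lambda>z. p z - q z) \<in> poly_fun n"
  using poly_fun.poly_add[OF _ poly_fun.poly_mult[OF poly_fun.poly_const[of "-1"]], of p n q] by simp

lemma poly_fun_prod: "(\<And>i. i \<in> I \<Longrightarrow> p i \<in> poly_fun n) \<Longrightarrow> (\<lambda>z. \<Prod>i\<in>I. p i z) \<in> poly_fun n"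
  by (induction I rule: infinite_finite_induct) (auto intro: poly_fun.intros)

lemma span_times:
  fixes f g :: "'x \<Rightarrow> complex"
  assumes "f \<in> complex_vector.span A" "g \<in> complex_vector.span B"
  shows "(\<lambda>x. f x * g x) \<in> complex_vector.span {\<lambda>x. f x * g x | f g. f \<in> A \<and> g \<in> B}"
    (is "_ \<in> complex_vector.span ?C")
  using assms(1)
proof (induction rule: span_induct_strong)
  case zero
  show ?case using complex_vector.span_zero[of ?C] by (simp add: zero_fun_def)
next
  case (add c a f)
  have "(\<lambda>x. a x * g x) \<in> complex_vector.span ?C"
    using assms(2)
  proof (induction rule: span_induct_strong)
    case zero
    show ?case using complex_vector.span_zero[of ?C] by (simp add: zero_fun_def)
  next
    case (add d b h)
    have "(\<lambda>x. a x * (d *\<^sub>C b + h) x) = d *\<^sub>C (\<lambda>x. a x * b x) + (\<lambda>x. a x * h x)"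
      by (simp add: fun_eq_iff scaleC_fun_def scaleC_complex_def algebra_simps)
    moreover have "(\<lambda>x. a x * b x) \<in> complex_vector.span ?C"
      by (rule complex_vector.span_base) (use add(1) \<open>a \<in> A\<close> in blast)
    ultimately show ?case using add(3)
      by (simp only:) (intro complex_vector.span_add complex_vector.span_scale)
  qed
  moreover have "(\<lambda>x. (c *\<^sub>C a + f) x * g x) = c *\<^sub>C (\<lambda>x. a x * g x) + (\<lambda>x. f x * g x)"
    by (simp add: fun_eq_iff scaleC_fun_def scaleC_complex_def algebra_simps)
  ultimately show ?case using add(3)
    by (simp only:) (intro complex_vector.span_add complex_vector.span_scale)
qed

text \<open>Indexed by words in the variables instead of exponent vectors: the index set is visibly
  countable and multiplication is concatenation. Repetitions are harmless since only spans are
  taken.\<close>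

definition monomial :: "nat list \<Rightarrow> (nat \<Rightarrow> complex) \<Rightarrow> complex" where
  "monomial xs z = prod_list (map z xs)"

lemma poly_fun_span_monomial: "p \<in> poly_fun n \<Longrightarrow> p \<in> complex_vector.span (range monomial)"
proof (induction rule: poly_fun.induct)
  case (poly_const c)
  have "(\<lambda>z. c) = c *\<^sub>C monomial []"
    by (simp add: fun_eq_iff monomial_def scaleC_fun_def scaleC_complex_def)
  then show ?case by (simp add: complex_vector.span_base complex_vector.span_scale)
next
  case (poly_coord i)
  have "(\<lambda>z. z i) = monomial [i]" by (simp add: fun_eq_iff monomial_def)
  then show ?case by (simp add: complex_vector.span_base)
next
  case (poly_add p q)
  then have "p + q \<in> complex_vector.span (range monomial)" by (rule_tac complex_vector.span_add)
  then show ?case by (simp add: plus_fun_def)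
next
  case (poly_mult p q)
  have "{\<lambda>x. f x * g x | f g. f \<in> range monomial \<and> g \<in> range monomial} \<subseteq> range monomial"
  proof (clarsimp)
    fix a b show "(\<lambda>x. monomial a x * monomial b x) \<in> range monomial"
      by (rule range_eqI[of _ _ "a @ b"]) (simp add: fun_eq_iff monomial_def)
  qed
  then show ?case using span_times[OF poly_mult(3,4)] complex_vector.span_mono by blast
qed

text \<open>This is the countable dimension of the polynomial ring, in the form of an exhaustion by
  finite-dimensional spaces. The same spaces serve every number n of variables.\<close>

lemma poly_fun_filtration:
  obtains E :: "nat \<Rightarrow> ((nat \<Rightarrow> complex) \<Rightarrow> complex) set"
  where "\<And>d. finite (E d)" "\<And>n p. p \<in> poly_fun n \<Longrightarrow> \<exists>d. p \<in> complex_vector.span (E d)"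
proof -
  define E where "E d = (\<lambda>i. monomial (from_nat i)) ` {..<d::nat}" for d
  have "\<exists>d. p \<in> complex_vector.span (E d)" if "p \<in> complex_vector.span (range monomial)" for p
    using that
  proof (induction rule: span_induct_strong)
    case zero
    show ?case using complex_vector.span_zero by blast
  next
    case (add c x y)
    obtain d where d: "y \<in> complex_vector.span (E d)" using add by blast
    obtain xs where xs: "x = monomial xs" using add(1) by blast
    have 1: "x \<in> E (max d (Suc (to_nat xs)))"
      unfolding E_def xs by (rule image_eqI[of _ _ "to_nat xs"]) auto
    have 2: "y \<in> complex_vector.span (E (max d (Suc (to_nat xs))))"
      by (rule set_mp[OF complex_vector.span_mono d]) (auto simp: E_def)
    show ?case
      using complex_vector.span_add[OF complex_vector.span_scale[OF complex_vector.span_base[OF 1]] 2] by blast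
  qed
  then show ?thesis
    using that[of E] poly_fun_span_monomial by (auto simp: E_def)
qed

section \<open>Ideals of polynomial functions and their zeros\<close>

definition poly_ideal :: "nat \<Rightarrow> ((nat \<Rightarrow> complex) \<Rightarrow> complex) set \<Rightarrow> bool" where
  "poly_ideal n J \<longleftrightarrow> J \<subseteq> poly_fun n \<and> (\<lambda>z. 0) \<in> J \<and> (\<forall>p\<in>J. \<forall>q\<in>J. (\<lambda>z. p z + q z) \<in> J)
     \<and> (\<forall>p\<in>poly_fun n. \<forall>q\<in>J. (\<lambda>z. p z * q z) \<in> J)"

lemma
  assumes "poly_ideal n J"
  shows poly_ideal_zero: "(\<lambda>z. 0) \<in> J"
    and poly_ideal_add: "p \<in> J \<Longrightarrow> q \<in> J \<Longrightarrow> (\<lambda>z. p z + q z) \<in> J"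
    and poly_ideal_mult: "r \<in> poly_fun n \<Longrightarrow> q \<in> J \<Longrightarrow> (\<lambda>z. r z * q z) \<in> J"
    and poly_ideal_sum: "(\<And>i. i \<in> I \<Longrightarrow> f i \<in> J) \<Longrightarrow> (\<lambda>z. \<Sum>i\<in>I. f i z) \<in> J"
    and poly_ideal_const: "(\<lambda>z. c) \<in> J \<Longrightarrow> (\<lambda>z. 1) \<notin> J \<Longrightarrow> c = 0"
proof -
  show 0: "(\<lambda>z. 0) \<in> J" and a: "\<And>p q. p \<in> J \<Longrightarrow> q \<in> J \<Longrightarrow> (\<lambda>z. p z + q z) \<in> J"
    and m: "\<And>r q. r \<in> poly_fun n \<Longrightarrow> q \<in> J \<Longrightarrow> (\<lambda>z. r z * q z) \<in> J"
    using assms unfolding poly_ideal_def by blast+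
  show "(\<And>i. i \<in> I \<Longrightarrow> f i \<in> J) \<Longrightarrow> (\<lambda>z. \<Sum>i\<in>I. f i z) \<in> J"
    by (induction I rule: infinite_finite_induct) (auto simp: 0 a)
  show "(\<lambda>z. c) \<in> J \<Longrightarrow> (\<lambda>z. 1) \<notin> J \<Longrightarrow> c = 0"
    using m[OF poly_fun.poly_const[of "inverse c"], of "\<lambda>z. c"] by (cases "c = 0") auto
qed

text \<open>If every a - c is invertible modulo a proper ideal J, no nonzero univariate polynomial
  in a lies in J: over the complex numbers it has a root r, the factor a - r can be cancelled modulo
  J, and the degree drops until a nonzero constant would lie in J.\<close>

lemma poly_ideal_univariate:
  assumes J: "poly_ideal n J" "(\<lambda>z. 1) \<notin> J" and a: "a \<in> poly_fun n"
    and b: "\<And>c. b c \<in> poly_fun n" "\<And>c. (\<lambda>z. b c z * (a z - c) - 1) \<in> J"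
    and P: "(P :: complex poly) \<noteq> 0" "(\<lambda>z. poly P (a z)) \<in> J"
  shows False
  using P
proof (induction "degree P" arbitrary: P rule: less_induct)
  case less
  have pa: "(\<lambda>z. poly Q (a z)) \<in> poly_fun n" for Q
    by (induction Q) (auto intro!: poly_fun.intros a)
  show False
  proof (cases "degree P = 0")
    case True
    then obtain k where "P = [:k:]" by (rule degree_eq_zeroE)
    with less poly_ideal_const[OF J(1) _ J(2)] show False by simp
  next
    case False
    then obtain r where "poly P r = 0"
      using fundamental_theorem_of_algebra[of P] by (auto simp: constant_degree)
    then have "[:- r, 1:] dvd P" by (simp add: poly_eq_0_iff_dvd)
    then obtain Q where Q: "P = [:- r, 1:] * Q" by (rule dvdE)
    have Q0: "Q \<noteq> 0" using less(2) Q by auto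
    have "degree Q < degree P" unfolding Q using Q0 by (subst degree_mult_eq) auto
    moreover have "(\<lambda>z. poly Q (a z)) \<in> J"
    proof -
      \<comment> \<open>With P = (x - r) Q this combination of two elements of J is exactly
        Q(a).\<close>
      have "(\<lambda>z. b r z * poly P (a z) + (- poly Q (a z)) * (b r z * (a z - r) - 1)) \<in> J"
        using poly_fun.poly_mult[OF poly_fun.poly_const[of "-1"] pa[of Q]]
        by (intro poly_ideal_add[OF J(1)] poly_ideal_mult[OF J(1)] b less(3)) simp
      then show ?thesis unfolding Q by (simp add: algebra_simps)
    qed
    ultimately show False using less(1) Q0 by blast
  qed
qed

text \<open>
  If \<open>a - c\<close> were invertible modulo \<open>J\<close> for all \<open>c\<close>, the uncountably many inverses would be linearly
  dependent, polynomials having countable dimension; clearing denominators gives a polynomial in \<open>a\<close>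
  that lies in \<open>J\<close>.
\<close>

lemma poly_ideal_extend:
  assumes J: "poly_ideal n J" "(\<lambda>z. 1) \<notin> J" and a: "a \<in> poly_fun n"
  shows "\<exists>c. \<forall>b\<in>poly_fun n. (\<lambda>z. b z * (a z - c) - 1) \<notin> J"
proof (rule ccontr)
  assume "\<not> ?thesis"
  then obtain b where b: "\<And>c. b c \<in> poly_fun n" "\<And>c. (\<lambda>z. b c z * (a z - c) - 1) \<in> J" by metis
  \<comment> \<open>A common inverse b of a - c and a - c' would satisfy (c' - c) b \<in> J, hence b
    \<in> J, and then 1 \<in> J.\<close>
  have inj: "inj b"
  proof (rule injI, rule ccontr)
    fix c c' assume eq: "b c = b c'" and ne: "c \<noteq> c'"
    have "(\<lambda>z. (b c z * (a z - c) - 1) + (- 1) * (b c' z * (a z - c') - 1)) \<in> J"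
      by (intro poly_ideal_add[OF J(1)] poly_ideal_mult[OF J(1)] b poly_fun.poly_const)
    then have "(\<lambda>z. (c' - c) * b c z) \<in> J" unfolding eq by (simp add: algebra_simps)
    then have "(\<lambda>z. inverse (c' - c) * ((c' - c) * b c z)) \<in> J"
      by (rule poly_ideal_mult[OF J(1) poly_fun.poly_const])
    then have "(\<lambda>z. b c z) \<in> J" using ne by (simp flip: mult.assoc)
    then have "(\<lambda>z. (a z - c) * b c z + (- 1) * (b c z * (a z - c) - 1)) \<in> J"
      by (intro poly_ideal_add[OF J(1)] poly_ideal_mult[OF J(1)] b poly_fun.poly_const poly_fun_diff a)
    then show False using J(2) by (simp add: algebra_simps)
  qed
  obtain E :: "nat \<Rightarrow> ((nat \<Rightarrow> complex) \<Rightarrow> complex) set" where E: "\<And>d. finite (E d)"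
    "\<And>n p. p \<in> poly_fun n \<Longrightarrow> \<exists>d. p \<in> complex_vector.span (E d)" by (rule poly_fun_filtration) (rule that)
  \<comment> \<open>The uncountably many inverses are distributed over countably many
    finite-dimensional spaces, so one space receives infinitely many.\<close>
  have "\<exists>d. infinite {c. b c \<in> complex_vector.span (E d)}"
  proof (rule ccontr)
    assume "\<not> ?thesis"
    then have "countable (\<Union>d. {c. b c \<in> complex_vector.span (E d)})"
      by (auto intro: countable_finite)
    moreover have "(\<Union>d. {c. b c \<in> complex_vector.span (E d)}) = UNIV" using E(2) b(1) by blast
    ultimately have "countable (UNIV :: complex set)" by simp
    then have "countable (range complex_of_real)" by (rule countable_subset[OF subset_UNIV])
    then have "countable (UNIV :: real set)" by (rule countable_image_inj_on) (simp add: inj_on_def)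
    then show False using uncountable_UNIV_real by blast
  qed
  then obtain d where "infinite {c. b c \<in> complex_vector.span (E d)}" by blast
  \<comment> \<open>One more element than the space has generators; by injectivity of b this many
    inverses are dependent.\<close>
  then obtain C where C: "card C = Suc (card (E d))" "finite C" "C \<subseteq> {c. b c \<in> complex_vector.span (E d)}"
    using infinite_arbitrarily_large by blast
  have "complex_vector.dependent (b ` C)"
  proof (rule ccontr)
    assume "\<not> ?thesis"
    then have "card (b ` C) \<le> card (E d)"
      using complex_vector.independent_span_bound[OF E(1)] C(3) by blast
    then show False using C(1) card_image[OF inj_on_subset[OF inj], of C] by simp
  qed
  then obtain u c0 where u: "c0 \<in> C" "u (b c0) \<noteq> 0" "(\<Sum>v\<in>b ` C. u v *\<^sub>C v) = 0"
    using complex_vector.dependent_finite[of "b ` C"] C(2) by auto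
  have dep: "(\<Sum>c\<in>C. u (b c) * b c z) = 0" for z
  proof -
    have "(\<Sum>v\<in>b ` C. u v * v z) = 0"
      using fun_cong[OF u(3), of z] by (simp add: sum_fun_apply scaleC_fun_def scaleC_complex_def)
    then show ?thesis by (subst (asm) sum.reindex[OF inj_on_subset[OF inj subset_UNIV]]) simp
  qed
  \<comment> \<open>The linear relation among the b c, with b c read as 1 / (x - c) and multiplied
    by all denominators.\<close>
  define P where "P = (\<Sum>c\<in>C. [:u (b c):] * (\<Prod>c'\<in>C - {c}. [:- c', 1:]))"
  have P: "poly P x = (\<Sum>c\<in>C. u (b c) * (\<Prod>c'\<in>C - {c}. x - c'))" for x
    by (simp add: P_def poly_sum poly_prod)
  \<comment> \<open>Every summand other than that of c0 contains the factor x - c0, so P does not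
    vanish at c0.\<close>
  have "poly P c0 = u (b c0) * (\<Prod>c'\<in>C - {c0}. c0 - c')"
    unfolding P by (subst sum.remove[OF C(2) u(1)]) (auto intro!: sum.neutral prod_zero simp: C(2) u(1))
  then have "P \<noteq> 0" using u(2) C(2) by auto
  moreover have "(\<lambda>z. poly P (a z)) \<in> J"
  proof -
    \<comment> \<open>When this element of J is expanded, the terms containing the inverses combine
      to the full product times the relation \<open>dep\<close> and drop out; what remains is
      P(a).\<close>
    have "(\<lambda>z. \<Sum>c\<in>C. (- u (b c) * (\<Prod>c'\<in>C - {c}. a z - c')) * (b c z * (a z - c) - 1)) \<in> J"
      by (intro poly_ideal_sum[OF J(1)] poly_ideal_mult[OF J(1)] b poly_fun.poly_mult poly_fun.poly_const poly_fun_prod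
          poly_fun_diff a)
    moreover have "(\<Sum>c\<in>C. (- u (b c) * (\<Prod>c'\<in>C - {c}. a z - c')) * (b c z * (a z - c) - 1)) = poly P (a z)" for z
    proof -
      have "(\<Sum>c\<in>C. (- u (b c) * (\<Prod>c'\<in>C - {c}. a z - c')) * (b c z * (a z - c) - 1))
        = (\<Sum>c\<in>C. u (b c) * (\<Prod>c'\<in>C - {c}. a z - c') - (\<Prod>c'\<in>C. a z - c') * (u (b c) * b c z))"
      proof (rule sum.cong[OF refl])
        fix c assume c: "c \<in> C"
        have "(- u' * p) * (q * (x - c) - 1) = u' * p - (x - c) * p * (u' * q)" for u' p q x :: complex
          by (simp add: algebra_simps)
        then show "(- u (b c) * (\<Prod>c'\<in>C - {c}. a z - c')) * (b c z * (a z - c) - 1)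
          = u (b c) * (\<Prod>c'\<in>C - {c}. a z - c') - (\<Prod>c'\<in>C. a z - c') * (u (b c) * b c z)"
          by (simp only: prod.remove[OF C(2) c, of "\<lambda>c'. a z - c'"])
      qed
      also have "\<dots> = poly P (a z) - (\<Prod>c'\<in>C. a z - c') * (\<Sum>c\<in>C. u (b c) * b c z)"
        by (simp add: P sum_subtractf sum_distrib_left)
      finally show ?thesis by (simp add: dep)
    qed
    ultimately show ?thesis by simp
  qed
  ultimately show False using poly_ideal_univariate[OF J a b] by blast
qed

text \<open>The ideal is enlarged one coordinate at a time, by \<open>poly_ideal_extend\<close>,
  until it contains z i - c i for all i and is still proper. Modulo such an ideal every polynomial p
  is congruent to the constant p(c), so p \<in> J puts this constant into a proper ideal and forces
  it to be 0.\<close>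

theorem nullstellensatz:
  assumes J: "poly_ideal n J" "(\<lambda>z. 1) \<notin> J"
  obtains c where "\<And>p. p \<in> J \<Longrightarrow> p c = 0"
proof -
  have "m \<le> n \<Longrightarrow> \<exists>c J'. poly_ideal n J' \<and> J \<subseteq> J' \<and> (\<lambda>z. 1) \<notin> J' \<and> (\<forall>i<m. (\<lambda>z. z i - c i) \<in> J')" for m
  proof (induction m)
    case 0
    show ?case using J by blast
  next
    case (Suc m)
    then obtain c J' where *: "poly_ideal n J'" "J \<subseteq> J'" "(\<lambda>z. 1) \<notin> J'" "\<And>i. i < m \<Longrightarrow> (\<lambda>z. z i - c i) \<in> J'"
      by auto
    have m: "(\<lambda>z. z m) \<in> poly_fun n" using Suc by (simp add: poly_fun.poly_coord)
    obtain k where k: "\<forall>b\<in>poly_fun n. (\<lambda>z. b z * (z m - k) - 1) \<notin> J'"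
      using poly_ideal_extend[OF *(1,3) m] by blast
    \<comment> \<open>The ideal generated by J' and z m - k. It is proper because k was chosen so
      that z m - k has no inverse modulo J'.\<close>
    let ?K = "{\<lambda>z. p z + b z * (z m - k) | p b. p \<in> J' \<and> b \<in> poly_fun n}"
    have sub: "J' \<subseteq> ?K"
    proof
      fix p assume "p \<in> J'"
      then show "p \<in> ?K" by (intro CollectI exI[of _ p] exI[of _ "\<lambda>z. 0"]) (simp add: poly_fun.poly_const)
    qed
    have "poly_ideal n ?K" unfolding poly_ideal_def
    proof (intro conjI ballI)
      show "?K \<subseteq> poly_fun n"
      proof
        fix p assume "p \<in> ?K"
        then obtain p' b where "p = (\<lambda>z. p' z + b z * (z m - k))" "p' \<in> J'" "b \<in> poly_fun n" by blast
        moreover have "J' \<subseteq> poly_fun n" using *(1) unfolding poly_ideal_def by (rule conjunct1)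
        ultimately show "p \<in> poly_fun n"
          by (simp only:) (intro poly_fun.poly_add poly_fun.poly_mult poly_fun_diff m poly_fun.poly_const; blast)
      qed
      show "(\<lambda>z. 0) \<in> ?K" using sub poly_ideal_zero[OF *(1)] by blast
    next
      fix p q assume "p \<in> ?K" "q \<in> ?K"
      then obtain p' b q' b' where "p = (\<lambda>z. p' z + b z * (z m - k))" "p' \<in> J'" "b \<in> poly_fun n"
        "q = (\<lambda>z. q' z + b' z * (z m - k))" "q' \<in> J'" "b' \<in> poly_fun n" by blast
      then show "(\<lambda>z. p z + q z) \<in> ?K"
        by (intro CollectI exI[of _ "\<lambda>z. p' z + q' z"] exI[of _ "\<lambda>z. b z + b' z"])
          (auto simp: algebra_simps intro: poly_fun.poly_add poly_ideal_add[OF *(1)])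
    next
      fix p q assume p: "p \<in> poly_fun n" and "q \<in> ?K"
      then obtain q' b' where "q = (\<lambda>z. q' z + b' z * (z m - k))" "q' \<in> J'" "b' \<in> poly_fun n" by blast
      with p show "(\<lambda>z. p z * q z) \<in> ?K"
        by (intro CollectI exI[of _ "\<lambda>z. p z * q' z"] exI[of _ "\<lambda>z. p z * b' z"])
          (auto simp: algebra_simps intro: poly_fun.poly_mult poly_ideal_mult[OF *(1)])
    qed
    moreover have "(\<lambda>z. 1) \<notin> ?K"
    proof
      assume "(\<lambda>z. 1) \<in> ?K"
      then obtain p b where e: "(\<lambda>z. 1) = (\<lambda>z. p z + b z * (z m - k))" "p \<in> J'" "b \<in> poly_fun n" by blast
      \<comment> \<open>A representation of 1 in ?K would exhibit b as an inverse of z m - k modulo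
        J'.\<close>
      have "b z * (z m - k) - 1 = (- 1) * p z" for z
        using fun_cong[OF e(1), of z] by algebra
      then have "(\<lambda>z. b z * (z m - k) - 1) = (\<lambda>z. (- 1) * p z)" by blast
      then show False using k e(3) poly_ideal_mult[OF *(1) poly_fun.poly_const e(2), of "-1"] by metis
    qed
    moreover have "(\<lambda>z. z i - (c(m := k)) i) \<in> ?K" if "i < Suc m" for i
    proof (cases "i = m")
      case True
      then show ?thesis
        by (intro CollectI exI[of _ "\<lambda>z. 0"] exI[of _ "\<lambda>z. 1"]) (simp add: poly_fun.poly_const poly_ideal_zero[OF *(1)])
    next
      case False
      then have "(\<lambda>z. z i - c i) \<in> ?K" using sub *(4)[of i] that by (intro set_mp[OF sub]) auto
      then show ?thesis using False by simp
    qed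
    ultimately show ?case using *(2) sub by (intro exI[of _ "c(m := k)"] exI[of _ ?K]) blast
  qed
  from this[of n] obtain c J' where *: "poly_ideal n J'" "J \<subseteq> J'" "(\<lambda>z. 1) \<notin> J'"
    "\<And>i. i < n \<Longrightarrow> (\<lambda>z. z i - c i) \<in> J'" by auto
  have r: "(\<lambda>z. p z - p c) \<in> J'" if "p \<in> poly_fun n" for p
    using that
  proof (induction rule: poly_fun.induct)
    case (poly_add p q)
    then show ?case using poly_ideal_add[OF *(1) poly_add(3,4)] by (simp add: algebra_simps)
  next
    case (poly_mult p q)
    have "(\<lambda>z. p z * (q z - q c) + q c * (p z - p c)) \<in> J'"
      by (intro poly_ideal_add[OF *(1)] poly_ideal_mult[OF *(1)] poly_fun.poly_const)
        (use poly_mult in simp_all)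
    then show ?case by (simp add: algebra_simps)
  qed (simp_all add: poly_ideal_zero[OF *(1)] *(4))
  show ?thesis
  proof (rule that[of c])
    fix p assume p: "p \<in> J"
    then have "p \<in> poly_fun n" "p \<in> J'" using J(1) *(2) unfolding poly_ideal_def by auto
    then have "(\<lambda>z. p z + (- 1) * (p z - p c)) \<in> J'"
      by (intro poly_ideal_add[OF *(1)] poly_ideal_mult[OF *(1)] r poly_fun.poly_const)
    then show "p c = 0" using poly_ideal_const[OF *(1) _ *(3)] by simp
  qed
qed

section \<open>Regular functions on a product\<close>

text \<open>The part of \<open>affine_open\<close> that describes open sets and regular functions
  through coordinates. The equations of the image are kept apart: they enter only where a zero of an
  ideal has to be turned into a point of the variety.\<close>

definition chart :: "'x fspace \<Rightarrow> 'x set \<Rightarrow> nat \<Rightarrow> ('x \<Rightarrow> nat \<Rightarrow> complex) \<Rightarrow> bool" where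
  "chart X U n x \<longleftrightarrow> U \<in> Opn X \<and>
     (\<forall>V. V \<subseteq> U \<longrightarrow> (V \<in> Opn X \<longleftrightarrow> (\<exists>Q\<subseteq>poly_fun n. V = {a \<in> U. \<exists>q\<in>Q. q (x a) \<noteq> 0})))
     \<and> (\<forall>V\<in>Opn X. V \<subseteq> U \<longrightarrow> Reg X V =
            {f. \<forall>a\<in>V. \<exists>p\<in>poly_fun n. \<exists>q\<in>poly_fun n. q (x a) \<noteq> 0 \<and>
                  (\<forall>b\<in>V. q (x b) \<noteq> 0 \<longrightarrow> f b = p (x b) / q (x b))})"

lemma affine_chart:
  assumes "affine_open X U"
  obtains n x P where "chart X U n x" "P \<subseteq> poly_fun n"
    "bij_betw x U {z \<in> {..<n} \<rightarrow>\<^sub>E UNIV. \<forall>p\<in>P. p z = 0}"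
proof -
  have "\<exists>n x P. chart X U n x \<and> P \<subseteq> poly_fun n \<and> bij_betw x U {z \<in> {..<n} \<rightarrow>\<^sub>E UNIV. \<forall>p\<in>P. p z = 0}"
    using assms unfolding affine_open_def chart_def by (elim conjE exE) (intro exI conjI; assumption)
  then show ?thesis using that by blast
qed

lemma
  assumes "chart X U n x"
  shows chart_open: "U \<in> Opn X"
    and chart_top: "V \<subseteq> U \<Longrightarrow> V \<in> Opn X \<longleftrightarrow> (\<exists>Q\<subseteq>poly_fun n. V = {a \<in> U. \<exists>q\<in>Q. q (x a) \<noteq> 0})"
    and chart_reg: "V \<in> Opn X \<Longrightarrow> V \<subseteq> U \<Longrightarrow> f \<in> Reg X V \<longleftrightarrow>
       (\<forall>a\<in>V. \<exists>p\<in>poly_fun n. \<exists>q\<in>poly_fun n. q (x a) \<noteq> 0 \<and>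
          (\<forall>b\<in>V. q (x b) \<noteq> 0 \<longrightarrow> f b = p (x b) / q (x b)))"
  using assms unfolding chart_def by (elim conjE; simp)+

text \<open>Besides being a common denominator, D is chosen so that D \<noteq> 0 forces a point of
  the chart into W. The condition b \<in> W then disappears when identities are multiplied by D, and
  they hold on the whole chart.\<close>

lemma chart_common_denominator:
  assumes X: "prevariety X" and ch: "chart X U n x"
    and W: "W \<in> Opn X" "x0 \<in> U" "x0 \<in> W" and "finite I" and a: "\<forall>i\<in>I. a i \<in> Reg X W"
  shows "\<exists>D\<in>poly_fun n. \<exists>R. D (x x0) \<noteq> 0 \<and> (\<forall>i\<in>I. R i \<in> poly_fun n) \<and>
     (\<forall>b\<in>U. D (x b) \<noteq> 0 \<longrightarrow> b \<in> W \<and> (\<forall>i\<in>I. a i b = R i (x b) / D (x b)))"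
  using assms(6,7)
proof (induction I rule: finite_induct)
  case empty
  note U = chart_open[OF ch]
  have "W \<inter> U \<in> Opn X" by (rule Opn_Int[OF X W(1) U])
  \<comment> \<open>One of the polynomials describing the open set W \<inter> U is nonzero at x0 and
    vanishes on U outside W; it is the first denominator.\<close>
  then obtain Q where Q: "Q \<subseteq> poly_fun n" "W \<inter> U = {a \<in> U. \<exists>q\<in>Q. q (x a) \<noteq> 0}"
    using chart_top[OF ch, of "W \<inter> U"] by blast
  then obtain q where q: "q \<in> Q" "q (x x0) \<noteq> 0" using W by blast
  have "b \<in> W" if "b \<in> U" "q (x b) \<noteq> 0" for b
    using eqset_imp_iff[OF Q(2), of b] q(1) that by blast
  then show ?case using q Q(1) by (intro bexI[of _ q]) auto
next
  case (insert i I)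
  then obtain D R where DR: "D \<in> poly_fun n" "D (x x0) \<noteq> 0" "\<forall>i\<in>I. R i \<in> poly_fun n"
    "\<forall>b\<in>U. D (x b) \<noteq> 0 \<longrightarrow> b \<in> W \<and> (\<forall>i\<in>I. a i b = R i (x b) / D (x b))" by blast
  have WU: "W \<inter> U \<in> Opn X" by (rule Opn_Int[OF X W(1) chart_open[OF ch]])
  have "a i \<in> Reg X (W \<inter> U)" by (rule Reg_mono[OF X W(1) WU]) (use insert(4) in auto)
  then obtain p q where pq: "p \<in> poly_fun n" "q \<in> poly_fun n" "q (x x0) \<noteq> 0"
    "\<forall>b\<in>W \<inter> U. q (x b) \<noteq> 0 \<longrightarrow> a i b = p (x b) / q (x b)"
    using chart_reg[OF ch WU, of "a i"] W by blast
  show ?case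
  proof (rule bexI[of _ "\<lambda>z. D z * q z"], rule exI[of _ "\<lambda>j z. if j = i then p z * D z else R j z * q z"], intro conjI ballI impI)
    fix j assume "j \<in> insert i I"
    then show "(\<lambda>z. if j = i then p z * D z else R j z * q z) \<in> poly_fun n"
      using pq DR by (cases "j = i") (auto intro: poly_fun.poly_mult)
  next
    fix b j assume b: "b \<in> U" "D (x b) * q (x b) \<noteq> 0"
    then show bW: "b \<in> W" using DR by auto
    assume "j \<in> insert i I"
    then show "a j b = (if j = i then p (x b) * D (x b) else R j (x b) * q (x b)) / (D (x b) * q (x b))"
      using DR pq b bW by auto
  qed (use pq DR in \<open>auto intro: poly_fun.poly_mult\<close>)
qed

text \<open>The denominators g for which gF is polynomial on U \<times> V form an ideal J. It
  contains the equations of U and V, so a common zero of J would be a point of U \<times> V; there F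
  is locally a quotient, which gives an element of J that does not vanish. By the Nullstellensatz 1
  \<in> J, hence F is a polynomial in the joint coordinates, and the slices of one polynomial lie in
  a finite-dimensional space.\<close>

lemma kunneth_affine:
  assumes X: "prevariety X" and Y: "prevariety Y" and U: "affine_open X U" and V: "affine_open Y V"
    and F: "F \<in> Reg (prod_fspace X Y) UNIV"
  shows "\<exists>A. finite A \<and> (\<forall>v\<in>V. (\<lambda>u. if u \<in> U then F (u, v) else 0) \<in> complex_vector.span A)"
proof -
  obtain n x P where U: "chart X U n x" "P \<subseteq> poly_fun n"
    "bij_betw x U {z \<in> {..<n} \<rightarrow>\<^sub>E UNIV. \<forall>p\<in>P. p z = 0}"
    using U by (rule affine_chart) (rule that)
  obtain m y S where V: "chart Y V m y" "S \<subseteq> poly_fun m"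
    "bij_betw y V {z \<in> {..<m} \<rightarrow>\<^sub>E UNIV. \<forall>p\<in>S. p z = 0}"
    using V by (rule affine_chart) (rule that)
  \<comment> \<open>Joint coordinates: the n coordinates of u followed by the m coordinates of v.
    Correspondingly \<open>sh\<close> makes a polynomial read the second block.\<close>
  define c where "c u v = (\<lambda>i. if i < n then x u i else y v (i - n))" for u v
  define sh where "sh p = (\<lambda>z :: nat \<Rightarrow> complex. p (\<lambda>i. z (n + i)) :: complex)" for p
  have shP: "sh p \<in> poly_fun (n + m)" if "p \<in> poly_fun m" for p
    unfolding sh_def by (rule poly_fun_shift[OF that])
  have shc: "sh p (c u v) = p (y v)" for p u v by (simp add: sh_def c_def)
  have mo: "p \<in> poly_fun (n + m)" if "p \<in> poly_fun n" for p by (rule poly_fun_mono[OF that]) simp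
  have moc: "p (c u v) = p (x u)" if "p \<in> poly_fun n" for p u v
    by (rule poly_fun_cong[OF that]) (simp add: c_def)
  define J where "J = {g \<in> poly_fun (n + m). \<exists>h\<in>poly_fun (n + m). \<forall>u\<in>U. \<forall>v\<in>V. g (c u v) * F (u, v) = h (c u v)}"
  have J: "poly_ideal (n + m) J" unfolding poly_ideal_def
  proof (intro conjI ballI)
    show "(\<lambda>z. 0) \<in> J" unfolding J_def by (auto intro!: poly_fun.poly_const bexI[of _ "\<lambda>z. 0"])
  next
    fix p q assume "p \<in> J" "q \<in> J"
    then obtain g h where "p \<in> poly_fun (n + m)" "q \<in> poly_fun (n + m)" "g \<in> poly_fun (n + m)" "h \<in> poly_fun (n + m)"
      "\<forall>u\<in>U. \<forall>v\<in>V. p (c u v) * F (u, v) = g (c u v)" "\<forall>u\<in>U. \<forall>v\<in>V. q (c u v) * F (u, v) = h (c u v)"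
      unfolding J_def by blast
    then show "(\<lambda>z. p z + q z) \<in> J"
      unfolding J_def
      by (intro CollectI conjI poly_fun.poly_add bexI[of _ "\<lambda>z. g z + h z"] ballI) (simp_all add: distrib_right)
  next
    fix p q assume p: "p \<in> poly_fun (n + m)" and "q \<in> J"
    then obtain h where "q \<in> poly_fun (n + m)" "h \<in> poly_fun (n + m)"
      "\<forall>u\<in>U. \<forall>v\<in>V. q (c u v) * F (u, v) = h (c u v)"
      unfolding J_def by blast
    with p show "(\<lambda>z. p z * q z) \<in> J"
      unfolding J_def
      by (intro CollectI conjI poly_fun.poly_mult bexI[of _ "\<lambda>z. p z * h z"] ballI) (simp_all add: mult.assoc)
  qed (auto simp: J_def)
  \<comment> \<open>In particular J contains the equations of both affine pieces.\<close>
  have J0: "g \<in> J" if "g \<in> poly_fun (n + m)" "\<And>u v. u \<in> U \<Longrightarrow> v \<in> V \<Longrightarrow> g (c u v) = 0" for g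
    unfolding J_def using that by (auto intro!: bexI[of _ "\<lambda>z. 0"] poly_fun.poly_const)
  have loc: "\<exists>g\<in>J. g (c u v) \<noteq> 0" if uv: "u \<in> U" "v \<in> V" for u v
  proof -
    obtain U' V' p q where *: "U' \<in> Opn X" "V' \<in> Opn Y" "p \<in> sum_prod X Y U' V'" "q \<in> sum_prod X Y U' V'"
       "(u, v) \<in> U' \<times> V'" "q (u, v) \<noteq> 0" "\<forall>r\<in>UNIV \<inter> U' \<times> V'. q r \<noteq> 0 \<longrightarrow> F r = p r / q r"
      using F[unfolded prod_Reg_iff, THEN bspec, OF UNIV_I, of "(u, v)"] by (elim bexE conjE)
    \<comment> \<open>Near (u, v) a sum of products is a polynomial in the joint coordinates divided
      by a denominator in the first block and one in the second.\<close>
    have rep: "\<exists>D D' p'. D \<in> poly_fun n \<and> D' \<in> poly_fun m \<and> p' \<in> poly_fun (n + m) \<and> D (x u) \<noteq> 0 \<and> D' (y v) \<noteq> 0 \<and>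
      (\<forall>s\<in>U. \<forall>t\<in>V. D (x s) \<noteq> 0 \<longrightarrow> D' (y t) \<noteq> 0 \<longrightarrow> s \<in> U' \<and> t \<in> V' \<and> p (s, t) = p' (c s t) / (D (x s) * D' (y t)))"
      if "p \<in> sum_prod X Y U' V'" for p
    proof -
      obtain N :: nat and a b where p: "\<forall>i\<in>{..<N}. a i \<in> Reg X U'"
        "\<forall>i\<in>{..<N}. b i \<in> Reg Y V'" "p = (\<lambda>(u, v). \<Sum>i<N. a i u * b i v)"
        using \<open>p \<in> sum_prod X Y U' V'\<close> unfolding sum_prod_def by blast
      have "u \<in> U'" "v \<in> V'" using *(5) by auto
      obtain D R where "D \<in> poly_fun n" "D (x u) \<noteq> 0" "\<forall>i\<in>{..<N}. R i \<in> poly_fun n"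
        "\<forall>b\<in>U. D (x b) \<noteq> 0 \<longrightarrow> b \<in> U' \<and> (\<forall>i\<in>{..<N}. a i b = R i (x b) / D (x b))"
        using chart_common_denominator[where a=a and I="{..<N}", OF X U(1) *(1) uv(1) \<open>u \<in> U'\<close> finite_lessThan p(1)]
        by (elim bexE exE conjE) (rule that)
      then have D: "D \<in> poly_fun n" "D (x u) \<noteq> 0" "\<And>i. i < N \<Longrightarrow> R i \<in> poly_fun n"
        "\<And>b. b\<in>U \<Longrightarrow> D (x b) \<noteq> 0 \<Longrightarrow> b \<in> U'"
        "\<And>b i. b\<in>U \<Longrightarrow> D (x b) \<noteq> 0 \<Longrightarrow> i < N \<Longrightarrow> a i b = R i (x b) / D (x b)" by blast+
      obtain D' R' where "D' \<in> poly_fun m" "D' (y v) \<noteq> 0" "\<forall>i\<in>{..<N}. R' i \<in> poly_fun m"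
        "\<forall>t\<in>V. D' (y t) \<noteq> 0 \<longrightarrow> t \<in> V' \<and> (\<forall>i\<in>{..<N}. b i t = R' i (y t) / D' (y t))"
        using chart_common_denominator[where a=b and I="{..<N}", OF Y V(1) *(2) uv(2) \<open>v \<in> V'\<close> finite_lessThan p(2)]
        by (elim bexE exE conjE) (rule that)
      then have D': "D' \<in> poly_fun m" "D' (y v) \<noteq> 0" "\<And>i. i < N \<Longrightarrow> R' i \<in> poly_fun m"
        "\<And>t. t\<in>V \<Longrightarrow> D' (y t) \<noteq> 0 \<Longrightarrow> t \<in> V'"
        "\<And>t i. t\<in>V \<Longrightarrow> D' (y t) \<noteq> 0 \<Longrightarrow> i < N \<Longrightarrow> b i t = R' i (y t) / D' (y t)" by blast+
      have s: "(\<lambda>z. \<Sum>i<N. R i z * sh (R' i) z) \<in> poly_fun (n + m)"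
      proof -
        have "M \<le> N \<Longrightarrow> (\<lambda>z. \<Sum>i<M. R i z * sh (R' i) z) \<in> poly_fun (n + m)" for M
          by (induction M) (simp_all add: poly_fun.poly_add poly_fun.poly_mult poly_fun.poly_const mo shP D(3) D'(3))
        then show ?thesis by simp
      qed
      show ?thesis
      proof (rule exI[of _ D], rule exI[of _ D'], rule exI[of _ "\<lambda>z. \<Sum>i<N. R i z * sh (R' i) z"], intro conjI ballI impI)
        fix s t assume st: "s \<in> U" "t \<in> V" "D (x s) \<noteq> 0" "D' (y t) \<noteq> 0"
        show "s \<in> U'" "t \<in> V'" using D(4)[OF st(1,3)] D'(4)[OF st(2,4)] by auto
        have "p (s, t) = (\<Sum>i<N. (R i (x s) / D (x s)) * (R' i (y t) / D' (y t)))"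
          unfolding p(3) split by (rule sum.cong[OF refl]) (simp add: D(5)[OF st(1,3)] D'(5)[OF st(2,4)])
        also have "\<dots> = (\<Sum>i<N. R i (c s t) * sh (R' i) (c s t)) / (D (x s) * D' (y t))"
          using D(3) by (simp add: sum_divide_distrib moc shc)
        finally show "p (s, t) = (\<Sum>i<N. R i (c s t) * sh (R' i) (c s t)) / (D (x s) * D' (y t))" .
      qed (use D(1,2) D'(1,2) s in auto)
    qed
    obtain D D' p' where p: "D \<in> poly_fun n" "D' \<in> poly_fun m" "p' \<in> poly_fun (n + m)" "D (x u) \<noteq> 0" "D' (y v) \<noteq> 0"
      "\<And>s t. s\<in>U \<Longrightarrow> t\<in>V \<Longrightarrow> D (x s) \<noteq> 0 \<Longrightarrow> D' (y t) \<noteq> 0 \<Longrightarrow> s \<in> U' \<and> t \<in> V' \<and> p (s, t) = p' (c s t) / (D (x s) * D' (y t))"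
      using rep[OF *(3)] by blast
    obtain E E' q' where q: "E \<in> poly_fun n" "E' \<in> poly_fun m" "q' \<in> poly_fun (n + m)" "E (x u) \<noteq> 0" "E' (y v) \<noteq> 0"
      "\<And>s t. s\<in>U \<Longrightarrow> t\<in>V \<Longrightarrow> E (x s) \<noteq> 0 \<Longrightarrow> E' (y t) \<noteq> 0 \<Longrightarrow> s \<in> U' \<and> t \<in> V' \<and> q (s, t) = q' (c s t) / (E (x s) * E' (y t))"
      using rep[OF *(4)] by blast
    \<comment> \<open>Clearing denominators in F = p / q gives the first three factors on each side.
      The common factor in parentheses makes ?g F = ?h hold also where some denominator vanishes,
      because both sides are 0 there.\<close>
    let ?g = "\<lambda>z. D z * sh D' z * q' z * (D z * sh D' z * q' z * E z * sh E' z)"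
    let ?h = "\<lambda>z. E z * sh E' z * p' z * (D z * sh D' z * q' z * E z * sh E' z)"
    have "?g (c s t) * F (s, t) = ?h (c s t)" if st: "s \<in> U" "t \<in> V" for s t
    proof (cases "D (x s) * D' (y t) * q' (c s t) * E (x s) * E' (y t) = 0")
      case True
      then show ?thesis by (simp add: moc[OF p(1)] moc[OF q(1)] shc) (auto simp: algebra_simps)
    next
      case False
      then have nz: "D (x s) \<noteq> 0" "D' (y t) \<noteq> 0" "q' (c s t) \<noteq> 0" "E (x s) \<noteq> 0" "E' (y t) \<noteq> 0" by auto
      have "F (s, t) = p (s, t) / q (s, t)" using *(7) p(6)[OF st nz(1,2)] q(6)[OF st nz(4,5)] nz by simp
      then have "F (s, t) = p' (c s t) * (E (x s) * E' (y t)) / (q' (c s t) * (D (x s) * D' (y t)))"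
        using p(6)[OF st nz(1,2)] q(6)[OF st nz(4,5)] by simp
      then show ?thesis using nz by (simp add: moc[OF p(1)] moc[OF q(1)] shc)
    qed
    moreover have "?g \<in> poly_fun (n + m)" "?h \<in> poly_fun (n + m)"
      by (intro poly_fun.poly_mult mo[OF p(1)] mo[OF q(1)] shP[OF p(2)] shP[OF q(2)] p(3) q(3))+
    ultimately have "?g \<in> J" unfolding J_def
      by (intro CollectI conjI bexI[of _ ?h] ballI)
    moreover have "?g (c u v) \<noteq> 0"
    proof -
      have "q' (c u v) \<noteq> 0" using *(6) conjunct2[OF conjunct2[OF q(6)[OF uv q(4,5)]]] by auto
      then show ?thesis using p(4,5) q(4,5) by (simp add: moc[OF p(1)] moc[OF q(1)] shc)
    qed
    ultimately show ?thesis by - (rule bexI; assumption)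
  qed
  have "(\<lambda>z. 1) \<in> J"
  proof (rule ccontr)
    assume "(\<lambda>z. 1) \<notin> J"
    then obtain z where z: "\<And>p. p \<in> J \<Longrightarrow> p z = 0" by (rule nullstellensatz[OF J]) (rule that)
    \<comment> \<open>A common zero of J is split into its two coordinate blocks. Each block
      satisfies the equations of its affine piece and thus comes from a point u or v.\<close>
    let ?z1 = "restrict z {..<n}" and ?z2 = "restrict (\<lambda>i. z (n + i)) {..<m}"
    have "p ?z1 = 0" if "p \<in> P" for p
    proof -
      have "p \<in> J"
      proof (rule J0)
        have pn: "p \<in> poly_fun n" using that U(2) by blast
        then show "p \<in> poly_fun (n + m)" by (rule mo)
        show "p (c u v) = 0" if "u \<in> U" for u v
          using bij_betwE[OF U(3)] that \<open>p \<in> P\<close> unfolding moc[OF pn] by blast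
      qed
      then have "p z = 0" by (rule z)
      moreover have "p ?z1 = p z" by (rule poly_fun_cong[of p n]) (use that U(2) in auto)
      ultimately show ?thesis by simp
    qed
    then have "?z1 \<in> {z \<in> {..<n} \<rightarrow>\<^sub>E UNIV. \<forall>p\<in>P. p z = 0}" by auto
    then obtain u where u: "u \<in> U" "?z1 = x u" using U(3) unfolding bij_betw_def by blast
    have "p ?z2 = 0" if "p \<in> S" for p
    proof -
      have "sh p \<in> J"
      proof (rule J0)
        have pn: "p \<in> poly_fun m" using that V(2) by blast
        then show "sh p \<in> poly_fun (n + m)" by (rule shP)
        show "sh p (c u v) = 0" if "v \<in> V" for u v
          using bij_betwE[OF V(3)] that \<open>p \<in> S\<close> unfolding shc by blast
      qed
      then have "sh p z = 0" by (rule z)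
      moreover have "p ?z2 = sh p z" unfolding sh_def by (rule poly_fun_cong[of p m]) (use that V(2) in auto)
      ultimately show ?thesis by simp
    qed
    then have "?z2 \<in> {z \<in> {..<m} \<rightarrow>\<^sub>E UNIV. \<forall>p\<in>S. p z = 0}" by auto
    then obtain v where v: "v \<in> V" "?z2 = y v" using V(3) unfolding bij_betw_def by blast
    obtain g where g: "g \<in> J" "g (c u v) \<noteq> 0" using loc[OF u(1) v(1)] by blast
    have "g (c u v) = g z"
    proof (rule poly_fun_cong[of g "n + m"])
      show "g \<in> poly_fun (n + m)" using g(1) by (simp add: J_def)
      fix i assume "i < n + m"
      then show "c u v i = z i"
        unfolding c_def u(2)[symmetric] v(2)[symmetric] by auto
    qed
    then show False using z g by simp
  qed
  then obtain h where h: "h \<in> poly_fun (n + m)" "\<And>u v. u \<in> U \<Longrightarrow> v \<in> V \<Longrightarrow> F (u, v) = h (c u v)"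
    unfolding J_def by auto
  \<comment> \<open>For a coordinate of v the slices are multiples of one function; sums and
    products of polynomials use the union and the pairwise products of the spanning sets.\<close>
  have "\<exists>A. finite A \<and> (\<forall>v. (\<lambda>u. if u \<in> U then h (c u v) else 0) \<in> complex_vector.span A)"
    using h(1)
  proof (induction rule: poly_fun.induct)
    case (poly_const k)
    show ?case by (rule exI[of _ "{\<lambda>u. if u \<in> U then k else 0}"]) (auto intro: complex_vector.span_base)
  next
    case (poly_coord i)
    show ?case
    proof (cases "i < n")
      case True
      then have "(\<lambda>u. if u \<in> U then c u v i else 0) = (\<lambda>u. if u \<in> U then x u i else 0)" for v
        by (simp add: c_def cong: if_cong)
      then show ?thesis
        by (intro exI[of _ "{\<lambda>u. if u \<in> U then x u i else 0}"]) (auto intro: complex_vector.span_base)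
    next
      case False
      then have "(\<lambda>u. if u \<in> U then c u v i else 0) = y v (i - n) *\<^sub>C (\<lambda>u. if u \<in> U then 1 else 0)" for v
        by (simp add: c_def scaleC_fun_def scaleC_complex_def fun_eq_iff)
      then show ?thesis
        by (intro exI[of _ "{\<lambda>u. if u \<in> U then 1 else 0}"])
          (auto intro!: complex_vector.span_scale intro: complex_vector.span_base)
    qed
  next
    case (poly_add p q)
    then obtain A B where A: "finite A" "\<And>v. (\<lambda>u. if u \<in> U then p (c u v) else 0) \<in> complex_vector.span A"
      and B: "finite B" "\<And>v. (\<lambda>u. if u \<in> U then q (c u v) else 0) \<in> complex_vector.span B" by blast
    have "(\<lambda>u. if u \<in> U then p (c u v) + q (c u v) else 0) \<in> complex_vector.span (A \<union> B)" for v
    proof -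
      have "(\<lambda>u. if u \<in> U then p (c u v) else 0) + (\<lambda>u. if u \<in> U then q (c u v) else 0) \<in> complex_vector.span (A \<union> B)"
        using A(2) B(2) complex_vector.span_mono[of A "A \<union> B"] complex_vector.span_mono[of B "A \<union> B"]
        by (intro complex_vector.span_add) blast+
      moreover have "(\<lambda>u. if u \<in> U then p (c u v) else 0) + (\<lambda>u. if u \<in> U then q (c u v) else 0)
        = (\<lambda>u. if u \<in> U then p (c u v) + q (c u v) else 0)" by (auto simp: fun_eq_iff)
      ultimately show ?thesis by simp
    qed
    then show ?case using A(1) B(1) by (intro exI[of _ "A \<union> B"]) auto
  next
    case (poly_mult p q)
    then obtain A B where A: "finite A" "\<And>v. (\<lambda>u. if u \<in> U then p (c u v) else 0) \<in> complex_vector.span A"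
      and B: "finite B" "\<And>v. (\<lambda>u. if u \<in> U then q (c u v) else 0) \<in> complex_vector.span B" by blast
    have e: "(\<lambda>u. if u \<in> U then p (c u v) * q (c u v) else 0) =
        (\<lambda>u. (if u \<in> U then p (c u v) else 0) * (if u \<in> U then q (c u v) else 0))" for v by auto
    show ?case unfolding e
      using span_times[OF A(2) B(2)] finite_image_set2[of "\<lambda>f. f \<in> A" "\<lambda>g. g \<in> B" "\<lambda>f g x. f x * g x"] A(1) B(1)
      by (intro exI[of _ "{\<lambda>x. f x * g x | f g. f \<in> A \<and> g \<in> B}"]) simp
  qed
  then obtain A where "finite A" "\<And>v. (\<lambda>u. if u \<in> U then h (c u v) else 0) \<in> complex_vector.span A" by blast
  moreover have "(\<lambda>u. if u \<in> U then F (u, v) else 0) = (\<lambda>u. if u \<in> U then h (c u v) else 0)" if "v \<in> V" for v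
    using h(2) that by auto
  ultimately show ?thesis by auto
qed

text \<open>The dual functionals are combinations of point evaluations. This form matters later:
  evaluating a slice of F at a point gives a function that is regular in the other variable.\<close>

lemma dual_points:
  fixes B :: "('x \<Rightarrow> complex) set"
  assumes "finite B" "complex_vector.independent B"
  shows "\<exists>\<phi>. \<forall>b\<in>B. \<phi> b \<in> complex_vector.span (range (\<lambda>x f. f x)) \<and> (\<forall>b'\<in>B. \<phi> b b' = (if b = b' then 1 else 0))"
  using assms
proof (induction B rule: finite_induct)
  case (insert b0 B)
  let ?E = "complex_vector.span (range (\<lambda>x (f::'x \<Rightarrow> complex). f x))"
  have ind: "complex_vector.independent B" "b0 \<notin> complex_vector.span B"
    using insert(2,4) complex_vector.independent_insert[of b0 B] by auto
  then obtain \<phi> where \<phi>: "\<And>b. b \<in> B \<Longrightarrow> \<phi> b \<in> ?E"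
    "\<And>b b'. b \<in> B \<Longrightarrow> b' \<in> B \<Longrightarrow> \<phi> b b' = (if b = b' then 1 else 0)" using insert.IH by metis
  \<comment> \<open>The part of b0 not captured by the functionals for B. It is nonzero by
    independence, so some point x0 detects it.\<close>
  define r where "r = b0 - (\<Sum>b\<in>B. \<phi> b b0 *\<^sub>C b)"
  have "(\<Sum>b\<in>B. \<phi> b b0 *\<^sub>C b) \<in> complex_vector.span B"
    by (intro complex_vector.span_sum complex_vector.span_scale complex_vector.span_base)
  then have "r \<noteq> 0" using ind(2) unfolding r_def by auto
  then obtain x0 where x0: "r x0 \<noteq> 0" by (auto simp: fun_eq_iff)
  \<comment> \<open>Evaluation at x0, corrected so as to vanish on B and normalised to be 1 at
    b0.\<close>
  define \<psi> where "\<psi> = inverse (r x0) *\<^sub>C ((\<lambda>f. f x0) - (\<Sum>b\<in>B. b x0 *\<^sub>C \<phi> b))"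
  have \<psi>: "\<psi> \<in> ?E" unfolding \<psi>_def
    by (intro complex_vector.span_scale complex_vector.span_diff complex_vector.span_sum \<phi>(1)
        complex_vector.span_base) auto
  have \<psi>_eq: "\<psi> f = inverse (r x0) * (f x0 - (\<Sum>b\<in>B. b x0 * \<phi> b f))" for f
    by (simp add: \<psi>_def scaleC_fun_def scaleC_complex_def sum_fun_apply)
  have \<psi>B: "\<psi> b = 0" if "b \<in> B" for b
  proof -
    have "(\<Sum>b'\<in>B. b' x0 * \<phi> b' b) = (\<Sum>b'\<in>B. if b' = b then b x0 else 0)"
      by (rule sum.cong[OF refl]) (simp add: \<phi>(2) that)
    then show ?thesis using that insert(1) by (simp add: \<psi>_eq)
  qed
  have \<psi>0: "\<psi> b0 = 1"
  proof -
    have "b0 x0 - (\<Sum>b\<in>B. b x0 * \<phi> b b0) = r x0"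
      by (simp add: r_def scaleC_fun_def scaleC_complex_def sum_fun_apply mult.commute)
    then show ?thesis using x0 by (simp add: \<psi>_eq)
  qed
  show ?case
  proof (rule exI[of _ "\<lambda>b. if b = b0 then \<psi> else \<phi> b - \<phi> b b0 *\<^sub>C \<psi>"], intro ballI conjI)
    fix b assume b: "b \<in> insert b0 B"
    then show "(if b = b0 then \<psi> else \<phi> b - \<phi> b b0 *\<^sub>C \<psi>) \<in> ?E"
      using \<psi> \<phi>(1) by (auto intro!: complex_vector.span_diff complex_vector.span_scale)
    fix b' assume "b' \<in> insert b0 B"
    with b show "(if b = b0 then \<psi> else \<phi> b - \<phi> b b0 *\<^sub>C \<psi>) b' = (if b = b' then 1 else 0)"
      using insert(2) by (auto simp: \<psi>0 \<psi>B \<phi>(2) scaleC_fun_def scaleC_complex_def)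
  qed
qed simp

text \<open>The slices of F span a finite-dimensional space. In a basis B consisting of slices, the
  coefficient of the slice at v is a combination of values F(u, v) at fixed points u, by
  \<open>dual_points\<close>, and is therefore regular in v. Both factors of each term are thus
  globally regular and no local decompositions have to be matched.\<close>

theorem kunneth:
  assumes X: "prevariety X" and Y: "prevariety Y" and F: "F \<in> Reg (prod_fspace X Y) UNIV"
  shows "F \<in> sum_prod X Y UNIV UNIV"
proof -
  have op: "UNIV \<in> Opn X" "UNIV \<in> Opn Y" using X Y by (simp_all add: prevariety_def)
  have opp: "UNIV \<in> Opn (prod_fspace X Y)"
    unfolding prod_Opn_iff sum_prod_def
    by (intro ballI bexI[of _ UNIV] op exI[of _ 1] bexI[of _ "\<lambda>_. 1"] CollectI exI[of _ "\<lambda>_ _. 1"])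
      (auto simp: Reg_const[OF X op(1)] Reg_const[OF Y op(2)])
  define G where "G v = (\<lambda>u. F (u, v))" for v
  have G1: "G v \<in> Reg X UNIV" for v
    using prod_Reg_left[OF X Y opp F, of v] by (simp add: G_def)
  have G2: "(\<lambda>v. G v u) \<in> Reg Y UNIV" for u
    using prod_Reg_right[OF X Y opp F, of u] by (simp add: G_def)
  obtain \<U> where \<U>: "finite \<U>" "\<Union>\<U> = UNIV" "\<forall>U\<in>\<U>. affine_open X U"
    using X unfolding prevariety_def by (elim conjE exE)
  obtain \<V> where \<V>: "finite \<V>" "\<Union>\<V> = UNIV" "\<forall>U\<in>\<V>. affine_open Y U"
    using Y unfolding prevariety_def by (elim conjE exE)
  have "\<forall>U V. \<exists>A. U \<in> \<U> \<longrightarrow> V \<in> \<V> \<longrightarrow> finite A \<and> (\<forall>v\<in>V. (\<lambda>u. if u \<in> U then G v u else 0) \<in> complex_vector.span A)"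
  proof (intro allI)
    fix U V
    show "\<exists>A. U \<in> \<U> \<longrightarrow> V \<in> \<V> \<longrightarrow> finite A \<and> (\<forall>v\<in>V. (\<lambda>u. if u \<in> U then G v u else 0) \<in> complex_vector.span A)"
    proof (cases "U \<in> \<U> \<and> V \<in> \<V>")
      case True
      then have "affine_open X U" "affine_open Y V" using \<U>(3) \<V>(3) by auto
      from kunneth_affine[OF X Y this F] show ?thesis unfolding G_def by (rule ex_forward) simp
    qed auto
  qed
  then obtain A where A: "\<And>U V. U \<in> \<U> \<Longrightarrow> V \<in> \<V> \<Longrightarrow> finite (A U V)"
    "\<And>U V v. U \<in> \<U> \<Longrightarrow> V \<in> \<V> \<Longrightarrow> v \<in> V \<Longrightarrow> (\<lambda>u. if u \<in> U then G v u else 0) \<in> complex_vector.span (A U V)"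
    by metis
  \<comment> \<open>Choosing one chart for every point partitions X. Cutting along this partition
    destroys regularity, but it preserves linear relations, which is all that the bound on the
    dimension uses; a slice is the sum of its cut pieces.\<close>
  have "\<forall>u. \<exists>U. U \<in> \<U> \<and> u \<in> U" using \<U>(2) by blast
  then obtain pick where pick: "\<And>u. pick u \<in> \<U>" "\<And>u. u \<in> pick u" by metis
  let ?cut = "\<lambda>U f u. if pick u = U then f u else (0::complex)"
  define A' where "A' = (\<Union>U\<in>\<U>. \<Union>V\<in>\<V>. ?cut U ` A U V)"
  have finA': "finite A'" unfolding A'_def using A(1) \<U>(1) \<V>(1) by auto
  have cut: "?cut U f \<in> complex_vector.span (?cut U ` S)" if "f \<in> complex_vector.span S" for U f S
    using that
  proof (induction rule: span_induct_strong)
    case zero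
    have "?cut U 0 = 0" by auto
    then show ?case by (simp add: complex_vector.span_zero)
  next
    case (add c f g)
    have "?cut U (c *\<^sub>C f + g) = c *\<^sub>C ?cut U f + ?cut U g"
      by (auto simp: fun_eq_iff scaleC_fun_def scaleC_complex_def)
    moreover have "?cut U f \<in> complex_vector.span (?cut U ` S)"
      using add(1) by (intro complex_vector.span_base imageI)
    ultimately show ?case using add(3)
      by (simp only:) (intro complex_vector.span_add complex_vector.span_scale)
  qed
  have GA: "G v \<in> complex_vector.span A'" for v
  proof -
    obtain V where V: "V \<in> \<V>" "v \<in> V" using \<V>(2) by blast
    have "?cut U (\<lambda>u. if u \<in> U then G v u else 0) \<in> complex_vector.span A'" if "U \<in> \<U>" for U
    proof -
      have "?cut U ` A U V \<subseteq> A'" unfolding A'_def using that V by blast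
      then show ?thesis using cut[OF A(2)[OF that V], of U] complex_vector.span_mono by blast
    qed
    then have "(\<Sum>U\<in>\<U>. ?cut U (\<lambda>u. if u \<in> U then G v u else 0)) \<in> complex_vector.span A'"
      by (rule complex_vector.span_sum)
    moreover have "(\<Sum>U\<in>\<U>. ?cut U (\<lambda>u. if u \<in> U then G v u else 0)) = G v"
    proof
      fix u
      have "(\<Sum>U\<in>\<U>. ?cut U (\<lambda>u. if u \<in> U then G v u else 0)) u = (\<Sum>U\<in>\<U>. if pick u = U then G v u else 0)"
        unfolding sum_fun_apply by (rule sum.cong[OF refl]) (use pick(2) in auto)
      then show "(\<Sum>U\<in>\<U>. ?cut U (\<lambda>u. if u \<in> U then G v u else 0)) u = G v u"
        using \<U>(1) pick(1) by simp
    qed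
    ultimately show ?thesis by simp
  qed
  obtain B where B: "B \<subseteq> range G" "complex_vector.independent B" "range G \<subseteq> complex_vector.span B"
    by (rule complex_vector.basis_exists[of "range G"]) (rule that)
  have fB: "finite B"
    using complex_vector.independent_span_bound[OF finA' B(2)] B(1) GA by blast
  obtain \<phi> where \<phi>: "\<And>b. b \<in> B \<Longrightarrow> \<phi> b \<in> complex_vector.span (range (\<lambda>x f. f x))"
    "\<And>b b'. b \<in> B \<Longrightarrow> b' \<in> B \<Longrightarrow> \<phi> b b' = (if b = b' then 1 else 0)"
    using dual_points[OF fB B(2)] by metis
  \<comment> \<open>Linear combinations of point evaluations applied to the slices vary regularly
    with v, since a single evaluation gives v \<mapsto> F(u, v).\<close>
  have lin: "lin_on UNIV UNIV \<psi> \<and> (\<lambda>v. \<psi> (G v)) \<in> Reg Y UNIV"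
    if "\<psi> \<in> complex_vector.span (range (\<lambda>x f. f x))" for \<psi>
    using that
  proof (induction rule: span_induct_strong)
    case zero
    show ?case by (auto simp: lin_on_def Reg_const[OF Y op(2)])
  next
    case (add c e \<psi>)
    obtain u where e: "e = (\<lambda>f. f u)" using add(1) by blast
    have "(\<lambda>v. c * G v u + \<psi> (G v)) \<in> Reg Y UNIV"
      using add(3) by (intro Reg_add[OF Y op(2)] Reg_mult[OF Y op(2)] Reg_const[OF Y op(2)] G2) blast
    then show ?case using add(3)
      by (auto simp: lin_on_def e scaleC_fun_def scaleC_complex_def algebra_simps)
  qed
  have Geq: "G v = (\<Sum>b\<in>B. \<phi> b (G v) *\<^sub>C b)" for v
  proof -
    obtain w where w: "G v = (\<Sum>b\<in>B. w b *\<^sub>C b)"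
      using B(3) complex_vector.span_finite[OF fB] by blast
    have "\<phi> b (G v) = w b" if "b \<in> B" for b
    proof -
      have "\<phi> b (G v) = (\<Sum>b'\<in>B. w b' *\<^sub>C \<phi> b b')"
        unfolding w using lin[OF \<phi>(1)[OF that]] by (intro lin_on_sum[of UNIV UNIV "\<phi> b"]) auto
      also have "\<dots> = (\<Sum>b'\<in>B. if b = b' then w b' else 0)"
        by (rule sum.cong[OF refl]) (simp add: \<phi>(2) that scaleC_complex_def)
      finally show ?thesis using that fB by simp
    qed
    then show ?thesis using w by simp
  qed
  have "F (u, v) = (\<Sum>b\<in>B. b u * \<phi> b (G v))" for u v
  proof -
    have "F (u, v) = G v u" by (simp add: G_def)
    also have "\<dots> = (\<Sum>b\<in>B. \<phi> b (G v) *\<^sub>C b) u" by (rule fun_cong[OF Geq])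
    also have "\<dots> = (\<Sum>b\<in>B. b u * \<phi> b (G v))"
      by (simp add: sum_fun_apply scaleC_fun_def scaleC_complex_def mult.commute)
    finally show ?thesis .
  qed
  then have "F = (\<lambda>(u, v). \<Sum>b\<in>B. b u * \<phi> b (G v))" by auto
  moreover have "(\<lambda>(u, v). \<Sum>b\<in>B. b u * \<phi> b (G v)) \<in> sum_prod X Y UNIV UNIV"
    by (rule sum_prodI[OF fB]) (use lin \<phi>(1) B(1) G1 in auto)
  ultimately show ?thesis by simp
qed

text \<open>The comultiplication of R(K), although K need not be affine.\<close>

lemma regfun_mult_expand:
  fixes c :: "'k::complex_algebraic_group \<Rightarrow> complex"
  assumes "c \<in> regfun"
  obtains n :: nat and a b where "\<And>i. i < n \<Longrightarrow> a i \<in> regfun" "\<And>i. i < n \<Longrightarrow> b i \<in> regfun"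
    "\<And>g h. c (g * h) = (\<Sum>i<n. a i g * b i h)"
proof -
  have "c \<circ> (\<lambda>(x, y). x * y) \<in> Reg (prod_fspace variety variety) UNIV"
    using mult_morphism[where 'a='k] assms UNIV_Opn[where 'k='k] unfolding morphism_def regfun_def by fastforce
  then have "c \<circ> (\<lambda>(x, y). x * y) \<in> sum_prod variety variety UNIV UNIV" by (rule kunneth[OF variety variety])
  then obtain n :: nat and a b where "\<And>i. i < n \<Longrightarrow> a i \<in> regfun" "\<And>i. i < n \<Longrightarrow> b i \<in> regfun"
    and e: "c \<circ> (\<lambda>(x, y). x * y) = (\<lambda>(u, v). \<Sum>i<n. a i u * b i v)"
    unfolding sum_prod_def regfun_def by blast
  moreover have "c (g * h) = (\<Sum>i<n. a i g * b i h)" for g h using fun_cong[OF e, of "(g, h)"] by simp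
  ultimately show ?thesis using that by blast
qed

text \<open>Right translation acts on a vector-valued regular function through the second factors of
  the comultiplication, so its orbit map is regular with values in a space of functions.\<close>

lemma regfun_in_translate:
  assumes "F \<in> regfun_in S"
  shows "(\<lambda>g k. F (k * g)) \<in> regfun_in UNIV"
  using assms
proof (induction rule: regfun_in_induct)
  case zero
  show ?case using regfun_in_const[of "\<lambda>k. 0" UNIV] by simp
next
  case (add c w G)
  obtain n :: nat and a b where ab: "\<And>i. i < n \<Longrightarrow> b i \<in> regfun"
    "\<And>g h. c (g * h) = (\<Sum>i<n. a i g * b i h)" by (rule regfun_mult_expand[OF add(1)]) (rule that)
  have "(\<lambda>g. \<Sum>i<n. b i g *\<^sub>C (\<lambda>k. a i k *\<^sub>C w)) \<in> regfun_in UNIV"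
    by (rule regfun_inI) (use ab in auto)
  moreover have "(\<lambda>k. c (k * g) *\<^sub>C w) = (\<Sum>i<n. b i g *\<^sub>C (\<lambda>k. a i k *\<^sub>C w))" for g
    by (simp add: fun_eq_iff sum_fun_apply scaleC_fun_def ab(2) scaleC_sum_left scaleC_scaleC mult.commute)
  ultimately have "(\<lambda>g k. c (k * g) *\<^sub>C w) \<in> regfun_in UNIV" by simp
  from regfun_in_add[OF this add(4)] show ?case by (simp add: plus_fun_def)
qed

section \<open>The Lie algebra is finite-dimensional\<close>

lemma near_one_nonzero:
  assumes "f \<in> near_one" "f 1 \<noteq> 0"
  obtains W where "W \<in> Opn variety" "1 \<in> W" "\<And>k. k \<in> W \<Longrightarrow> f k \<noteq> 0"
proof -
  obtain U where U: "U \<in> Opn variety" "1 \<in> U" "f \<in> Reg variety U"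
    using assms unfolding near_one_def by blast
  show ?thesis by (rule that[OF Opn_nonzero[OF variety U(1,3)]]) (use U assms in auto)
qed

lemma near_one_scale_right: "f \<in> near_one \<Longrightarrow> (\<lambda>k. f k * c) \<in> near_one"
  by (rule near_one_mult[OF _ near_one_const])

lemma lie_scale_right: "f \<in> near_one \<Longrightarrow> apply_lie X (\<lambda>k. f k * c) = apply_lie X f * c"
  using lie_scale[of f X c] by (simp add: mult.commute)

lemma near_one_divide:
  "f \<in> near_one \<Longrightarrow> g \<in> near_one \<Longrightarrow> g 1 \<noteq> 0 \<Longrightarrow> (\<lambda>k. f k / g k) \<in> near_one"
  unfolding divide_inverse by (rule near_one_mult[OF _ near_one_inverse])

lemma near_one_morphism:
  assumes "morphism variety variety h" "U \<in> Opn variety" "f \<in> Reg variety U" "h 1 \<in> U"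
  shows "(\<lambda>k. f (h k)) \<in> near_one"
proof -
  have "h -` U \<in> Opn variety" "f \<circ> h \<in> Reg variety (h -` U)"
    using assms unfolding morphism_def by blast+
  then show ?thesis using assms(4) by (intro near_oneI[of "h -` U"]) (simp_all add: o_def)
qed

lemma near_one_pullback:
  assumes "morphism variety variety h" "h 1 = 1" "f \<in> near_one"
  shows "(\<lambda>k. f (h k)) \<in> near_one"
  using assms near_one_morphism[OF assms(1)] unfolding near_one_def by auto

text \<open>In an affine chart around 1 every germ is a quotient of polynomials in the coordinates.
  By the Leibniz and quotient rules a tangent vector is determined by its values on the
  coordinates.\<close>

lemma lie_coordinates:
  obtains n :: nat and x where "\<And>i. i < n \<Longrightarrow> x i \<in> near_one"
    "\<And>X :: 'k::complex_algebraic_group lie. \<forall>i<n. apply_lie X (x i) = 0 \<Longrightarrow> X = 0"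
proof -
  let ?V = "variety :: 'k fspace"
  obtain W where W: "affine_open ?V W" "1 \<in> W" by (rule affine_nbhd[OF variety])
  obtain n y P where ch: "chart ?V W n y" using W(1) by (rule affine_chart) (rule that)
  note Wo = chart_open[OF ch]
  have preg: "(\<lambda>a. p (y a)) \<in> Reg ?V W" if "p \<in> poly_fun n" for p
    unfolding chart_reg[OF ch Wo order_refl]
    by (intro ballI bexI[of _ p] bexI[of _ "\<lambda>z. 1"]) (use that in \<open>auto intro: poly_fun.poly_const\<close>)
  then have pn: "(\<lambda>a. p (y a)) \<in> near_one" if "p \<in> poly_fun n" for p
    using near_oneI[OF Wo W(2)] that by blast
  show ?thesis
  proof (rule that[of n "\<lambda>i a. y a i"])
    show "(\<lambda>a. y a i) \<in> near_one" if "i < n" for i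
      using pn[OF poly_fun.poly_coord[OF that]] .
    fix X :: "'k lie" assume X: "\<forall>i<n. apply_lie X (\<lambda>a. y a i) = 0"
    have Xp: "apply_lie X (\<lambda>a. p (y a)) = 0" if "p \<in> poly_fun n" for p
      using that
    proof (induction rule: poly_fun.induct)
      case (poly_add p q)
      then show ?case using lie_add[OF pn pn, of p q X] by simp
    next
      case (poly_mult p q)
      then show ?case using lie_mult[OF pn pn, of p q X] by simp
    qed (simp_all add: lie_const X)
    show "X = 0"
    proof (rule lie_eqI)
      fix f :: "'k \<Rightarrow> complex" assume "f \<in> near_one"
      then obtain U where U: "U \<in> Opn ?V" "1 \<in> U" "f \<in> Reg ?V U" unfolding near_one_def by blast
      have UW: "U \<inter> W \<in> Opn ?V" by (rule Opn_Int[OF variety U(1) Wo])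
      have "f \<in> Reg ?V (U \<inter> W)" by (rule Reg_mono[OF variety U(1) UW _ U(3)]) blast
      then obtain p q where pq: "p \<in> poly_fun n" "q \<in> poly_fun n" "q (y 1) \<noteq> 0"
        "\<And>b. b \<in> U \<inter> W \<Longrightarrow> q (y b) \<noteq> 0 \<Longrightarrow> f b = p (y b) / q (y b)"
        using chart_reg[OF ch UW, of f] U(2) W(2) by blast
      have "(\<lambda>a. q (y a)) \<in> Reg ?V (U \<inter> W)" by (rule Reg_mono[OF variety Wo UW _ preg[OF pq(2)]]) blast
      then have o: "{b \<in> U \<inter> W. q (y b) \<noteq> 0} \<in> Opn ?V" by (rule Opn_nonzero[OF variety UW])
      have "apply_lie X f = apply_lie X (\<lambda>b. p (y b) / q (y b))"
        by (rule lie_cong[OF near_one_divide[OF pn pn] o]) (use pq U W in auto)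
      also have "\<dots> = 0"
        by (subst lie_quotient[OF pn pn]) (use pq Xp in auto)
      finally show "apply_lie X f = apply_lie 0 f" by simp
    qed
  qed
qed

text \<open>The image is written as a sum of coefficients times unit vectors so that it already has
  the form of a vector-valued function: regularity of a map into the Lie algebra reduces to its n
  coordinates.\<close>

lemma lie_embedding:
  obtains n :: nat and x and L :: "'k::complex_algebraic_group lie \<Rightarrow> nat \<Rightarrow> complex"
  where "\<And>i. i < n \<Longrightarrow> x i \<in> near_one" "\<And>X. L X = (\<Sum>i<n. apply_lie X (x i) *\<^sub>C (\<lambda>j. if j = i then 1 else 0))"
    "lin_on UNIV UNIV L" "\<And>X. L X = 0 \<Longrightarrow> X = 0"
proof -
  obtain n :: nat and x where x: "\<And>i. i < n \<Longrightarrow> x i \<in> near_one"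
    "\<And>X :: 'k lie. \<forall>i<n. apply_lie X (x i) = 0 \<Longrightarrow> X = 0" by (rule lie_coordinates) (rule that)
  let ?L = "\<lambda>X :: 'k lie. \<Sum>i<n. apply_lie X (x i) *\<^sub>C ((\<lambda>j. if j = i then 1 else 0) :: nat \<Rightarrow> complex)"
  have L: "?L X j = (if j < n then apply_lie X (x j) else 0)" for X j
    by (simp add: sum_fun_apply scaleC_fun_def scaleC_complex_def if_distrib cong: if_cong)
  show ?thesis
  proof (rule that[of n x ?L])
    show "lin_on UNIV UNIV ?L"
      by (auto simp: lin_on_def scaleC_add_left sum.distrib scaleC_sum_right scaleC_scaleC)
    show "X = 0" if "?L X = 0" for X
    proof (rule x(2), intro allI impI)
      fix i assume "i < n"
      then show "apply_lie X (x i) = 0" using fun_cong[OF that, of i] unfolding L by simp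
    qed
  qed (use x in auto)
qed

lemma lie_finite_basis:
  obtains B :: "'k::complex_algebraic_group lie set" where "finite B" "complex_vector.span B = UNIV"
proof -
  obtain n :: nat and x and L :: "'k lie \<Rightarrow> nat \<Rightarrow> complex"
  where L: "\<And>X. L X = (\<Sum>i<n. apply_lie X (x i) *\<^sub>C (\<lambda>j. if j = i then 1 else 0))"
    "lin_on UNIV UNIV L" "\<And>X. L X = 0 \<Longrightarrow> X = 0" by (rule lie_embedding) (rule that)
  interpret p: vector_space_pair "scaleC :: complex \<Rightarrow> 'k lie \<Rightarrow> 'k lie" "scaleC :: complex \<Rightarrow> (nat \<Rightarrow> complex) \<Rightarrow> _"
    by unfold_locales
  have inj: "inj L"
  proof (rule injI)
    fix X Y assume "L X = L Y"
    then have "L (X - Y) = 0" using lin_on_diff[OF L(2)] by simp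
    then show "X = Y" using L(3) by fastforce
  qed
  obtain B :: "'k lie set" where B: "complex_vector.independent B" "UNIV \<subseteq> complex_vector.span B"
    by (rule complex_vector.basis_exists[of UNIV]) (rule that)
  have "complex_vector.independent (L ` B)"
    using p.linear_independent_injective_image[of L B] B inj L(2) by (simp add: lin_on_linear inj_on_subset)
  moreover have "L ` B \<subseteq> complex_vector.span ((\<lambda>i j. if j = i then 1 else 0) ` {..<n})"
    unfolding L(1) by (auto intro!: complex_vector.span_sum complex_vector.span_scale intro: complex_vector.span_base)
  ultimately have "finite (L ` B)"
    using complex_vector.independent_span_bound[of "(\<lambda>i j. if j = i then 1 else 0) ` {..<n}" "L ` B"] by blast
  then have "finite B" by (rule finite_imageD) (rule inj_on_subset[OF inj subset_UNIV])
  then show ?thesis using that B by blast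
qed

section \<open>Differentials and the adjoint action\<close>

lemma
  fixes \<gamma> :: "'t::complex_algebraic_group \<Rightarrow> 'k::complex_algebraic_group"
  assumes \<gamma>: "morphism variety variety \<gamma>" "\<gamma> 1 = 1"
  shows lie_map_add: "lie_map \<gamma> (X + Y) = lie_map \<gamma> X + lie_map \<gamma> Y"
    and lie_map_scale: "lie_map \<gamma> (c *\<^sub>C X) = c *\<^sub>C lie_map \<gamma> X"
    and lie_map_apply: "f \<in> near_one \<Longrightarrow> apply_lie (lie_map \<gamma> X) f = apply_lie X (\<lambda>t. f (\<gamma> t))"
  by (auto intro!: lie_eqI simp: apply_lie_map[OF \<gamma>] o_def)

lemma lie_map_compose:
  fixes \<gamma> :: "'t::complex_algebraic_group \<Rightarrow> 'k::complex_algebraic_group" and \<delta> :: "'k \<Rightarrow> 'l::complex_algebraic_group"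
  assumes "morphism variety variety \<gamma>" "\<gamma> 1 = 1" "morphism variety variety \<delta>" "\<delta> 1 = 1"
  shows "lie_map \<delta> (lie_map \<gamma> X) = lie_map (\<lambda>t. \<delta> (\<gamma> t)) X"
proof (rule lie_eqI)
  have m: "morphism variety variety (\<lambda>t. \<delta> (\<gamma> t))" using morphism_compose[OF assms(1,3)] by (simp add: o_def)
  fix f :: "'l \<Rightarrow> complex" assume f: "f \<in> near_one"
  then show "apply_lie (lie_map \<delta> (lie_map \<gamma> X)) f = apply_lie (lie_map (\<lambda>t. \<delta> (\<gamma> t)) X) f"
    using near_one_pullback[OF assms(3,4) f]
    by (simp add: lie_map_apply[OF m] lie_map_apply[OF assms(3,4)] lie_map_apply[OF assms(1,2)] assms(2,4))
qed

lemma near_one_conv: "f \<in> near_one \<Longrightarrow> (\<lambda>g. apply_lie Y (\<lambda>h. f (g * h))) \<in> near_one"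
  by (erule near_one_translate) blast

text \<open>The bracket is the commutator for \<open>conv\<close>, and \<open>conv\<close> is
  compatible with \<gamma> because f(\<gamma>(s) \<gamma>(t)) = f(\<gamma>(st)).\<close>

lemma lie_map_bracket:
  fixes \<gamma> :: "'t::complex_algebraic_group \<Rightarrow> 'k::complex_algebraic_group"
  assumes \<gamma>: "morphism variety variety \<gamma>" "\<And>s t. \<gamma> (s * t) = \<gamma> s * \<gamma> t"
  shows "lie_map \<gamma> (bracket X Y) = bracket (lie_map \<gamma> X) (lie_map \<gamma> Y)"
proof (rule lie_eqI)
  note \<gamma>1 = group_hom(1)[of \<gamma>, OF \<gamma>(2)]
  fix f :: "'k \<Rightarrow> complex" assume f: "f \<in> near_one"
  have "conv (lie_map \<gamma> X) (lie_map \<gamma> Y) f = conv X Y (\<lambda>t. f (\<gamma> t))" for X Y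
  proof -
    obtain G where G: "G \<in> Opn variety" "1 \<in> G" "\<And>g. g \<in> G \<Longrightarrow> (\<lambda>h. f (g * h)) \<in> near_one"
      by (rule near_one_translate[OF f]) (rule that)
    have "conv (lie_map \<gamma> X) (lie_map \<gamma> Y) f = apply_lie X (\<lambda>s. apply_lie (lie_map \<gamma> Y) (\<lambda>h. f (\<gamma> s * h)))"
      unfolding conv_def by (rule lie_map_apply[OF \<gamma>(1) \<gamma>1 near_one_conv[OF f]])
    also have "\<dots> = apply_lie X (\<lambda>s. apply_lie Y (\<lambda>t. f (\<gamma> s * \<gamma> t)))"
    proof (rule lie_cong[of _ "\<gamma> -` G"])
      show "(\<lambda>s. apply_lie Y (\<lambda>t. f (\<gamma> s * \<gamma> t))) \<in> near_one"
        using near_one_conv[OF near_one_pullback[OF \<gamma>(1) \<gamma>1 f]] by (simp add: \<gamma>(2))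
      show "\<gamma> -` G \<in> Opn variety" using \<gamma>(1) G(1) unfolding morphism_def by blast
      show "apply_lie (lie_map \<gamma> Y) (\<lambda>h. f (\<gamma> s * h)) = apply_lie Y (\<lambda>t. f (\<gamma> s * \<gamma> t))" if "s \<in> \<gamma> -` G" for s
        using lie_map_apply[OF \<gamma>(1) \<gamma>1 G(3), of "\<gamma> s" Y] that by simp
    qed (use G \<gamma>1 in auto)
    finally show ?thesis by (simp add: conv_def \<gamma>(2))
  qed
  then show "apply_lie (lie_map \<gamma> (bracket X Y)) f = apply_lie (bracket (lie_map \<gamma> X) (lie_map \<gamma> Y)) f"
    using near_one_pullback[OF \<gamma>(1) \<gamma>1 f]
    by (simp add: lie_map_apply[OF \<gamma>(1) \<gamma>1 f] apply_bracket_lie f)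
qed

lemma
  fixes k l :: "'k::complex_algebraic_group"
  shows Ad_add: "Ad k (X + Y) = Ad k X + Ad k Y"
    and Ad_scale: "Ad k (c *\<^sub>C X) = c *\<^sub>C Ad k X"
    and Ad_apply: "f \<in> near_one \<Longrightarrow> apply_lie (Ad k X) f = apply_lie X (\<lambda>h. f (k * h * inverse k))"
    and Ad_bracket: "Ad k (bracket X Y) = bracket (Ad k X) (Ad k Y)"
    and Ad_one: "Ad 1 X = X"
    and Ad_mult: "Ad (k * l) X = Ad k (Ad l X)"
proof -
  have 1: "k * 1 * inverse k = 1" for k :: 'k by (simp add: group_simps)
  show "Ad k (X + Y) = Ad k X + Ad k Y" "Ad k (c *\<^sub>C X) = c *\<^sub>C Ad k X"
    unfolding Ad_def by (rule lie_map_add[OF morphism_conj 1] lie_map_scale[OF morphism_conj 1])+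
  have a: "apply_lie (Ad k X) f = apply_lie X (\<lambda>h. f (k * h * inverse k))" if "f \<in> near_one" for f k and X :: "'k lie"
    unfolding Ad_def by (rule lie_map_apply[OF morphism_conj 1 that])
  then show "f \<in> near_one \<Longrightarrow> apply_lie (Ad k X) f = apply_lie X (\<lambda>h. f (k * h * inverse k))" .
  show "Ad 1 X = X" by (rule lie_eqI) (simp add: a group_simps)
  show "Ad k (bracket X Y) = bracket (Ad k X) (Ad k Y)" unfolding Ad_def
    by (rule lie_map_bracket[OF morphism_conj]) (simp add: group_simps mult.assoc)
  show "Ad (k * l) X = Ad k (Ad l X)" unfolding Ad_def
    by (subst lie_map_compose[OF morphism_conj 1 morphism_conj 1]) (simp add: group_simps mult.assoc)
qed

lemma lie_map_Ad:
  fixes \<gamma> :: "'t::complex_algebraic_group \<Rightarrow> 'k::complex_algebraic_group"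
  assumes \<gamma>: "morphism variety variety \<gamma>" "\<And>s t. \<gamma> (s * t) = \<gamma> s * \<gamma> t"
  shows "lie_map \<gamma> (Ad t X) = Ad (\<gamma> t) (lie_map \<gamma> X)"
proof -
  note \<gamma>1 = group_hom[of \<gamma>, OF \<gamma>(2)]
  have 1: "k * 1 * inverse k = 1" for k :: "'g::complex_algebraic_group" by (simp add: group_simps)
  show ?thesis unfolding Ad_def
    by (simp add: lie_map_compose[OF morphism_conj 1 \<gamma>(1) \<gamma>1(1)] lie_map_compose[OF \<gamma>(1) \<gamma>1(1) morphism_conj 1] \<gamma>(2) \<gamma>1)
qed

text \<open>
  Functions of two variables that are locally quotients of sums of products; the formula for the mixed
  derivative is symmetric in the two variables.
\<close>

lemma
  fixes p q :: "'k::complex_algebraic_group \<times> 'k \<Rightarrow> complex"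
  assumes UV: "U \<in> Opn variety" "V \<in> Opn variety" "1 \<in> U" "1 \<in> V"
    and pq: "p \<in> sum_prod variety variety U V" "q \<in> sum_prod variety variety U V" "q (1, 1) \<noteq> 0"
    and F: "\<And>g h. g \<in> U \<Longrightarrow> h \<in> V \<Longrightarrow> q (g, h) \<noteq> 0 \<Longrightarrow> F g h = p (g, h) / q (g, h)"
  shows near_one_partial: "(\<lambda>g. apply_lie Y (F g)) \<in> near_one"
    and lie_mixed: "apply_lie X (\<lambda>g. apply_lie Y (F g)) =
      (apply_lie X (\<lambda>g. apply_lie Y (\<lambda>h. p (g, h))) * q (1, 1) - p (1, 1) * apply_lie X (\<lambda>g. apply_lie Y (\<lambda>h. q (g, h)))) / q (1, 1) ^ 2
      - (apply_lie X (\<lambda>g. p (g, 1)) * apply_lie Y (\<lambda>h. q (1, h)) + apply_lie Y (\<lambda>h. p (1, h)) * apply_lie X (\<lambda>g. q (g, 1))) / q (1, 1) ^ 2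
      + 2 * p (1, 1) * apply_lie X (\<lambda>g. q (g, 1)) * apply_lie Y (\<lambda>h. q (1, h)) / q (1, 1) ^ 3"
proof -
  note S = UV(1,2,4)
  let ?G = "{g \<in> U. q (g, 1) \<noteq> 0}"
  have G: "?G \<in> Opn variety" by (rule Opn_nonzero[OF variety UV(1) sum_prod_slice_left[OF S pq(2)]])
  have 1: "1 \<in> ?G" using UV pq by simp
  have sl: "(\<lambda>h. p (g, h)) \<in> near_one" "(\<lambda>h. q (g, h)) \<in> near_one" for g
    using near_oneI[OF UV(2,4) sum_prod_slice_right[OF S pq(1)]]
      near_oneI[OF UV(2,4) sum_prod_slice_right[OF S pq(2)]] by auto
  have N: "{h \<in> V. q (g, h) \<noteq> 0} \<in> Opn variety" for g
    by (rule Opn_nonzero[OF variety UV(2) sum_prod_slice_right[OF S pq(2)]])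
  let ?yp = "\<lambda>g. apply_lie Y (\<lambda>h. p (g, h))" and ?yq = "\<lambda>g. apply_lie Y (\<lambda>h. q (g, h))"
  have eq: "apply_lie Y (F g) = (?yp g * q (g, 1) - p (g, 1) * ?yq g) / (q (g, 1) * q (g, 1))" if g: "g \<in> ?G" for g
  proof -
    have "apply_lie Y (F g) = apply_lie Y (\<lambda>h. p (g, h) / q (g, h))"
      by (rule lie_cong[OF near_one_divide[OF sl] N]) (use g UV F in auto)
    also have "\<dots> = (?yp g * q (g, 1) - p (g, 1) * ?yq g) * inverse (q (g, 1) * q (g, 1))"
      by (rule lie_quotient[OF sl]) (use g in simp)
    finally show ?thesis by (simp add: divide_inverse)
  qed
  have q1: "(\<lambda>g. q (g, 1)) \<in> near_one" "(\<lambda>g. p (g, 1)) \<in> near_one"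
    by (rule near_oneI[OF UV(1,3) sum_prod_slice_left[OF S]], rule pq)+
  have pd: "?yp \<in> near_one" "?yq \<in> near_one"
    by (rule near_oneI[OF UV(1,3) sum_prod_partial[OF S]], rule pq)+
  have num: "(\<lambda>g. ?yp g * q (g, 1) - p (g, 1) * ?yq g) \<in> near_one"
    and den: "(\<lambda>g. q (g, 1) * q (g, 1)) \<in> near_one"
    by (intro near_one_mult near_one_diff q1 pd)+
  have quo: "(\<lambda>g. (?yp g * q (g, 1) - p (g, 1) * ?yq g) / (q (g, 1) * q (g, 1))) \<in> near_one"
    by (rule near_one_divide[OF num den]) (use pq in simp)
  show "(\<lambda>g. apply_lie Y (F g)) \<in> near_one"
    by (rule near_one_cong[OF quo G 1 eq])
  have "apply_lie X (\<lambda>g. apply_lie Y (F g)) =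
      apply_lie X (\<lambda>g. (?yp g * q (g, 1) - p (g, 1) * ?yq g) / (q (g, 1) * q (g, 1)))"
    by (rule lie_cong[OF quo G 1 eq])
  also have "\<dots> = ((?yp 1 * apply_lie X (\<lambda>g. q (g, 1)) + apply_lie X ?yp * q (1, 1)
      - (p (1, 1) * apply_lie X ?yq + apply_lie X (\<lambda>g. p (g, 1)) * ?yq 1)) * (q (1, 1) * q (1, 1))
      - (?yp 1 * q (1, 1) - p (1, 1) * ?yq 1) * (q (1, 1) * apply_lie X (\<lambda>g. q (g, 1)) + apply_lie X (\<lambda>g. q (g, 1)) * q (1, 1)))
      * inverse (q (1, 1) * q (1, 1) * (q (1, 1) * q (1, 1)))"
    by (subst lie_quotient[OF num den]) (simp_all add: pq(3) lie_diff near_one_mult lie_mult q1 pd)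
  also have "\<dots> = (apply_lie X ?yp * q (1, 1) - p (1, 1) * apply_lie X ?yq) / q (1, 1) ^ 2
      - (apply_lie X (\<lambda>g. p (g, 1)) * ?yq 1 + ?yp 1 * apply_lie X (\<lambda>g. q (g, 1))) / q (1, 1) ^ 2
      + 2 * p (1, 1) * apply_lie X (\<lambda>g. q (g, 1)) * ?yq 1 / q (1, 1) ^ 3"
    using pq(3) by (simp add: field_simps power2_eq_square power3_eq_cube)
  finally show "apply_lie X (\<lambda>g. apply_lie Y (F g)) =
      (apply_lie X ?yp * q (1, 1) - p (1, 1) * apply_lie X ?yq) / q (1, 1) ^ 2
      - (apply_lie X (\<lambda>g. p (g, 1)) * ?yq 1 + ?yp 1 * apply_lie X (\<lambda>g. q (g, 1))) / q (1, 1) ^ 2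
      + 2 * p (1, 1) * apply_lie X (\<lambda>g. q (g, 1)) * ?yq 1 / q (1, 1) ^ 3" .
qed

text \<open>Derivatives in two independent variables commute: this is clear for sums of products,
  and the formula for the mixed derivative of a quotient is symmetric. It is needed to compute the
  differential of Ad.\<close>

lemma
  fixes f :: "'k::complex_algebraic_group \<Rightarrow> complex"
  assumes f: "f \<in> near_one"
  shows lie_exchange: "apply_lie X (\<lambda>g. apply_lie Y (\<lambda>h. f (g * h))) = apply_lie Y (\<lambda>h. apply_lie X (\<lambda>g. f (g * h)))"
    and near_one_conv_left: "(\<lambda>h. apply_lie X (\<lambda>g. f (g * h))) \<in> near_one"
proof -
  obtain U V p q
  where UV: "U \<in> Opn variety" "V \<in> Opn variety" "(1::'k) \<in> U" "(1::'k) \<in> V"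
    and pq: "p \<in> sum_prod variety variety U V" "q \<in> sum_prod variety variety U V" "q (1, 1) \<noteq> 0"
    and F: "\<forall>g\<in>U. \<forall>h\<in>V. q (g, h) \<noteq> 0 \<longrightarrow> f (g * h) = p (g, h) / q (g, h)"
    by (rule near_one_translate_prod[OF f]) (rule that; assumption)
  let ?sw = "\<lambda>p (h, g). p (g, h)"
  have swap: "(\<lambda>(h, g). p (g, h)) \<in> sum_prod variety variety V U"
    and ex: "apply_lie X (\<lambda>g. apply_lie Y (\<lambda>h. p (g, h))) = apply_lie Y (\<lambda>h. apply_lie X (\<lambda>g. p (g, h)))"
    if "p \<in> sum_prod variety variety U V" for p :: "'k \<times> 'k \<Rightarrow> complex"
  proof -
    obtain m :: nat and a b where p: "\<And>i. i < m \<Longrightarrow> a i \<in> Reg variety U"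
      "\<And>i. i < m \<Longrightarrow> b i \<in> Reg variety V" "p = (\<lambda>(u, v). \<Sum>i<m. a i u * b i v)"
      using \<open>p \<in> sum_prod variety variety U V\<close> unfolding sum_prod_def by blast
    have "(\<lambda>(h, g). p (g, h)) = (\<lambda>(h, g). \<Sum>i<m. b i h * a i g)" unfolding p(3) by (simp add: mult.commute)
    also have "\<dots> \<in> sum_prod variety variety V U"
      by (rule sum_prodI) (use p in auto)
    finally show "(\<lambda>(h, g). p (g, h)) \<in> sum_prod variety variety V U" .
    have ab: "a i \<in> near_one" "b i \<in> near_one" if "i < m" for i
      using near_oneI[OF UV(1,3)] near_oneI[OF UV(2,4)] p that by auto
    have Y: "apply_lie Y (\<lambda>h. p (g, h)) = (\<Sum>i<m. apply_lie Y (b i) * a i g)" for g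
      unfolding p(3) split using ab
      by (subst lie_sum) (auto intro: near_one_scale simp: lie_scale mult.commute)
    have X: "apply_lie X (\<lambda>g. p (g, h)) = (\<Sum>i<m. apply_lie X (a i) * b i h)" for h
      unfolding p(3) split using ab
      by (subst lie_sum) (auto intro: near_one_scale_right simp: lie_scale_right)
    show "apply_lie X (\<lambda>g. apply_lie Y (\<lambda>h. p (g, h))) = apply_lie Y (\<lambda>h. apply_lie X (\<lambda>g. p (g, h)))"
      unfolding X Y using ab
      by (subst (1 2) lie_sum) (auto intro!: near_one_scale sum.cong simp: lie_scale)
  qed
  have F1: "f (g * h) = p (g, h) / q (g, h)" if "g \<in> U" "h \<in> V" "q (g, h) \<noteq> 0" for g h
    using F that by blast
  have F2: "f (g * h) = (\<lambda>(h, g). p (g, h)) (h, g) / (\<lambda>(h, g). q (g, h)) (h, g)"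
    if "h \<in> V" "g \<in> U" "(\<lambda>(h, g). q (g, h)) (h, g) \<noteq> 0" for g h
    using F that by simp
  have q2: "(\<lambda>(h, g). q (g, h)) (1, 1) \<noteq> 0" using pq by simp
  have m1: "apply_lie X (\<lambda>g. apply_lie Y (\<lambda>h. f (g * h))) =
      (apply_lie X (\<lambda>g. apply_lie Y (\<lambda>h. p (g, h))) * q (1, 1) - p (1, 1) * apply_lie X (\<lambda>g. apply_lie Y (\<lambda>h. q (g, h)))) / q (1, 1) ^ 2
      - (apply_lie X (\<lambda>g. p (g, 1)) * apply_lie Y (\<lambda>h. q (1, h)) + apply_lie Y (\<lambda>h. p (1, h)) * apply_lie X (\<lambda>g. q (g, 1))) / q (1, 1) ^ 2
      + 2 * p (1, 1) * apply_lie X (\<lambda>g. q (g, 1)) * apply_lie Y (\<lambda>h. q (1, h)) / q (1, 1) ^ 3"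
    by (rule lie_mixed[OF UV pq]) (rule F1)
  have m2: "apply_lie Y (\<lambda>h. apply_lie X (\<lambda>g. f (g * h))) =
      (apply_lie Y (\<lambda>h. apply_lie X (\<lambda>g. p (g, h))) * q (1, 1) - p (1, 1) * apply_lie Y (\<lambda>h. apply_lie X (\<lambda>g. q (g, h)))) / q (1, 1) ^ 2
      - (apply_lie Y (\<lambda>h. p (1, h)) * apply_lie X (\<lambda>g. q (g, 1)) + apply_lie X (\<lambda>g. p (g, 1)) * apply_lie Y (\<lambda>h. q (1, h))) / q (1, 1) ^ 2
      + 2 * p (1, 1) * apply_lie Y (\<lambda>h. q (1, h)) * apply_lie X (\<lambda>g. q (g, 1)) / q (1, 1) ^ 3"
    by (rule lie_mixed[OF UV(2,1,4,3) swap[OF pq(1)] swap[OF pq(2)] q2, unfolded split]) (rule F1)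
  show "apply_lie X (\<lambda>g. apply_lie Y (\<lambda>h. f (g * h))) = apply_lie Y (\<lambda>h. apply_lie X (\<lambda>g. f (g * h)))"
    unfolding m1 m2 ex[OF pq(1)] ex[OF pq(2)] by (simp add: mult_ac add_ac)
  show "(\<lambda>h. apply_lie X (\<lambda>g. f (g * h))) \<in> near_one"
    by (rule near_one_partial[OF UV(2,1,4,3) swap[OF pq(1)] swap[OF pq(2)] q2]) (rule F2)
qed

text \<open>With f(xy) = p(x, y) / q(x, y) locally, take x = gh and y = inverse g. The derivative in
  h then touches only the first argument, the inverse only the second, and the quotient rule
  expresses the result through functions regular near 1.\<close>

lemma near_one_Ad:
  fixes f :: "'k::complex_algebraic_group \<Rightarrow> complex"
  assumes f: "f \<in> near_one"
  shows "(\<lambda>g. apply_lie X (\<lambda>h. f (g * h * inverse g))) \<in> near_one"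
proof -
  obtain U V p q
  where UV: "U \<in> Opn variety" "V \<in> Opn variety" "(1::'k) \<in> U" "(1::'k) \<in> V"
    and pq: "p \<in> sum_prod variety variety U V" "q \<in> sum_prod variety variety U V" "q (1, 1) \<noteq> 0"
    and F: "\<forall>g\<in>U. \<forall>h\<in>V. q (g, h) \<noteq> 0 \<longrightarrow> f (g * h) = p (g, h) / q (g, h)"
    by (rule near_one_translate_prod[OF f]) (rule that; assumption)
  have A: "(\<lambda>g. p (g, inverse g)) \<in> near_one" "\<And>g. g \<in> U \<Longrightarrow> (\<lambda>h. p (g * h, inverse g)) \<in> near_one"
    "(\<lambda>g. apply_lie X (\<lambda>h. p (g * h, inverse g))) \<in> near_one"
    if "p \<in> sum_prod variety variety U V" for p :: "'k \<times> 'k \<Rightarrow> complex"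
  proof -
    obtain m :: nat and a b where p: "\<And>i. i < m \<Longrightarrow> a i \<in> Reg variety U"
      "\<And>i. i < m \<Longrightarrow> b i \<in> Reg variety V" "p = (\<lambda>(u, v). \<Sum>i<m. a i u * b i v)"
      using \<open>p \<in> sum_prod variety variety U V\<close> unfolding sum_prod_def by blast
    have ab: "a i \<in> near_one" "b i \<in> near_one" if "i < m" for i
      using near_oneI[OF UV(1,3)] near_oneI[OF UV(2,4)] p that by auto
    have bi: "(\<lambda>g. b i (inverse g)) \<in> near_one" if "i < m" for i
      by (rule near_one_pullback[OF inverse_morphism _ ab(2)[OF that]]) (simp add: group_simps)
    have ag: "(\<lambda>h. a i (g * h)) \<in> near_one" if "i < m" "g \<in> U" for i g
      by (rule near_one_morphism[OF morphism_mult_left UV(1) p(1)]) (use that in auto)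
    show "(\<lambda>g. p (g, inverse g)) \<in> near_one"
      unfolding p(3) split by (intro near_one_sum near_one_mult ab bi) auto
    show "(\<lambda>h. p (g * h, inverse g)) \<in> near_one" if "g \<in> U" for g
      unfolding p(3) split by (intro near_one_sum near_one_mult ag that near_one_const) auto
    have "(\<lambda>g. \<Sum>i<m. apply_lie X (\<lambda>h. a i (g * h)) * b i (inverse g)) \<in> near_one"
      by (intro near_one_sum near_one_mult near_one_conv ab bi) auto
    then show "(\<lambda>g. apply_lie X (\<lambda>h. p (g * h, inverse g))) \<in> near_one"
    proof (rule near_one_cong[OF _ UV(1,3)])
      fix g assume "g \<in> U"
      then show "apply_lie X (\<lambda>h. p (g * h, inverse g)) = (\<Sum>i<m. apply_lie X (\<lambda>h. a i (g * h)) * b i (inverse g))"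
        unfolding p(3) split using ag
        by (subst lie_sum) (auto intro: near_one_scale_right simp: lie_scale_right)
    qed
  qed
  let ?p = "\<lambda>g. p (g, inverse g)" and ?q = "\<lambda>g. q (g, inverse g)"
  let ?xp = "\<lambda>g. apply_lie X (\<lambda>h. p (g * h, inverse g))" and ?xq = "\<lambda>g. apply_lie X (\<lambda>h. q (g * h, inverse g))"
  obtain W where W: "W \<in> Opn variety" "1 \<in> W" "\<And>g. g \<in> W \<Longrightarrow> ?q g \<noteq> 0"
    by (rule near_one_nonzero[OF A(1)[OF pq(2)]]) (use pq that in \<open>auto simp: group_simps\<close>)
  \<comment> \<open>On this neighbourhood (g, inverse g) lies in U \<times> V and q is nonzero
    there, so that the quotient represents f(gh inverse g) for h near 1.\<close>
  let ?G = "U \<inter> (inverse -` V \<inter> W)"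
  have iV: "inverse -` V \<in> Opn variety" using inverse_morphism UV(2) unfolding morphism_def by blast
  have G: "?G \<in> Opn variety" by (intro Opn_Int[OF variety] UV(1) iV W(1))
  have 1: "1 \<in> ?G" using UV W by (simp add: group_simps)
  have "(\<lambda>g. (?xp g * ?q g - ?p g * ?xq g) / (?q g * ?q g)) \<in> near_one"
    by (intro near_one_divide near_one_diff near_one_mult A pq) (use W in auto)
  then show ?thesis
  proof (rule near_one_cong[OF _ G 1])
    fix g assume g: "g \<in> ?G"
    then have gU: "g \<in> U" by simp
    note n = A(2)[OF pq(1) gU] A(2)[OF pq(2) gU]
    obtain W' where W': "W' \<in> Opn variety" "1 \<in> W'" "\<And>h. h \<in> W' \<Longrightarrow> q (g * h, inverse g) \<noteq> 0"
      by (rule near_one_nonzero[OF n(2)]) (use W g that in auto)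
    have gU': "(\<lambda>h. g * h) -` U \<in> Opn variety" using morphism_mult_left UV(1) unfolding morphism_def by blast
    have "apply_lie X (\<lambda>h. f (g * h * inverse g)) = apply_lie X (\<lambda>h. p (g * h, inverse g) / q (g * h, inverse g))"
      by (rule lie_cong[OF near_one_divide[OF n] Opn_Int[OF variety gU' W'(1)]]) (use F W' W g in auto)
    also have "\<dots> = (?xp g * ?q g - ?p g * ?xq g) * inverse (?q g * ?q g)"
      using lie_quotient[OF n, of X] W(3)[of g] g by simp
    finally show "apply_lie X (\<lambda>h. f (g * h * inverse g)) = (?xp g * ?q g - ?p g * ?xq g) / (?q g * ?q g)"
      by (simp add: divide_inverse)
  qed
qed

text \<open>Regularity near 1 is moved to any point k0 by Ad(k) = Ad(k0) Ad(inverse k0 * k), with f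
  replaced by its conjugate f' under k0.\<close>

lemma regfun_Ad:
  fixes f :: "'k::complex_algebraic_group \<Rightarrow> complex"
  assumes f: "f \<in> near_one"
  shows "(\<lambda>k. apply_lie (Ad k X) f) \<in> regfun"
  unfolding regfun_def
proof (rule Reg_local[OF variety])
  fix k0 :: 'k
  define f' where "f' h = f (k0 * h * inverse k0)" for h
  have "f' \<in> near_one" unfolding f'_def
    by (rule near_one_pullback[OF morphism_conj _ f]) (simp add: group_simps)
  then obtain U where U: "U \<in> Opn variety" "1 \<in> U" "(\<lambda>g. apply_lie X (\<lambda>h. f' (g * h * inverse g))) \<in> Reg variety U"
    using near_one_Ad unfolding near_one_def by blast
  let ?t = "\<lambda>k. inverse k0 * k"
  have "?t -` U \<in> Opn variety" "(\<lambda>g. apply_lie X (\<lambda>h. f' (g * h * inverse g))) \<circ> ?t \<in> Reg variety (?t -` U)"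
    using morphism_mult_left[of "inverse k0"] U unfolding morphism_def by blast+
  moreover have "(\<lambda>g. apply_lie X (\<lambda>h. f' (g * h * inverse g))) \<circ> ?t = (\<lambda>k. apply_lie (Ad k X) f)"
    by (simp add: fun_eq_iff Ad_apply[OF f] f'_def group_simps mult.assoc)
  ultimately show "\<exists>V\<in>Opn variety. k0 \<in> V \<and> V \<subseteq> UNIV \<and> (\<lambda>k. apply_lie (Ad k X) f) \<in> Reg variety V"
    using U(2) by (intro bexI[of _ "?t -` U"]) (auto simp: group_simps)
qed

lemma regfun_in_Ad: "(\<lambda>k. Ad k (X :: 'k::complex_algebraic_group lie)) \<in> regfun_in UNIV"
proof -
  obtain n :: nat and x and L :: "'k lie \<Rightarrow> nat \<Rightarrow> complex"
  where L: "\<And>i. i < n \<Longrightarrow> x i \<in> near_one" "\<And>X. L X = (\<Sum>i<n. apply_lie X (x i) *\<^sub>C (\<lambda>j. if j = i then 1 else 0))"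
    "lin_on UNIV UNIV L" "\<And>X. L X = 0 \<Longrightarrow> X = 0" by (rule lie_embedding) (rule that)
  show ?thesis
  proof (rule regfun_in_reflect[OF _ complex_vector.subspace_UNIV UNIV_I L(3,4)])
    show "(\<lambda>k. L (Ad k X)) \<in> regfun_in UNIV"
      unfolding L(2) by (rule regfun_inI) (use L(1) regfun_Ad in auto)
  qed
qed

lemma apply_lie_sum: "apply_lie (\<Sum>i\<in>I. c i *\<^sub>C X i) f = (\<Sum>i\<in>I. c i * apply_lie (X i) f)"
  by (induction I rule: infinite_finite_induct) auto

text \<open>Expand Ad(g) Y = \<Sum> a i(g) w i and apply the Leibniz rule in g to the second factor
  of \<open>conv X Y f\<close>. The part where a i is not differentiated becomes
  \<open>conv Y X f\<close> after exchanging the derivatives; the part where it is differentiated is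
  the derivative of Ad.\<close>

lemma vderiv_Ad:
  fixes X Y :: "'k::complex_algebraic_group lie"
  shows "vderiv X (\<lambda>g. Ad g Y) = bracket X Y"
proof (rule lie_eqI)
  fix f :: "'k \<Rightarrow> complex" assume f: "f \<in> near_one"
  obtain m :: nat and a w where a: "\<And>i. i < m \<Longrightarrow> a i \<in> regfun"
    and Ad: "(\<lambda>g. Ad g Y) = (\<lambda>g. \<Sum>i<m. a i g *\<^sub>C w i)"
    using regfun_in_Ad[of Y] by (rule regfun_inE) (rule that)
  obtain U where U: "U \<in> Opn variety" "1 \<in> U" "f \<in> Reg variety U" using f unfolding near_one_def by blast
  have "(\<lambda>h. f (h * g)) \<in> near_one" if "g \<in> U" for g
    by (rule near_one_morphism[OF morphism_mult_right U(1,3)]) (use that in auto)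
  \<comment> \<open>Comes from gh = (g h inverse g) g: moving g to the right replaces Y by Ad(g)
    Y.\<close>
  then have e: "apply_lie Y (\<lambda>h. f (g * h)) = (\<Sum>i<m. a i g * apply_lie (w i) (\<lambda>h. f (h * g)))" if "g \<in> U" for g
    using Ad_apply[of "\<lambda>h. f (h * g)" g Y] that fun_cong[OF Ad, of g]
    by (simp add: apply_lie_sum group_simps mult.assoc)
  note an = regfun_near_one[OF a]
  note wn = near_one_conv_left[OF f]
  have "conv X Y f = apply_lie X (\<lambda>g. \<Sum>i<m. a i g * apply_lie (w i) (\<lambda>h. f (h * g)))"
    unfolding conv_def
    by (rule lie_cong[OF _ U(1,2) e]) (auto intro!: near_one_sum near_one_mult an wn)
  also have "\<dots> = (\<Sum>i<m. a i 1 * apply_lie X (\<lambda>g. apply_lie (w i) (\<lambda>h. f (h * g)))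
      + apply_lie X (a i) * apply_lie (w i) f)"
    by (subst lie_sum) (auto intro!: near_one_mult an wn sum.cong simp: lie_mult an wn)
  also have "\<dots> = (\<Sum>i<m. a i 1 * apply_lie (w i) (\<lambda>h. apply_lie X (\<lambda>g. f (h * g))))
      + (\<Sum>i<m. apply_lie X (a i) * apply_lie (w i) f)"
    by (simp add: sum.distrib lie_exchange[OF f])
  also have "(\<Sum>i<m. a i 1 * apply_lie (w i) (\<lambda>h. apply_lie X (\<lambda>g. f (h * g)))) = conv Y X f"
    unfolding conv_def using fun_cong[OF Ad, of 1] by (simp add: Ad_one apply_lie_sum)
  also have "(\<Sum>i<m. apply_lie X (a i) * apply_lie (w i) f) = apply_lie (vderiv X (\<lambda>g. Ad g Y)) f"
    unfolding Ad by (subst vderiv_eq) (auto simp: a apply_lie_sum)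
  finally show "apply_lie (vderiv X (\<lambda>g. Ad g Y)) f = apply_lie (bracket X Y) f"
    by (simp add: apply_bracket_lie f)
qed

section \<open>Derivatives along translations\<close>

lemma vderiv_lie_map:
  fixes \<gamma> :: "'t::complex_algebraic_group \<Rightarrow> 'k::complex_algebraic_group"
  assumes "morphism variety variety \<gamma>" "\<gamma> 1 = 1" "F \<in> regfun_in S"
  shows "vderiv (lie_map \<gamma> X) F = vderiv X (\<lambda>t. F (\<gamma> t))"
proof -
  obtain n :: nat and c w where F: "\<And>i. i < n \<Longrightarrow> c i \<in> regfun" 
    "F = (\<lambda>k. \<Sum>i<n. c i k *\<^sub>C w i)" using assms(3) by (rule regfun_inE) (rule that)
  have 1: "vderiv (lie_map \<gamma> X) F = (\<Sum>i<n. apply_lie (lie_map \<gamma> X) (c i) *\<^sub>C w i)"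
    unfolding F(2) by (rule vderiv_eq) (use F(1) in auto)
  have 2: "vderiv X (\<lambda>t. F (\<gamma> t)) = (\<Sum>i<n. apply_lie X (\<lambda>t. c i (\<gamma> t)) *\<^sub>C w i)"
    unfolding F(2) by (rule vderiv_eq) (use F(1) regfun_morphism[OF assms(1)] in auto)
  show ?thesis unfolding 1 2
    by (rule sum.cong[OF refl]) (simp add: lie_map_apply[OF assms(1,2)] F(1) regfun_near_one)
qed

text \<open>Differentiate the constant function k \<mapsto> c(k * inverse k), expanded by the
  comultiplication.\<close>

lemma lie_inverse:
  assumes c: "c \<in> regfun"
  shows "apply_lie X (\<lambda>k. c (inverse k)) = - apply_lie X c"
proof -
  obtain n :: nat and a b where ab: "\<And>i. i < n \<Longrightarrow> a i \<in> regfun" "\<And>i. i < n \<Longrightarrow> b i \<in> regfun"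
    "\<And>g h. c (g * h) = (\<Sum>i<n. a i g * b i h)" by (rule regfun_mult_expand[OF c]) (rule that)
  note n = regfun_near_one[OF ab(1)] regfun_near_one[OF regfun_inverse[OF ab(2)]]
  have "0 = apply_lie X (\<lambda>k. \<Sum>i<n. a i k * b i (inverse k))"
    by (simp flip: ab(3) add: group_simps lie_const)
  also have "\<dots> = (\<Sum>i<n. a i 1 * apply_lie X (\<lambda>k. b i (inverse k))) + (\<Sum>i<n. apply_lie X (a i) * b i 1)"
    by (subst lie_sum) (auto intro!: near_one_mult n sum.cong simp: lie_mult n group_simps sum.distrib[symmetric])
  also have "(\<Sum>i<n. a i 1 * apply_lie X (\<lambda>k. b i (inverse k))) = apply_lie X (\<lambda>k. \<Sum>i<n. a i 1 * b i (inverse k))"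
    by (subst lie_sum) (auto intro!: near_one_scale n simp: lie_scale n)
  also have "\<dots> = apply_lie X (\<lambda>k. c (inverse k))" by (simp flip: ab(3))
  also have "(\<Sum>i<n. apply_lie X (a i) * b i 1) = apply_lie X (\<lambda>k. \<Sum>i<n. b i 1 * a i k)"
    by (subst lie_sum) (auto intro!: near_one_scale n sum.cong simp: lie_scale n)
  also have "\<dots> = apply_lie X c" by (simp add: mult.commute flip: ab(3))
  finally show ?thesis by (simp add: eq_neg_iff_add_eq_0)
qed

lemma vderiv_inverse:
  assumes "F \<in> regfun_in S"
  shows "vderiv X (\<lambda>k. F (inverse k)) = - vderiv X F"
proof -
  obtain n :: nat and c w where F: "\<And>i. i < n \<Longrightarrow> c i \<in> regfun" 
    "F = (\<lambda>k. \<Sum>i<n. c i k *\<^sub>C w i)" using assms by (rule regfun_inE) (rule that)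
  have 1: "vderiv X F = (\<Sum>i<n. apply_lie X (c i) *\<^sub>C w i)"
    unfolding F(2) by (rule vderiv_eq) (use F(1) in auto)
  have 2: "vderiv X (\<lambda>k. F (inverse k)) = (\<Sum>i<n. apply_lie X (\<lambda>k. c i (inverse k)) *\<^sub>C w i)"
    unfolding F(2) by (rule vderiv_eq) (use F(1) regfun_inverse in auto)
  show ?thesis unfolding 1 2 by (simp add: lie_inverse F(1) sum_negf)
qed

lemma
  assumes "F \<in> regfun_in S"
  shows regfun_in_mult_left: "(\<lambda>k. F (a * k)) \<in> regfun_in S"
    and regfun_in_mult_right: "(\<lambda>k. F (k * a)) \<in> regfun_in S"
    and regfun_in_inverse_mult: "(\<lambda>k. F (inverse k * a)) \<in> regfun_in S"
  by (rule regfun_in_precompose[OF assms], erule regfun_mult_left regfun_mult_right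
      regfun_inverse[OF regfun_mult_right])+

text \<open>The infinitesimal left regular action of X, which is the second summand of
  \<lambda>(X).\<close>

definition left_deriv :: "'k::complex_algebraic_group lie \<Rightarrow> ('k \<Rightarrow> 'v::complex_vector) \<Rightarrow> 'k \<Rightarrow> 'v" where
  "left_deriv X F = (\<lambda>k. vderiv X (\<lambda>g. F (inverse g * k)))"

lemma left_deriv_eq:
  assumes "finite I" "\<And>i. i \<in> I \<Longrightarrow> c i \<in> regfun"
  shows "left_deriv X (\<lambda>k. \<Sum>i\<in>I. c i k *\<^sub>C w i) k = (\<Sum>i\<in>I. apply_lie X (\<lambda>g. c i (inverse g * k)) *\<^sub>C w i)"
  unfolding left_deriv_def
  by (rule vderiv_eq[OF assms(1)]) (rule regfun_inverse[OF regfun_mult_right[OF assms(2)]])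

text \<open>In c(gh) = \<Sum> a i(g) b i(h) the derivative falls on the factors a i and leaves
  constants; the dependence on k stays in the regular functions b i.\<close>

lemma regfun_left_deriv:
  assumes "c \<in> regfun"
  shows "(\<lambda>k. apply_lie X (\<lambda>g. c (inverse g * k))) \<in> regfun"
proof -
  obtain n :: nat and a b where ab: "\<And>i. i < n \<Longrightarrow> a i \<in> regfun" "\<And>i. i < n \<Longrightarrow> b i \<in> regfun"
    "\<And>g h. c (g * h) = (\<Sum>i<n. a i g * b i h)" by (rule regfun_mult_expand[OF assms]) (rule that)
  have "apply_lie X (\<lambda>g. c (inverse g * k)) = (\<Sum>i<n. b i k * apply_lie X (\<lambda>g. a i (inverse g)))" for k
    unfolding ab(3)
    using regfun_near_one[OF regfun_inverse[OF ab(1)]]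
    by (subst lie_sum) (auto intro: near_one_scale simp: lie_scale mult.commute)
  then show ?thesis using ab by (auto intro!: regfun_sum regfun_mult regfun_const)
qed

lemma left_deriv_in:
  assumes "F \<in> regfun_in S"
  shows "left_deriv X F \<in> regfun_in S"
proof -
  obtain n :: nat and c w where F: "\<And>i. i < n \<Longrightarrow> c i \<in> regfun" "\<And>i. i < n \<Longrightarrow> w i \<in> S"
    "F = (\<lambda>k. \<Sum>i<n. c i k *\<^sub>C w i)" using assms by (rule regfun_inE) (rule that)
  have "left_deriv X F = (\<lambda>k. \<Sum>i<n. apply_lie X (\<lambda>g. c i (inverse g * k)) *\<^sub>C w i)"
    unfolding F(3) by (rule ext, rule left_deriv_eq) (use F(1) in auto)
  also have "\<dots> \<in> regfun_in S"
    by (rule regfun_inI) (use F regfun_left_deriv in auto)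
  finally show ?thesis .
qed

lemma left_deriv_bracket:
  assumes "F \<in> regfun_in S"
  shows "left_deriv X (left_deriv Y F) k = left_deriv Y (left_deriv X F) k + left_deriv (bracket X Y) F k"
proof -
  obtain n :: nat and c w where F: "\<And>i. i < n \<Longrightarrow> c i \<in> regfun" 
    "F = (\<lambda>k. \<Sum>i<n. c i k *\<^sub>C w i)" using assms by (rule regfun_inE) (rule that)
  have 1: "left_deriv X F = (\<lambda>k. \<Sum>i<n. apply_lie X (\<lambda>g. c i (inverse g * k)) *\<^sub>C w i)" for X
    unfolding F(2) by (rule ext, rule left_deriv_eq) (use F(1) in auto)
  \<comment> \<open>The iterated derivative evaluates c at inverse h * inverse g * k = inverse (g *
    h) * k, which is the pattern of \<open>conv\<close> in the order X, Y.\<close>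
  have 2: "left_deriv X (left_deriv Y F) k = (\<Sum>i<n. conv X Y (\<lambda>g. c i (inverse g * k)) *\<^sub>C w i)" for X Y
    unfolding 1[of Y] conv_def
    by (subst left_deriv_eq) (use F(1) regfun_left_deriv in \<open>auto simp: group_simps mult.assoc\<close>)
  have "c i \<in> regfun \<Longrightarrow> (\<lambda>g. c i (inverse g * k)) \<in> near_one" for i
    by (rule regfun_near_one[OF regfun_inverse[OF regfun_mult_right]])
  then have "apply_lie (bracket X Y) (\<lambda>g. c i (inverse g * k)) = 
     conv X Y (\<lambda>g. c i (inverse g * k)) - conv Y X (\<lambda>g. c i (inverse g * k))" if "i < n" for i
    using F(1)[OF that] by (simp add: apply_bracket_lie)
  then show ?thesis unfolding 2 1[of "bracket X Y"] by (simp flip: sum.distrib scaleC_add_left)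
qed

text \<open>For x = k h inverse k one has inverse x * k = k * inverse h: left translation in the
  direction Ad(k) X is right translation in the direction -X. This links \<lambda> with the action
  of K on \<Gamma>(W).\<close>

lemma left_deriv_Ad:
  assumes "F \<in> regfun_in S"
  shows "left_deriv (Ad k X) F k = - vderiv X (\<lambda>g. F (k * g))"
proof -
  have 1: "k * 1 * inverse k = 1" by (simp add: group_simps)
  have "left_deriv (Ad k X) F k = vderiv X (\<lambda>h. F (k * inverse h))"
    unfolding left_deriv_def Ad_def
    by (subst vderiv_lie_map[OF morphism_conj 1 regfun_in_inverse_mult[OF assms]])
      (simp add: group_simps mult.assoc)
  then show ?thesis using vderiv_inverse[OF regfun_in_mult_left[OF assms], of X k] by simp
qed

section \<open>Presented algebras\<close>

lemma presented_induct [case_names gen scalar plus times]: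
  assumes "\<And>g. P (gen g)" "\<And>c. P (c *\<^sub>C 1)" "\<And>x y. P x \<Longrightarrow> P y \<Longrightarrow> P (x + y)"
    "\<And>x y. P x \<Longrightarrow> P y \<Longrightarrow> P (x * y)"
  shows "P x"
proof -
  have "P (abs_presented t)" for t
    by (induction t) (simp_all only: abs_presented_simps assms)
  then show ?thesis using presented_rep[of x] by metis
qed

lemma
  assumes S: "complex_vector.subspace S" and r: "\<And>g. lin_on S S (r g)"
  shows eval_act_lin: "lin_on S S (eval_act r t)"
proof (induction t)
  case (Scalar c)
  show ?case by (rule lin_onI)
    (simp_all add: complex_vector.subspace_scale[OF S] scaleC_add_right complex_vector.scale_left_commute)
next
  case (Plus s t)
  then show ?case by (intro lin_onI)
    (simp_all add: lin_on_in[OF Plus(1)] lin_on_in[OF Plus(2)] lin_on_add[OF Plus(1)] lin_on_add[OF Plus(2)]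
      lin_on_scale[OF Plus(1)] lin_on_scale[OF Plus(2)] complex_vector.subspace_add[OF S] scaleC_add_right)
next
  case (Times s t)
  then show ?case by (intro lin_onI)
    (simp_all add: lin_on_in[OF Times(1)] lin_on_in[OF Times(2)] lin_on_add[OF Times(1)] lin_on_add[OF Times(2)]
      lin_on_scale[OF Times(1)] lin_on_scale[OF Times(2)])
next
  case (Gen g)
  have "eval_act r (Gen g) = r g" by (rule ext) simp
  then show ?case using r by simp
qed

text \<open>The operators are linear, and the relations hold, only on an invariant subspace S; the
  comparison of equivalent terms therefore carries v \<in> S through the induction.\<close>

lemma eval_act_aeq:
  assumes S: "complex_vector.subspace S" and r: "\<And>g. lin_on S S (r g)"
    and rel: "\<And>s t v. relator s t \<Longrightarrow> v \<in> S \<Longrightarrow> eval_act r s v = eval_act r t v"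
  shows "aeq s t \<Longrightarrow> v \<in> S \<Longrightarrow> eval_act r s v = eval_act r t v"
proof (induction arbitrary: v rule: aeq.induct)
  case (aeq_times_cong s s' t t')
  then show ?case using lin_on_in[OF eval_act_lin[of S r, OF S r]] by simp
next
  case (aeq_distrib_left s t u)
  then show ?case
    by (simp add: lin_on_add[OF eval_act_lin[of S r, OF S r]] lin_on_in[OF eval_act_lin[of S r, OF S r]])
next
  case (aeq_scalar_central a s)
  then show ?case by (simp add: lin_on_scale[OF eval_act_lin[of S r, OF S r]])
qed (simp_all add: rel scaleC_add_left scaleC_add_right scaleC_scaleC add_ac)

lemma alg_act_gen:
  assumes "complex_vector.subspace S" "\<And>g. lin_on S S (r g)"
    "\<And>s t v. relator s t \<Longrightarrow> v \<in> S \<Longrightarrow> eval_act r s v = eval_act r t v" "v \<in> S"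
  shows "alg_act r (gen g) v = r g v"
proof -
  have "aeq (rep_presented (gen g)) (Gen g)"
    using aeq_rep_abs[of "Gen g"] by (simp add: gen.abs_eq)
  then show ?thesis
    unfolding alg_act_def using eval_act_aeq[of S r, OF assms(1-3) _ assms(4)] by fastforce
qed

section \<open>Functoriality of the standard complex\<close>

definition lie_hom :: "('l::complex_lie_algebra \<Rightarrow> 'm::complex_lie_algebra) \<Rightarrow> bool" where
  "lie_hom h \<longleftrightarrow> (\<forall>x y. h (x + y) = h x + h y) \<and> (\<forall>c x. h (c *\<^sub>C x) = c *\<^sub>C h x)
     \<and> (\<forall>x y. h (bracket x y) = bracket (h x) (h y))"

lemma lie_hom_Ad: "lie_hom (Ad k)"
  by (simp add: lie_hom_def Ad_add Ad_scale Ad_bracket)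

lemma lie_hom_lie_map:
  "morphism variety variety \<gamma> \<Longrightarrow> (\<And>s t. \<gamma> (s * t) = \<gamma> s * \<gamma> t) \<Longrightarrow> lie_hom (lie_map \<gamma>)"
  by (simp add: lie_hom_def lie_map_add lie_map_scale lie_map_bracket group_hom(1))

lemma N_map_relator:
  assumes h: "lie_hom h"
  shows "relator s t \<Longrightarrow> eval_alg (\<lambda>g. case g of Ev x \<Rightarrow> N_ev (h x) | Od x \<Rightarrow> N_od (h x)) s
    = eval_alg (\<lambda>g. case g of Ev x \<Rightarrow> N_ev (h x) | Od x \<Rightarrow> N_od (h x)) t"
  unfolding relator_ngen_def
proof (induction rule: nrel.induct)
  case (5 x y)
  show ?case using N_relations(5)[of "h x" "h y"] h by (simp add: lie_hom_def)
next
  case (6 x y)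
  show ?case using N_relations(6)[of "h x" "h y"] h by (simp add: lie_hom_def)
qed (use h in \<open>simp_all add: lie_hom_def N_relations(1-4,7) scaleC_mult_left\<close>)

lemma N_map_simps:
  fixes x y :: "'l::complex_lie_algebra N" and h :: "'l \<Rightarrow> 'm::complex_lie_algebra"
  assumes h: "lie_hom h"
  shows "N_map h (x + y) = N_map h x + N_map h y" "N_map h (x * y) = N_map h x * N_map h y"
    "N_map h (c *\<^sub>C x) = c *\<^sub>C N_map h x" "N_map h 1 = 1"
    "N_map h (N_ev z) = N_ev (h z)" "N_map h (N_od z) = N_od (h z)"
  unfolding N_map_def by (simp_all add: alg_hom[OF N_map_relator[OF h]])

lemma N_map_lin: "lie_hom h \<Longrightarrow> lin_on UNIV UNIV (N_map h)"
  by (simp add: lin_on_def N_map_simps)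

lemma N_map_zero: "lie_hom h \<Longrightarrow> N_map h 0 = 0"
  using N_map_simps(3)[of h 0 0] by simp

lemma N_map_compose:
  assumes "lie_hom h" "lie_hom h'"
  shows "N_map h' (N_map h x) = N_map (\<lambda>z. h' (h z)) x"
proof -
  have hh: "lie_hom (\<lambda>z. h' (h z))" using assms by (simp add: lie_hom_def)
  show ?thesis
  proof (induction x rule: presented_induct)
    case (gen g)
    show ?case by (cases g) (simp_all add: N_map_simps assms hh)
  qed (simp_all add: N_map_simps assms hh)
qed

lemma N_map_ident: "N_map (\<lambda>z. z) x = x"
proof -
  have hh: "lie_hom (\<lambda>z. z :: 'a)" by (simp add: lie_hom_def)
  show ?thesis
  proof (induction x rule: presented_induct)
    case (gen g)
    show ?case by (cases g) (simp_all add: N_map_simps hh)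
  qed (simp_all add: N_map_simps hh)
qed

lemma
  fixes k l :: "'k::complex_algebraic_group"
  shows N_map_Ad_one: "N_map (Ad (1::'k)) x = x"
    and N_map_Ad_mult: "N_map (Ad (k * l)) x = N_map (Ad k) (N_map (Ad l) x)"
proof -
  have "Ad (1::'k) = (\<lambda>z. z)" by (rule ext) (rule Ad_one)
  then show "N_map (Ad (1::'k)) x = x" by (simp add: N_map_ident)
  have "Ad (k * l) = (\<lambda>z. Ad k (Ad l z))" by (rule ext) (rule Ad_mult)
  then show "N_map (Ad (k * l)) x = N_map (Ad k) (N_map (Ad l) x)"
    by (simp add: N_map_compose lie_hom_Ad)
qed

lemma N_map_parity: "lie_hom h \<Longrightarrow> N_parity (N_map h x) = N_map h (N_parity x)"
proof (induction x rule: presented_induct)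
  case (gen g)
  then show ?case using N_map_simps(3)[of h "-1"] by (cases g) (simp_all add: N_map_simps N_parity_hom)
qed (simp_all add: N_map_simps N_parity_hom)

lemma N_map_diff: "lie_hom h \<Longrightarrow> N_diff (N_map h x) = N_map h (N_diff x)"
proof (induction x rule: presented_induct)
  case (gen g)
  then show ?case by (cases g) (simp_all add: N_map_simps N_diff_simps N_map_zero)
qed (simp_all add: N_map_simps N_diff_simps N_map_parity N_map_zero)

text \<open>Induction over arbitrary products needs a product rule for \<iota> that does not assume
  homogeneous factors; \<open>iota_pair\<close> has one because it keeps the even and odd parts
  apart.\<close>

lemma N_map_iota:
  assumes h: "lie_hom h"
  shows "iota (N_map h x) = N_map h (iota x)"
proof -
  have m: "N_map h (- y) = - N_map h y" "N_map h (y - z) = N_map h y - N_map h z" for y z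
    using lin_on_uminus[OF N_map_lin[OF h]] lin_on_diff[OF N_map_lin[OF h] complex_vector.subspace_UNIV] by auto
  have "iota_pair (N_map h x) = (N_map h (fst (iota_pair x)), N_map h (snd (iota_pair x)))"
  proof (induction x rule: presented_induct)
    case (gen g)
    show ?case by (cases g) (simp_all add: N_map_simps h iota_pair_lin m N_map_zero)
  qed (simp_all add: N_map_simps h iota_pair_lin iota_pair_mult m N_map_zero)
  then show ?thesis by (simp add: iota_def flip: iota_pair_def) (simp add: N_map_simps h)
qed

section \<open>The grading of the standard complex\<close>

lemma U_to_N_relator:
  "relator s t \<Longrightarrow> eval_alg (\<lambda>g. case g of UGen x \<Rightarrow> N_ev x) s = eval_alg (\<lambda>g. case g of UGen x \<Rightarrow> N_ev x) t"
  unfolding relator_ugen_def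
proof (induction rule: urel.induct)
  case (3 x y)
  show ?case using N_relations(5)[of x y] by simp
qed (simp_all add: N_relations(1,2) scaleC_mult_left)

lemma U_to_N_simps:
  fixes u v :: "'l::complex_lie_algebra U" and x :: 'l
  shows "U_to_N (U_in x) = N_ev x" "U_to_N (1 :: 'l U) = 1" "U_to_N (u + v) = U_to_N u + U_to_N v"
    "U_to_N (u * v) = U_to_N u * U_to_N v" "U_to_N (c *\<^sub>C u) = c *\<^sub>C U_to_N u"
  unfolding U_to_N_def by (simp_all add: alg_hom[OF U_to_N_relator])

lemma N_deg_subspace: "complex_vector.subspace (N_deg j)"
  by (simp add: N_deg_def complex_vector.subspace_single_0)

lemmas N_deg_zero = complex_vector.subspace_0[OF N_deg_subspace]
  and N_deg_add = complex_vector.subspace_add[OF N_deg_subspace]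
  and N_deg_scale = complex_vector.subspace_scale[OF N_deg_subspace]
  and N_deg_neg = complex_vector.subspace_neg[OF N_deg_subspace]
  and N_deg_minus = complex_vector.subspace_diff[OF N_deg_subspace]

lemma N_deg_word: "U_to_N u * prod_list (map N_od xs) \<in> N_deg (- int (length xs))"
  unfolding N_deg_def by (auto intro!: complex_vector.span_base)

lemma N_deg_span_induct [consumes 1, case_names zero add]:
  assumes "x \<in> N_deg j" "P 0"
    "\<And>c u xs y. j = - int (length xs) \<Longrightarrow> y \<in> N_deg j \<Longrightarrow> P y \<Longrightarrow> P (c *\<^sub>C (U_to_N u * prod_list (map N_od xs)) + y)"
  shows "P x"
proof (cases "j \<le> 0")
  case False
  then show ?thesis using assms(1,2) by (simp add: N_deg_def)
next
  case True
  have "x \<in> complex_vector.span {U_to_N u * prod_list (map N_od xs) | u xs. int (length xs) = - j}"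
    using assms(1) True by (simp add: N_deg_def)
  then show ?thesis
  proof (induction rule: span_induct_strong)
    case (add c x y)
    then obtain u xs where "x = U_to_N u * prod_list (map N_od xs)" "int (length xs) = - j" by blast
    moreover have "y \<in> N_deg j" using add(2) True by (simp add: N_deg_def)
    ultimately show ?case using assms(3)[of xs y c u] add(3) by simp
  qed (rule assms(2))
qed

lemma N_deg_U_mult:
  assumes "y \<in> N_deg j"
  shows "U_to_N u * y \<in> N_deg j"
  using assms
proof (induction rule: N_deg_span_induct)
  case (add c v xs y)
  have "U_to_N u * (c *\<^sub>C (U_to_N v * prod_list (map N_od xs)) + y)
     = c *\<^sub>C (U_to_N (u * v) * prod_list (map N_od xs)) + U_to_N u * y"
    by (simp add: U_to_N_simps distrib_left scaleC_mult_right mult.assoc)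
  with add show ?case using N_deg_word[of "u * v" xs] by (simp add: N_deg_add N_deg_scale)
qed (simp add: N_deg_zero)

lemma N_deg_ev_mult: "y \<in> N_deg j \<Longrightarrow> N_ev x * y \<in> N_deg j"
  using N_deg_U_mult[of y j "U_in x"] by (simp add: U_to_N_simps)

text \<open>The words spanning \<open>N_deg\<close> have U(k) in front, so an odd generator
  multiplied from the left must cross U(k). Crossing is shown by induction on u; for a product it
  uses that the span ?M of elements \<open>U_to_N v * N_od z\<close> is stable under right
  multiplication by every factor that the odd generators can already cross.\<close>

lemma N_deg_od_mult:
  fixes y :: "'l::complex_lie_algebra N"
  assumes "y \<in> N_deg j"
  shows "N_od x * y \<in> N_deg (j - 1)"
proof -
  let ?M = "complex_vector.span {U_to_N v * N_od z | v (z::'l). True}"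
  have MU: "m * U_to_N u \<in> ?M" if od: "\<And>z::'l. N_od z * U_to_N u \<in> ?M" and "m \<in> ?M" for u m
    using that(2)
  proof (induction rule: span_induct_strong)
    case (add c m n)
    then obtain v z where m: "m = U_to_N v * N_od z" by blast
    have "U_to_N v * k \<in> ?M" if "k \<in> ?M" for k
      using that
    proof (induction rule: span_induct_strong)
      case (add d k l)
      then obtain w z' where "k = U_to_N w * N_od z'" by blast
      then have "U_to_N v * (d *\<^sub>C k + l) = d *\<^sub>C (U_to_N (v * w) * N_od z') + U_to_N v * l"
        by (simp add: U_to_N_simps distrib_left scaleC_mult_right mult.assoc)
      moreover have "U_to_N (v * w) * N_od z' \<in> ?M" by (rule complex_vector.span_base) blast
      ultimately show ?case using add(3) by (simp add: complex_vector.span_add complex_vector.span_scale)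
    qed (simp add: complex_vector.span_zero)
    from this[OF od[of z]] have "m * U_to_N u \<in> ?M" by (simp add: m mult.assoc)
    then show ?case using add(3)
      by (simp add: distrib_right scaleC_mult_left complex_vector.span_add complex_vector.span_scale)
  qed (simp add: complex_vector.span_zero)
  have od: "N_od z * U_to_N u \<in> ?M" for u and z :: 'l
  proof (induction u arbitrary: z rule: presented_induct)
    case (gen g)
    obtain w where g: "g = UGen w" by (cases g)
    have "N_od z * U_to_N (gen g) = U_to_N (U_in w) * N_od z - U_to_N 1 * N_od (bracket w z)"
      using N_relations(6)[of w z] by (simp add: g U_to_N_simps)
    also have "\<dots> \<in> ?M" by (intro complex_vector.span_diff complex_vector.span_base) blast+
    finally show ?case .
  next
    case (scalar c)
    have "N_od z * U_to_N (c *\<^sub>C 1) = c *\<^sub>C (U_to_N 1 * N_od z)"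
      by (simp add: U_to_N_simps scaleC_mult_right)
    also have "\<dots> \<in> ?M" by (intro complex_vector.span_scale complex_vector.span_base) blast
    finally show ?case .
  next
    case (plus u v)
    then show ?case by (simp add: U_to_N_simps distrib_left complex_vector.span_add)
  next
    case (times u v)
    have "N_od z * U_to_N (u * v) = (N_od z * U_to_N u) * U_to_N v" by (simp add: U_to_N_simps mult.assoc)
    then show ?case using MU[OF times(2) times(1)] by simp
  qed
  show ?thesis using assms
  proof (induction rule: N_deg_span_induct)
    case (add c u xs y)
    have "m * prod_list (map N_od xs) \<in> N_deg (j - 1)" if "m \<in> ?M" for m
      using that
    proof (induction rule: span_induct_strong)
      case (add d m n)
      then obtain v z where m: "m = U_to_N v * N_od z" by blast
      have "U_to_N v * prod_list (map N_od (z # xs)) \<in> N_deg (j - 1)"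
        using N_deg_word[of v "z # xs"] \<open>j = - int (length xs)\<close> 
        by (metis add_uminus_conv_diff length_Cons minus_add_distrib of_nat_Suc add.commute)
      then have "m * prod_list (map N_od xs) \<in> N_deg (j - 1)"
        by (simp add: m mult.assoc)
      then show ?case using add(3) by (simp add: distrib_right scaleC_mult_left N_deg_add N_deg_scale)
    qed (simp add: N_deg_zero)
    from this[OF od[of x u]] show ?case using add(3)
      by (simp add: distrib_left scaleC_mult_right N_deg_add N_deg_scale mult.assoc)
  qed (simp add: N_deg_zero)
qed

lemma N_deg_one: "1 \<in> N_deg 0"
  using N_deg_word[of 1 "[]"] by (simp add: U_to_N_simps)

lemma N_deg_ev: "N_ev x \<in> N_deg 0"
  using N_deg_ev_mult[OF N_deg_one] by simp

lemma N_deg_od: "N_od x \<in> N_deg (- 1)"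
  using N_deg_od_mult[OF N_deg_one] by simp

text \<open>Every homogeneous element is built from 1 by linear combinations and left multiplication
  by generators. The predicate depends on the degree because odd generators lower it.\<close>

lemma N_deg_induct [consumes 1, case_names zero one add scale ev od]:
  fixes x :: "'l::complex_lie_algebra N"
  assumes x: "x \<in> N_deg j" and zero: "\<And>j. P j 0" and one: "P 0 1"
    and add: "\<And>j x y. x \<in> N_deg j \<Longrightarrow> y \<in> N_deg j \<Longrightarrow> P j x \<Longrightarrow> P j y \<Longrightarrow> P j (x + y)"
    and scale: "\<And>j c x. x \<in> N_deg j \<Longrightarrow> P j x \<Longrightarrow> P j (c *\<^sub>C x)"
    and ev: "\<And>j x y. y \<in> N_deg j \<Longrightarrow> P j y \<Longrightarrow> P j (N_ev x * y)"
    and od: "\<And>j x y. y \<in> N_deg j \<Longrightarrow> P j y \<Longrightarrow> P (j - 1) (N_od x * y)"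
  shows "P j x"
proof -
  have 1: "prod_list (map N_od xs) \<in> N_deg (- int (length xs)) \<and> P (- int (length xs)) (prod_list (map N_od xs))"
    for xs :: "'l list"
  proof (induction xs)
    case (Cons x xs)
    have e: "- int (length (x # xs)) = - int (length xs) - 1" by simp
    show ?case unfolding e
      using Cons od[of "prod_list (map N_od xs)" "- int (length xs)" x] N_deg_od_mult[of "prod_list (map N_od xs)" "- int (length xs)" x]
      by simp
  qed (simp add: one N_deg_one)
  have 2: "P j y \<Longrightarrow> y \<in> N_deg j \<Longrightarrow> P j (U_to_N u * y)" for u y j
  proof (induction u arbitrary: y rule: presented_induct)
    case (gen g)
    then show ?case by (cases g) (simp add: U_to_N_simps ev)
  qed (simp_all add: U_to_N_simps scaleC_mult_left scale distrib_right add N_deg_U_mult mult.assoc)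
  show ?thesis
    using x
  proof (induction rule: N_deg_span_induct)
    case (add c u xs y)
    then show ?case
      using 1[of xs] 2 by (simp add: assms(4) scale N_deg_word N_deg_scale N_deg_U_mult)
  qed (rule zero)
qed

lemma N_deg_mult:
  assumes "x \<in> N_deg i" "y \<in> N_deg j"
  shows "x * y \<in> N_deg (i + j)"
  using assms(1)
proof (induction rule: N_deg_induct)
  case (od i x z)
  then show ?case using N_deg_od_mult[OF od(2), of x] by (simp add: mult.assoc algebra_simps)
qed (simp_all add: N_deg_zero assms(2) distrib_right N_deg_add scaleC_mult_left N_deg_scale mult.assoc N_deg_ev_mult)

section \<open>The differential, functoriality and the antiautomorphism in each degree\<close>

lemma N_diff_zero: "N_diff 0 = 0"
  using N_diff_simps(5)[of 0 0] by simp

lemma iota_zero: "iota 0 = 0"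
  using iota_simps(5)[of 0 0] by simp

lemma N_diff_lin: "lin_on UNIV UNIV N_diff"
  by (simp add: lin_on_def N_diff_simps)

lemma iota_lin: "lin_on UNIV UNIV iota"
  by (simp add: lin_on_def iota_simps)

lemma N_diff_in_deg:
  assumes "x \<in> N_deg j"
  shows "N_diff x \<in> N_deg (j + 1)"
  using assms
proof (induction rule: N_deg_induct)
  case (od j x y)
  have "N_od x * N_diff y \<in> N_deg j" using N_deg_od_mult[OF od(2)] by simp
  then show ?case using N_deg_minus[OF N_deg_ev_mult[OF od(1), of x]] by (simp add: N_diff_simps N_parity_hom)
qed (simp_all add: N_diff_zero N_diff_simps N_deg_zero N_deg_add N_deg_scale N_deg_ev_mult N_parity_hom)

lemma N_map_in_deg:
  assumes h: "lie_hom h" and "x \<in> N_deg j"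
  shows "N_map h x \<in> N_deg j"
  using assms(2)
  by (induction rule: N_deg_induct)
    (simp_all add: N_map_simps h N_map_zero N_deg_zero N_deg_one N_deg_add N_deg_scale N_deg_ev_mult N_deg_od_mult)

lemma iota_in_deg:
  assumes "x \<in> N_deg j"
  shows "iota x \<in> N_deg j"
  using assms
proof (induction rule: N_deg_induct)
  case (ev j x y)
  then show ?case using iota_mult[OF N_deg_ev ev(1), of x] N_deg_mult[OF ev(2) N_deg_ev, of x]
    by (simp add: iota_simps N_deg_neg scaleC_one)
next
  case (od j x y)
  then show ?case using iota_mult[OF N_deg_od od(1), of x] N_deg_mult[OF od(2) N_deg_od, of x]
    by (simp add: iota_simps N_deg_neg N_deg_scale)
qed (simp_all add: iota_zero iota_simps N_deg_zero N_deg_one N_deg_add N_deg_scale)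

lemma neg_one_powi: 
  "(- 1) powi a * (- 1) powi b = ((- 1) powi (a + b) :: complex)"
  by (simp add: power_int_add)

text \<open>Most sign comparisons below are settled by comparing the parities of two
  exponents.\<close>

lemma neg_one_powi_cong: "even a = even b \<Longrightarrow> (- 1) powi a = ((- 1) powi b :: complex)"
  by (cases "even a") (simp_all add: power_int_minus_left)

lemma neg_one_powi_scale: "(- 1) powi a *\<^sub>C ((- 1) powi b *\<^sub>C (x::'v::complex_vector)) = (- 1) powi (a + b) *\<^sub>C x"
  by (simp add: scaleC_scaleC neg_one_powi)

lemma neg_one_powi_even: "even a \<Longrightarrow> (- 1) powi a = (1 :: complex)"
  by (simp add: power_int_minus_left)

lemma iota_iota:
  assumes "x \<in> N_deg j"
  shows "iota (iota x) = x"
  using assms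
proof (induction rule: N_deg_induct)
  case (ev j x y)
  have "iota (N_ev x * y) = - (iota y * N_ev x)"
    using iota_mult[OF N_deg_ev ev(1), of x] by (simp add: iota_simps scaleC_one)
  moreover have "iota (iota y * N_ev x) = - (N_ev x * y)"
    using iota_mult[OF iota_in_deg[OF ev(1)] N_deg_ev, of x] ev(2) by (simp add: iota_simps scaleC_one)
  ultimately show ?case using lin_on_uminus[OF iota_lin, of "iota y * N_ev x"] by simp
next
  case (od j x y)
  have "iota (N_od x * y) = (- 1) powi j *\<^sub>C - (iota y * N_od x)"
    using iota_mult[OF N_deg_od od(1), of x] by (simp add: iota_simps neg_one_powi_cong[of "- j" j])
  moreover have "iota (iota y * N_od x) = (- 1) powi j *\<^sub>C - (N_od x * y)"
    using iota_mult[OF iota_in_deg[OF od(1)] N_deg_od, of x] od(2) by (simp add: iota_simps neg_one_powi_cong[of "- j" j])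
  moreover have "iota (- z) = - iota z" for z :: "'a N" using lin_on_uminus[OF iota_lin, of z] by simp
  ultimately show ?case
    by (simp add: iota_simps scaleC_scaleC neg_one_powi neg_one_powi_cong[of "j + j" 0] scaleC_one)
qed (simp_all add: iota_zero iota_simps)

lemma N_diff_iota:
  assumes "x \<in> N_deg j"
  shows "N_diff (iota x) = iota (N_diff x)"
  using assms
proof (induction rule: N_deg_induct)
  case (ev j x y)
  have "iota (N_ev x * y) = - (iota y * N_ev x)" "iota (N_ev x * N_diff y) = - (iota (N_diff y) * N_ev x)"
    using iota_mult[OF N_deg_ev ev(1), of x] iota_mult[OF N_deg_ev N_diff_in_deg[OF ev(1)], of x]
    by (simp_all add: iota_simps scaleC_one)
  moreover have "N_diff (iota y * N_ev x) = iota (N_diff y) * N_ev x"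
    by (simp add: N_diff_simps ev(2))
  ultimately show ?case using lin_on_uminus[OF N_diff_lin, of "iota y * N_ev x"]
    by (simp add: N_diff_simps N_parity_hom)
next
  case (od j x y)
  have "iota (N_od x * y) = (- 1) powi j *\<^sub>C - (iota y * N_od x)"
    "iota (N_od x * N_diff y) = (- 1) powi (j + 1) *\<^sub>C - (iota (N_diff y) * N_od x)"
    "iota (N_ev x * y) = - (iota y * N_ev x)"
    using iota_mult[OF N_deg_od od(1), of x] iota_mult[OF N_deg_od N_diff_in_deg[OF od(1)], of x]
      iota_mult[OF N_deg_ev od(1), of x]
    by (simp_all add: iota_simps scaleC_one neg_one_powi_cong[of "- j" j] neg_one_powi_cong[of "- j - 1" "j + 1"])
  moreover have "N_diff (iota y * N_od x) = iota (N_diff y) * N_od x + (- 1) powi j *\<^sub>C (iota y * N_ev x)"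
    using N_diff_mult[OF iota_in_deg[OF od(1)], of "N_od x"] by (simp add: N_diff_simps od(2))
  moreover have "(- 1) powi (j + 1) = - ((- 1) powi j :: complex)" by (simp add: power_int_add)
  moreover have "iota (- z) = - iota z" "iota (z - z') = iota z - iota z'" for z z' :: "'a N"
    using lin_on_uminus[OF iota_lin, of z] lin_on_diff[OF iota_lin complex_vector.subspace_UNIV, of z z'] by simp_all
  moreover have "N_diff (- z) = - N_diff z" for z :: "'a N" using lin_on_uminus[OF N_diff_lin, of z] by simp
  ultimately show ?case
    by (simp add: N_diff_simps N_parity_hom scaleC_add_right scaleC_scaleC neg_one_powi
       neg_one_powi_cong[of "j + j" 0] scaleC_one)
qed (simp_all add: iota_zero N_diff_zero iota_simps N_diff_simps)

lemma N_diff_parity: "N_parity (N_diff x) = - N_diff (N_parity x)"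
proof (induction x rule: presented_induct)
  case (gen g)
  have "N_diff (- z) = - N_diff z" for z :: "'a N" using lin_on_uminus[OF N_diff_lin, of z] by simp
  then show ?case by (cases g) (simp_all add: N_parity_hom N_diff_simps N_parity_zero)
qed (simp_all add: N_parity_hom N_diff_simps N_parity_zero)

lemma N_diff_diff: "N_diff (N_diff x) = 0"
proof (induction x rule: presented_induct)
  case (gen g)
  show ?case by (cases g) (simp_all add: N_diff_simps N_diff_zero)
qed (simp_all add: N_diff_simps N_diff_zero N_diff_parity)

section \<open>Finite generation over the enveloping algebra\<close>

lemma N_od_square: "N_od x * N_od (x::'l::complex_lie_algebra) = 0"
proof -
  have "2 *\<^sub>C (N_od x * N_od x) = 0"
    using N_relations(7)[of x x] scaleC_add_left[of 1 1 "N_od x * N_od x"] by (simp add: scaleC_one)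
  then show ?thesis by simp
qed

text \<open>Anticommutation moves two equal factors next to each other, where
  \<open>N_od_square\<close> applies.\<close>

lemma N_od_prod_zero:
  assumes "\<not> distinct xs"
  shows "prod_list (map N_od xs) = (0 :: 'l::complex_lie_algebra N)"
proof -
  obtain as y bs cs where xs: "xs = as @ [y] @ bs @ [y] @ cs"
    using assms not_distinct_decomp by blast
  have anti: "N_od z * N_od y = - (N_od y * N_od z)" for z
    using N_relations(7)[of z y] by (simp add: eq_neg_iff_add_eq_0)
  have "prod_list (map N_od bs) * N_od y = (- 1) ^ length bs *\<^sub>C (N_od y * prod_list (map N_od bs))" for bs
  proof (induction bs)
    case (Cons b bs)
    have "prod_list (map N_od (b # bs)) * N_od y = N_od b * (prod_list (map N_od bs) * N_od y)"
      by (simp add: mult.assoc)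
    also have "\<dots> = (- 1) ^ length bs *\<^sub>C ((N_od b * N_od y) * prod_list (map N_od bs))"
      unfolding Cons by (simp add: scaleC_mult_right mult.assoc)
    finally show ?case unfolding anti by (simp add: mult.assoc)
  qed (simp add: scaleC_one)
  then have "N_od y * prod_list (map N_od bs) * N_od y
      = (- 1) ^ length bs *\<^sub>C (N_od y * N_od y * prod_list (map N_od bs))"
    by (simp add: mult.assoc scaleC_mult_right)
  also have "\<dots> = 0" by (simp add: N_od_square)
  finally have "prod_list (map N_od as) * (N_od y * prod_list (map N_od bs) * N_od y) * prod_list (map N_od cs) = 0"
    by simp
  then show ?thesis unfolding xs by (simp add: mult.assoc)
qed

text \<open>Products of odd basis vectors of length at most \<open>card B\<close> generate, since a
  longer word repeats a letter and vanishes. The degree is recorded with each generator so that one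
  finite set covers all degrees.\<close>

lemma N_deg_finitely_generated:
  fixes B :: "'l::complex_lie_algebra set"
  assumes B: "finite B" "complex_vector.span B = UNIV"
  obtains E :: "(int \<times> 'l N) set" where "finite E" "\<And>j e. (j, e) \<in> E \<Longrightarrow> e \<in> N_deg j"
    "\<And>j n. n \<in> N_deg j \<Longrightarrow> n \<in> complex_vector.span {U_to_N u * e | u e. (j, e) \<in> E}"
proof -
  define L where "L = {xs. set xs \<subseteq> B \<and> length xs \<le> card B}"
  define E where "E = (\<lambda>xs. (- int (length xs), prod_list (map N_od xs))) ` L"
  have fin: "finite E" unfolding E_def L_def using finite_lists_length_le[OF B(1)] by simp
  let ?Q = "\<lambda>m. complex_vector.span {prod_list (map N_od ys) | ys. set ys \<subseteq> B \<and> length ys = m}"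
  have 1: "N_od x * y \<in> ?Q (Suc m)" if "y \<in> ?Q m" for x y m
  proof -
    have "x \<in> complex_vector.span B" using B(2) by simp
    then show ?thesis
    proof (induction rule: span_induct_strong)
      case zero
      show ?case using N_relations(4)[of 0 "0::'l"] by (simp add: complex_vector.span_zero)
    next
      case (add c b x)
      have "N_od b * y \<in> ?Q (Suc m)"
        using that
      proof (induction rule: span_induct_strong)
        case (add d y z)
        then obtain ys where ys: "y = prod_list (map N_od ys)" "set ys \<subseteq> B" "length ys = m" by blast
        have "N_od b * y \<in> ?Q (Suc m)"
          by (rule complex_vector.span_base, rule CollectI, rule exI[of _ "b # ys"]) (use ys \<open>b \<in> B\<close> in simp)
        then show ?case using add(3)
          by (simp add: distrib_left scaleC_mult_right complex_vector.span_add complex_vector.span_scale)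
      qed (simp add: complex_vector.span_zero)
      then show ?case using add(3)
        by (simp add: N_relations(3,4) distrib_right scaleC_mult_left complex_vector.span_add complex_vector.span_scale)
    qed
  qed
  have 2: "prod_list (map N_od xs) \<in> ?Q (length xs)" for xs :: "'l list"
  proof (induction xs)
    case Nil
    show ?case by (rule complex_vector.span_base) auto
  next
    case (Cons x xs)
    then show ?case using 1 by simp
  qed
  have 3: "U_to_N u * y \<in> complex_vector.span {U_to_N u * e | u e. (- int m, e) \<in> E}" (is "_ \<in> ?S")
    if "y \<in> ?Q m" for u y m
    using that
  proof (induction rule: span_induct_strong)
    case (add c y z)
    then obtain ys where ys: "y = prod_list (map N_od ys)" "set ys \<subseteq> B" "length ys = m" by blast
    have "U_to_N u * y \<in> ?S"
    proof (cases "length ys \<le> card B")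
      case True
      then have "(- int m, y) \<in> E" unfolding E_def L_def using ys by auto
      then show ?thesis by (intro complex_vector.span_base) blast
    next
      case False
      then have "\<not> distinct ys" using card_mono[OF B(1) ys(2)] distinct_card[of ys] by auto
      then show ?thesis using N_od_prod_zero[of ys] ys(1) by (simp add: complex_vector.span_zero)
    qed
    then show ?case using add(3)
      by (simp add: distrib_left scaleC_mult_right complex_vector.span_add complex_vector.span_scale)
  qed (simp add: complex_vector.span_zero)
  show ?thesis
  proof (rule that[OF fin])
    show "e \<in> N_deg j" if "(j, e) \<in> E" for j e
      using that N_deg_word[of 1] by (auto simp: E_def U_to_N_simps)
    show "n \<in> complex_vector.span {U_to_N u * e | u e. (j, e) \<in> E}" if "n \<in> N_deg j" for j n
      using that
    proof (induction rule: N_deg_span_induct)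
      case (add c u xs y)
      then show ?case using 3[OF 2, of u xs]
        by (simp add: complex_vector.span_add complex_vector.span_scale)
    qed (simp add: complex_vector.span_zero)
  qed
qed

section \<open>The adjoint action on the standard complex\<close>

lemma N_mult_lin: "lin_on UNIV UNIV (\<lambda>y. x * y)" "lin_on UNIV UNIV (\<lambda>y. y * x)"
  for x :: "'b::complex_algebra_1"
  by (simp_all add: lin_on_def distrib_left distrib_right scaleC_mult_left scaleC_mult_right)

lemma N_gen_lin: "lin_on UNIV UNIV (N_ev :: 'l::complex_lie_algebra \<Rightarrow> _)" "lin_on UNIV UNIV (N_od :: 'l \<Rightarrow> _)"
  by (simp_all add: lin_on_def N_relations(1-4))

text \<open>The differential of the action by Ad is the commutator with X: on generators this is
  \<open>vderiv_Ad\<close> combined with the defining relations, and both sides obey the Leibniz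
  rule on products.\<close>

lemma
  fixes n :: "'k::complex_algebraic_group lie N"
  shows regfun_in_N_map_Ad_UNIV: "(\<lambda>k. N_map (Ad k) n) \<in> regfun_in UNIV"
    and vderiv_N_map_Ad: "vderiv X (\<lambda>k. N_map (Ad k) n) = N_ev X * n - n * N_ev X"
proof -
  note S = complex_vector.subspace_UNIV
  have "(\<lambda>k. N_map (Ad k) n) \<in> regfun_in UNIV \<and> vderiv X (\<lambda>k. N_map (Ad k) n) = N_ev X * n - n * N_ev X"
  proof (induction n rule: presented_induct)
    case (gen g)
    show ?case
    proof (cases g)
      case (Ev z)
      show ?thesis using regfun_in_lin[OF regfun_in_Ad S N_gen_lin(1), of z]
          vderiv_lin[OF regfun_in_Ad S N_gen_lin(1), of X z] N_relations(5)[of X z]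
        by (simp add: Ev N_map_simps lie_hom_Ad vderiv_Ad)
    next
      case (Od z)
      show ?thesis using regfun_in_lin[OF regfun_in_Ad S N_gen_lin(2), of z]
          vderiv_lin[OF regfun_in_Ad S N_gen_lin(2), of X z] N_relations(6)[of X z]
        by (simp add: Od N_map_simps lie_hom_Ad vderiv_Ad)
    qed
  next
    case (scalar c)
    show ?case
      by (simp add: N_map_simps lie_hom_Ad regfun_in_const vderiv_const scaleC_mult_left scaleC_mult_right)
  next
    case (plus x y)
    then have r: "(\<lambda>k. N_map (Ad k) x) \<in> regfun_in UNIV" "(\<lambda>k. N_map (Ad k) y) \<in> regfun_in UNIV" by auto
    with plus show ?case
      by (simp add: N_map_simps lie_hom_Ad regfun_in_add vderiv_add[OF r] algebra_simps)
  next
    case (times x y)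
    then have r: "(\<lambda>k. N_map (Ad k) x) \<in> regfun_in UNIV" "(\<lambda>k. N_map (Ad k) y) \<in> regfun_in UNIV" by auto
    show ?case
      using regfun_in_bilin[where B="(*)", OF r S S N_mult_lin]
        vderiv_bilin[where B="(*)", OF r S S N_mult_lin, of X] times
      by (simp add: N_map_simps lie_hom_Ad N_map_Ad_one algebra_simps)
  qed
  then show "(\<lambda>k. N_map (Ad k) n) \<in> regfun_in UNIV" "vderiv X (\<lambda>k. N_map (Ad k) n) = N_ev X * n - n * N_ev X"
    by auto
qed

lemma Ad_iota_in_deg: "x \<in> N_deg i \<Longrightarrow> N_map (Ad k) (iota x) \<in> N_deg i"
  by (simp add: N_map_in_deg lie_hom_Ad iota_in_deg)

lemma regfun_in_N_map_Ad: "n \<in> N_deg j \<Longrightarrow> (\<lambda>k. N_map (Ad k) n) \<in> regfun_in (N_deg j)"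
  by (rule regfun_in_restrict[OF regfun_in_N_map_Ad_UNIV N_deg_subspace]) (rule N_map_in_deg[OF lie_hom_Ad])

section \<open>Equivariant modules\<close>

lemma
  assumes "is_module H D V"
  shows mod_subspace: "complex_vector.subspace (mcar V j)"
    and mod_diff: "lin_on (mcar V j) (mcar V (j + 1)) (mdiff V j)"
    and mod_diff_diff: "v \<in> mcar V j \<Longrightarrow> mdiff V (j + 1) (mdiff V j v) = 0"
    and mod_alg: "lin_on (mcar V j) (mcar V j) (malg V a j)"
    and mod_alg_one: "v \<in> mcar V j \<Longrightarrow> malg V 1 j v = v"
    and mod_alg_add: "v \<in> mcar V j \<Longrightarrow> malg V (a + b) j v = malg V a j v + malg V b j v"
    and mod_alg_mult: "v \<in> mcar V j \<Longrightarrow> malg V (a * b) j v = malg V a j (malg V b j v)"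
    and mod_alg_scale: "v \<in> mcar V j \<Longrightarrow> malg V (c *\<^sub>C a) j v = c *\<^sub>C malg V a j v"
    and mod_alg_diff: "v \<in> mcar V j \<Longrightarrow> mdiff V j (malg V a j v) = malg V a (j + 1) (mdiff V j v)"
    and mod_grp: "algebraic_action (mcar V j) (\<lambda>k. mgrp V k j)"
    and mod_grp_diff: "v \<in> mcar V j \<Longrightarrow> mdiff V j (mgrp V k j v) = mgrp V k (j + 1) (mdiff V j v)"
    and mod_dg: "x \<in> dg_deg D i \<Longrightarrow> lin_on (mcar V j) (mcar V (i + j)) (mdg V i x j)"
    and mod_dg_one: "v \<in> mcar V j \<Longrightarrow> mdg V 0 1 j v = v"
    and mod_dg_lin: "v \<in> mcar V j \<Longrightarrow> lin_on (dg_deg D i) (mcar V (i + j)) (\<lambda>x. mdg V i x j v)"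
    and mod_dg_mult: "x \<in> dg_deg D h \<Longrightarrow> y \<in> dg_deg D i \<Longrightarrow> v \<in> mcar V j \<Longrightarrow>
          mdg V (h + i) (x * y) j v = mdg V h x (i + j) (mdg V i y j v)"
    and mod_dg_diff: "x \<in> dg_deg D i \<Longrightarrow> v \<in> mcar V j \<Longrightarrow> mdiff V (i + j) (mdg V i x j v)
            = mdg V (i + 1) (dg_diff D x) j v + (- 1) powi i *\<^sub>C mdg V i x (j + 1) (mdiff V j v)"
    and mod_alg_grp: "v \<in> mcar V j \<Longrightarrow> mgrp V k j (malg V a j v) = malg V (hc_act H k a) j (mgrp V k j v)"
    and mod_dg_grp: "x \<in> dg_deg D i \<Longrightarrow> v \<in> mcar V j \<Longrightarrow>
          mgrp V k (i + j) (mdg V i x j v) = mdg V i (dg_act D k x) j (mgrp V k j v)"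
    and mod_alg_dg: "x \<in> dg_deg D i \<Longrightarrow> v \<in> mcar V j \<Longrightarrow> malg V a (i + j) (mdg V i x j v) = mdg V i x j (malg V a j v)"
    and mod_vderiv: "v \<in> mcar V j \<Longrightarrow>
          malg V (hc_inc H \<xi>) j v + mdg V 0 (dg_inc D \<xi>) j v = vderiv \<xi> (\<lambda>k. mgrp V k j v)"
proof -
  note m1 = assms[unfolded is_module_def]
  note m2 = m1[THEN conjunct2]
  note m3 = m2[THEN conjunct2]
  note m4 = m3[THEN conjunct2]
  note m5 = m4[THEN conjunct2]
  note m6 = m5[THEN conjunct2]
  note m7 = m6[THEN conjunct2]
  note m8 = m7[THEN conjunct2]
  note m9 = m8[THEN conjunct2]
  note m10 = m9[THEN conjunct2]
  note m11 = m10[THEN conjunct2]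
  note m12 = m11[THEN conjunct2]
  note m13 = m12[THEN conjunct2]
  note m14 = m13[THEN conjunct2]
  note m15 = m14[THEN conjunct2]
  note m16 = m15[THEN conjunct2]
  note a1 = m1[THEN conjunct1, rule_format]
  note a2 = m2[THEN conjunct1, rule_format]
  note a3 = m3[THEN conjunct1, rule_format]
  note a4 = m4[THEN conjunct1, rule_format]
  note a5 = m5[THEN conjunct1, rule_format]
  note a6 = m6[THEN conjunct1, rule_format]
  note a7 = m7[THEN conjunct1, rule_format]
  note a8 = m8[THEN conjunct1, rule_format]
  note a9 = m9[THEN conjunct1, rule_format]
  note a10 = m10[THEN conjunct1, rule_format]
  note a11 = m11[THEN conjunct1, rule_format]
  note a12 = m12[THEN conjunct1, rule_format]
  note a13 = m13[THEN conjunct1, rule_format]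
  note a14 = m14[THEN conjunct1, rule_format]
  note a15 = m15[THEN conjunct1, rule_format]
  note a16 = m16[rule_format]
  note a5' = a5[THEN conjunct2, THEN conjunct1, rule_format]
  show "complex_vector.subspace (mcar V j)" by (rule a1)
  show "lin_on (mcar V j) (mcar V (j + 1)) (mdiff V j)" by (rule a2)
  show "v \<in> mcar V j \<Longrightarrow> mdiff V (j + 1) (mdiff V j v) = 0" by (rule a3)
  show "lin_on (mcar V j) (mcar V j) (malg V a j)" by (rule a4)
  show "v \<in> mcar V j \<Longrightarrow> malg V 1 j v = v" by (rule a5[THEN conjunct1])
  show "v \<in> mcar V j \<Longrightarrow> malg V (a + b) j v = malg V a j v + malg V b j v" by (rule a5'[THEN conjunct1])
  show "v \<in> mcar V j \<Longrightarrow> malg V (a * b) j v = malg V a j (malg V b j v)" by (rule a5'[THEN conjunct2])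
  show "v \<in> mcar V j \<Longrightarrow> malg V (c *\<^sub>C a) j v = c *\<^sub>C malg V a j v"
    by (rule a5[THEN conjunct2, THEN conjunct2, THEN conjunct1, rule_format])
  show "v \<in> mcar V j \<Longrightarrow> mdiff V j (malg V a j v) = malg V a (j + 1) (mdiff V j v)"
    by (rule a5[THEN conjunct2, THEN conjunct2, THEN conjunct2, rule_format])
  show grp: "algebraic_action (mcar V j) (\<lambda>k. mgrp V k j)" for j by (rule a6)
  show "v \<in> mcar V j \<Longrightarrow> mdiff V j (mgrp V k j v) = mgrp V k (j + 1) (mdiff V j v)" by (rule a7)
  show "x \<in> dg_deg D i \<Longrightarrow> lin_on (mcar V j) (mcar V (i + j)) (mdg V i x j)" by (rule a8)
  show "v \<in> mcar V j \<Longrightarrow> mdg V 0 1 j v = v" by (rule a9)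
  show "v \<in> mcar V j \<Longrightarrow> lin_on (dg_deg D i) (mcar V (i + j)) (\<lambda>x. mdg V i x j v)" by (rule a10)
  show "x \<in> dg_deg D h \<Longrightarrow> y \<in> dg_deg D i \<Longrightarrow> v \<in> mcar V j \<Longrightarrow>
          mdg V (h + i) (x * y) j v = mdg V h x (i + j) (mdg V i y j v)" by (rule a11)
  show "x \<in> dg_deg D i \<Longrightarrow> v \<in> mcar V j \<Longrightarrow> mdiff V (i + j) (mdg V i x j v)
            = mdg V (i + 1) (dg_diff D x) j v + (- 1) powi i *\<^sub>C mdg V i x (j + 1) (mdiff V j v)" by (rule a12)
  show "x \<in> dg_deg D i \<Longrightarrow> v \<in> mcar V j \<Longrightarrow> malg V a (i + j) (mdg V i x j v) = mdg V i x j (malg V a j v)" by (rule a15)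
  show "v \<in> mcar V j \<Longrightarrow>
          malg V (hc_inc H \<xi>) j v + mdg V 0 (dg_inc D \<xi>) j v = vderiv \<xi> (\<lambda>k. mgrp V k j v)" by (rule a16)
  \<comment> \<open>Equivariance in \<open>is_module\<close> has the form of a conjugation. Applied
    to \<nu>(k) v it becomes a rule for moving \<nu>(k) past the other operators.\<close>
  have i: "mgrp V (inverse k) j (mgrp V k j v) = v" "mgrp V k j v \<in> mcar V j" if "v \<in> mcar V j" for k j v
    using algebraic_action_inverse(2)[OF grp that] algebraic_action_in[OF grp that] by auto
  show "mgrp V k j (malg V a j v) = malg V (hc_act H k a) j (mgrp V k j v)" if "v \<in> mcar V j"
    using a13[OF i(2)[OF that], of k a] i(1)[OF that] by simp
  show "mgrp V k (i + j) (mdg V i x j v) = mdg V i (dg_act D k x) j (mgrp V k j v)" if "x \<in> dg_deg D i" "v \<in> mcar V j"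
    using a14[OF that(1) i(2)[OF that(2)], of k] i(1)[OF that(2)] by simp
qed

lemma mod_zero: "is_module H D V \<Longrightarrow> 0 \<in> mcar V j"
  by (rule complex_vector.subspace_0[OF mod_subspace])

lemma std_dg_simps [simp]:
  "dg_deg std_dg = N_deg" "dg_diff std_dg = N_diff" "dg_act std_dg = (\<lambda>k. N_map (Ad k))" "dg_inc std_dg = N_ev"
  by (simp_all add: std_dg_def)

lemma
  assumes "harish_chandra_pair H"
  shows hc_action: "algebraic_action UNIV (hc_act H)"
    and hc_act_mult: "hc_act H k (a * b) = hc_act H k a * hc_act H k b"
    and hc_act_one: "hc_act H k 1 = 1"
    and hc_inc_lin: "lin_on UNIV UNIV (hc_inc H)"
    and hc_inc_bracket: "hc_inc H (bracket \<xi> \<eta>) = hc_inc H \<xi> * hc_inc H \<eta> - hc_inc H \<eta> * hc_inc H \<xi>"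
    and hc_inc_Ad: "hc_inc H (Ad k \<xi>) = hc_act H k (hc_inc H \<xi>)"
    and hc_vderiv: "vderiv \<xi> (\<lambda>k. hc_act H k a) = hc_inc H \<xi> * a - a * hc_inc H \<xi>"
  using assms unfolding harish_chandra_pair_def by (elim conjE; blast)+

lemma regfun_in_subspace: "complex_vector.subspace (regfun_in S)"
  using regfun_in_zero[of S] regfun_in_add[of _ S] regfun_in_scale[OF _ regfun_const, of _ S]
  by (intro complex_vector.subspaceI) (auto simp: plus_fun_def zero_fun_def scaleC_fun_def)

text \<open>A Leibniz rule for functions in which k occurs both as a parameter and as the argument.
  It is used for L(y) = f(y n) and Y(k) = Ad(k)(\<iota> x), the shape of the action of N(k) on
  \<Gamma>(W).\<close>

lemma
  assumes Y: "Y \<in> regfun_in S" and S: "complex_vector.subspace S" and L: "lin_on S (regfun_in T) L"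
  shows regfun_in_diagonal: "(\<lambda>k. L (Y k) k) \<in> regfun_in T"
    and vderiv_diagonal: "vderiv X (\<lambda>k. L (Y k) k) = vderiv X (L (Y 1)) + L (vderiv X Y) 1"
proof -
  have "(\<lambda>k. L (Y k) k) \<in> regfun_in T \<and> vderiv X (\<lambda>k. L (Y k) k) = vderiv X (L (Y 1)) + L (vderiv X Y) 1"
    using Y
  proof (induction rule: regfun_in_induct)
    case zero
    show ?case using lin_on_zero[OF L S] by (simp add: regfun_in_zero vderiv_zero zero_fun_def)
  next
    case (add c w G)
    have e: "L (a *\<^sub>C w + x) k = a *\<^sub>C L w k + L x k" if "x \<in> S" for a x k
      using lin_on_add[OF L, of "a *\<^sub>C w" x] lin_on_scale[OF L add(2), of a] that add(2)
      by (simp add: complex_vector.subspace_scale[OF S] scaleC_fun_def)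
    note w = lin_on_in[OF L add(2)]
    have s: "c 1 *\<^sub>C L w + L (G 1) = (\<lambda>k. c 1 *\<^sub>C L w k + L (G 1) k)" by (simp add: scaleC_fun_def plus_fun_def)
    note G = regfun_in_value[OF S add(3)]
    have G1: "vderiv X (\<lambda>k. c 1 *\<^sub>C L w k + L (G 1) k) = c 1 *\<^sub>C vderiv X (L w) + vderiv X (L (G 1))"
      using vderiv_add[OF regfun_in_scale[OF w regfun_const] lin_on_in[OF L G], of X "c 1" 1] vderiv_scale[OF w regfun_const, of X "c 1"]
      by (simp add: lie_const)
    show ?case
      using add(4) vderiv_add[OF regfun_in_scale[OF w add(1)] conjunct1[OF add(4)], of X]
      by (simp add: e G G1 e[OF vderiv_in[OF add(3) S]] regfun_in_add regfun_in_scale[OF w add(1)]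
          vderiv_scale[OF w add(1)] vderiv_add[OF regfun_in_single[OF add(1,2)] add(3)] vderiv_single[OF add(1)])
  qed
  then show "(\<lambda>k. L (Y k) k) \<in> regfun_in T" "vderiv X (\<lambda>k. L (Y k) k) = vderiv X (L (Y 1)) + L (vderiv X Y) 1"
    by auto
qed

locale hc_morphism =
  fixes H :: "('k::complex_algebraic_group, 'a::complex_algebra_1) hc_pair"
    and \<gamma> :: "'t::complex_algebraic_group \<Rightarrow> 'k"
  assumes hc: "harish_chandra_pair H" and \<gamma>: "alg_group_morphism \<gamma>"
begin

lemma \<gamma>_morphism: "morphism variety variety \<gamma>" and \<gamma>_mult: "\<gamma> (s * t) = \<gamma> s * \<gamma> t"
  using \<gamma> unfolding alg_group_morphism_def by blast+

lemmas \<gamma>_one = group_hom(1)[of \<gamma>, OF \<gamma>_mult] and \<gamma>_inverse = group_hom(2)[of \<gamma>, OF \<gamma>_mult]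
  and \<gamma>_lie_hom = lie_hom_lie_map[OF \<gamma>_morphism \<gamma>_mult]

lemma N_map_\<gamma>_Ad: "N_map (lie_map \<gamma>) (N_map (Ad t) x) = N_map (Ad (\<gamma> t)) (N_map (lie_map \<gamma>) x)"
  using lie_map_Ad[OF \<gamma>_morphism \<gamma>_mult, of t]
  by (simp add: N_map_compose lie_hom_Ad \<gamma>_lie_hom)

lemma pullback_simps [simp]:
  "hc_act (hc_pullback \<gamma> H) t = hc_act H (\<gamma> t)" "hc_inc (hc_pullback \<gamma> H) \<xi> = hc_inc H (lie_map \<gamma> \<xi>)"
  by (simp_all add: hc_pullback_def)

lemma Res_simps [simp]:
  "mcar (Res \<gamma> V) = mcar V" "mdiff (Res \<gamma> V) = mdiff V" "malg (Res \<gamma> V) = malg V"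
  "mgrp (Res \<gamma> V) t = mgrp V (\<gamma> t)" "mdg (Res \<gamma> V) i x = mdg V i (N_map (lie_map \<gamma>) x)"
  by (simp_all add: Res_def)

lemma Res_module:
  assumes V: "is_module H std_dg V"
  shows "is_module (hc_pullback \<gamma> H) std_dg (Res \<gamma> V)"
  unfolding is_module_def
proof (intro conjI allI ballI, simp_all only: Res_simps std_dg_simps pullback_simps)
  fix j
  show "algebraic_action (mcar V j) (\<lambda>t. mgrp V (\<gamma> t) j)"
  proof (rule algebraic_actionI[OF mod_subspace[OF V] algebraic_action_lin[OF mod_grp[OF V]]])
    show "(\<lambda>t. mgrp V (\<gamma> t) j v) \<in> regfun_in UNIV" if "v \<in> mcar V j" for v
      by (rule regfun_in_mono[OF regfun_in_precompose[OF algebraic_action_reg[OF mod_grp[OF V] mod_subspace[OF V] that]] subset_UNIV])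
        (rule regfun_morphism[OF \<gamma>_morphism])
  qed (simp_all add: \<gamma>_one \<gamma>_mult algebraic_action_one[OF mod_grp[OF V]] algebraic_action_mult[OF mod_grp[OF V]])
next
  fix i j and x :: "'t lie N" assume "x \<in> N_deg i"
  then have x: "N_map (lie_map \<gamma>) x \<in> dg_deg std_dg i" by (simp add: N_map_in_deg \<gamma>_lie_hom)
  show "lin_on (mcar V j) (mcar V (i + j)) (mdg V i (N_map (lie_map \<gamma>) x) j)" by (rule mod_dg[OF V x])
  fix v assume v: "v \<in> mcar V j"
  show "mdiff V (i + j) (mdg V i (N_map (lie_map \<gamma>) x) j v) = mdg V (i + 1) (N_map (lie_map \<gamma>) (N_diff x)) j v +
       (- 1) powi i *\<^sub>C mdg V i (N_map (lie_map \<gamma>) x) (j + 1) (mdiff V j v)"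
    using mod_dg_diff[OF V x v] by (simp add: N_map_diff \<gamma>_lie_hom)
  show "malg V a (i + j) (mdg V i (N_map (lie_map \<gamma>) x) j v) = mdg V i (N_map (lie_map \<gamma>) x) j (malg V a j v)" for a
    by (rule mod_alg_dg[OF V x v])
  show "mdg V i (N_map (lie_map \<gamma>) (N_map (Ad k) x)) j v = mgrp V (\<gamma> k) (i + j) (mdg V i (N_map (lie_map \<gamma>) x) j (mgrp V (\<gamma> (inverse k)) j v))" for k
    using algebraic_action_in[OF mod_grp[OF V] v, of "inverse (\<gamma> k)"] algebraic_action_inverse(1)[OF mod_grp[OF V] v, of "\<gamma> k"]
    by (simp add: mod_dg_grp[OF V x] N_map_\<gamma>_Ad \<gamma>_inverse)
next
  fix h i j and x y :: "'t lie N" and v assume "x \<in> N_deg h" "y \<in> N_deg i" and v: "v \<in> mcar V j"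
  then have "N_map (lie_map \<gamma>) x \<in> dg_deg std_dg h" "N_map (lie_map \<gamma>) y \<in> dg_deg std_dg i" by (simp_all add: N_map_in_deg \<gamma>_lie_hom)
  from mod_dg_mult[OF V this v]
  show "mdg V (h + i) (N_map (lie_map \<gamma>) (x * y)) j v = mdg V h (N_map (lie_map \<gamma>) x) (i + j) (mdg V i (N_map (lie_map \<gamma>) y) j v)"
    by (simp add: N_map_simps \<gamma>_lie_hom)
next
  fix i j v assume v: "v \<in> mcar V j"
  show "mdg V 0 (N_map (lie_map \<gamma>) 1) j v = v" using mod_dg_one[OF V v] by (simp add: N_map_simps \<gamma>_lie_hom)
  have "lin_on (N_deg i) (N_deg i) (N_map (lie_map \<gamma>))"
    by (rule lin_onI) (simp_all add: N_map_in_deg \<gamma>_lie_hom N_map_simps)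
  from lin_on_compose[OF this mod_dg_lin[OF V v, unfolded std_dg_simps]]
  show "lin_on (N_deg i) (mcar V (i + j)) (\<lambda>x. mdg V i (N_map (lie_map \<gamma>) x) j v)" .
  show "malg V (hc_act H (\<gamma> k) a) j v = mgrp V (\<gamma> k) j (malg V a j (mgrp V (\<gamma> (inverse k)) j v))" for k a
    using algebraic_action_in[OF mod_grp[OF V] v, of "inverse (\<gamma> k)"] algebraic_action_inverse(1)[OF mod_grp[OF V] v, of "\<gamma> k"]
    by (simp add: mod_alg_grp[OF V] \<gamma>_inverse)
  show "malg V (hc_inc H (lie_map \<gamma> \<xi>)) j v + mdg V 0 (N_map (lie_map \<gamma>) (N_ev \<xi>)) j v = vderiv \<xi> (\<lambda>k. mgrp V (\<gamma> k) j v)" for \<xi>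
    using mod_vderiv[OF V v, of "lie_map \<gamma> \<xi>"]
      vderiv_lie_map[OF \<gamma>_morphism \<gamma>_one algebraic_action_reg[OF mod_grp[OF V] mod_subspace[OF V] v], of \<xi>]
    by (simp add: N_map_simps \<gamma>_lie_hom)
qed (simp_all add: mod_subspace[OF V] mod_diff[OF V] mod_diff_diff[OF V] mod_alg[OF V] mod_alg_one[OF V]
    mod_alg_add[OF V] mod_alg_mult[OF V] mod_alg_scale[OF V] mod_alg_diff[OF V] mod_grp_diff[OF V])

lemma Res_mor: "Mor std_dg V V' \<subseteq> Mor std_dg (Res \<gamma> V) (Res \<gamma> V')"
  by (auto simp: Mor_def N_map_in_deg \<gamma>_lie_hom)

section \<open>The module of regular functions\<close>

text \<open>\<lambda>(X) in degree j. Although W carries only an action of T, the first summand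
  makes sense for all X in the Lie algebra of K because \<psi>(X) acts through the algebra.\<close>

definition lam :: "('t, 'a, 'w::complex_vector) equiv_complex \<Rightarrow> 'k lie \<Rightarrow> int \<Rightarrow> ('k \<Rightarrow> 'w) \<Rightarrow> 'k \<Rightarrow> 'w" where
  "lam W X j F = (\<lambda>k. malg W (hc_inc H X) j (F k) + left_deriv X F k)"

lemma left_deriv_lin:
  assumes "F \<in> regfun_in S" "complex_vector.subspace S" "lin_on S T L"
  shows "left_deriv X (\<lambda>k. L (F k)) k = L (left_deriv X F k)"
  unfolding left_deriv_def by (rule vderiv_lin[OF regfun_in_inverse_mult[OF assms(1)] assms(2,3)])

lemma left_deriv_add:
  assumes "F \<in> regfun_in S" "G \<in> regfun_in S"
  shows "left_deriv X (\<lambda>k. F k + G k) k = left_deriv X F k + left_deriv X G k"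
  unfolding left_deriv_def by (rule vderiv_add[OF regfun_in_inverse_mult[OF assms(1)] regfun_in_inverse_mult[OF assms(2)]])

lemma left_deriv_scale:
  assumes "F \<in> regfun_in S"
  shows "left_deriv X (\<lambda>k. c *\<^sub>C F k) k = c *\<^sub>C left_deriv X F k"
  unfolding left_deriv_def using vderiv_scale[OF regfun_in_inverse_mult[OF assms] regfun_const, of X c]
  by (simp add: lie_const)

context
  fixes W :: "('t, 'a, 'w::complex_vector) equiv_complex"
  assumes W: "is_module (hc_pullback \<gamma> H) std_dg W"
begin

lemma lam_lin: "lin_on (regfun_in (mcar W j)) (regfun_in (mcar W j)) (lam W X j)"
proof (rule lin_onI)
  fix F G :: "'k \<Rightarrow> 'w" and c assume F: "F \<in> regfun_in (mcar W j)" 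
  note v = regfun_in_value[OF mod_subspace[OF W]]
  show "lam W X j F \<in> regfun_in (mcar W j)"
    unfolding lam_def by (intro regfun_in_add left_deriv_in F regfun_in_lin[OF F mod_subspace[OF W] mod_alg[OF W]])
  show "lam W X j (c *\<^sub>C F) = c *\<^sub>C lam W X j F"
    using v[OF F] left_deriv_scale[OF F]
    by (simp add: lam_def fun_eq_iff scaleC_fun_def lin_on_scale[OF mod_alg[OF W]] scaleC_add_right)
  assume G: "G \<in> regfun_in (mcar W j)"
  show "lam W X j (F + G) = lam W X j F + lam W X j G"
    using v[OF F] v[OF G] left_deriv_add[OF F G]
    by (simp add: lam_def fun_eq_iff plus_fun_def lin_on_add[OF mod_alg[OF W]])
qed

lemma lam_relations:
  assumes F: "F \<in> regfun_in (mcar W j)"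
  shows "lam W (X + Y) j F = lam W X j F + lam W Y j F"
    and "lam W (c *\<^sub>C X) j F = c *\<^sub>C lam W X j F"
    and "lam W X j (lam W Y j F) = lam W Y j (lam W X j F) + lam W (bracket X Y) j F"
proof -
  note v = regfun_in_value[OF mod_subspace[OF W] F]
  note f = regfun_in_inverse_mult[OF F]
  note i = hc_inc_lin[OF hc]
  show "lam W (X + Y) j F = lam W X j F + lam W Y j F"
    by (simp add: lam_def fun_eq_iff left_deriv_def vderiv_lie[OF f] lin_on_add[OF i] mod_alg_add[OF W] v)
  show "lam W (c *\<^sub>C X) j F = c *\<^sub>C lam W X j F"
    by (simp add: lam_def fun_eq_iff left_deriv_def vderiv_lie[OF f] lin_on_scale[OF i] mod_alg_scale[OF W] v
       scaleC_add_right scaleC_fun_def)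
  \<comment> \<open>The two mixed terms are exchanged by swapping X and Y, so the commutator
    involves only the algebra part and the derivative part, each of which respects brackets.\<close>
  have e: "lam W X j (lam W Y j F) k = malg W (hc_inc H X * hc_inc H Y) j (F k) + malg W (hc_inc H X) j (left_deriv Y F k)
      + malg W (hc_inc H Y) j (left_deriv X F k) + left_deriv X (left_deriv Y F) k" for X Y k
  proof -
    note l = left_deriv_in[OF F, of Y]
    have "left_deriv X (lam W Y j F) k = malg W (hc_inc H Y) j (left_deriv X F k) + left_deriv X (left_deriv Y F) k"
      unfolding lam_def
      by (simp add: left_deriv_add[OF regfun_in_lin[OF F mod_subspace[OF W] mod_alg[OF W]] l]
        left_deriv_lin[OF F mod_subspace[OF W] mod_alg[OF W]])
    then show ?thesis unfolding lam_def[of W X] 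
      by (simp add: lam_def lin_on_add[OF mod_alg[OF W]] lin_on_in[OF mod_alg[OF W]] v
        regfun_in_value[OF mod_subspace[OF W] l] mod_alg_mult[OF W])
  qed
  have m: "malg W (a - b) j (F k) = malg W a j (F k) - malg W b j (F k)" for a b k
    using mod_alg_add[OF W v, of "a - b" b] by (simp add: eq_diff_eq)
  show "lam W X j (lam W Y j F) = lam W Y j (lam W X j F) + lam W (bracket X Y) j F"
  proof
    fix k
    show "lam W X j (lam W Y j F) k = (lam W Y j (lam W X j F) + lam W (bracket X Y) j F) k"
      unfolding plus_fun_def e left_deriv_bracket[OF F, of X Y]
      by (simp add: lam_def hc_inc_bracket[OF hc] m)
  qed
qed

lemma RK_malg: "malg (RK H \<gamma> W) u j = alg_act (\<lambda>g. case g of UGen X \<Rightarrow> lam W X j) u"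
proof -
  have "(\<lambda>F k. malg W (hc_inc H X) j (F k) + vderiv X (\<lambda>g. F (inverse g * k))) = lam W X j" for X
    by (intro ext) (simp add: lam_def left_deriv_def)
  then show ?thesis by (simp add: RK_def)
qed

text \<open>\<open>alg_act\<close> evaluates some representing term; that it agrees with
  \<lambda>(X) on a generator rests on the relations of U(k), which hold for functions in R(K)
  \<otimes> W.\<close>

lemma RK_malg_gen:
  assumes F: "F \<in> regfun_in (mcar W j)"
  shows "malg (RK H \<gamma> W) (U_in X) j F = lam W X j F"
proof -
  let ?r = "\<lambda>g. case g of UGen X \<Rightarrow> lam W X j"
  have "alg_act ?r (U_in X) F = ?r (UGen X) F"
  proof (rule alg_act_gen[OF regfun_in_subspace[of "mcar W j"] _ _ F])
    show "lin_on (regfun_in (mcar W j)) (regfun_in (mcar W j)) (?r g)" for g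
      by (cases g) (simp add: lam_lin)
    show "relator s t \<Longrightarrow> F \<in> regfun_in (mcar W j) \<Longrightarrow> eval_act ?r s F = eval_act ?r t F" for s t F
      unfolding relator_ugen_def
    proof (induction rule: urel.induct)
      case (3 x y)
      then show ?case using lam_relations(3)[of F j x y] by simp
    qed (simp_all add: lam_relations(1,2))
  qed
  then show ?thesis by (simp add: RK_malg)
qed

end

section \<open>The functor \<open>\<Gamma>\<close> on objects\<close>

text \<open>Membership in the Hom complex, with linearity over U(k) required on the Lie algebra
  only. The sign (-1)^(i(j + p)) unites (-1)^(ij) from the action of N(t) on N(k) with (-1)^(pi)
  from the Hom complex.\<close>

definition gam :: "('t, 'a, 'w::complex_vector) equiv_complex \<Rightarrow> int \<Rightarrow> (int \<Rightarrow> 'k lie N \<Rightarrow> 'k \<Rightarrow> 'w) \<Rightarrow> bool" where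
  "gam W p f \<longleftrightarrow> (\<forall>j. lin_on (N_deg j) (regfun_in (mcar W (j + p))) (f j)) \<and> (\<forall>j n. n \<notin> N_deg j \<longrightarrow> f j n = 0)
     \<and> (\<forall>j X. \<forall>n\<in>N_deg j. f j (N_ev X * n) = lam W X (j + p) (f j n))
     \<and> (\<forall>j t k. \<forall>n\<in>N_deg j. f j (N_map (Ad (\<gamma> t)) n) k = mgrp W t (j + p) (f j n (inverse (\<gamma> t) * k)))
     \<and> (\<forall>i j k. \<forall>m\<in>N_deg i. \<forall>n\<in>N_deg j.
          f (i + j) (n * iota (N_map (lie_map \<gamma>) m)) k = (- 1) powi (i * (j + p)) *\<^sub>C mdg W i m (j + p) (f j n k))"

lemma gamI:
  assumes "\<And>j n. n \<in> N_deg j \<Longrightarrow> f j n \<in> regfun_in (mcar W (j + p))"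
    "\<And>j n n' k. n \<in> N_deg j \<Longrightarrow> n' \<in> N_deg j \<Longrightarrow> f j (n + n') k = f j n k + f j n' k"
    "\<And>j c n k. n \<in> N_deg j \<Longrightarrow> f j (c *\<^sub>C n) k = c *\<^sub>C f j n k"
    "\<And>j n k. n \<notin> N_deg j \<Longrightarrow> f j n k = 0"
    "\<And>j X n k. n \<in> N_deg j \<Longrightarrow> f j (N_ev X * n) k = lam W X (j + p) (f j n) k"
    "\<And>j t k n. n \<in> N_deg j \<Longrightarrow> f j (N_map (Ad (\<gamma> t)) n) k = mgrp W t (j + p) (f j n (inverse (\<gamma> t) * k))"
    "\<And>i j k m n. m \<in> N_deg i \<Longrightarrow> n \<in> N_deg j \<Longrightarrow>
          f (i + j) (n * iota (N_map (lie_map \<gamma>) m)) k = (- 1) powi (i * (j + p)) *\<^sub>C mdg W i m (j + p) (f j n k)"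
  shows "gam W p f"
  unfolding gam_def using assms
  by (auto simp: fun_eq_iff plus_fun_def scaleC_fun_def intro!: lin_onI)

lemma iota_\<gamma>_in_deg: "m \<in> N_deg i \<Longrightarrow> iota (N_map (lie_map \<gamma>) m) \<in> N_deg i"
  by (simp add: iota_in_deg N_map_in_deg \<gamma>_lie_hom)

abbreviation "\<Gamma> \<equiv> Gamma_eq H \<gamma>"

lemma Gamma_simps:
  "malg (\<Gamma> W) a p f j n k = malg W (hc_act H k a) (j + p) (f j n k)"
  "mgrp (\<Gamma> W) g p f j n k = f j n (k * g)"
  "mdg (\<Gamma> W) i x p f j n k = (if n \<in> N_deg j then (- 1) powi (i * p) *\<^sub>C f (i + j) (N_map (Ad k) (iota x) * n) k else 0)"
  "mdiff (\<Gamma> W) p f j n k = (if n \<in> N_deg j then mdiff W (j + p) (f j n k) - (- 1) powi p *\<^sub>C f (j + 1) (N_diff n) k else 0)"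
  by (simp_all add: Gamma_eq_def Hom_diff_def NK_def RK_def scaleC_fun_def)

context
  fixes W :: "('t, 'a, 'w::complex_vector) equiv_complex"
  assumes W: "is_module (hc_pullback \<gamma> H) std_dg W"
begin

text \<open>Since (-1)^a is its own inverse, the sign from N(k) can be moved to the other side;
  linearity over U(k) and over its generators are equivalent by induction on terms.\<close>

lemma Gamma_car: "mcar (\<Gamma> W) p = {f. gam W p f}"
proof (rule set_eqI)
  fix f :: "int \<Rightarrow> 'k lie N \<Rightarrow> 'k \<Rightarrow> 'w"
  let ?L = "\<forall>j. lin_on (N_deg j) (regfun_in (mcar W (j + p))) (f j)"
  have sg: "(f (i + j) ((- 1) powi (i * j) *\<^sub>C (n * iota (N_map (lie_map \<gamma>) m)))
        = (- 1) powi (p * i) *\<^sub>C (\<lambda>k. mdg W i m (j + p) (f j n k))) \<longleftrightarrow>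
      (\<forall>k. f (i + j) (n * iota (N_map (lie_map \<gamma>) m)) k = (- 1) powi (i * (j + p)) *\<^sub>C mdg W i m (j + p) (f j n k))"
    if L: ?L and mn: "m \<in> N_deg i" "n \<in> N_deg j" for i j m n
  proof -
    have "n * iota (N_map (lie_map \<gamma>) m) \<in> N_deg (i + j)"
      using N_deg_mult[OF mn(2) iota_\<gamma>_in_deg[OF mn(1)]] by (simp add: add.commute)
    then have e: "f (i + j) ((- 1) powi (i * j) *\<^sub>C (n * iota (N_map (lie_map \<gamma>) m))) 
        = (- 1) powi (i * j) *\<^sub>C f (i + j) (n * iota (N_map (lie_map \<gamma>) m))"
      using lin_on_scale[OF L[rule_format]] by blast
    have "(- 1) powi a *\<^sub>C x = (- 1) powi b *\<^sub>C y \<longleftrightarrow> x = (- 1) powi (a + b) *\<^sub>C y" for a b and x y :: 'w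
    proof
      assume "(- 1) powi a *\<^sub>C x = (- 1) powi b *\<^sub>C y"
      then have "(- 1) powi a *\<^sub>C (- 1) powi a *\<^sub>C x = (- 1) powi a *\<^sub>C (- 1) powi b *\<^sub>C y" by simp
      then show "x = (- 1) powi (a + b) *\<^sub>C y"
        by (simp add: neg_one_powi neg_one_powi_even[of "a + a"] scaleC_one)
    next
      assume "x = (- 1) powi (a + b) *\<^sub>C y"
      then show "(- 1) powi a *\<^sub>C x = (- 1) powi b *\<^sub>C y"
        by (simp add: neg_one_powi neg_one_powi_cong[of "2 * a + b" b])
    qed
    then show ?thesis unfolding e by (simp add: fun_eq_iff scaleC_fun_def algebra_simps)
  qed
  \<comment> \<open>The induction also carries that the product remains in degree j, which is where
    f j may be evaluated.\<close>
  have ev: "f j (U_to_N u * n) = malg (RK H \<gamma> W) u (j + p) (f j n)"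
    if L: ?L and X: "\<forall>j X. \<forall>n\<in>N_deg j. f j (N_ev X * n) = lam W X (j + p) (f j n)" and n: "n \<in> N_deg j" for u j n
  proof -
    let ?h = "\<lambda>g. case g of UGen x \<Rightarrow> N_ev x" and ?r = "\<lambda>g. case g of UGen X \<Rightarrow> lam W X (j + p)"
    have "eval_alg ?h t * n \<in> N_deg j \<and> f j (eval_alg ?h t * n) = eval_act ?r t (f j n)" if "n \<in> N_deg j" for t n
      using that
    proof (induction t arbitrary: n)
      case (Gen g)
      then show ?case using X by (cases g) (simp add: N_deg_ev_mult)
    next
      case (Scalar c)
      then show ?case by (simp add: scaleC_mult_left N_deg_scale lin_on_scale[OF L[rule_format]])
    next
      case (Plus s t)
      then show ?case by (simp add: distrib_right N_deg_add lin_on_add[OF L[rule_format]])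
    next
      case (Times s t)
      then show ?case by (simp add: mult.assoc)
    qed
    from this[OF n] show ?thesis
      by (simp add: RK_malg[OF W] alg_act_def U_to_N_def alg_hom_def)
  qed
  have g: "f j (N_ev X * n) = lam W X (j + p) (f j n)"
    if L: ?L and U: "\<forall>u j. \<forall>v\<in>N_deg j. f j (U_to_N u * v) = malg (RK H \<gamma> W) u (j + p) (f j v)" and n: "n \<in> N_deg j" for X j n
    using U[rule_format, OF n, of "U_in X"] RK_malg_gen[OF W lin_on_in[OF L[rule_format] n]] by (simp add: U_to_N_simps)
  have "f \<in> mcar (\<Gamma> W) p \<longleftrightarrow> ?L \<and> (\<forall>j n. n \<notin> N_deg j \<longrightarrow> f j n = 0)
     \<and> (\<forall>u j. \<forall>v\<in>N_deg j. f j (U_to_N u * v) = malg (RK H \<gamma> W) u (j + p) (f j v))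
     \<and> (\<forall>t j. \<forall>n\<in>N_deg j. f j (N_map (Ad (\<gamma> t)) n) = (\<lambda>k. mgrp W t (j + p) (f j n (inverse (\<gamma> t) * k))))
     \<and> (\<forall>i j. \<forall>m\<in>N_deg i. \<forall>n\<in>N_deg j. f (i + j) ((- 1) powi (i * j) *\<^sub>C (n * iota (N_map (lie_map \<gamma>) m)))
        = (- 1) powi (p * i) *\<^sub>C (\<lambda>k. mdg W i m (j + p) (f j n k)))"
    unfolding Gamma_eq_def Hom_deg_def by (simp add: NK_def) (simp add: RK_def all_conj_distrib conj_assoc)
  also have "\<dots> \<longleftrightarrow> gam W p f"
  proof (cases ?L)
    case True
    have c1: "(\<forall>u j. \<forall>v\<in>N_deg j. f j (U_to_N u * v) = malg (RK H \<gamma> W) u (j + p) (f j v)) \<longleftrightarrow>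
        (\<forall>j X. \<forall>n\<in>N_deg j. f j (N_ev X * n) = lam W X (j + p) (f j n))"
      using ev[OF True] g[OF True] by blast
    have c2: "(\<forall>t j. \<forall>n\<in>N_deg j. f j (N_map (Ad (\<gamma> t)) n) = (\<lambda>k. mgrp W t (j + p) (f j n (inverse (\<gamma> t) * k)))) \<longleftrightarrow>
        (\<forall>j t k. \<forall>n\<in>N_deg j. f j (N_map (Ad (\<gamma> t)) n) k = mgrp W t (j + p) (f j n (inverse (\<gamma> t) * k)))"
      unfolding fun_eq_iff by blast
    have c3: "(\<forall>i j. \<forall>m\<in>N_deg i. \<forall>n\<in>N_deg j. f (i + j) ((- 1) powi (i * j) *\<^sub>C (n * iota (N_map (lie_map \<gamma>) m)))
        = (- 1) powi (p * i) *\<^sub>C (\<lambda>k. mdg W i m (j + p) (f j n k))) \<longleftrightarrow>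
        (\<forall>i j k. \<forall>m\<in>N_deg i. \<forall>n\<in>N_deg j.
          f (i + j) (n * iota (N_map (lie_map \<gamma>) m)) k = (- 1) powi (i * (j + p)) *\<^sub>C mdg W i m (j + p) (f j n k))"
      using sg[OF True] by (simp cong: ball_cong) blast
    show ?thesis unfolding gam_def c1 c2 c3 ..
  qed (simp only: gam_def simp_thms)
  finally show "f \<in> mcar (\<Gamma> W) p \<longleftrightarrow> f \<in> {f. gam W p f}" by simp
qed

lemma
  assumes f: "gam W p f"
  shows gam_reg: "n \<in> N_deg j \<Longrightarrow> q = j + p \<Longrightarrow> f j n \<in> regfun_in (mcar W q)"
    and gam_lin: "lin_on (N_deg j) (regfun_in (mcar W (j + p))) (f j)"
    and gam_add: "n \<in> N_deg j \<Longrightarrow> n' \<in> N_deg j \<Longrightarrow> f j (n + n') k = f j n k + f j n' k"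
    and gam_scale: "n \<in> N_deg j \<Longrightarrow> f j (c *\<^sub>C n) k = c *\<^sub>C f j n k"
    and gam_out: "n \<notin> N_deg j \<Longrightarrow> f j n = 0"
    and gam_zero: "f j 0 k = 0"
    and gam_value: "n \<in> N_deg j \<Longrightarrow> q = j + p \<Longrightarrow> f j n k \<in> mcar W q"
    and gam_ev: "n \<in> N_deg j \<Longrightarrow> f j (N_ev X * n) = lam W X (j + p) (f j n)"
    and gam_grp: "n \<in> N_deg j \<Longrightarrow> f j (N_map (Ad (\<gamma> t)) n) k = mgrp W t (j + p) (f j n (inverse (\<gamma> t) * k))"
    and gam_dg: "m \<in> N_deg i \<Longrightarrow> n \<in> N_deg j \<Longrightarrow> f (i + j) (n * iota (N_map (lie_map \<gamma>) m)) k = (- 1) powi (i * (j + p)) *\<^sub>C mdg W i m (j + p) (f j n k)"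
proof -
  note f1 = f[unfolded gam_def]
  show l: "lin_on (N_deg j) (regfun_in (mcar W (j + p))) (f j)" for j using f1 by blast
  show r: "n \<in> N_deg j \<Longrightarrow> q = j + p \<Longrightarrow> f j n \<in> regfun_in (mcar W q)" for n j q using lin_on_in[OF l] by simp
  show "n \<in> N_deg j \<Longrightarrow> n' \<in> N_deg j \<Longrightarrow> f j (n + n') k = f j n k + f j n' k"
    using lin_on_add[OF l] by simp
  show "n \<in> N_deg j \<Longrightarrow> f j (c *\<^sub>C n) k = c *\<^sub>C f j n k"
    using lin_on_scale[OF l] by (simp add: scaleC_fun_def)
  show "f j 0 k = 0" using lin_on_zero[OF l N_deg_subspace] by simp
  show "n \<in> N_deg j \<Longrightarrow> q = j + p \<Longrightarrow> f j n k \<in> mcar W q"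
    by (rule regfun_in_value[OF mod_subspace[OF W] r])
qed (use f[unfolded gam_def] in \<open>(elim conjE; simp)+\<close>)

section \<open>Stability of the Hom complex under its operators\<close>

lemma lam_diff:
  assumes F: "F \<in> regfun_in (mcar W q)"
  shows "lam W X (q + 1) (\<lambda>k. mdiff W q (F k)) k = mdiff W q (lam W X q F k)"
proof -
  note v = regfun_in_value[OF mod_subspace[OF W] F]
  note l = regfun_in_value[OF mod_subspace[OF W] left_deriv_in[OF F]]
  show ?thesis
    by (simp add: lam_def left_deriv_lin[OF F mod_subspace[OF W] mod_diff[OF W]] mod_alg_diff[OF W v, simplified]
       lin_on_add[OF mod_diff[OF W]] lin_on_in[OF mod_alg[OF W]] v l)
qed

lemma lam_lincomb:
  assumes F: "F \<in> regfun_in (mcar W q)" and G: "G \<in> regfun_in (mcar W q)"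
  shows "lam W X q (\<lambda>k. F k - c *\<^sub>C G k) k = lam W X q F k - c *\<^sub>C lam W X q G k"
proof -
  note S = regfun_in_subspace[of "mcar W q"]
  have "lam W X q (F - c *\<^sub>C G) = lam W X q F - c *\<^sub>C lam W X q G"
    using lin_on_diff[OF lam_lin[OF W] S F complex_vector.subspace_scale[OF S G], of X c] lin_on_scale[OF lam_lin[OF W] G, of X c]
    by simp
  then show ?thesis by (simp add: fun_eq_iff fun_diff_def scaleC_fun_def)
qed

lemma lam_scale:
  assumes F: "F \<in> regfun_in (mcar W q)"
  shows "lam W X q (\<lambda>k. c *\<^sub>C F k) k = c *\<^sub>C lam W X q F k"
  using fun_cong[OF lin_on_scale[OF lam_lin[OF W] F, of X c], of k] by (simp add: scaleC_fun_def)

text \<open>\<lambda>(X) and T commute with the differentials of both complexes. For N(t) the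
  Leibniz rules on the two sides produce terms with the differential of m, and these cancel.\<close>

lemma gam_Gamma_diff:
  assumes f: "gam W p f"
  shows "gam W (p + 1) (mdiff (\<Gamma> W) p f)"
proof (rule gamI)
  fix j and n :: "'k lie N" assume n: "n \<in> N_deg j"
  note dn = N_diff_in_deg[OF n]
  note sub = mod_subspace[OF W]
  have e: "mdiff (\<Gamma> W) p f j n = (\<lambda>k. mdiff W (j + p) (f j n k) - (- 1) powi p *\<^sub>C f (j + 1) (N_diff n) k)"
    using n by (simp add: fun_eq_iff Gamma_simps)
  have A: "(\<lambda>k. mdiff W (j + p) (f j n k)) \<in> regfun_in (mcar W (j + (p + 1)))"
    using regfun_in_lin[OF gam_reg[OF f n refl] sub mod_diff[OF W]] by (simp add: add.assoc)
  have B: "f (j + 1) (N_diff n) \<in> regfun_in (mcar W (j + (p + 1)))"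
    by (rule gam_reg[OF f dn]) simp
  show "mdiff (\<Gamma> W) p f j n \<in> regfun_in (mcar W (j + (p + 1)))"
    unfolding e using regfun_in_add[OF A regfun_in_scale[OF B regfun_const[of "- ((- 1) powi p)"]]] by simp
  note va = gam_value[OF f n refl] and vb = gam_value[OF f dn, of "j + (p + 1)"]
  show "mdiff (\<Gamma> W) p f j (c *\<^sub>C n) k = c *\<^sub>C mdiff (\<Gamma> W) p f j n k" for c k
    using n dn by (simp add: Gamma_simps N_deg_scale gam_scale[OF f] lin_on_scale[OF mod_diff[OF W]] va N_diff_simps
        complex_vector.scale_right_diff_distrib complex_vector.scale_left_commute)
  show "mdiff (\<Gamma> W) p f j (n + n') k = mdiff (\<Gamma> W) p f j n k + mdiff (\<Gamma> W) p f j n' k" if n': "n' \<in> N_deg j" for n' k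
    using n dn n' N_diff_in_deg[OF n'] gam_value[OF f n' refl, of k]
    by (simp add: Gamma_simps N_deg_add gam_add[OF f] lin_on_add[OF mod_diff[OF W]] va N_diff_simps scaleC_add_right)
  show "mdiff (\<Gamma> W) p f j (N_ev X * n) k = lam W X (j + (p + 1)) (mdiff (\<Gamma> W) p f j n) k" for X k
  proof -
    have "mdiff (\<Gamma> W) p f j (N_ev X * n) k = mdiff W (j + p) (lam W X (j + p) (f j n) k)
        - (- 1) powi p *\<^sub>C lam W X (j + 1 + p) (f (j + 1) (N_diff n)) k"
      using n dn by (simp add: Gamma_simps N_deg_ev_mult N_diff_simps N_parity_hom gam_ev[OF f])
    also have "\<dots> = lam W X (j + (p + 1)) (\<lambda>k. mdiff W (j + p) (f j n k)) k
        - (- 1) powi p *\<^sub>C lam W X (j + (p + 1)) (f (j + 1) (N_diff n)) k"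
      using lam_diff[OF gam_reg[OF f n refl], of X k] by (simp add: add_ac)
    finally show ?thesis unfolding e lam_lincomb[OF A B] .
  qed
  show "mdiff (\<Gamma> W) p f j (N_map (Ad (\<gamma> t)) n) k = mgrp W t (j + (p + 1)) (mdiff (\<Gamma> W) p f j n (inverse (\<gamma> t) * k))" for t k
  proof -
    let ?k = "inverse (\<gamma> t) * k"
    have "mdiff (\<Gamma> W) p f j (N_map (Ad (\<gamma> t)) n) k = mgrp W t (j + (p + 1)) (mdiff W (j + p) (f j n ?k))
        - (- 1) powi p *\<^sub>C mgrp W t (j + (p + 1)) (f (j + 1) (N_diff n) ?k)"
      using n dn by (simp add: Gamma_simps N_map_in_deg lie_hom_Ad gam_grp[OF f] N_map_diff mod_grp_diff[OF W] va add_ac)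
    moreover have "mdiff W (j + p) (f j n ?k) \<in> mcar W (j + (p + 1))"
      using lin_on_in[OF mod_diff[OF W] va, of ?k] by (simp add: add.assoc)
    moreover have "f (j + 1) (N_diff n) ?k \<in> mcar W (j + (p + 1))" by (rule vb) simp
    ultimately show ?thesis unfolding e
      by (simp add: lin_on_diff[OF algebraic_action_lin[OF mod_grp[OF W]] sub] complex_vector.subspace_scale[OF sub]
        lin_on_scale[OF algebraic_action_lin[OF mod_grp[OF W]]])
  qed
  show "mdiff (\<Gamma> W) p f (i + j) (n * iota (N_map (lie_map \<gamma>) m)) k =
       (- 1) powi (i * (j + (p + 1))) *\<^sub>C mdg W i m (j + (p + 1)) (mdiff (\<Gamma> W) p f j n k)" if m: "m \<in> N_deg i" for i k m
  proof -
    let ?m = "iota (N_map (lie_map \<gamma>) m)" and ?dm = "iota (N_map (lie_map \<gamma>) (N_diff m))"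
    have mD: "m \<in> dg_deg std_dg i" using m by simp
    note m' = iota_\<gamma>_in_deg[OF m] and dm' = iota_\<gamma>_in_deg[OF N_diff_in_deg[OF m]]
    have d: "N_diff ?m = ?dm"
      using N_diff_iota[OF N_map_in_deg[OF \<gamma>_lie_hom m]] by (simp add: N_map_diff \<gamma>_lie_hom)
    have nm: "n * ?m \<in> N_deg (i + j)" using N_deg_mult[OF n m'] by (simp add: add.commute)
    have 1: "N_diff n * ?m \<in> N_deg (i + j + 1)" "n * ?dm \<in> N_deg (i + j + 1)"
      using N_deg_mult[OF dn m'] N_deg_mult[OF n dm'] by (simp_all add: add_ac)
    have "N_diff (n * ?m) = N_diff n * ?m + (- 1) powi j *\<^sub>C (n * ?dm)"
      by (simp add: N_diff_mult[OF n] d)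
    then have f2: "f (i + j + 1) (N_diff (n * ?m)) k = f (i + j + 1) (N_diff n * ?m) k + (- 1) powi j *\<^sub>C f (i + j + 1) (n * ?dm) k"
      using 1 by (simp add: gam_add[OF f] gam_scale[OF f] N_deg_scale)
    have f3: "f (i + j + 1) (N_diff n * ?m) k = (- 1) powi (i * (j + (p + 1))) *\<^sub>C mdg W i m (j + (p + 1)) (f (j + 1) (N_diff n) k)"
      using gam_dg[OF f m dn, of k] by (simp add: add_ac)
    have f4: "f (i + j + 1) (n * ?dm) k = (- 1) powi ((i + 1) * (j + p)) *\<^sub>C mdg W (i + 1) (N_diff m) (j + p) (f j n k)"
      using gam_dg[OF f N_diff_in_deg[OF m] n, of k] by (simp add: add_ac)
    have vdg: "mdg W i m (j + p) (f j n k) \<in> mcar W (i + j + p)"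
      using lin_on_in[OF mod_dg[OF W mD] va, of k] by (simp add: add.assoc)
    have f1: "mdiff W (i + j + p) (f (i + j) (n * ?m) k) = (- 1) powi (i * (j + p)) *\<^sub>C
        (mdg W (i + 1) (N_diff m) (j + p) (f j n k) + (- 1) powi i *\<^sub>C mdg W i m (j + (p + 1)) (mdiff W (j + p) (f j n k)))"
      using mod_dg_diff[OF W mD va, of k]
      unfolding gam_dg[OF f m n] lin_on_scale[OF mod_diff[OF W] vdg] by (simp add: add_ac)
    have v1: "mdiff W (j + p) (f j n k) \<in> mcar W (j + (p + 1))"
      using lin_on_in[OF mod_diff[OF W] va, of k] by (simp add: add.assoc)
    have v2: "f (j + 1) (N_diff n) k \<in> mcar W (j + (p + 1))" by (rule vb) simp
    have "mdiff (\<Gamma> W) p f (i + j) (n * ?m) k = mdiff W (i + j + p) (f (i + j) (n * ?m) k) - (- 1) powi p *\<^sub>C f (i + j + 1) (N_diff (n * ?m)) k"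
      using nm by (simp add: Gamma_simps)
    also have "\<dots> = (- 1) powi (i * (j + p)) *\<^sub>C mdg W (i + 1) (N_diff m) (j + p) (f j n k)
        + (- 1) powi (i * (j + p) + i) *\<^sub>C mdg W i m (j + (p + 1)) (mdiff W (j + p) (f j n k))
        - ((- 1) powi (p + i * (j + (p + 1))) *\<^sub>C mdg W i m (j + (p + 1)) (f (j + 1) (N_diff n) k)
           + (- 1) powi (p + (j + (i + 1) * (j + p))) *\<^sub>C mdg W (i + 1) (N_diff m) (j + p) (f j n k))"
      unfolding f1 f2 f3 f4 scaleC_add_right neg_one_powi_scale ..
    \<comment> \<open>The exponents differ by 2(j + p), hence the two terms with
      \<open>N_diff m\<close> have equal coefficients and cancel.\<close>
    also have "(- 1) powi (p + (j + (i + 1) * (j + p))) = ((- 1) powi (i * (j + p)) :: complex)"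
      by (rule neg_one_powi_cong) auto
    also have "(- 1) powi (i * (j + p) + i) = ((- 1) powi (i * (j + (p + 1))) :: complex)"
      by (rule neg_one_powi_cong) auto
    also have "(- 1) powi (p + i * (j + (p + 1))) = ((- 1) powi (i * (j + (p + 1)) + p) :: complex)"
      by (rule neg_one_powi_cong) auto
    finally show ?thesis unfolding e
      by (simp add: lin_on_diff[OF mod_dg[OF W mD] sub v1] complex_vector.subspace_scale[OF sub] v2
          lin_on_scale[OF mod_dg[OF W mD] v2] complex_vector.scale_right_diff_distrib neg_one_powi)
  qed
next
  show "n \<notin> N_deg j \<Longrightarrow> mdiff (\<Gamma> W) p f j n k = 0" for j n k by (simp add: Gamma_simps)
qed

end

context
  fixes W :: "('t, 'a, 'w::complex_vector) equiv_complex"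
  assumes W: "is_module (hc_pullback \<gamma> H) std_dg W"
begin

lemma gam_Gamma_alg:
  assumes f: "gam W p f"
  shows "gam W p (malg (\<Gamma> W) a p f)"
proof (rule gamI)
  fix j and n :: "'k lie N" assume n: "n \<in> N_deg j"
  note sub = mod_subspace[OF W]
  note act = hc_action[OF hc]
  note fr = gam_reg[OF W f n refl] and v = gam_value[OF W f n refl]
  have e: "malg (\<Gamma> W) a p f j n = (\<lambda>k. malg W (hc_act H k a) (j + p) (f j n k))"
    by (simp add: fun_eq_iff Gamma_simps)
  have ar: "(\<lambda>k. hc_act H k b) \<in> regfun_in UNIV" for b
    by (rule algebraic_action_reg[OF act complex_vector.subspace_UNIV UNIV_I])
  have bil: "lin_on (mcar W q) (mcar W q) (malg W b q)" "y \<in> mcar W q \<Longrightarrow> lin_on UNIV (mcar W q) (\<lambda>b. malg W b q y)" for b q y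
    by (rule mod_alg[OF W])
      (simp add: lin_on_def image_subset_iff mod_alg_add[OF W] mod_alg_scale[OF W] lin_on_in[OF mod_alg[OF W]])
  note S = complex_vector.subspace_UNIV
  show "malg (\<Gamma> W) a p f j n \<in> regfun_in (mcar W (j + p))"
    unfolding e by (rule regfun_in_bilin[where B="\<lambda>b. malg W b (j + p)", OF ar fr S sub bil])
  show "malg (\<Gamma> W) a p f j (c *\<^sub>C n) k = c *\<^sub>C malg (\<Gamma> W) a p f j n k" for c k
    using n by (simp add: Gamma_simps gam_scale[OF W f] lin_on_scale[OF mod_alg[OF W]] v)
  show "malg (\<Gamma> W) a p f j (n + n') k = malg (\<Gamma> W) a p f j n k + malg (\<Gamma> W) a p f j n' k" if n': "n' \<in> N_deg j" for n' k
    using n n' by (simp add: Gamma_simps gam_add[OF W f] lin_on_add[OF mod_alg[OF W]] v gam_value[OF W f n' refl])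
  show "malg (\<Gamma> W) a p f j (N_ev X * n) k = lam W X (j + p) (malg (\<Gamma> W) a p f j n) k" for X k
  proof -
    let ?A = "hc_act H k a" and ?F = "f j n k" and ?x = "hc_inc H X"
    \<comment> \<open>This uses that the differential of \<phi> is the commutator with \<psi>(X).
      The resulting term compensates exactly for \<phi>(k)a and \<psi>(X) not commuting.\<close>
    have A: "vderiv X (\<lambda>g. hc_act H (inverse g * k) a) = - (?x * ?A - ?A * ?x)"
      using vderiv_inverse[OF ar[of ?A], of X]
      by (simp add: algebraic_action_mult[OF act UNIV_I] hc_vderiv[OF hc])
    have ar': "(\<lambda>g. hc_act H (inverse g * k) a) \<in> regfun_in UNIV" by (rule regfun_in_inverse_mult[OF ar])
    have "left_deriv X (malg (\<Gamma> W) a p f j n) k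
       = malg W (- (?x * ?A - ?A * ?x)) (j + p) ?F + malg W ?A (j + p) (left_deriv X (f j n) k)"
      using vderiv_bilin[where B="\<lambda>b. malg W b (j + p)", OF ar' regfun_in_inverse_mult[OF fr] S sub bil, of X k]
      unfolding left_deriv_def e A by (simp add: group_simps)
    moreover have "malg W (- (?x * ?A - ?A * ?x)) (j + p) ?F
       = malg W ?A (j + p) (malg W ?x (j + p) ?F) - malg W ?x (j + p) (malg W ?A (j + p) ?F)"
      using lin_on_diff[OF bil(2)[OF v[of k]] S UNIV_I UNIV_I, of "?A * ?x" "?x * ?A"]
      by (simp add: mod_alg_mult[OF W v])
    moreover have "malg (\<Gamma> W) a p f j (N_ev X * n) k = malg W ?A (j + p) (malg W ?x (j + p) ?F) + malg W ?A (j + p) (left_deriv X (f j n) k)"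
      by (simp add: Gamma_simps gam_ev[OF W f n] lam_def lin_on_add[OF mod_alg[OF W]] lin_on_in[OF mod_alg[OF W]] v
        regfun_in_value[OF sub left_deriv_in[OF fr]])
    ultimately show ?thesis by (simp add: lam_def Gamma_simps)
  qed
  show "malg (\<Gamma> W) a p f j (N_map (Ad (\<gamma> t)) n) k = mgrp W t (j + p) (malg (\<Gamma> W) a p f j n (inverse (\<gamma> t) * k))" for t k
    using algebraic_action_mult[OF act UNIV_I, of "\<gamma> t" "inverse (\<gamma> t) * k" a]
    by (simp add: Gamma_simps gam_grp[OF W f n] mod_alg_grp[OF W v] group_simps)
  show "malg (\<Gamma> W) a p f (i + j) (n * iota (N_map (lie_map \<gamma>) m)) k =
       (- 1) powi (i * (j + p)) *\<^sub>C mdg W i m (j + p) (malg (\<Gamma> W) a p f j n k)" if m: "m \<in> N_deg i" for i k m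
  proof -
    have mD: "m \<in> dg_deg std_dg i" using m by simp
    note vd = lin_on_in[OF mod_dg[OF W mD] v, of k]
    show ?thesis using mod_alg_dg[OF W mD v, of "hc_act H k a" k]
      by (simp add: Gamma_simps gam_dg[OF W f m n] lin_on_scale[OF mod_alg[OF W] vd] add.assoc)
  qed
next
  fix j k and n :: "'k lie N" assume "n \<notin> N_deg j"
  then show "malg (\<Gamma> W) a p f j n k = 0"
    using lin_on_zero[OF mod_alg[OF W] mod_subspace[OF W]] by (simp add: Gamma_simps gam_out[OF W f])
qed

lemma gam_Gamma_grp:
  assumes f: "gam W p f"
  shows "gam W p (mgrp (\<Gamma> W) g p f)"
proof (rule gamI)
  fix j and n :: "'k lie N" assume n: "n \<in> N_deg j"
  note fr = gam_reg[OF W f n refl]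
  have e: "mgrp (\<Gamma> W) g p f j n = (\<lambda>k. f j n (k * g))" by (simp add: fun_eq_iff Gamma_simps)
  show "mgrp (\<Gamma> W) g p f j n \<in> regfun_in (mcar W (j + p))" unfolding e by (rule regfun_in_mult_right[OF fr])
  show "mgrp (\<Gamma> W) g p f j (N_ev X * n) k = lam W X (j + p) (mgrp (\<Gamma> W) g p f j n) k" for X k
    by (simp add: Gamma_simps gam_ev[OF W f n] lam_def left_deriv_def mult.assoc)
qed (simp_all add: Gamma_simps gam_scale[OF W f] gam_add[OF W f] gam_grp[OF W f] gam_dg[OF W f] gam_out[OF W f] mult.assoc)

text \<open>The action multiplies n on the left by Ad(k)(\<iota> x), which does not interfere with
  the right action of N(t). For linearity over the Lie algebra, the commutator of X with this factor
  is cancelled by its derivative in k.\<close>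

lemma gam_Gamma_dg:
  assumes f: "gam W p f" and x: "x \<in> N_deg i"
  shows "gam W (i + p) (mdg (\<Gamma> W) i x p f)"
proof (rule gamI)
  note sub = mod_subspace[OF W]
  fix j and n :: "'k lie N" assume n: "n \<in> N_deg j"
  let ?Y = "\<lambda>k. N_map (Ad k) (iota x)" and ?s = "(- 1) powi (i * p) :: complex"
  note Y = Ad_iota_in_deg[OF x]
  have q: "i + j + p = j + (i + p)" by simp
  have yn: "y * n \<in> N_deg (i + j)" if "y \<in> N_deg i" for y by (rule N_deg_mult[OF that n])
  let ?L = "\<lambda>y. f (i + j) (y * n)"
  have L: "lin_on (N_deg i) (regfun_in (mcar W (j + (i + p)))) ?L"
    using lin_on_compose[of "N_deg i" "N_deg (i + j)" "\<lambda>y. y * n", OF _ gam_lin[OF W f]] yn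
    by (simp add: q lin_on_def image_subset_iff distrib_right scaleC_mult_left)
  have Yr: "?Y \<in> regfun_in (N_deg i)" by (rule regfun_in_N_map_Ad[OF iota_in_deg[OF x]])
  define G where "G = (\<lambda>k. ?L (?Y k) k)"
  have e: "mdg (\<Gamma> W) i x p f j n = (\<lambda>k. ?s *\<^sub>C G k)" using n by (simp add: fun_eq_iff Gamma_simps G_def)
  have G: "G \<in> regfun_in (mcar W (j + (i + p)))"
    unfolding G_def by (rule regfun_in_diagonal[OF Yr N_deg_subspace L])
  show "mdg (\<Gamma> W) i x p f j n \<in> regfun_in (mcar W (j + (i + p)))"
    unfolding e by (rule regfun_in_scale[OF G regfun_const])
  show "mdg (\<Gamma> W) i x p f j (c *\<^sub>C n) k = c *\<^sub>C mdg (\<Gamma> W) i x p f j n k" for c k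
    using n yn[OF Y] by (simp add: Gamma_simps N_deg_scale scaleC_mult_right gam_scale[OF W f] mult.commute)
  show "mdg (\<Gamma> W) i x p f j (n + n') k = mdg (\<Gamma> W) i x p f j n k + mdg (\<Gamma> W) i x p f j n' k" if n': "n' \<in> N_deg j" for n' k
    using n n' yn[OF Y] N_deg_mult[OF Y n'] by (simp add: Gamma_simps N_deg_add distrib_left gam_add[OF W f] scaleC_add_right)
  show "mdg (\<Gamma> W) i x p f j (N_ev X * n) k = lam W X (j + (i + p)) (mdg (\<Gamma> W) i x p f j n) k" for X k
  proof -
    let ?L' = "\<lambda>y g. ?L y (inverse g * k)"
    have L': "lin_on (N_deg i) (regfun_in (mcar W (j + (i + p)))) ?L'"
      using regfun_in_inverse_mult[OF lin_on_in[OF L]] lin_on_add[OF L] lin_on_scale[OF L]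
      by (intro lin_onI) (simp_all add: fun_eq_iff plus_fun_def scaleC_fun_def)
    have dY: "vderiv X (\<lambda>g. ?Y (inverse g * k)) = - (N_ev X * ?Y k - ?Y k * N_ev X)"
      using vderiv_inverse[OF regfun_in_N_map_Ad_UNIV, of X "?Y k"] by (simp add: N_map_Ad_mult vderiv_N_map_Ad)
    have 1: "N_ev X * ?Y k \<in> N_deg i" "?Y k * N_ev X \<in> N_deg i"
      using N_deg_mult[OF N_deg_ev Y, of X k] N_deg_mult[OF Y N_deg_ev, of k X] by simp_all
    \<comment> \<open>Here k occurs both in the factor Ad(k)(\<iota> x) and as the argument. The
      derivative of the factor is the commutator Y X - X Y; applying f to X Y n produces
      \<lambda>(X) with the factor frozen, so that \<lambda>(X) G is the value at Y X n.\<close>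
    have "left_deriv X G k = left_deriv X (?L (?Y k)) k + ?L (vderiv X (\<lambda>g. ?Y (inverse g * k))) k"
      unfolding left_deriv_def G_def
      using vderiv_diagonal[OF regfun_in_inverse_mult[OF Yr] N_deg_subspace L', of X k] by (simp add: group_simps)
    also have "?L (vderiv X (\<lambda>g. ?Y (inverse g * k))) k = ?L (?Y k * N_ev X) k - ?L (N_ev X * ?Y k) k"
      unfolding dY minus_diff_eq using lin_on_diff[OF L N_deg_subspace 1(2,1)] by simp
    also have "?L (N_ev X * ?Y k) k = malg W (hc_inc H X) (j + (i + p)) (G k) + left_deriv X (?L (?Y k)) k"
      by (simp add: mult.assoc gam_ev[OF W f yn[OF Y]] lam_def G_def q)
    finally have "lam W X (j + (i + p)) G k = ?L (?Y k * N_ev X) k" by (simp add: lam_def)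
    then show ?thesis unfolding e lam_scale[OF W G] using n by (simp add: Gamma_simps N_deg_ev_mult mult.assoc)
  qed
  show "mdg (\<Gamma> W) i x p f j (N_map (Ad (\<gamma> t)) n) k = mgrp W t (j + (i + p)) (mdg (\<Gamma> W) i x p f j n (inverse (\<gamma> t) * k))" for t k
  proof -
    \<comment> \<open>Pulling Ad(\<gamma> t) out of the product turns the parameter k of the factor
      into inverse (\<gamma> t) * k, the argument that the equivariance of f under T
      produces.\<close>
    have "?Y k * N_map (Ad (\<gamma> t)) n = N_map (Ad (\<gamma> t)) (?Y (inverse (\<gamma> t) * k) * n)"
      by (simp add: N_map_simps lie_hom_Ad group_simps flip: N_map_Ad_mult)
    then have "f (i + j) (?Y k * N_map (Ad (\<gamma> t)) n) k = mgrp W t (j + (i + p)) (G (inverse (\<gamma> t) * k))"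
      by (simp add: gam_grp[OF W f yn[OF Y]] G_def q)
    then show ?thesis using n regfun_in_value[OF sub G, of "inverse (\<gamma> t) * k"] unfolding e
      by (simp add: Gamma_simps N_map_in_deg lie_hom_Ad lin_on_scale[OF algebraic_action_lin[OF mod_grp[OF W]]])
  qed
  show "mdg (\<Gamma> W) i x p f (h + j) (n * iota (N_map (lie_map \<gamma>) m)) k =
       (- 1) powi (h * (j + (i + p))) *\<^sub>C mdg W h m (j + (i + p)) (mdg (\<Gamma> W) i x p f j n k)" if m: "m \<in> N_deg h" for h k m
  proof -
    have mD: "m \<in> dg_deg std_dg h" using m by simp
    have nm: "n * iota (N_map (lie_map \<gamma>) m) \<in> N_deg (h + j)"
      using N_deg_mult[OF n iota_\<gamma>_in_deg[OF m]] by (simp add: add.commute)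
    have "f (i + (h + j)) (?Y k * n * iota (N_map (lie_map \<gamma>) m)) k
        = (- 1) powi (h * (j + (i + p))) *\<^sub>C mdg W h m (j + (i + p)) (G k)"
      using gam_dg[OF W f m yn[OF Y], of k] by (simp add: G_def q add.left_commute)
    then have "mdg (\<Gamma> W) i x p f (h + j) (n * iota (N_map (lie_map \<gamma>) m)) k
        = ?s *\<^sub>C (- 1) powi (h * (j + (i + p))) *\<^sub>C mdg W h m (j + (i + p)) (G k)"
      using nm by (simp only: Gamma_simps if_True mult.assoc)
    then show ?thesis unfolding e lin_on_scale[OF mod_dg[OF W mD] regfun_in_value[OF sub G]]
      by (simp only: complex_vector.scale_left_commute[of ?s])
  qed
next
  show "n \<notin> N_deg j \<Longrightarrow> mdg (\<Gamma> W) i x p f j n k = 0" for j n k by (simp add: Gamma_simps)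
qed

section \<open>The action of K on the Hom complex is algebraic\<close>

lemma gam_subspace: "complex_vector.subspace {f. gam W p f}"
proof (rule complex_vector.subspaceI)
  note sub = mod_subspace[OF W]
  show "0 \<in> {f. gam W p f}"
  proof (rule CollectI, rule gamI)
    fix j X k and n :: "'k lie N" assume "n \<in> N_deg j"
    show "(0 :: int \<Rightarrow> 'k lie N \<Rightarrow> 'k \<Rightarrow> 'w) j (N_ev X * n) k = lam W X (j + p) ((0 :: int \<Rightarrow> 'k lie N \<Rightarrow> 'k \<Rightarrow> 'w) j n) k"
      using lin_on_zero[OF lam_lin[OF W] regfun_in_subspace, of X "j + p"] by simp
  next
    fix j and n :: "'k lie N"
    show "(0 :: int \<Rightarrow> 'k lie N \<Rightarrow> 'k \<Rightarrow> 'w) j n \<in> regfun_in (mcar W (j + p))"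
      using regfun_in_zero by (simp add: zero_fun_def)
  next
    fix i j k and m :: "'t lie N" and n :: "'k lie N" assume "m \<in> N_deg i"
    then have "m \<in> dg_deg std_dg i" by simp
    from lin_on_zero[OF mod_dg[OF W this] sub, of "j + p"]
    show "(0 :: int \<Rightarrow> 'k lie N \<Rightarrow> 'k \<Rightarrow> 'w) (i + j) (n * iota (N_map (lie_map \<gamma>) m)) k =
       (- 1) powi (i * (j + p)) *\<^sub>C mdg W i m (j + p) ((0 :: int \<Rightarrow> 'k lie N \<Rightarrow> 'k \<Rightarrow> 'w) j n k)" by simp
  qed (simp_all add: lin_on_zero[OF algebraic_action_lin[OF mod_grp[OF W]] sub])
next
  note sub = mod_subspace[OF W]
  fix f g c assume "f \<in> {f. gam W p f}" "g \<in> {f. gam W p f}"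
  then have f: "gam W p f" and g: "gam W p g" by auto
  show "f + g \<in> {f. gam W p f}"
  proof (rule CollectI, rule gamI)
    fix j and n :: "'k lie N" assume n: "n \<in> N_deg j"
    note r = gam_reg[OF W f n refl] gam_reg[OF W g n refl] and v = gam_value[OF W f n refl] gam_value[OF W g n refl]
    show "(f + g) j n \<in> regfun_in (mcar W (j + p))"
      using regfun_in_add[OF r] by (simp add: plus_fun_def)
    show "(f + g) j (N_ev X * n) k = lam W X (j + p) ((f + g) j n) k" for X k
      using lin_on_add[OF lam_lin[OF W] r, of X] by (simp add: gam_ev[OF W f n] gam_ev[OF W g n])
    show "(f + g) j (N_map (Ad (\<gamma> t)) n) k = mgrp W t (j + p) ((f + g) j n (inverse (\<gamma> t) * k))" for t k
      by (simp add: gam_grp[OF W f n] gam_grp[OF W g n] lin_on_add[OF algebraic_action_lin[OF mod_grp[OF W]]] v)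
    show "(f + g) (i + j) (n * iota (N_map (lie_map \<gamma>) m)) k =
       (- 1) powi (i * (j + p)) *\<^sub>C mdg W i m (j + p) ((f + g) j n k)" if m: "m \<in> N_deg i" for i k m
    proof -
      have mD: "m \<in> dg_deg std_dg i" using m by simp
      show ?thesis by (simp add: gam_dg[OF W f m n] gam_dg[OF W g m n] lin_on_add[OF mod_dg[OF W mD]] v scaleC_add_right)
    qed
  qed (simp_all add: gam_add[OF W f] gam_add[OF W g] gam_scale[OF W f] gam_scale[OF W g] gam_out[OF W f] gam_out[OF W g] scaleC_add_right)
next
  note sub = mod_subspace[OF W]
  fix f c assume "f \<in> {f. gam W p f}"
  then have f: "gam W p f" by auto
  show "c *\<^sub>C f \<in> {f. gam W p f}"
  proof (rule CollectI, rule gamI)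
    fix j and n :: "'k lie N" assume n: "n \<in> N_deg j"
    note r = gam_reg[OF W f n refl] and v = gam_value[OF W f n refl]
    show "(c *\<^sub>C f) j n \<in> regfun_in (mcar W (j + p))"
      using regfun_in_scale[OF r regfun_const] by (simp add: scaleC_fun_def)
    show "(c *\<^sub>C f) j (N_ev X * n) k = lam W X (j + p) ((c *\<^sub>C f) j n) k" for X k
      using lam_scale[OF W r, of X c k] by (simp add: gam_ev[OF W f n] scaleC_fun_def)
    show "(c *\<^sub>C f) j (N_map (Ad (\<gamma> t)) n) k = mgrp W t (j + p) ((c *\<^sub>C f) j n (inverse (\<gamma> t) * k))" for t k
      by (simp add: gam_grp[OF W f n] lin_on_scale[OF algebraic_action_lin[OF mod_grp[OF W]]] v scaleC_fun_def)
    show "(c *\<^sub>C f) (i + j) (n * iota (N_map (lie_map \<gamma>) m)) k =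
       (- 1) powi (i * (j + p)) *\<^sub>C mdg W i m (j + p) ((c *\<^sub>C f) j n k)" if m: "m \<in> N_deg i" for i k m
    proof -
      have mD: "m \<in> dg_deg std_dg i" using m by simp
      show ?thesis by (simp add: gam_dg[OF W f m n] lin_on_scale[OF mod_dg[OF W mD]] v scaleC_fun_def mult.commute)
    qed
  qed (simp_all add: gam_add[OF W f] gam_scale[OF W f] gam_out[OF W f] scaleC_add_right scaleC_fun_def mult.commute)
qed

text \<open>If f vanishes as a function on K at a generator e, then so does its value at u e for
  every u in U(k), since \<lambda>(X) maps the zero function to itself.\<close>

lemma gam_eqI:
  fixes E :: "(int \<times> 'k lie N) set"
  assumes E: "\<And>j e. (j, e) \<in> E \<Longrightarrow> e \<in> N_deg j"
    "\<And>j n. n \<in> N_deg j \<Longrightarrow> n \<in> complex_vector.span {U_to_N u * e | u e. (j, e) \<in> E}"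
    and f: "gam W p f" and 0: "\<And>j e. (j, e) \<in> E \<Longrightarrow> f j e = 0"
  shows "f = 0"
proof (intro ext)
  fix j k and n :: "'k lie N"
  show "f j n k = (0 :: int \<Rightarrow> 'k lie N \<Rightarrow> 'k \<Rightarrow> 'w) j n k"
  proof (cases "n \<in> N_deg j")
    case False
    then show ?thesis by (simp add: gam_out[OF W f])
  next
    case True
    have U: "n \<in> N_deg j \<Longrightarrow> \<forall>k. f j n k = 0 \<Longrightarrow> f j (U_to_N u * n) k = 0" for u n j k
    proof (induction u arbitrary: n k rule: presented_induct)
      case (gen g)
      obtain z where g: "g = UGen z" by (cases g)
      have "f j n = 0" using gen(2) by (simp add: fun_eq_iff)
      moreover have "lam W z (j + p) (0 :: 'k \<Rightarrow> 'w) = 0" by (rule lin_on_zero[OF lam_lin[OF W] regfun_in_subspace])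
      ultimately show ?case
        using fun_cong[OF gam_ev[OF W f gen(1), of z], of k] by (simp only: g U_to_N_simps zero_fun_apply)
    qed (simp_all add: U_to_N_simps scaleC_mult_left gam_scale[OF W f] distrib_right gam_add[OF W f] mult.assoc N_deg_U_mult)
    have sp: "{U_to_N u * e | u e. (j, e) \<in> E} \<subseteq> N_deg j" using E(1) N_deg_U_mult by blast
    have "n \<in> complex_vector.span {U_to_N u * e | u e. (j, e) \<in> E}" by (rule E(2)[OF True])
    then have "f j n k = 0"
    proof (induction rule: span_induct_strong)
      case zero
      show ?case by (rule gam_zero[OF W f])
    next
      case (add c x y)
      have "y \<in> N_deg j" using add(2) complex_vector.span_minimal[OF sp N_deg_subspace] by blast
      moreover have "x \<in> N_deg j" using add(1) sp by blast
      moreover have "f j x k = 0" using add(1) U E(1) 0 by auto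
      ultimately show ?case using add(3)
        by (simp add: gam_add[OF W f] gam_scale[OF W f] N_deg_scale)
    qed
    then show ?thesis by simp
  qed
qed

text \<open>Restriction to the finitely many generators E is an injective linear map, so
  \<open>regfun_in_reflect\<close> applies. In each of these coordinates the orbit map is right
  translation of one function in R(K) \<otimes> W, which is regular by
  \<open>regfun_in_translate\<close>.\<close>

lemma gam_orbit_regular:
  assumes f: "gam W p f"
  shows "(\<lambda>g. mgrp (\<Gamma> W) g p f) \<in> regfun_in {f. gam W p f}"
proof -
  obtain B :: "'k lie set" where B: "finite B" "complex_vector.span B = UNIV" by (rule lie_finite_basis)
  obtain E :: "(int \<times> 'k lie N) set" where E: "finite E" "\<And>j e. (j, e) \<in> E \<Longrightarrow> e \<in> N_deg j"
    "\<And>j n. n \<in> N_deg j \<Longrightarrow> n \<in> complex_vector.span {U_to_N u * e | u e. (j, e) \<in> E}"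
    by (rule N_deg_finitely_generated[OF B]) (rule that)
  let ?R = "\<lambda>f j n. if (j, n) \<in> E then f j n else (0 :: 'k \<Rightarrow> 'w)"
  \<comment> \<open>The family supported at the single index e with value F; restrictions to E are
    finite sums of such families.\<close>
  let ?\<delta> = "\<lambda>e (F :: 'k \<Rightarrow> 'w) j n. if (j, n) = e then F else 0"
  show ?thesis
  proof (rule regfun_in_reflect[where L="?R", OF _ gam_subspace])
    show "lin_on {f. gam W p f} UNIV ?R"
      by (auto simp: lin_on_def fun_eq_iff scaleC_fun_def)
    show "mgrp (\<Gamma> W) g p f \<in> {f. gam W p f}" for g using gam_Gamma_grp[OF f] by simp
    show "f = 0" if "f \<in> {f. gam W p f}" "?R f = 0" for f
    proof (rule gam_eqI[OF E(2,3)])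
      show "gam W p f" using that by simp
      show "f j e = 0" if "(j, e) \<in> E" for j e
        using fun_cong[OF fun_cong[OF \<open>?R f = 0\<close>, of j], of e] that by simp
    qed
    have single: "(\<lambda>g. ?\<delta> (j, e) (\<lambda>k. f j e (k * g))) \<in> regfun_in UNIV" if "(j, e) \<in> E" for j e
    proof (rule regfun_in_lin[OF regfun_in_translate complex_vector.subspace_UNIV, where L="?\<delta> (j, e)"])
      show "f j e \<in> regfun_in (mcar W (j + p))" by (rule gam_reg[OF W f E(2)[OF that] refl])
      show "lin_on UNIV UNIV (?\<delta> (j, e))" by (auto simp: lin_on_def fun_eq_iff scaleC_fun_def)
    qed
    have "(\<lambda>g. \<Sum>e\<in>E. ?\<delta> e (\<lambda>k. f (fst e) (snd e) (k * g))) \<in> regfun_in UNIV"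
    proof (intro regfun_in_sum)
      fix e assume "e \<in> E"
      then show "(\<lambda>g. ?\<delta> e (\<lambda>k. f (fst e) (snd e) (k * g))) \<in> regfun_in UNIV"
        using single[of "fst e" "snd e"] by simp
    qed
    moreover have "(\<Sum>e\<in>E. ?\<delta> e (\<lambda>k. f (fst e) (snd e) (k * g))) = ?R (mgrp (\<Gamma> W) g p f)" for g
    proof (intro ext)
      fix j n k
      have "(\<Sum>e\<in>E. ?\<delta> e (\<lambda>k. f (fst e) (snd e) (k * g))) j n k = (\<Sum>e\<in>E. if (j, n) = e then f j n (k * g) else 0)"
        unfolding sum_fun_apply by (rule sum.cong[OF refl]) auto
      also have "\<dots> = (if (j, n) \<in> E then f j n (k * g) else 0)" using E(1) by simp
      finally show "(\<Sum>e\<in>E. ?\<delta> e (\<lambda>k. f (fst e) (snd e) (k * g))) j n k = ?R (mgrp (\<Gamma> W) g p f) j n k"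
        by (simp add: Gamma_simps)
    qed
    ultimately show "(\<lambda>g. ?R (mgrp (\<Gamma> W) g p f)) \<in> regfun_in UNIV" by simp
  qed
qed

end

section \<open>The axioms of an equivariant complex for \<Gamma>(W)\<close>

lemma Gamma_module:
  fixes W :: "('t, 'a, 'w::complex_vector) equiv_complex"
  assumes W: "is_module (hc_pullback \<gamma> H) std_dg W"
  shows "is_module H std_dg (\<Gamma> W)"
  unfolding is_module_def
proof (intro conjI allI ballI, simp_all only: Gamma_car[OF W] std_dg_simps mem_Collect_eq)
  let ?G = "Gamma_eq H \<gamma> W"
  note sub = mod_subspace[OF W]
  note act = hc_action[OF hc]
  fix p
  show "complex_vector.subspace {f. gam W p f}" by (rule gam_subspace[OF W])
  show "lin_on {f. gam W p f} {f. gam W (p + 1) f} (mdiff ?G p)"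
  proof (rule lin_onI)
    fix f g c assume "f \<in> {f. gam W p f}" "g \<in> {f. gam W p f}"
    then have f: "gam W p f" and g: "gam W p g" by auto
    show "mdiff ?G p (f + g) = mdiff ?G p f + mdiff ?G p g"
      using gam_value[OF W f _ refl] gam_value[OF W g _ refl]
      by (intro ext) (simp add: Gamma_simps lin_on_add[OF mod_diff[OF W]] scaleC_add_right)
  next
    fix f c assume "f \<in> {f. gam W p f}"
    then have f: "gam W p f" by auto
    then show "mdiff ?G p f \<in> {f. gam W (p + 1) f}" using gam_Gamma_diff[OF W] by simp
    show "mdiff ?G p (c *\<^sub>C f) = c *\<^sub>C mdiff ?G p f"
      using gam_value[OF W f _ refl]
      by (intro ext) (simp add: Gamma_simps scaleC_fun_def lin_on_scale[OF mod_diff[OF W]]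
          complex_vector.scale_right_diff_distrib complex_vector.scale_left_commute)
  qed
  show "lin_on {f. gam W p f} {f. gam W p f} (malg ?G a p)" for a
  proof (rule lin_onI)
    fix f g assume "f \<in> {f. gam W p f}" "g \<in> {f. gam W p f}"
    then have f: "gam W p f" and g: "gam W p g" by auto
    show "malg ?G a p (f + g) = malg ?G a p f + malg ?G a p g"
    proof (intro ext)
      fix j n k show "malg ?G a p (f + g) j n k = (malg ?G a p f + malg ?G a p g) j n k"
        by (cases "n \<in> N_deg j") (simp_all add: Gamma_simps lin_on_add[OF mod_alg[OF W]] gam_value[OF W f _ refl]
            gam_value[OF W g _ refl] gam_out[OF W f] gam_out[OF W g] lin_on_zero[OF mod_alg[OF W] sub])
    qed
  next
    fix f c assume "f \<in> {f. gam W p f}"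
    then have f: "gam W p f" by auto
    then show "malg ?G a p f \<in> {f. gam W p f}" using gam_Gamma_alg[OF W] by simp
    show "malg ?G a p (c *\<^sub>C f) = c *\<^sub>C malg ?G a p f"
    proof (intro ext)
      fix j n k show "malg ?G a p (c *\<^sub>C f) j n k = (c *\<^sub>C malg ?G a p f) j n k"
        by (cases "n \<in> N_deg j") (simp_all add: Gamma_simps lin_on_scale[OF mod_alg[OF W]] gam_value[OF W f _ refl]
            gam_out[OF W f] lin_on_zero[OF mod_alg[OF W] sub] scaleC_fun_def)
    qed
  qed
  show "algebraic_action {f. gam W p f} (\<lambda>g. mgrp ?G g p)"
  proof (rule algebraic_actionI[OF gam_subspace[OF W]])
    show "lin_on {f. gam W p f} {f. gam W p f} (mgrp ?G g p)" for g
      using gam_Gamma_grp[OF W] by (intro lin_onI ext) (simp_all add: Gamma_simps scaleC_fun_def)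
    show "(\<lambda>g. mgrp ?G g p f) \<in> regfun_in UNIV" if "f \<in> {f. gam W p f}" for f
      using regfun_in_mono[OF gam_orbit_regular[OF W] subset_UNIV] that by simp
  qed (simp_all add: Gamma_simps fun_eq_iff mult.assoc)
  fix f assume f: "gam W p f"
  note v = gam_value[OF W f _ refl]
  note o = gam_out[OF W f]
  \<comment> \<open>The normalisation f j n = 0 for n outside \<open>N_deg j\<close> keeps all
    values in the carrier, so many identities need no case distinction.\<close>
  have vv: "f j n k \<in> mcar W (j + p)" for j n k
    using v o mod_zero[OF W] by (cases "n \<in> N_deg j") auto
  show "mdiff ?G (p + 1) (mdiff ?G p f) = 0"
  proof (intro ext)
    fix j k and n :: "'k lie N"
    show "mdiff ?G (p + 1) (mdiff ?G p f) j n k = (0 :: int \<Rightarrow> 'k lie N \<Rightarrow> 'k \<Rightarrow> 'w) j n k"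
    proof (cases "n \<in> N_deg j")
      case True
      note dn = N_diff_in_deg[OF True]
      have 1: "mdiff W (j + p) (f j n k) \<in> mcar W (j + (p + 1))"
        using lin_on_in[OF mod_diff[OF W] v[OF True], of k] by (simp add: add.assoc)
      have 2: "f (j + 1) (N_diff n) k \<in> mcar W (j + (p + 1))" using v[OF dn, of k] by (simp add: add_ac)
      have 3: "mdiff W (j + (p + 1)) (mdiff W (j + p) (f j n k)) = 0"
        using mod_diff_diff[OF W v[OF True], of k] by (simp add: add.assoc)
      have "mdiff ?G (p + 1) (mdiff ?G p f) j n k =
          mdiff W (j + (p + 1)) (mdiff W (j + p) (f j n k) - (- 1) powi p *\<^sub>C f (j + 1) (N_diff n) k)
          - (- 1) powi (p + 1) *\<^sub>C mdiff W (j + (p + 1)) (f (j + 1) (N_diff n) k)"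
        using True dn gam_zero[OF W f] by (simp add: Gamma_simps N_diff_diff add_ac)
      also have "\<dots> = 0"
        unfolding lin_on_diff[OF mod_diff[OF W] sub 1 complex_vector.subspace_scale[OF sub 2]] lin_on_scale[OF mod_diff[OF W] 2] 3
        by (simp add: power_int_add)
      finally show ?thesis by simp
    qed (simp add: Gamma_simps)
  qed
  show "malg ?G 1 p f = f"
    by (intro ext) (simp add: Gamma_simps hc_act_one[OF hc] mod_alg_one[OF W vv])
  show "malg ?G (a + b) p f = malg ?G a p f + malg ?G b p f" for a b
    by (intro ext) (simp add: Gamma_simps lin_on_add[OF algebraic_action_lin[OF act]] mod_alg_add[OF W vv])
  show "malg ?G (a * b) p f = malg ?G a p (malg ?G b p f)" for a b
    by (intro ext) (simp add: Gamma_simps hc_act_mult[OF hc] mod_alg_mult[OF W vv])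
  show "malg ?G (c *\<^sub>C a) p f = c *\<^sub>C malg ?G a p f" for c a
    by (intro ext) (simp add: Gamma_simps scaleC_fun_def lin_on_scale[OF algebraic_action_lin[OF act]] mod_alg_scale[OF W vv])
  show "mdiff ?G p (malg ?G a p f) = malg ?G a (p + 1) (mdiff ?G p f)" for a
  proof (intro ext)
    fix j k and n :: "'k lie N"
    show "mdiff ?G p (malg ?G a p f) j n k = malg ?G a (p + 1) (mdiff ?G p f) j n k"
    proof (cases "n \<in> N_deg j")
      case True
      have 1: "mdiff W (j + p) (f j n k) \<in> mcar W (j + (p + 1))"
        using lin_on_in[OF mod_diff[OF W] vv, of j n k] by (simp add: add.assoc)
      have 2: "f (j + 1) (N_diff n) k \<in> mcar W (j + (p + 1))" using vv[of "j + 1" "N_diff n" k] by (simp add: add_ac)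
      let ?b = "hc_act H k a"
      have 3: "malg W ?b (j + (p + 1)) (mdiff W (j + p) (f j n k) - (- 1) powi p *\<^sub>C f (j + 1) (N_diff n) k)
          = malg W ?b (j + (p + 1)) (mdiff W (j + p) (f j n k)) - (- 1) powi p *\<^sub>C malg W ?b (j + (p + 1)) (f (j + 1) (N_diff n) k)"
        unfolding lin_on_diff[OF mod_alg[OF W] sub 1 complex_vector.subspace_scale[OF sub 2]] lin_on_scale[OF mod_alg[OF W] 2] ..
      have 4: "mdiff W (j + p) (malg W ?b (j + p) (f j n k)) = malg W ?b (j + (p + 1)) (mdiff W (j + p) (f j n k))"
        using mod_alg_diff[OF W vv[of j n k], of ?b] by (simp add: add.assoc)
      have 5: "j + 1 + p = j + (p + 1)" by simp
      show ?thesis using True by (simp only: Gamma_simps if_True 3 4 5)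
    next
      case False
      then show ?thesis using lin_on_zero[OF mod_alg[OF W] sub] by (simp add: Gamma_simps)
    qed
  qed
  show "mdiff ?G p (mgrp ?G g p f) = mgrp ?G g (p + 1) (mdiff ?G p f)" for g
    by (intro ext) (simp add: Gamma_simps)
  show "malg ?G (hc_act H g a) p f = mgrp ?G g p (malg ?G a p (mgrp ?G (inverse g) p f))" for g a
    by (intro ext) (simp add: Gamma_simps algebraic_action_mult[OF act UNIV_I] group_simps mult.assoc)
  show "mdg ?G 0 1 p f = f"
  proof (intro ext)
    fix j k and n :: "'k lie N"
    show "mdg ?G 0 1 p f j n k = f j n k"
      by (cases "n \<in> N_deg j") (simp_all add: Gamma_simps iota_simps N_map_simps lie_hom_Ad scaleC_one o)
  qed
  show "malg ?G (hc_inc H \<xi>) p f + mdg ?G 0 (N_ev \<xi>) p f = vderiv \<xi> (\<lambda>k. mgrp ?G k p f)" for \<xi>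
  proof (intro ext)
    fix j k and n :: "'k lie N"
    have "lin_on UNIV UNIV (\<lambda>F :: int \<Rightarrow> 'k lie N \<Rightarrow> 'k \<Rightarrow> 'w. F j n k)" by (simp add: lin_on_def scaleC_fun_def)
    from vderiv_lin[OF regfun_in_mono[OF gam_orbit_regular[OF W f] subset_UNIV] complex_vector.subspace_UNIV this, of \<xi>]
    have *: "vderiv \<xi> (\<lambda>k. mgrp ?G k p f) j n k = vderiv \<xi> (\<lambda>g. f j n (k * g))" by (simp add: Gamma_simps)
    show "(malg ?G (hc_inc H \<xi>) p f + mdg ?G 0 (N_ev \<xi>) p f) j n k = vderiv \<xi> (\<lambda>k. mgrp ?G k p f) j n k"
    proof (cases "n \<in> N_deg j")
      case True
      \<comment> \<open>Since \<iota> \<xi> = -\<xi>, the action of \<xi> through N(k) is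
        -\<lambda>(Ad(k) \<xi>) applied to f j n. Its algebra summand cancels the action of
        \<psi>(\<xi>), by equivariance of \<psi>; the derivative that remains is right translation
        along \<xi> by \<open>left_deriv_Ad\<close>.\<close>
      have "f j (- (N_ev (Ad k \<xi>) * n)) k = - (malg W (hc_act H k (hc_inc H \<xi>)) (j + p) (f j n k) + left_deriv (Ad k \<xi>) (f j n) k)"
        using gam_scale[OF W f N_deg_ev_mult[OF True], of "-1" "Ad k \<xi>" k]
        by (simp add: gam_ev[OF W f True] lam_def hc_inc_Ad[OF hc])
      moreover have "N_map (Ad k) (- N_ev \<xi>) = - N_ev (Ad k \<xi>)"
        using lin_on_uminus[OF N_map_lin[OF lie_hom_Ad], of "N_ev \<xi>" k] by (simp add: N_map_simps lie_hom_Ad)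
      ultimately show ?thesis
        using True left_deriv_Ad[OF gam_reg[OF W f True refl], of k \<xi>]
        by (simp add: * Gamma_simps iota_simps scaleC_one)
    next
      case False
      then show ?thesis using lin_on_zero[OF mod_alg[OF W] sub] by (simp add: * o Gamma_simps vderiv_zero)
    qed
  qed
  show "lin_on (N_deg i) {f. gam W (i + p) f} (\<lambda>x. mdg ?G i x p f)" for i
  proof (rule lin_onI)
    fix x y :: "'k lie N" and c assume x: "x \<in> N_deg i"
    then show "mdg ?G i x p f \<in> {f. gam W (i + p) f}" using gam_Gamma_dg[OF W f] by simp
    show "mdg ?G i (c *\<^sub>C x) p f = c *\<^sub>C mdg ?G i x p f"
    proof (intro ext)
      fix j k and n :: "'k lie N"
      have 1: "N_map (Ad k) (iota (c *\<^sub>C x)) * n = c *\<^sub>C (N_map (Ad k) (iota x) * n)"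
        by (simp add: iota_simps N_map_simps lie_hom_Ad scaleC_mult_left)
      show "mdg ?G i (c *\<^sub>C x) p f j n k = (c *\<^sub>C mdg ?G i x p f) j n k"
      proof (cases "n \<in> N_deg j")
        case True
        show ?thesis
          unfolding Gamma_simps scaleC_fun_def 1 gam_scale[OF W f N_deg_mult[OF Ad_iota_in_deg[OF x] True]]
          using True by (simp add: mult.commute)
      qed (simp add: Gamma_simps scaleC_fun_def)
    qed
    assume y: "y \<in> N_deg i"
    show "mdg ?G i (x + y) p f = mdg ?G i x p f + mdg ?G i y p f"
    proof (intro ext)
      fix j k and n :: "'k lie N"
      have 1: "N_map (Ad k) (iota (x + y)) * n = N_map (Ad k) (iota x) * n + N_map (Ad k) (iota y) * n"
        by (simp add: iota_simps N_map_simps lie_hom_Ad distrib_right)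
      show "mdg ?G i (x + y) p f j n k = (mdg ?G i x p f + mdg ?G i y p f) j n k"
      proof (cases "n \<in> N_deg j")
        case True
        show ?thesis
          unfolding Gamma_simps plus_fun_apply 1
            gam_add[OF W f N_deg_mult[OF Ad_iota_in_deg[OF x] True] N_deg_mult[OF Ad_iota_in_deg[OF y] True]]
          using True by (simp add: scaleC_add_right)
      qed (simp add: Gamma_simps)
    qed
  qed
next
  let ?G = "Gamma_eq H \<gamma> W"
  note sub = mod_subspace[OF W]
  fix i p and x :: "'k lie N" assume x: "x \<in> N_deg i"
  show "lin_on {f. gam W p f} {f. gam W (i + p) f} (mdg ?G i x p)"
    using gam_Gamma_dg[OF W _ x] by (intro lin_onI ext) (simp_all add: Gamma_simps scaleC_fun_def scaleC_add_right mult.commute)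
  fix f assume f: "gam W p f"
  note Y = Ad_iota_in_deg[OF x]
  note v = gam_value[OF W f _ refl]
  show "mdiff ?G (i + p) (mdg ?G i x p f) = mdg ?G (i + 1) (N_diff x) p f + (- 1) powi i *\<^sub>C mdg ?G i x (p + 1) (mdiff ?G p f)"
  proof (intro ext)
    fix j k and n :: "'k lie N"
    let ?y = "N_map (Ad k) (iota x)"
    show "mdiff ?G (i + p) (mdg ?G i x p f) j n k
      = (mdg ?G (i + 1) (N_diff x) p f + (- 1) powi i *\<^sub>C mdg ?G i x (p + 1) (mdiff ?G p f)) j n k"
    proof (cases "n \<in> N_deg j")
      case n: True
      note dn = N_diff_in_deg[OF n]
      have d: "N_diff ?y = N_map (Ad k) (iota (N_diff x))" by (simp add: N_map_diff lie_hom_Ad N_diff_iota[OF x])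
      have yn: "?y * n \<in> N_deg (i + j)" by (rule N_deg_mult[OF Y n])
      have 1: "N_diff ?y * n \<in> N_deg (i + j + 1)" "?y * N_diff n \<in> N_deg (i + j + 1)"
        using N_deg_mult[OF N_diff_in_deg[OF Y] n, of k] N_deg_mult[OF Y dn, of k] by (simp_all add: add_ac)
      have f2: "f (i + j + 1) (N_diff (?y * n)) k = f (i + j + 1) (N_diff ?y * n) k + (- 1) powi i *\<^sub>C f (i + j + 1) (?y * N_diff n) k"
        unfolding N_diff_mult[OF Y] using 1 by (simp add: gam_add[OF W f] gam_scale[OF W f] N_deg_scale)
      let ?a = "mdiff W (i + j + p) (f (i + j) (?y * n) k)"
      let ?b = "f (i + j + 1) (N_diff ?y * n) k" and ?c = "f (i + j + 1) (?y * N_diff n) k"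
      have l: "mdiff ?G (i + p) (mdg ?G i x p f) j n k = (- 1) powi (i * p) *\<^sub>C ?a - (- 1) powi ((i + p) + i * p) *\<^sub>C ?c"
        using n dn lin_on_scale[OF mod_diff[OF W] v[OF yn], of "(- 1) powi (i * p)" k]
        by (simp add: Gamma_simps neg_one_powi add_ac)
      have r1: "mdg ?G (i + 1) (N_diff x) p f j n k = (- 1) powi ((i + 1) * p) *\<^sub>C ?b"
        using n by (simp add: Gamma_simps d add_ac)
      have r2: "((- 1) powi i *\<^sub>C mdg ?G i x (p + 1) (mdiff ?G p f)) j n k =
          (- 1) powi (i + i * (p + 1)) *\<^sub>C (?a - (- 1) powi p *\<^sub>C (?b + (- 1) powi i *\<^sub>C ?c))"
        using n yn f2 by (simp add: Gamma_simps scaleC_fun_def neg_one_powi)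
      \<comment> \<open>By these parities the summand ?b of r2 cancels r1, and the other summands of
        r2 give l.\<close>
      have s: "(- 1) powi (i + i * (p + 1)) = ((- 1) powi (i * p) :: complex)"
        "(- 1) powi (i * p + p) = ((- 1) powi ((i + 1) * p) :: complex)"
        "(- 1) powi ((i + p) + i * p) = ((- 1) powi (i * p + p + i) :: complex)"
        by (rule neg_one_powi_cong; auto)+
      show ?thesis
        unfolding plus_fun_def l r1 r2 s
        by (simp add: complex_vector.scale_right_diff_distrib scaleC_add_right neg_one_powi s add.assoc)
    next
      case False
      then show ?thesis by (simp add: Gamma_simps scaleC_fun_def)
    qed
  qed
  show "malg ?G a (i + p) (mdg ?G i x p f) = mdg ?G i x p (malg ?G a p f)" for a
  proof (intro ext)
    fix j k and n :: "'k lie N"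
    show "malg ?G a (i + p) (mdg ?G i x p f) j n k = mdg ?G i x p (malg ?G a p f) j n k"
    proof (cases "n \<in> N_deg j")
      case True
      show ?thesis
        using True lin_on_scale[OF mod_alg[OF W] v[OF N_deg_mult[OF Y True]], of "hc_act H k a" "(- 1) powi (i * p)" k k]
        by (simp add: Gamma_simps add_ac)
    next
      case False
      then show ?thesis using lin_on_zero[OF mod_alg[OF W] sub] by (simp add: Gamma_simps)
    qed
  qed
  show "mdg ?G i (N_map (Ad g) x) p f = mgrp ?G g (i + p) (mdg ?G i x p (mgrp ?G (inverse g) p f))" for g
    by (intro ext) (simp add: Gamma_simps N_map_iota lie_hom_Ad group_simps mult.assoc flip: N_map_Ad_mult)
next
  let ?G = "Gamma_eq H \<gamma> W"
  fix h i p and x y :: "'k lie N" and f assume x: "x \<in> N_deg h" and y: "y \<in> N_deg i" and f: "gam W p f"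
  show "mdg ?G (h + i) (x * y) p f = mdg ?G h x (i + p) (mdg ?G i y p f)"
  proof (intro ext)
    fix j k and n :: "'k lie N"
    show "mdg ?G (h + i) (x * y) p f j n k = mdg ?G h x (i + p) (mdg ?G i y p f) j n k"
    proof (cases "n \<in> N_deg j")
      case n: True
      let ?x = "N_map (Ad k) (iota x)" and ?y = "N_map (Ad k) (iota y)"
      have m: "?y * (?x * n) \<in> N_deg (i + (h + j))"
        by (rule N_deg_mult[OF Ad_iota_in_deg[OF y] N_deg_mult[OF Ad_iota_in_deg[OF x] n]])
      \<comment> \<open>Precomposition reverses the order of factors and \<iota> reverses it back,
        so a left action results. The sign of \<iota> supplies the term hi in the exponent.\<close>
      have "N_map (Ad k) (iota (x * y)) * n = (- 1) powi (h * i) *\<^sub>C (?y * (?x * n))"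
        unfolding iota_mult[OF x y] by (simp add: N_map_simps lie_hom_Ad scaleC_mult_left mult.assoc)
      then have "mdg ?G (h + i) (x * y) p f j n k = (- 1) powi ((h + i) * p + h * i) *\<^sub>C f (i + (h + j)) (?y * (?x * n)) k"
        using n gam_scale[OF W f m, of "(- 1) powi (h * i)" k] by (simp add: Gamma_simps neg_one_powi add_ac)
      also have "(- 1) powi ((h + i) * p + h * i) = ((- 1) powi (h * (i + p) + i * p) :: complex)"
        by (rule neg_one_powi_cong) auto
      finally show ?thesis using n N_deg_mult[OF Ad_iota_in_deg[OF x] n, of k] by (simp add: Gamma_simps neg_one_powi)
    qed (simp add: Gamma_simps)
  qed
qed

section \<open>The functor \<open>\<Gamma>\<close> on morphisms\<close>

lemma
  assumes "f \<in> Mor D V W"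
  shows mor_lin: "lin_on (mcar V j) (mcar W j) (f j)"
    and mor_out: "v \<notin> mcar V j \<Longrightarrow> f j v = 0"
    and mor_diff: "v \<in> mcar V j \<Longrightarrow> f (j + 1) (mdiff V j v) = mdiff W j (f j v)"
    and mor_alg: "v \<in> mcar V j \<Longrightarrow> f j (malg V a j v) = malg W a j (f j v)"
    and mor_grp: "v \<in> mcar V j \<Longrightarrow> f j (mgrp V k j v) = mgrp W k j (f j v)"
    and mor_dg: "x \<in> dg_deg D i \<Longrightarrow> v \<in> mcar V j \<Longrightarrow> f (i + j) (mdg V i x j v) = mdg W i x j (f j v)"
  using assms unfolding Mor_def by (elim CollectE conjE; blast)+

lemma MorI:
  assumes "\<And>j. lin_on (mcar V j) (mcar W j) (f j)" "\<And>j v. v \<notin> mcar V j \<Longrightarrow> f j v = 0"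
    "\<And>j v. v \<in> mcar V j \<Longrightarrow> f (j + 1) (mdiff V j v) = mdiff W j (f j v)"
    "\<And>a j v. v \<in> mcar V j \<Longrightarrow> f j (malg V a j v) = malg W a j (f j v)"
    "\<And>k j v. v \<in> mcar V j \<Longrightarrow> f j (mgrp V k j v) = mgrp W k j (f j v)"
    "\<And>i j x v. x \<in> dg_deg D i \<Longrightarrow> v \<in> mcar V j \<Longrightarrow> f (i + j) (mdg V i x j v) = mdg W i x j (f j v)"
  shows "f \<in> Mor D V W"
  using assms unfolding Mor_def by blast

lemma mor_value:
  assumes "f \<in> Mor D V W" "is_module H' D' W"
  shows "f j v \<in> mcar W j"
  using lin_on_in[OF mor_lin[OF assms(1)]] mor_out[OF assms(1)] mod_zero[OF assms(2)]
  by (cases "v \<in> mcar V j") auto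

lemma mor_zero:
  assumes "f \<in> Mor D V W" "is_module H' D' V"
  shows "f j 0 = 0"
  by (rule lin_on_zero[OF mor_lin[OF assms(1)] mod_subspace[OF assms(2)]])

lemma gam_mor:
  fixes W :: "('t, 'a, 'w::complex_vector) equiv_complex" and W' :: "('t, 'a, 'u::complex_vector) equiv_complex"
  assumes W: "is_module (hc_pullback \<gamma> H) std_dg W" and W': "is_module (hc_pullback \<gamma> H) std_dg W'"
    and \<beta>: "\<beta> \<in> Mor std_dg W W'" and f: "gam W p f"
  shows "gam W' p (\<lambda>j n k. \<beta> (j + p) (f j n k))"
proof (rule gamI)
  note l = mor_lin[OF \<beta>]
  fix j and n :: "'k lie N" assume n: "n \<in> N_deg j"
  note v = gam_value[OF W f n refl] and r = gam_reg[OF W f n refl]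
  show "(\<lambda>k. \<beta> (j + p) (f j n k)) \<in> regfun_in (mcar W' (j + p))"
    by (rule regfun_in_lin[OF r mod_subspace[OF W] l])
  show "\<beta> (j + p) (f j (c *\<^sub>C n) k) = c *\<^sub>C \<beta> (j + p) (f j n k)" for c k
    by (simp add: gam_scale[OF W f n] lin_on_scale[OF l v])
  show "\<beta> (j + p) (f j (n + n') k) = \<beta> (j + p) (f j n k) + \<beta> (j + p) (f j n' k)" if "n' \<in> N_deg j" for n' k
    by (simp add: gam_add[OF W f n that] lin_on_add[OF l v gam_value[OF W f that refl]])
  show "\<beta> (j + p) (f j (N_ev X * n) k) = lam W' X (j + p) (\<lambda>k. \<beta> (j + p) (f j n k)) k" for X k
    using regfun_in_value[OF mod_subspace[OF W] left_deriv_in[OF r]]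
    by (simp add: gam_ev[OF W f n] lam_def lin_on_add[OF l] lin_on_in[OF mod_alg[OF W]] v mor_alg[OF \<beta>]
        left_deriv_lin[OF r mod_subspace[OF W] l])
  show "\<beta> (j + p) (f j (N_map (Ad (\<gamma> t)) n) k) = mgrp W' t (j + p) (\<beta> (j + p) (f j n (inverse (\<gamma> t) * k)))" for t k
    by (simp add: gam_grp[OF W f n] mor_grp[OF \<beta> v])
  show "\<beta> (i + j + p) (f (i + j) (n * iota (N_map (lie_map \<gamma>) m)) k) =
       (- 1) powi (i * (j + p)) *\<^sub>C mdg W' i m (j + p) (\<beta> (j + p) (f j n k))" if m: "m \<in> N_deg i" for i k m
  proof -
    have mD: "m \<in> dg_deg std_dg i" using m by simp
    show ?thesis
      using mor_dg[OF \<beta> mD v, of k] lin_on_scale[OF l lin_on_in[OF mod_dg[OF W mD] v], of "(- 1) powi (i * (j + p))" k]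
      by (simp add: gam_dg[OF W f m n] add.assoc)
  qed
next
  show "n \<notin> N_deg j \<Longrightarrow> \<beta> (j + p) (f j n k) = 0" for j n k
    by (simp add: gam_out[OF W f] mor_zero[OF \<beta> W])
qed

lemma Gamma_mor_apply:
  assumes W: "is_module (hc_pullback \<gamma> H) std_dg W"
  shows "Gamma_eq_mor H \<gamma> W \<beta> p f = (if gam W p f then \<lambda>j n k. \<beta> (j + p) (f j n k) else 0)"
  by (simp add: Gamma_eq_mor_def Gamma_car[OF W])

lemma Gamma_mor:
  fixes W :: "('t, 'a, 'w::complex_vector) equiv_complex" and W' :: "('t, 'a, 'u::complex_vector) equiv_complex"
  assumes W: "is_module (hc_pullback \<gamma> H) std_dg W" and W': "is_module (hc_pullback \<gamma> H) std_dg W'"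
    and \<beta>: "\<beta> \<in> Mor std_dg W W'"
  shows "Gamma_eq_mor H \<gamma> W \<beta> \<in> Mor std_dg (\<Gamma> W) (\<Gamma> W')"
proof (rule MorI, simp_all only: Gamma_car[OF W] Gamma_car[OF W'] mem_Collect_eq std_dg_simps)
  note l = mor_lin[OF \<beta>]
  note a = Gamma_mor_apply[OF W]
  have vv: "f j n k \<in> mcar W (j + p)" if f: "gam W p f" for f j n k p
    using gam_value[OF W f _ refl] gam_out[OF W f] mod_zero[OF W] by (cases "n \<in> N_deg j") auto
  note sub = gam_subspace[OF W]
  fix p
  show "lin_on {f. gam W p f} {f. gam W' p f} (Gamma_eq_mor H \<gamma> W \<beta> p)"
  proof (rule lin_onI)
    fix f g assume fg: "f \<in> {f. gam W p f}" "g \<in> {f. gam W p f}"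
    then show "Gamma_eq_mor H \<gamma> W \<beta> p (f + g) = Gamma_eq_mor H \<gamma> W \<beta> p f + Gamma_eq_mor H \<gamma> W \<beta> p g"
      using complex_vector.subspace_add[OF sub fg]
      by (intro ext) (simp add: a lin_on_add[OF l] vv)
  next
    fix f c assume f: "f \<in> {f. gam W p f}"
    then show "Gamma_eq_mor H \<gamma> W \<beta> p f \<in> {f. gam W' p f}" using gam_mor[OF W W' \<beta>] by (simp add: a)
    show "Gamma_eq_mor H \<gamma> W \<beta> p (c *\<^sub>C f) = c *\<^sub>C Gamma_eq_mor H \<gamma> W \<beta> p f"
      using f complex_vector.subspace_scale[OF sub f]
      by (intro ext) (simp add: a lin_on_scale[OF l] vv scaleC_fun_def)
  qed
  show "Gamma_eq_mor H \<gamma> W \<beta> p f = 0" if "\<not> gam W p f" for f using that by (simp add: a)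
  fix f assume f: "gam W p f"
  show "Gamma_eq_mor H \<gamma> W \<beta> (p + 1) (mdiff (\<Gamma> W) p f) = mdiff (\<Gamma> W') p (Gamma_eq_mor H \<gamma> W \<beta> p f)"
  proof (intro ext)
    fix j k and n :: "'k lie N"
    have 1: "mdiff W (j + p) (f j n k) \<in> mcar W (j + (p + 1))"
      using lin_on_in[OF mod_diff[OF W] vv[OF f], of j n k] by (simp add: add.assoc)
    have 2: "f (j + 1) (N_diff n) k \<in> mcar W (j + (p + 1))" using vv[OF f, of "j + 1" "N_diff n" k] by (simp add: add_ac)
    have 3: "\<beta> (j + (p + 1)) (mdiff W (j + p) (f j n k) - (- 1) powi p *\<^sub>C f (j + 1) (N_diff n) k)
        = \<beta> (j + (p + 1)) (mdiff W (j + p) (f j n k)) - (- 1) powi p *\<^sub>C \<beta> (j + (p + 1)) (f (j + 1) (N_diff n) k)"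
      unfolding lin_on_diff[OF l mod_subspace[OF W] 1 complex_vector.subspace_scale[OF mod_subspace[OF W] 2]] lin_on_scale[OF l 2] ..
    have 4: "\<beta> (j + (p + 1)) (mdiff W (j + p) (f j n k)) = mdiff W' (j + p) (\<beta> (j + p) (f j n k))"
      using mor_diff[OF \<beta> vv[OF f], of j n k] by (simp add: add.assoc)
    have 5: "j + 1 + p = j + (p + 1)" by simp
    show "Gamma_eq_mor H \<gamma> W \<beta> (p + 1) (mdiff (\<Gamma> W) p f) j n k = mdiff (\<Gamma> W') p (Gamma_eq_mor H \<gamma> W \<beta> p f) j n k"
      unfolding a using f gam_Gamma_diff[OF W f]
      by (cases "n \<in> N_deg j") (simp_all only: if_True if_False Gamma_simps 3 4 5 mor_zero[OF \<beta> W])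
  qed
  show "Gamma_eq_mor H \<gamma> W \<beta> p (malg (\<Gamma> W) b p f) = malg (\<Gamma> W') b p (Gamma_eq_mor H \<gamma> W \<beta> p f)" for b
    by (intro ext) (simp add: a f gam_Gamma_alg[OF W f] Gamma_simps mor_alg[OF \<beta> vv[OF f]])
  show "Gamma_eq_mor H \<gamma> W \<beta> p (mgrp (\<Gamma> W) g p f) = mgrp (\<Gamma> W') g p (Gamma_eq_mor H \<gamma> W \<beta> p f)" for g
    by (intro ext) (simp add: a f gam_Gamma_grp[OF W f] Gamma_simps)
  show "Gamma_eq_mor H \<gamma> W \<beta> (i + p) (mdg (\<Gamma> W) i x p f) = mdg (\<Gamma> W') i x p (Gamma_eq_mor H \<gamma> W \<beta> p f)"
    if x: "x \<in> N_deg i" for i x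
  proof (intro ext)
    fix j k and n :: "'k lie N"
    show "Gamma_eq_mor H \<gamma> W \<beta> (i + p) (mdg (\<Gamma> W) i x p f) j n k = mdg (\<Gamma> W') i x p (Gamma_eq_mor H \<gamma> W \<beta> p f) j n k"
      using lin_on_scale[OF l vv[OF f, of "i + j"], of "(- 1) powi (i * p)"]
      by (simp add: a f gam_Gamma_dg[OF W f x] Gamma_simps mor_zero[OF \<beta> W] add_ac)
  qed
qed

lemma Gamma_mor_id:
  fixes W :: "('t, 'a, 'w::complex_vector) equiv_complex"
  assumes W: "is_module (hc_pullback \<gamma> H) std_dg W"
  shows "Gamma_eq_mor H \<gamma> W (id_mor W) = id_mor (\<Gamma> W)"
proof (intro ext)
  fix p f j n k
  have "f j n k \<in> mcar W (j + p)" if f: "gam W p f"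
    using gam_value[OF W f _ refl] gam_out[OF W f] mod_zero[OF W] by (cases "n \<in> N_deg j") auto
  then show "Gamma_eq_mor H \<gamma> W (id_mor W) p f j n k = id_mor (\<Gamma> W) p f j n k"
    by (simp add: Gamma_mor_apply[OF W] id_mor_def Gamma_car[OF W])
qed

lemma Gamma_mor_comp:
  fixes W :: "('t, 'a, 'w::complex_vector) equiv_complex" and W' :: "('t, 'a, 'u::complex_vector) equiv_complex"
  assumes W: "is_module (hc_pullback \<gamma> H) std_dg W" and W': "is_module (hc_pullback \<gamma> H) std_dg W'"
    and \<beta>: "\<beta> \<in> Mor std_dg W W'" and \<beta>': "\<beta>' \<in> Mor std_dg W' W''"
  shows "Gamma_eq_mor H \<gamma> W (\<beta>' \<odot> \<beta>) = Gamma_eq_mor H \<gamma> W' \<beta>' \<odot> Gamma_eq_mor H \<gamma> W \<beta>"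
proof (intro ext)
  fix p f j n k
  show "Gamma_eq_mor H \<gamma> W (\<beta>' \<odot> \<beta>) p f j n k = (Gamma_eq_mor H \<gamma> W' \<beta>' \<odot> Gamma_eq_mor H \<gamma> W \<beta>) p f j n k"
    using gam_mor[OF W W' \<beta>, of p f]
    by (simp add: Gamma_mor_apply[OF W] Gamma_mor_apply[OF W'] comp_mor_def mor_zero[OF \<beta>' W'])
qed

section \<open>The adjunction\<close>

text \<open>Every morphism into \<Gamma>(W) has this form, with h its evaluation at (1, 1): apply
  compatibility with \<omega>(\<iota> n) and \<nu>(k) and evaluate. The values 0 outside the
  carriers match the normalisation of morphisms and of the Hom complex.\<close>

definition coind :: "('k, 'a, 'v::complex_vector) equiv_complex \<Rightarrow> (int \<Rightarrow> 'v \<Rightarrow> 'w::complex_vector) \<Rightarrow>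
    int \<Rightarrow> 'v \<Rightarrow> int \<Rightarrow> 'k lie N \<Rightarrow> 'k \<Rightarrow> 'w" where
  "coind V h j v = (if v \<in> mcar V j then
     (\<lambda>q n k. if n \<in> N_deg q then (- 1) powi (q * j) *\<^sub>C h (q + j) (mdg V q (iota n) j (mgrp V k j v)) else 0) else 0)"

context
  fixes V :: "('k, 'a, 'v::complex_vector) equiv_complex" and W :: "('t, 'a, 'w::complex_vector) equiv_complex"
  assumes V: "is_module H std_dg V" and W: "is_module (hc_pullback \<gamma> H) std_dg W"
begin

text \<open>The evaluation takes place in degree 0 of N(k), at its unit and at the unit of K. The
  conditions imposed by T and N(t) on elements of \<Gamma>(W) are what makes this evaluation
  equivariant.\<close>

lemma eval_one_Mor:
  assumes f: "f \<in> Mor std_dg V (\<Gamma> W)"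
  shows "(\<lambda>j v. f j v 0 1 1) \<in> Mor std_dg (Res \<gamma> V) W"
proof (rule MorI)
  note one = N_deg_one
  note l = mor_lin[OF f, unfolded Gamma_car[OF W]]
  have g: "gam W j (f j v)" if "v \<in> mcar V j" for j v using lin_on_in[OF l that] by simp
  fix j
  show "lin_on (mcar (Res \<gamma> V) j) (mcar W j) (\<lambda>v. f j v 0 1 1)"
    using gam_value[OF W g one, of _ j j 1] by (intro lin_onI) (simp_all add: lin_on_add[OF l] lin_on_scale[OF l] scaleC_fun_def)
  fix v
  show "v \<notin> mcar (Res \<gamma> V) j \<Longrightarrow> f j v 0 1 1 = 0" by (simp add: mor_out[OF f])
  assume "v \<in> mcar (Res \<gamma> V) j"
  then have v: "v \<in> mcar V j" by simp
  show "f (j + 1) (mdiff (Res \<gamma> V) j v) 0 1 1 = mdiff W j (f j v 0 1 1)"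
    by (simp add: mor_diff[OF f v] Gamma_simps one N_diff_simps gam_zero[OF W g[OF v]])
  show "f j (malg (Res \<gamma> V) a j v) 0 1 1 = malg W a j (f j v 0 1 1)" for a
    by (simp add: mor_alg[OF f v] Gamma_simps algebraic_action_one[OF hc_action[OF hc] UNIV_I])
  \<comment> \<open>K acts by right translation, so the left side is the value at \<gamma> t;
    equivariance under T relates it to the value at 1 since Ad fixes the unit of N(k).\<close>
  show "f j (mgrp (Res \<gamma> V) t j v) 0 1 1 = mgrp W t j (f j v 0 1 1)" for t
    using gam_grp[OF W g[OF v] one, of t "\<gamma> t"]
    by (simp add: mor_grp[OF f v] Gamma_simps N_map_simps lie_hom_Ad group_left_inverse)
  \<comment> \<open>Both the action on \<Gamma>(W) and the N(t)-linearity of f j v involve the value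
    at \<iota> m, each with the sign (-1)^(ij), and the signs cancel.\<close>
  show "f (i + j) (mdg (Res \<gamma> V) i m j v) 0 1 1 = mdg W i m j (f j v 0 1 1)" if "m \<in> dg_deg std_dg i" for i m
  proof -
    have m: "m \<in> N_deg i" using that by simp
    have m': "N_map (lie_map \<gamma>) m \<in> dg_deg std_dg i" using m by (simp add: N_map_in_deg \<gamma>_lie_hom)
    show ?thesis
      using gam_dg[OF W g[OF v] m one, of 1]
      by (simp add: mor_dg[OF f m' v] Gamma_simps one N_map_Ad_one neg_one_powi neg_one_powi_even scaleC_one)
  qed
qed

lemma coind_gam:
  assumes h: "h \<in> Mor std_dg (Res \<gamma> V) W" and v: "v \<in> mcar V j"
  shows "gam W j (coind V h j v)"
proof (rule gamI)
  fix q and n :: "'k lie N" assume n: "n \<in> N_deg q"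
  note sub = mod_subspace[OF V]
  note r = algebraic_action_reg[OF mod_grp[OF V] sub v]
  note u = algebraic_action_in[OF mod_grp[OF V] v]
  have \<iota>: "iota n \<in> dg_deg std_dg q" using iota_in_deg[OF n] by simp
  let ?s = "(- 1) powi (q * j) :: complex"
  let ?L = "\<lambda>w. ?s *\<^sub>C h (q + j) (mdg V q (iota n) j w)"
  note dg = lin_on_in[OF mod_dg[OF V \<iota>]]
  have hl: "lin_on (mcar V q) (mcar W q) (h q)" for q using mor_lin[OF h] by simp
  have L: "lin_on (mcar V j) (mcar W (q + j)) ?L"
    using lin_on_in[OF hl dg] complex_vector.subspace_scale[OF mod_subspace[OF W]]
    by (intro lin_onI) (simp_all add: lin_on_add[OF mod_dg[OF V \<iota>]] lin_on_add[OF hl] lin_on_scale[OF mod_dg[OF V \<iota>]]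
        lin_on_scale[OF hl] dg scaleC_add_right complex_vector.scale_left_commute)
  have e: "coind V h j v q n = (\<lambda>k. ?L (mgrp V k j v))" using v n by (simp add: coind_def)
  show "coind V h j v q n \<in> regfun_in (mcar W (q + j))"
    unfolding e by (rule regfun_in_lin[OF r sub L])
  have dl: "lin_on (N_deg q) (mcar V (q + j)) (\<lambda>x. mdg V q x j (mgrp V k j v))" for k
    using mod_dg_lin[OF V u, of q k] by simp
  note \<iota>' = iota_in_deg[OF n]
  show "coind V h j v q (c *\<^sub>C n) k = c *\<^sub>C coind V h j v q n k" for c k
    using v n by (simp add: coind_def N_deg_scale iota_simps lin_on_scale[OF dl \<iota>'] lin_on_scale[OF hl dg[OF u]] mult.commute)
  show "coind V h j v q (n + n') k = coind V h j v q n k + coind V h j v q n' k" if n': "n' \<in> N_deg q" for n' k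
    using v n n' lin_on_in[OF dl iota_in_deg[OF n']]
    by (simp add: coind_def N_deg_add iota_simps lin_on_add[OF dl \<iota>' iota_in_deg[OF n']] lin_on_add[OF hl dg[OF u]] scaleC_add_right)
  show "coind V h j v q (N_ev X * n) k = lam W X (q + j) (coind V h j v q n) k" for X k
  proof -
    let ?u = "mgrp V k j v"
    have X: "N_ev X \<in> dg_deg std_dg 0" by (simp add: N_deg_ev)
    have Xu: "malg V (hc_inc H X) j ?u \<in> mcar V j" "mdg V 0 (N_ev X) j ?u \<in> mcar V j"
      using lin_on_in[OF mod_alg[OF V] u] lin_on_in[OF mod_dg[OF V X] u] by simp_all
    \<comment> \<open>The derivative of the K-action on V is \<pi>(\<psi>(X)) + \<omega>(X), taken
      with a minus sign for left translation. In \<lambda>(X) the algebra terms cancel, and the term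
      with \<omega>(X) combines with \<omega>(\<iota> n) into \<omega>(\<iota>(X n)).\<close>
    have "left_deriv X (\<lambda>k. mgrp V k j v) k = vderiv X (\<lambda>g. mgrp V (inverse g) j ?u)"
      by (simp add: left_deriv_def algebraic_action_mult[OF mod_grp[OF V] v])
    also have "\<dots> = - (malg V (hc_inc H X) j ?u + mdg V 0 (N_ev X) j ?u)"
      using vderiv_inverse[OF algebraic_action_reg[OF mod_grp[OF V] sub u], of X k] mod_vderiv[OF V u, of X k] by simp
    finally have "left_deriv X (coind V h j v q n) k = - ?L (malg V (hc_inc H X) j ?u + mdg V 0 (N_ev X) j ?u)"
      unfolding e left_deriv_lin[OF r sub L]
      by (simp only: lin_on_uminus[OF L complex_vector.subspace_add[OF sub Xu]])
    also have "\<dots> = - ?L (malg V (hc_inc H X) j ?u) - ?L (mdg V 0 (N_ev X) j ?u)"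
      unfolding lin_on_add[OF L Xu] by simp
    also have "?L (malg V (hc_inc H X) j ?u) = malg W (hc_inc H X) (q + j) (?L ?u)"
      using mor_alg[OF h, of "mdg V q (iota n) j ?u" "q + j" "hc_inc H X"] dg[OF u]
        lin_on_scale[OF mod_alg[OF W] lin_on_in[OF hl dg[OF u]], of "hc_inc H X" ?s k]
      by (simp add: mod_alg_dg[OF V \<iota> u])
    finally have "lam W X (q + j) (coind V h j v q n) k = - ?L (mdg V 0 (N_ev X) j ?u)"
      by (simp add: lam_def e)
    also have "mdg V q (iota n) j (mdg V 0 (N_ev X) j ?u) = mdg V q (iota n * N_ev X) j ?u"
      using mod_dg_mult[OF V \<iota> X u, of k] by simp
    also have "- (?s *\<^sub>C h (q + j) (mdg V q (iota n * N_ev X) j ?u)) = ?s *\<^sub>C h (q + j) (mdg V q (- (iota n * N_ev X)) j ?u)"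
    proof -
      have nX: "iota n * N_ev X \<in> N_deg q" using N_deg_mult[OF \<iota>' N_deg_ev] by simp
      show ?thesis
        by (simp only: lin_on_uminus[OF dl nX] lin_on_uminus[OF hl lin_on_in[OF dl nX]] complex_vector.scale_minus_right)
    qed
    also have "- (iota n * N_ev X) = iota (N_ev X * n)"
      using iota_mult[OF N_deg_ev n, of X] by (simp add: iota_simps scaleC_one)
    finally show ?thesis using v n by (simp add: coind_def N_deg_ev_mult)
  qed
  show "coind V h j v q (N_map (Ad (\<gamma> t)) n) k = mgrp W t (q + j) (coind V h j v q n (inverse (\<gamma> t) * k))" for t k
  proof -
    let ?w = "mgrp V (inverse (\<gamma> t) * k) j v"
    have "mgrp V (\<gamma> t) j ?w = mgrp V k j v"
      by (simp add: group_simps flip: algebraic_action_mult[OF mod_grp[OF V] v])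
    then have "mdg V q (iota (N_map (Ad (\<gamma> t)) n)) j (mgrp V k j v) = mgrp V (\<gamma> t) (q + j) (mdg V q (iota n) j ?w)"
      using mod_dg_grp[OF V \<iota> u, of "\<gamma> t" "inverse (\<gamma> t) * k"] by (simp add: N_map_iota lie_hom_Ad)
    moreover have "h (q + j) (mgrp V (\<gamma> t) (q + j) (mdg V q (iota n) j ?w)) = mgrp W t (q + j) (h (q + j) (mdg V q (iota n) j ?w))"
      using mor_grp[OF h, of "mdg V q (iota n) j ?w" "q + j" t] dg[OF u] by simp
    ultimately show ?thesis
      using v n lin_on_scale[OF algebraic_action_lin[OF mod_grp[OF W]] lin_on_in[OF hl dg[OF u]], of t ?s "inverse (\<gamma> t) * k"]
      by (simp add: coind_def N_map_in_deg lie_hom_Ad)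
  qed
  show "coind V h j v (i + q) (n * iota (N_map (lie_map \<gamma>) m)) k =
       (- 1) powi (i * (q + j)) *\<^sub>C mdg W i m (q + j) (coind V h j v q n k)" if m: "m \<in> N_deg i" for i k m
  proof -
    let ?m = "N_map (lie_map \<gamma>) m" and ?u = "mgrp V k j v"
    have m': "?m \<in> N_deg i" by (simp add: N_map_in_deg \<gamma>_lie_hom m)
    have mD: "?m \<in> dg_deg std_dg i" "m \<in> dg_deg std_dg i" using m m' by simp_all
    have nm: "n * iota ?m \<in> N_deg (i + q)" using N_deg_mult[OF n iota_in_deg[OF m']] by (simp add: add.commute)
    have mn: "?m * iota n \<in> N_deg (i + q)" by (rule N_deg_mult[OF m' \<iota>'])
    have dl': "lin_on (N_deg (i + q)) (mcar V (i + q + j)) (\<lambda>x. mdg V (i + q) x j ?u)"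
      using mod_dg_lin[OF V u, of "i + q" k] by simp
    \<comment> \<open>Reversal brings m in front of \<iota> n, so that \<omega>(m) becomes the
      outermost operator and can pass through h.\<close>
    have "iota (n * iota ?m) = (- 1) powi (q * i) *\<^sub>C (?m * iota n)"
      by (simp add: iota_mult[OF n iota_in_deg[OF m']] iota_iota[OF m'])
    then have "coind V h j v (i + q) (n * iota ?m) k
        = (- 1) powi ((i + q) * j) *\<^sub>C (- 1) powi (q * i) *\<^sub>C h (i + q + j) (mdg V (i + q) (?m * iota n) j ?u)"
      using v nm by (simp only: coind_def if_True lin_on_scale[OF dl' mn] lin_on_scale[OF hl lin_on_in[OF dl' mn]])
    also have "mdg V (i + q) (?m * iota n) j ?u = mdg V i ?m (q + j) (mdg V q (iota n) j ?u)"
      by (rule mod_dg_mult[OF V mD(1) \<iota> u])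
    also have "h (i + q + j) \<dots> = mdg W i m (q + j) (h (q + j) (mdg V q (iota n) j ?u))"
      using mor_dg[OF h mD(2), of "mdg V q (iota n) j ?u" "q + j"] dg[OF u] by (simp add: add.assoc)
    also have "(- 1) powi ((i + q) * j) *\<^sub>C (- 1) powi (q * i) *\<^sub>C \<dots> = (- 1) powi (i * (q + j)) *\<^sub>C ?s *\<^sub>C \<dots>"
      unfolding neg_one_powi_scale by (rule arg_cong[of _ _ "\<lambda>s. s *\<^sub>C _"], rule neg_one_powi_cong) auto
    also have "?s *\<^sub>C mdg W i m (q + j) (h (q + j) (mdg V q (iota n) j ?u)) = mdg W i m (q + j) (coind V h j v q n k)"
      unfolding e by (rule lin_on_scale[OF mod_dg[OF W mD(2)] lin_on_in[OF hl dg[OF u]], symmetric])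
    finally show ?thesis .
  qed
next
  show "n \<notin> N_deg q \<Longrightarrow> coind V h j v q n k = 0" for q n k by (simp add: coind_def)
qed

end

context
  fixes V :: "('k, 'a, 'v::complex_vector) equiv_complex" and W :: "('t, 'a, 'w::complex_vector) equiv_complex"
  assumes V: "is_module H std_dg V" and W: "is_module (hc_pullback \<gamma> H) std_dg W"
begin

lemma coind_Mor:
  assumes h: "h \<in> Mor std_dg (Res \<gamma> V) W"
  shows "coind V h \<in> Mor std_dg V (\<Gamma> W)"
proof (rule MorI, simp_all only: Gamma_car[OF W] std_dg_simps mem_Collect_eq)
  note sub = mod_subspace[OF V]
  note gl = algebraic_action_lin[OF mod_grp[OF V]]
  have hl: "lin_on (mcar V q) (mcar W q) (h q)" for q using mor_lin[OF h] by simp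
  fix j
  show "lin_on (mcar V j) {f. gam W j f} (coind V h j)"
  proof (rule lin_onI)
    fix v w c assume v: "v \<in> mcar V j"
    then show "coind V h j v \<in> {f. gam W j f}" using coind_gam[OF V W h] by simp
    note u = algebraic_action_in[OF mod_grp[OF V] v]
    show "coind V h j (c *\<^sub>C v) = c *\<^sub>C coind V h j v"
    proof (intro ext)
      fix q k and n :: "'k lie N"
      show "coind V h j (c *\<^sub>C v) q n k = (c *\<^sub>C coind V h j v) q n k"
      proof (cases "n \<in> N_deg q")
        case True
        then have \<iota>: "iota n \<in> dg_deg std_dg q" by (simp add: iota_in_deg)
        show ?thesis
          using True v complex_vector.subspace_scale[OF sub v]
          by (simp add: coind_def scaleC_fun_def lin_on_scale[OF gl] lin_on_scale[OF mod_dg[OF V \<iota>] u]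
              lin_on_scale[OF hl lin_on_in[OF mod_dg[OF V \<iota>] u]] mult.commute)
      qed (simp add: coind_def scaleC_fun_def)
    qed
    assume w: "w \<in> mcar V j"
    note u' = algebraic_action_in[OF mod_grp[OF V] w]
    show "coind V h j (v + w) = coind V h j v + coind V h j w"
    proof (intro ext)
      fix q k and n :: "'k lie N"
      show "coind V h j (v + w) q n k = (coind V h j v + coind V h j w) q n k"
      proof (cases "n \<in> N_deg q")
        case True
        then have \<iota>: "iota n \<in> dg_deg std_dg q" by (simp add: iota_in_deg)
        note dg = lin_on_in[OF mod_dg[OF V \<iota>]]
        show ?thesis
          using True v w complex_vector.subspace_add[OF sub v w]
          by (simp add: coind_def lin_on_add[OF gl] lin_on_add[OF mod_dg[OF V \<iota>] u u']
              lin_on_add[OF hl dg[OF u] dg[OF u']] scaleC_add_right)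
      qed (simp add: coind_def)
    qed
  qed
  fix v
  show "v \<notin> mcar V j \<Longrightarrow> coind V h j v = 0" by (simp add: coind_def)
  assume v: "v \<in> mcar V j"
  note u = algebraic_action_in[OF mod_grp[OF V] v]
  show "coind V h (j + 1) (mdiff V j v) = mdiff (\<Gamma> W) j (coind V h j v)"
  proof (intro ext)
    fix q k and n :: "'k lie N"
    let ?u = "mgrp V k j v"
    show "coind V h (j + 1) (mdiff V j v) q n k = mdiff (\<Gamma> W) j (coind V h j v) q n k"
    proof (cases "n \<in> N_deg q")
      case n: True
      note \<iota>' = iota_in_deg[OF n]
      then have \<iota>: "iota n \<in> dg_deg std_dg q" by simp
      have d\<iota>: "N_diff (iota n) \<in> dg_deg std_dg (q + 1)" using N_diff_in_deg[OF \<iota>'] by simp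
      have du: "mdiff V j ?u \<in> mcar V (j + 1)" by (rule lin_on_in[OF mod_diff[OF V] u])
      note dg = lin_on_in[OF mod_dg[OF V \<iota>] u]
      let ?x = "mdg V q (iota n) j ?u" and ?a = "mdg V (q + 1) (N_diff (iota n)) j ?u" and ?b = "mdg V q (iota n) (j + 1) (mdiff V j ?u)"
      have a: "?a \<in> mcar V (q + j + 1)" using lin_on_in[OF mod_dg[OF V d\<iota>] u, of k] by (simp add: add_ac)
      have b: "?b \<in> mcar V (q + j + 1)" using lin_on_in[OF mod_dg[OF V \<iota>] du] by (simp add: add_ac)
      have "mdiff W (q + j) (h (q + j) ?x) = h (q + j + 1) (mdiff V (q + j) ?x)"
        using mor_diff[OF h, of ?x "q + j"] dg by simp
      also have "mdiff V (q + j) ?x = ?a + (- 1) powi q *\<^sub>C ?b"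
        using mod_dg_diff[OF V \<iota> u, of k] by simp
      also have "h (q + j + 1) \<dots> = h (q + j + 1) ?a + (- 1) powi q *\<^sub>C h (q + j + 1) ?b"
        by (simp only: lin_on_add[OF hl a complex_vector.subspace_scale[OF sub b]] lin_on_scale[OF hl b])
      finally have 1: "mdiff W (q + j) (h (q + j) ?x) = h (q + j + 1) ?a + (- 1) powi q *\<^sub>C h (q + j + 1) ?b" .
      have 2: "q + (j + 1) = q + j + 1" "q + 1 + j = q + j + 1" by simp_all
      have "mdiff (\<Gamma> W) j (coind V h j v) q n k
          = (- 1) powi (q * j) *\<^sub>C (h (q + j + 1) ?a + (- 1) powi q *\<^sub>C h (q + j + 1) ?b)
            - (- 1) powi j *\<^sub>C (- 1) powi ((q + 1) * j) *\<^sub>C h (q + j + 1) ?a"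
        using v n N_diff_in_deg[OF n] lin_on_scale[OF mod_diff[OF W] lin_on_in[OF hl dg], of "(- 1) powi (q * j)"]
        by (simp only: Gamma_simps coind_def if_True 1 2 N_diff_iota[OF n])
      \<comment> \<open>The exponents agree up to 2j, hence the terms with the differential of
        \<iota> n cancel and only those with the differential of v remain.\<close>
      also have "(- 1) powi j *\<^sub>C (- 1) powi ((q + 1) * j) *\<^sub>C h (q + j + 1) ?a = (- 1) powi (q * j) *\<^sub>C h (q + j + 1) ?a"
        unfolding neg_one_powi_scale by (rule arg_cong[of _ _ "\<lambda>s. s *\<^sub>C _"], rule neg_one_powi_cong) auto
      also have "(- 1) powi (q * j) *\<^sub>C (h (q + j + 1) ?a + (- 1) powi q *\<^sub>C h (q + j + 1) ?b) - (- 1) powi (q * j) *\<^sub>C h (q + j + 1) ?a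
          = (- 1) powi (q * j + q) *\<^sub>C h (q + j + 1) ?b"
        unfolding scaleC_add_right neg_one_powi_scale by simp
      also have "\<dots> = coind V h (j + 1) (mdiff V j v) q n k"
        using v n lin_on_in[OF mod_diff[OF V] v] mod_grp_diff[OF V v, of k]
        by (simp add: coind_def distrib_left add.assoc)
      finally show ?thesis by simp
    qed (simp add: coind_def Gamma_simps)
  qed
  show "coind V h j (malg V a j v) = malg (\<Gamma> W) a j (coind V h j v)" for a
  proof (intro ext)
    fix q k and n :: "'k lie N"
    let ?a = "hc_act H k a"
    show "coind V h j (malg V a j v) q n k = malg (\<Gamma> W) a j (coind V h j v) q n k"
    proof (cases "n \<in> N_deg q")
      case n: True
      then have \<iota>: "iota n \<in> dg_deg std_dg q" by (simp add: iota_in_deg)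
      note dg = lin_on_in[OF mod_dg[OF V \<iota>] u]
      have "h (q + j) (malg V ?a (q + j) (mdg V q (iota n) j (mgrp V k j v))) = malg W ?a (q + j) (h (q + j) (mdg V q (iota n) j (mgrp V k j v)))"
        using mor_alg[OF h, of "mdg V q (iota n) j (mgrp V k j v)" "q + j" ?a] dg by simp
      then show ?thesis
        using v n lin_on_in[OF mod_alg[OF V] v, of a]
        by (simp add: coind_def Gamma_simps mod_alg_grp[OF V v] mod_alg_dg[OF V \<iota> u] lin_on_scale[OF mod_alg[OF W] lin_on_in[OF hl dg]])
    next
      case False
      then show ?thesis using lin_on_zero[OF mod_alg[OF W] mod_subspace[OF W]] v by (simp add: coind_def Gamma_simps)
    qed
  qed
  show "coind V h j (mgrp V g j v) = mgrp (\<Gamma> W) g j (coind V h j v)" for g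
    using v algebraic_action_in[OF mod_grp[OF V] v, of g]
    by (intro ext) (simp add: coind_def Gamma_simps algebraic_action_mult[OF mod_grp[OF V] v])
  show "coind V h (i + j) (mdg V i x j v) = mdg (\<Gamma> W) i x j (coind V h j v)" if x: "x \<in> N_deg i" for i x
  proof (intro ext)
    fix q k and n :: "'k lie N"
    let ?y = "N_map (Ad k) (iota x)" and ?x = "N_map (Ad k) x" and ?u = "mgrp V k j v"
    show "coind V h (i + j) (mdg V i x j v) q n k = mdg (\<Gamma> W) i x j (coind V h j v) q n k"
    proof (cases "n \<in> N_deg q")
      case n: True
      note \<iota>' = iota_in_deg[OF n]
      have x': "?x \<in> N_deg i" using x by (simp add: N_map_in_deg lie_hom_Ad)
      have D: "iota n \<in> dg_deg std_dg q" "?x \<in> dg_deg std_dg i" "x \<in> dg_deg std_dg i" using \<iota>' x x' by simp_all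
      have y: "?y \<in> N_deg i" by (rule Ad_iota_in_deg[OF x])
      have nx: "iota n * ?x \<in> N_deg (i + q)" using N_deg_mult[OF \<iota>' x'] by (simp add: add.commute)
      have dl: "lin_on (N_deg (i + q)) (mcar V (i + q + j)) (\<lambda>x. mdg V (i + q) x j ?u)"
        using mod_dg_lin[OF V u, of "i + q" k] by simp
      \<comment> \<open>The two applications of \<iota> to x cancel and Ad(k) x ends up next to
        \<nu>(k) v, where equivariance of \<omega> turns it into \<nu>(k) \<omega>(x) v.\<close>
      have "iota (?y * n) = (- 1) powi (i * q) *\<^sub>C (iota n * ?x)"
        by (simp add: iota_mult[OF y n] N_map_iota lie_hom_Ad iota_iota[OF x])
      then have "mdg (\<Gamma> W) i x j (coind V h j v) q n k
          = (- 1) powi (i * j) *\<^sub>C (- 1) powi ((i + q) * j) *\<^sub>C (- 1) powi (i * q) *\<^sub>C h (i + q + j) (mdg V (i + q) (iota n * ?x) j ?u)"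
        using v n N_deg_mult[OF y n]
        by (simp only: Gamma_simps coind_def if_True lin_on_scale[OF dl nx] lin_on_scale[OF hl lin_on_in[OF dl nx]])
      also have "\<dots> = (- 1) powi (q * (i + j)) *\<^sub>C h (i + q + j) (mdg V (i + q) (iota n * ?x) j ?u)"
        unfolding neg_one_powi_scale by (rule arg_cong[of _ _ "\<lambda>s. s *\<^sub>C _"], rule neg_one_powi_cong) auto
      also have "mdg V (i + q) (iota n * ?x) j ?u = mdg V q (iota n) (i + j) (mdg V i ?x j ?u)"
        using mod_dg_mult[OF V D(1,2) u, of k] by (simp add: add.commute[of i q])
      also have "mdg V i ?x j ?u = mgrp V k (i + j) (mdg V i x j v)"
        using mod_dg_grp[OF V D(3) v, of k] by simp
      finally show ?thesis using n lin_on_in[OF mod_dg[OF V D(3)] v] by (simp add: coind_def add_ac)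
    qed (simp add: coind_def Gamma_simps)
  qed
qed

lemma adjunction:
  "bij_betw (\<lambda>f j v. f j v 0 1 1) (Mor std_dg V (\<Gamma> W)) (Mor std_dg (Res \<gamma> V) W)"
proof (rule bij_betw_byWitness[where f' = "coind V"])
  show "\<forall>f\<in>Mor std_dg V (\<Gamma> W). coind V (\<lambda>j v. f j v 0 1 1) = f"
  proof (intro ballI ext)
    fix f j v q k and n :: "'k lie N"
    assume f: "f \<in> Mor std_dg V (\<Gamma> W)"
    show "coind V (\<lambda>j v. f j v 0 1 1) j v q n k = f j v q n k"
    proof (cases "v \<in> mcar V j")
      case v: True
      note u = algebraic_action_in[OF mod_grp[OF V] v]
      have g: "gam W j (f j v)" using lin_on_in[OF mor_lin[OF f] v] by (simp add: Gamma_car[OF W])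
      show ?thesis
      proof (cases "n \<in> N_deg q")
        case n: True
        then have \<iota>: "iota n \<in> dg_deg std_dg q" by (simp add: iota_in_deg)
        \<comment> \<open>Evaluating \<omega>(\<iota> n) \<nu>(k) f(v) at (1, 1) reads f(v) at
          \<iota>(\<iota> n) = n and at 1 * k = k. The sign is the one in \<open>coind\<close>,
          which is its own inverse.\<close>
        have "f (q + j) (mdg V q (iota n) j (mgrp V k j v)) 0 1 1 = (- 1) powi (q * j) *\<^sub>C f j v q n k"
          unfolding mor_dg[OF f \<iota> u] mor_grp[OF f v]
          by (simp add: Gamma_simps N_deg_one N_map_Ad_one iota_iota[OF n])
        then show ?thesis using v n by (simp add: coind_def neg_one_powi neg_one_powi_even scaleC_one)
      qed (simp add: coind_def gam_out[OF W g])
    qed (simp add: coind_def mor_out[OF f])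
  qed
  show "\<forall>h\<in>Mor std_dg (Res \<gamma> V) W. (\<lambda>j v. coind V h j v 0 1 1) = h"
  proof (intro ballI ext)
    fix h j v assume h: "h \<in> Mor std_dg (Res \<gamma> V) W"
    show "coind V h j v 0 1 1 = h j v"
      using mor_out[OF h, of v j]
      by (cases "v \<in> mcar V j")
        (simp_all add: coind_def N_deg_one iota_simps scaleC_one algebraic_action_one[OF mod_grp[OF V]] mod_dg_one[OF V])
  qed
  show "(\<lambda>f j v. f j v 0 1 1) ` Mor std_dg V (\<Gamma> W) \<subseteq> Mor std_dg (Res \<gamma> V) W"
    using eval_one_Mor[OF V W] by blast
  show "coind V ` Mor std_dg (Res \<gamma> V) W \<subseteq> Mor std_dg V (\<Gamma> W)"
    using coind_Mor by blast
qed

end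

text \<open>\<Gamma>(\<beta>) applies \<beta> to the values of f, hence commutes with evaluation at
  a point; precomposition with \<alpha> changes only the argument v.\<close>

lemma adjunction_natural:
  fixes V' V :: "('k, 'a, 'v::complex_vector) equiv_complex" and W W' :: "('t, 'a, 'w::complex_vector) equiv_complex"
  assumes W: "is_module (hc_pullback \<gamma> H) std_dg W"
    and f: "f \<in> Mor std_dg V (\<Gamma> W)" and \<alpha>: "\<alpha> \<in> Mor std_dg V' V" and V: "is_module H std_dg V"
  shows "(\<lambda>j v. (Gamma_eq_mor H \<gamma> W \<beta> \<odot> f \<odot> \<alpha>) j v 0 1 1) = \<beta> \<odot> (\<lambda>j v. f j v 0 1 1) \<odot> \<alpha>"
proof (intro ext)
  fix j v
  have "gam W j (f j (\<alpha> j v))"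
    using lin_on_in[OF mor_lin[OF f] mor_value[OF \<alpha> V]] by (simp add: Gamma_car[OF W])
  then show "(Gamma_eq_mor H \<gamma> W \<beta> \<odot> f \<odot> \<alpha>) j v 0 1 1 = (\<beta> \<odot> (\<lambda>j v. f j v 0 1 1) \<odot> \<alpha>) j v"
    by (simp add: comp_mor_def Gamma_mor_apply[OF W])
qed

end

theorem theorem3p1p3:
  fixes H :: "('k::complex_algebraic_group, 'a::complex_algebra_1) hc_pair"
    and \<gamma> :: "'t::complex_algebraic_group \<Rightarrow> 'k"
  assumes "harish_chandra_pair H"
    and "alg_group_morphism \<gamma>"
    and "inj (lie_map \<gamma>)"
  shows
    \<comment> \<open>the forgetful functor, on modules with underlying type \<open>'v\<close>\<close>
    "(\<forall>V :: ('k, 'a, 'v::complex_vector) equiv_complex.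
        is_module H std_dg V \<longrightarrow> is_module (hc_pullback \<gamma> H) std_dg (Res \<gamma> V)
        \<and> id_mor (Res \<gamma> V) = id_mor V)
     \<and> (\<forall>(V :: ('k, 'a, 'v) equiv_complex) (V' :: ('k, 'a, 'v) equiv_complex).
        is_module H std_dg V \<longrightarrow> is_module H std_dg V' \<longrightarrow>
        Mor std_dg V V' \<subseteq> Mor std_dg (Res \<gamma> V) (Res \<gamma> V'))
     \<and>
     \<comment> \<open>the functor \<open>\<Gamma>\<close>, on modules with underlying type \<open>'w\<close>\<close>
     (\<forall>W :: ('t, 'a, 'w::complex_vector) equiv_complex.
        is_module (hc_pullback \<gamma> H) std_dg W \<longrightarrow> is_module H std_dg (Gamma_eq H \<gamma> W)
        \<and> Gamma_eq_mor H \<gamma> W (id_mor W) = id_mor (Gamma_eq H \<gamma> W))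
     \<and> (\<forall>(W :: ('t, 'a, 'w) equiv_complex) (W' :: ('t, 'a, 'w) equiv_complex).
        is_module (hc_pullback \<gamma> H) std_dg W \<longrightarrow> is_module (hc_pullback \<gamma> H) std_dg W' \<longrightarrow>
        (\<forall>\<beta>\<in>Mor std_dg W W'. Gamma_eq_mor H \<gamma> W \<beta> \<in> Mor std_dg (Gamma_eq H \<gamma> W) (Gamma_eq H \<gamma> W')))
     \<and> (\<forall>(W :: ('t, 'a, 'w) equiv_complex) (W' :: ('t, 'a, 'w) equiv_complex)
         (W'' :: ('t, 'a, 'w) equiv_complex).
        is_module (hc_pullback \<gamma> H) std_dg W \<longrightarrow> is_module (hc_pullback \<gamma> H) std_dg W' \<longrightarrow> is_module (hc_pullback \<gamma> H) std_dg W'' \<longrightarrow>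
        (\<forall>\<beta>\<in>Mor std_dg W W'. \<forall>\<beta>'\<in>Mor std_dg W' W''.
           Gamma_eq_mor H \<gamma> W (\<beta>' \<odot> \<beta>) = Gamma_eq_mor H \<gamma> W' \<beta>' \<odot> Gamma_eq_mor H \<gamma> W \<beta>))
     \<and>
     \<comment> \<open>the adjunction: bijections of morphism sets, natural in both variables\<close>
     (\<exists>\<Phi> :: ('k, 'a, 'v) equiv_complex \<Rightarrow> ('t, 'a, 'w) equiv_complex \<Rightarrow>
          (int \<Rightarrow> 'v \<Rightarrow> int \<Rightarrow> 'k lie N \<Rightarrow> 'k \<Rightarrow> 'w) \<Rightarrow> (int \<Rightarrow> 'v \<Rightarrow> 'w).
        (\<forall>V W. is_module H std_dg V \<longrightarrow> is_module (hc_pullback \<gamma> H) std_dg W \<longrightarrow>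
           bij_betw (\<Phi> V W) (Mor std_dg V (Gamma_eq H \<gamma> W)) (Mor std_dg (Res \<gamma> V) W))
        \<and> (\<forall>V V' W W'. is_module H std_dg V \<longrightarrow> is_module H std_dg V' \<longrightarrow>
           is_module (hc_pullback \<gamma> H) std_dg W \<longrightarrow> is_module (hc_pullback \<gamma> H) std_dg W' \<longrightarrow>
           (\<forall>\<alpha>\<in>Mor std_dg V' V. \<forall>\<beta>\<in>Mor std_dg W W'. \<forall>f\<in>Mor std_dg V (Gamma_eq H \<gamma> W).
              \<Phi> V' W' (Gamma_eq_mor H \<gamma> W \<beta> \<odot> f \<odot> \<alpha>) = \<beta> \<odot> \<Phi> V W f \<odot> \<alpha>)))"
proof -
  interpret hc_morphism H \<gamma> using assms(1,2) by unfold_locales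
  show ?thesis
    apply (intro conjI)
    subgoal using Res_module by (auto simp: id_mor_def)
    subgoal using Res_mor by blast
    subgoal using Gamma_module Gamma_mor_id by blast
    subgoal using Gamma_mor by blast
    subgoal using Gamma_mor_comp by blast
    subgoal
      by (rule exI[of _ "\<lambda>V W f j v. f j v 0 1 1"])
        (intro conjI allI impI ballI adjunction adjunction_natural; assumption)
    done
qed

end
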